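(* There is an algorithm that, given any first-order formula $\phi$ over the tree signature, returns $\mathrm{true}$, $\mathrm{false}$, or a disjunction of fully simplified formulae, the result being equivalent to $\phi$ in the extended theory of trees. In particular, if $\phi$ is closed, the algorithm returns $\mathrm{true}$ or $\mathrm{false}$.
   Context: Signature and trees: sorts $S$, generators $g: s_1\times\cdots\times s_n\to s$, $F_s$ the nonempty set of generators of $s$ (possibly finite), every sort having at least two generators; predicates $\mathrm{fin}_s$. The structure $\mathcal T$ interprets each sort $s$ as the set of (possibly infinite) rooted ordered generator-labeled trees of sort $s$ (root labeled $g: s_1\times\cdots\times s_n\to s$, children in order of sorts $s_1,\dots,s_n$), generators as tree-building, $\mathrm{fin}_s$ as finiteness; the extended theory of trees is the set of sentences true in $\mathcal T$. $S_{FF}$ (resp. $S_{FI}$) is the set of sorts with finitely many finite (resp. infinite) trees. Basic formula: $(\bigwedge_i v_i=t_i)\wedge(\bigwedge_j\mathrm{fin}(u_j))$, each $t_i$ a variable or $g(\bar z)$ with variables $\bar z$. Solved w.r.t. a total order on variables: all $v_i,u_j$ pairwise distinct; $x>y$ for each equation $x=y$ between variables; $\mathrm{fin}(v)$ occurs only if the sort of $v$ has both finite and infinite trees. Reachability in a basic formula: $x_n$ is reachable from $x_0$ if it contains $x_0=t_0\wedge\cdots\wedge x_{n-1}=t_{n-1}$ with $t_i$ containing $x_{i+1}$ (properly if $n>0$); in $\exists\bar x\,.\,\alpha$, reachable means from the free variables of $\exists\bar x\,.\,\alpha$. Normal formula of depth $d\ge1$: $\neg(\exists\bar x\,.\,\alpha\wedge\bigwedge_{i=1}^n\phi_i)$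 with $\alpha$ basic and $\phi_i$ normal of depth $d_i$, $d=1+\max(0,d_1,\dots,d_n)$. Instantiable variable in $\neg(\exists\bar x\,.\,\alpha\wedge\bigwedge_i\neg(\exists\bar y_i\,.\,\beta_i))$ with $\alpha,\beta_i$ solved basic: with $\beta_i^*$ being $\beta_i$ minus conjuncts occurring in $\alpha$, a variable $v:s$ free in the formula or in $\bar x$ is instantiable if (1) $F_s$ is finite, some $\beta_i^*$ contains $v=g(\bar w)$, and $v$ is not properly reachable from $v$ in $\beta_i$; or (2) $s\in S_{FF}\cap S_{FI}$, some $\beta_i^*$ contains $v$, and $\alpha$ has no equation $v=t$; or (3) $s\in S_{FF}$, $\alpha$ contains $\mathrm{fin}(v)$ and some $\beta_i^*$ contains $v$; or (4) $s\in S_{FI}$ and some $\beta_i^*$ contains only $\mathrm{fin}$-constraints, among them $\mathrm{fin}(v)$. A normal formula $\neg(\exists\bar x\,.\,\alpha\wedge\bigwedge_i\neg(\exists\bar y_i\,.\,\beta_i))$ of depth at most 2 is solved if: (1) $\alpha$ and each $\beta_i$ are solved basic formulae w.r.t. an ordering where free variables $<$ $\bar x$ $<$ $\bar y_i$ (more deeply bound variables are larger); (2) the equations of $\alpha$ occur in every $\beta_i$; (3) each $\beta_i$ has a conjunct not in $\alpha$; (4) no variable is instantiable; (5) all $\bar x$ (resp. $\bar y_i$) are reachable from the free variables of $\exists\bar x\,.\,\alpha$ (resp. $\exists\bar y_i\,.\,\beta_i$). A formula $\psi$ is fully simplified if $\neg\psi$ is a solved normal formula.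
   Formalization: The set of sorts is assumed finite; with infinitely many sorts the claim fails, e.g. when the n-th sort has two or three constants according to whether n lies in an undecidable set. *)

theory Defs
  imports Main "HOL-Library.Nat_Bijection"
begin

section \<open>Signatures\<close>

text \<open>
  Sorts, generator names and variable names are natural numbers, since formulae have to be finite
  words over a countable alphabet in order to be the input of an algorithm. A generator carries its
  arity \<open>g: s1 * ... * sn -> s\<close>, so that the sort of a term can be read off the term.
\<close>

type_synonym srt = nat

datatype gen = Gen (gname: nat) (gargs: "srt list") (gres: srt)

record signature =
  sorts :: "srt set"
  gens :: "gen set"

definition gens_of :: "signature \<Rightarrow> srt \<Rightarrow> gen set" where
  "gens_of S s = {g \<in> gens S. gres g = s}"

text \<open>
  There are finitely many sorts, while a sort may have infinitely many generators. Infinitely many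
  sorts cannot be allowed: if the \<open>n\<close>-th sort has two or three generators, all of them constants,
  according to whether \<open>n\<close> belongs to a given set of numbers, then a decision procedure for
  sentences decides that set.
\<close>

definition tree_signature :: "signature \<Rightarrow> bool" where
  "tree_signature S \<longleftrightarrow>
     finite (sorts S) \<and>
     (\<forall>g \<in> gens S. gres g \<in> sorts S \<and> set (gargs g) \<subseteq> sorts S) \<and>
     (\<forall>s \<in> sorts S. \<exists>g \<in> gens_of S s. \<exists>h \<in> gens_of S s. g \<noteq> h)"


section \<open>Trees\<close>

codatatype tree = Node (root: gen) (children: "tree list")

coinductive tree_of :: "signature \<Rightarrow> srt \<Rightarrow> tree \<Rightarrow> bool" for S where
  "g \<in> gens S \<Longrightarrow> list_all2 (tree_of S) (gargs g) ts \<Longrightarrow> tree_of S (gres g) (Node g ts)"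

definition trees :: "signature \<Rightarrow> srt \<Rightarrow> tree set" where
  "trees S s = {t. tree_of S s t}"

text \<open>Nodes are addressed by the sequence of child indices leading to them from the root.\<close>

inductive position :: "tree \<Rightarrow> nat list \<Rightarrow> bool" where
  root: "position t []"
| child: "i < length (children t) \<Longrightarrow> position (children t ! i) p \<Longrightarrow> position t (i # p)"

definition finite_tree :: "tree \<Rightarrow> bool" where
  "finite_tree t \<longleftrightarrow> finite {p. position t p}"

definition finite_trees :: "signature \<Rightarrow> srt \<Rightarrow> tree set" where
  "finite_trees S s = {t \<in> trees S s. finite_tree t}"

definition infinite_trees :: "signature \<Rightarrow> srt \<Rightarrow> tree set" where
  "infinite_trees S s = {t \<in> trees S s. \<not> finite_tree t}"

definition S_FF :: "signature \<Rightarrow> srt set" where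
  "S_FF S = {s \<in> sorts S. finite (finite_trees S s)}"

definition S_FI :: "signature \<Rightarrow> srt set" where
  "S_FI S = {s \<in> sorts S. finite (infinite_trees S s)}"


section \<open>First-order formulae and the extended theory of trees\<close>

datatype var = V (vname: nat) (vsort: srt)

datatype trm = Var var | App gen "trm list"

datatype fm =
    Tru | Fls
  | Eq trm trm
  | Fin srt trm
  | Neg fm
  | And fm fm | Or fm fm | Imp fm fm | Iff fm fm
  | Exists var fm | Forall var fm

fun sort_of :: "trm \<Rightarrow> srt" where
  "sort_of (Var v) = vsort v"
| "sort_of (App g ts) = gres g"

fun wf_trm :: "signature \<Rightarrow> trm \<Rightarrow> bool" where
  "wf_trm S (Var v) \<longleftrightarrow> vsort v \<in> sorts S"
| "wf_trm S (App g ts) \<longleftrightarrow>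
     g \<in> gens S \<and> map sort_of ts = gargs g \<and> (\<forall>t \<in> set ts. wf_trm S t)"

fun wf_fm :: "signature \<Rightarrow> fm \<Rightarrow> bool" where
  "wf_fm S Tru \<longleftrightarrow> True"
| "wf_fm S Fls \<longleftrightarrow> True"
| "wf_fm S (Eq t u) \<longleftrightarrow> wf_trm S t \<and> wf_trm S u \<and> sort_of t = sort_of u"
| "wf_fm S (Fin s t) \<longleftrightarrow> wf_trm S t \<and> sort_of t = s"
| "wf_fm S (Neg p) \<longleftrightarrow> wf_fm S p"
| "wf_fm S (And p q) \<longleftrightarrow> wf_fm S p \<and> wf_fm S q"
| "wf_fm S (Or p q) \<longleftrightarrow> wf_fm S p \<and> wf_fm S q"
| "wf_fm S (Imp p q) \<longleftrightarrow> wf_fm S p \<and> wf_fm S q"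
| "wf_fm S (Iff p q) \<longleftrightarrow> wf_fm S p \<and> wf_fm S q"
| "wf_fm S (Exists v p) \<longleftrightarrow> vsort v \<in> sorts S \<and> wf_fm S p"
| "wf_fm S (Forall v p) \<longleftrightarrow> vsort v \<in> sorts S \<and> wf_fm S p"

fun vars_trm :: "trm \<Rightarrow> var set" where
  "vars_trm (Var v) = {v}"
| "vars_trm (App g ts) = (\<Union>t \<in> set ts. vars_trm t)"

fun fv :: "fm \<Rightarrow> var set" where
  "fv Tru = {}"
| "fv Fls = {}"
| "fv (Eq t u) = vars_trm t \<union> vars_trm u"
| "fv (Fin s t) = vars_trm t"
| "fv (Neg p) = fv p"
| "fv (And p q) = fv p \<union> fv q"
| "fv (Or p q) = fv p \<union> fv q"
| "fv (Imp p q) = fv p \<union> fv q"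
| "fv (Iff p q) = fv p \<union> fv q"
| "fv (Exists v p) = fv p - {v}"
| "fv (Forall v p) = fv p - {v}"

fun eval_trm :: "(var \<Rightarrow> tree) \<Rightarrow> trm \<Rightarrow> tree" where
  "eval_trm e (Var v) = e v"
| "eval_trm e (App g ts) = Node g (map (eval_trm e) ts)"

fun sat :: "signature \<Rightarrow> (var \<Rightarrow> tree) \<Rightarrow> fm \<Rightarrow> bool" where
  "sat S e Tru \<longleftrightarrow> True"
| "sat S e Fls \<longleftrightarrow> False"
| "sat S e (Eq t u) \<longleftrightarrow> eval_trm e t = eval_trm e u"
| "sat S e (Fin s t) \<longleftrightarrow> finite_tree (eval_trm e t)"
| "sat S e (Neg p) \<longleftrightarrow> \<not> sat S e p"
| "sat S e (And p q) \<longleftrightarrow> sat S e p \<and> sat S e q"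
| "sat S e (Or p q) \<longleftrightarrow> sat S e p \<or> sat S e q"
| "sat S e (Imp p q) \<longleftrightarrow> (sat S e p \<longrightarrow> sat S e q)"
| "sat S e (Iff p q) \<longleftrightarrow> (sat S e p \<longleftrightarrow> sat S e q)"
| "sat S e (Exists v p) \<longleftrightarrow> (\<exists>t \<in> trees S (vsort v). sat S (e(v := t)) p)"
| "sat S e (Forall v p) \<longleftrightarrow> (\<forall>t \<in> trees S (vsort v). sat S (e(v := t)) p)"

definition valuation :: "signature \<Rightarrow> (var \<Rightarrow> tree) \<Rightarrow> bool" where
  "valuation S e \<longleftrightarrow> (\<forall>v. vsort v \<in> sorts S \<longrightarrow> e v \<in> trees S (vsort v))"

definition sentence :: "signature \<Rightarrow> fm \<Rightarrow> bool" where
  "sentence S p \<longleftrightarrow> wf_fm S p \<and> fv p = {}"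

definition extended_theory_of_trees :: "signature \<Rightarrow> fm set" where
  "extended_theory_of_trees S = {p. sentence S p \<and> (\<forall>e. valuation S e \<longrightarrow> sat S e p)}"

text \<open>
  Two formulae are equivalent in the theory if the universal closure of their biconditional
  belongs to it.
\<close>

definition equivalent :: "signature \<Rightarrow> fm \<Rightarrow> fm \<Rightarrow> bool" where
  "equivalent S p q \<longleftrightarrow>
     (\<exists>xs. set xs = fv (Iff p q) \<and> foldr Forall xs (Iff p q) \<in> extended_theory_of_trees S)"


section \<open>Basic and normal formulae\<close>

fun conj_list :: "fm list \<Rightarrow> fm" where
  "conj_list [] = Tru"
| "conj_list [p] = p"
| "conj_list (p # ps) = And p (conj_list ps)"

fun disj_list :: "fm list \<Rightarrow> fm" where
  "disj_list [] = Fls"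
| "disj_list [p] = p"
| "disj_list (p # ps) = Or p (disj_list ps)"

datatype flat = FVar var | FApp gen "var list"

fun vars_flat :: "flat \<Rightarrow> var set" where
  "vars_flat (FVar x) = {x}"
| "vars_flat (FApp g zs) = set zs"

fun trm_of_flat :: "flat \<Rightarrow> trm" where
  "trm_of_flat (FVar x) = Var x"
| "trm_of_flat (FApp g zs) = App g (map Var zs)"

text \<open>The basic formula \<open>v1 = t1 \<and> ... \<and> fin(u1) \<and> ...\<close>\<close>

datatype basic = Basic (eqs: "(var \<times> flat) list") (fins: "var list")

definition atoms_of_basic :: "basic \<Rightarrow> fm list" where
  "atoms_of_basic b =
     map (\<lambda>(v, t). Eq (Var v) (trm_of_flat t)) (eqs b) @ map (\<lambda>u. Fin (vsort u) (Var u)) (fins b)"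

definition vars_basic :: "basic \<Rightarrow> var set" where
  "vars_basic b = (\<Union>(v, t) \<in> set (eqs b). insert v (vars_flat t)) \<union> set (fins b)"

text \<open>\<open>minus_basic b a\<close> is \<open>b\<close> without the conjuncts occurring in \<open>a\<close>.\<close>

definition minus_basic :: "basic \<Rightarrow> basic \<Rightarrow> basic" where
  "minus_basic b a =
     Basic (filter (\<lambda>e. e \<notin> set (eqs a)) (eqs b)) (filter (\<lambda>u. u \<notin> set (fins a)) (fins b))"

text \<open>\<open>NF xs a [n1, ..., nk]\<close> is the formula \<open>\<not> (\<exists>xs. a \<and> n1 \<and> ... \<and> nk)\<close>.\<close>

datatype nf = NF (bvars: "var list") (base: basic) (subs: "nf list")

primrec fm_of_nf :: "nf \<Rightarrow> fm" where
  "fm_of_nf (NF xs a ns) = Neg (foldr Exists xs (conj_list (atoms_of_basic a @ map fm_of_nf ns)))"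

primrec depth :: "nf \<Rightarrow> nat" where
  "depth (NF xs a ns) = 1 + Max (insert 0 (set (map depth ns)))"

definition edges :: "basic \<Rightarrow> (var \<times> var) set" where
  "edges b = {(x, y). \<exists>t. (x, t) \<in> set (eqs b) \<and> y \<in> vars_flat t}"

definition reachable :: "basic \<Rightarrow> var \<Rightarrow> var \<Rightarrow> bool" where
  "reachable b x y \<longleftrightarrow> (x, y) \<in> (edges b)\<^sup>*"

definition properly_reachable :: "basic \<Rightarrow> var \<Rightarrow> var \<Rightarrow> bool" where
  "properly_reachable b x y \<longleftrightarrow> (x, y) \<in> (edges b)\<^sup>+"

text \<open>All variables \<open>xs\<close> are reachable in \<open>\<exists>xs. b\<close>, i.e. from its free variables.\<close>

definition all_reachable :: "var list \<Rightarrow> basic \<Rightarrow> bool" where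
  "all_reachable xs b \<longleftrightarrow> (\<forall>y \<in> set xs. \<exists>x \<in> vars_basic b - set xs. reachable b x y)"


section \<open>Solved normal formulae\<close>

text \<open>Here and below, \<open>(x, y) \<in> r\<close> is read as \<open>x < y\<close>.\<close>

definition solved_basic :: "signature \<Rightarrow> var rel \<Rightarrow> basic \<Rightarrow> bool" where
  "solved_basic S r b \<longleftrightarrow>
     distinct (map fst (eqs b) @ fins b) \<and>
     (\<forall>x y. (x, FVar y) \<in> set (eqs b) \<longrightarrow> (y, x) \<in> r) \<and>
     (\<forall>u \<in> set (fins b). finite_trees S (vsort u) \<noteq> {} \<and> infinite_trees S (vsort u) \<noteq> {})"

text \<open>
  The four disjuncts below speak about \<open>N = \<not> (\<exists>xs. a \<and> \<not> (\<exists>ys1. b1) \<and> ... \<and> \<not> (\<exists>ysk. bk))\<close>,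
  where \<open>b\<close> ranges over \<open>b1, ..., bk\<close>.
\<close>

definition instantiable :: "signature \<Rightarrow> nf \<Rightarrow> var \<Rightarrow> bool" where
  "instantiable S N v \<longleftrightarrow>
     (let a = base N; bs = base ` set (subs N); s = vsort v in
      v \<in> fv (fm_of_nf N) \<union> set (bvars N) \<and>
      (finite (gens_of S s) \<and>
         (\<exists>b \<in> bs. (\<exists>g ws. (v, FApp g ws) \<in> set (eqs (minus_basic b a))) \<and>
                   \<not> properly_reachable b v v) \<or>
       s \<in> S_FF S \<inter> S_FI S \<and> (\<exists>b \<in> bs. v \<in> vars_basic (minus_basic b a)) \<and>
         v \<notin> fst ` set (eqs a) \<or>
       s \<in> S_FF S \<and> v \<in> set (fins a) \<and> (\<exists>b \<in> bs. v \<in> vars_basic (minus_basic b a)) \<or>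
       s \<in> S_FI S \<and>
         (\<exists>b \<in> bs. eqs (minus_basic b a) = [] \<and> v \<in> set (fins (minus_basic b a)))))"

definition solved :: "signature \<Rightarrow> nf \<Rightarrow> bool" where
  "solved S N \<longleftrightarrow>
     depth N \<le> 2 \<and>
     (\<exists>r. strict_linear_order r \<and>
        (\<forall>u \<in> fv (fm_of_nf N). \<forall>x \<in> set (bvars N). (u, x) \<in> r) \<and>
        (\<forall>n \<in> set (subs N). \<forall>u \<in> fv (fm_of_nf N) \<union> set (bvars N). \<forall>y \<in> set (bvars n). (u, y) \<in> r) \<and>
        solved_basic S r (base N) \<and>
        (\<forall>n \<in> set (subs N). solved_basic S r (base n))) \<and>
     (\<forall>n \<in> set (subs N). set (eqs (base N)) \<subseteq> set (eqs (base n))) \<and>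
     (\<forall>n \<in> set (subs N). minus_basic (base n) (base N) \<noteq> Basic [] []) \<and>
     (\<forall>v. \<not> instantiable S N v) \<and>
     all_reachable (bvars N) (base N) \<and>
     (\<forall>n \<in> set (subs N). all_reachable (bvars n) (base n))"

definition fully_simplified :: "signature \<Rightarrow> fm \<Rightarrow> bool" where
  "fully_simplified S p \<longleftrightarrow> wf_fm S p \<and> (\<exists>N. solved S N \<and> fm_of_nf N = Neg p)"


section \<open>Algorithms\<close>

text \<open>
  Algorithms are partial recursive functions in Kleene's sense, i.e. terms over the initial
  functions, composition, primitive recursion and unbounded minimisation.
  \<open>computes f xs y\<close> means that \<open>f\<close> halts on the arguments \<open>xs\<close> with value \<open>y\<close>.
\<close>

datatype recf =
    Zero
  | Succ
  | Proj nat
  | Comp recf "recf list"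
  | PrimRec recf recf
  | Mu recf

inductive computes :: "recf \<Rightarrow> nat list \<Rightarrow> nat \<Rightarrow> bool" where
  Zero: "computes Zero xs 0"
| Succ: "computes Succ [x] (Suc x)"
| Proj: "i < length xs \<Longrightarrow> computes (Proj i) xs (xs ! i)"
| Comp: "list_all2 (\<lambda>g y. computes g xs y) gs ys \<Longrightarrow> computes f ys z \<Longrightarrow> computes (Comp f gs) xs z"
| PrimRec_0: "computes f xs y \<Longrightarrow> computes (PrimRec f g) (0 # xs) y"
| PrimRec_Suc: "computes (PrimRec f g) (n # xs) y \<Longrightarrow> computes g (n # y # xs) z \<Longrightarrow>
    computes (PrimRec f g) (Suc n # xs) z"
| Mu: "computes f (n # xs) 0 \<Longrightarrow> (\<And>m. m < n \<Longrightarrow> \<exists>y. computes f (m # xs) (Suc y)) \<Longrightarrow>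
    computes (Mu f) xs n"

inductive_cases computes_elims:
  "computes Zero xs y"
  "computes Succ xs y"
  "computes (Proj i) xs y"
  "computes (Comp f gs) xs y"
  "computes (PrimRec f g) xs y"
  "computes (Mu f) xs y"

lemma computes_deterministic: "computes f xs y \<Longrightarrow> computes f xs z \<Longrightarrow> y = z"
proof (induction arbitrary: z rule: computes.induct)
  case (Comp xs gs ys f w)
  from Comp.prems obtain ys' where ys': "list_all2 (\<lambda>g y. computes g xs y) gs ys'" "computes f ys' z"
    by (cases rule: computes_elims(4)) blast
  have "ys = ys'"
    using Comp.IH(1) ys'(1) by (intro nth_equalityI) (simp_all add: list_all2_conv_all_nth)
  with Comp.IH(2) ys'(2) show ?case by simp
next
  case (PrimRec_Suc f g n xs y w)
  from PrimRec_Suc.prems obtain y' where "computes (PrimRec f g) (n # xs) y'" "computes g (n # y' # xs) z"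
    by (cases rule: computes_elims(5)) auto
  with PrimRec_Suc.IH show ?case by blast
next
  case (Mu f n xs)
  have z: "computes f (z # xs) 0 \<and> (\<forall>m < z. \<exists>y. computes f (m # xs) (Suc y))"
    using Mu.prems by (rule computes_elims(6)) blast
  show ?case
  proof (rule linorder_cases[of n z])
    assume "n < z"
    with z obtain y where "computes f (n # xs) (Suc y)" by blast
    with Mu.IH(1) have "0 = Suc y" by blast
    then show ?thesis by simp
  next
    assume "z < n"
    with Mu.IH(2) obtain y where "\<forall>w. computes f (z # xs) w \<longrightarrow> Suc y = w" by blast
    with z have "Suc y = 0" by blast
    then show ?thesis by simp
  next
    assume "n = z"
    then show ?thesis .
  qed
next case Zero then show ?case by (auto elim: computes_elims(1))
next case (Succ x) then show ?case by (auto elim: computes_elims(2))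
next case (Proj i xs) then show ?case by (auto elim: computes_elims(3))
next case (PrimRec_0 f xs y g) from PrimRec_0.prems PrimRec_0.IH show ?case by (cases rule: computes_elims(5)) auto
qed

text \<open>Goedel numbering\<close>

definition code_gen :: "gen \<Rightarrow> nat" where
  "code_gen g = list_encode (gname g # gres g # gargs g)"

definition code_var :: "var \<Rightarrow> nat" where
  "code_var v = prod_encode (vname v, vsort v)"

primrec code_trm :: "trm \<Rightarrow> nat" where
  "code_trm (Var v) = list_encode [0, code_var v]"
| "code_trm (App g ts) = list_encode (1 # code_gen g # map code_trm ts)"

primrec code_fm :: "fm \<Rightarrow> nat" where
  "code_fm Tru = list_encode [0]"
| "code_fm Fls = list_encode [1]"
| "code_fm (Eq t u) = list_encode [2, code_trm t, code_trm u]"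
| "code_fm (Fin s t) = list_encode [3, s, code_trm t]"
| "code_fm (Neg p) = list_encode [4, code_fm p]"
| "code_fm (And p q) = list_encode [5, code_fm p, code_fm q]"
| "code_fm (Or p q) = list_encode [6, code_fm p, code_fm q]"
| "code_fm (Imp p q) = list_encode [7, code_fm p, code_fm q]"
| "code_fm (Iff p q) = list_encode [8, code_fm p, code_fm q]"
| "code_fm (Exists v p) = list_encode [9, code_var v, code_fm p]"
| "code_fm (Forall v p) = list_encode [10, code_var v, code_fm p]"

lemma inj_code_trm: "code_trm t = code_trm u \<Longrightarrow> t = u"
proof (induction t arbitrary: u)
  case (Var v)
  then show ?case by (cases u) (auto simp del: list_encode.simps simp add: list_encode_eq code_var_def intro: var.expand)
next
  case (App g ts)
  then obtain h us where u: "u = App h us" by (cases u) (auto simp del: list_encode.simps simp add: list_encode_eq)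
  with App.prems have "g = h" "map code_trm ts = map code_trm us"
    by (auto simp del: list_encode.simps simp add: list_encode_eq code_gen_def intro: gen.expand)
  moreover from this(2) have "ts = us"
    using App.IH by (auto simp: list_eq_iff_nth_eq)
  ultimately show ?case using u by simp
qed

lemma inj_code_fm: "code_fm p = code_fm q \<Longrightarrow> p = q"
proof (induction p arbitrary: q)
  case Tru then show ?case by (cases q) (auto simp del: list_encode.simps simp add: list_encode_eq)
next
  case Fls then show ?case by (cases q) (auto simp del: list_encode.simps simp add: list_encode_eq)
next
  case (Eq t u) then show ?case by (cases q) (auto simp del: list_encode.simps simp add: list_encode_eq dest: inj_code_trm)
next
  case (Fin s t) then show ?case by (cases q) (auto simp del: list_encode.simps simp add: list_encode_eq dest: inj_code_trm)
next
  case (Neg p) then show ?case by (cases q) (auto simp del: list_encode.simps simp add: list_encode_eq)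
next
  case (And p1 p2) then show ?case by (cases q) (auto simp del: list_encode.simps simp add: list_encode_eq)
next
  case (Or p1 p2) then show ?case by (cases q) (auto simp del: list_encode.simps simp add: list_encode_eq)
next
  case (Imp p1 p2) then show ?case by (cases q) (auto simp del: list_encode.simps simp add: list_encode_eq)
next
  case (Iff p1 p2) then show ?case by (cases q) (auto simp del: list_encode.simps simp add: list_encode_eq)
next
  case (Exists v p) then show ?case
    by (cases q) (auto simp del: list_encode.simps simp add: list_encode_eq code_var_def intro: var.expand)
next
  case (Forall v p) then show ?case
    by (cases q) (auto simp del: list_encode.simps simp add: list_encode_eq code_var_def intro: var.expand)
qed

end

theory Submission
  imports Defs
begin

text \<open>
  Being of the required form and equivalent to a given formula is recursively enumerable, and some
  formula of the required form always is equivalent to it, so that an unbounded search is the algorithm.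

  Both parts rest on back-and-forth arguments for matchings of finitely many trees that respect
  equality, finiteness and the root generators in a finite set \<open>G\<close> down to some depth. \<open>G\<close> contains the
  generators of the formula and all generators of those kinds (finite or infinite trees of a sort) with
  finitely many roots. A matching that is good to depth about \<open>n + 2 (r + 1)\<^sup>n\<close>, with \<open>r\<close> bounding the
  arities, can be extended to any further tree with depth \<open>n\<close> left: unmatched subtrees are rebuilt on
  top of generic leaves, which exist unless there are only finitely many trees of the kind in question,
  and then these trees belong to the matching from the start.

  Hence only finitely many descriptions of a tuple of trees matter, each of which is a fully simplified
  formula, and every formula is equivalent to a disjunction of them. On the other hand quantifiers may
  be evaluated over finite systems of equations with opaque leaves, only finitely many of which have to
  be tried. The signature need not be decidable, but enters through finitely many data only.
\<close>

subsection \<open>Recursive functions and recursively enumerable predicates\<close>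

text \<open>The obstacle is injectivity. A rebuilt subtree must differ from every tree in use, but
  an infinite tree can reappear inside itself: a node above a leaf may come out equal to that leaf,
  or equal to a partner assigned long before. Generic leaves exclude the first. The second is
  excluded by counting: the at most \<open>(r + 1)^n\<close> subtrees in question pass through an
  increasing chain of sets, which stands still after at most that many levels, and at such a level a
  coincidence is refuted because guarded equations have unique solutions. The chain argument is used
  twice, once to find a level at which the matched subtrees of the new tree no longer increase, once
  against coincidences; hence the factor 2 in the depth.

  The search accepts a candidate only after the universal closure of the biconditional has been
  evaluated to true. Truth and falsity are derived by separate positive rules, which makes
  evaluation a least fixed point and hence semi-decidable; the back-and-forth step makes it
  sound.\<close>

definition rc :: "nat \<Rightarrow> (nat list \<Rightarrow> nat) \<Rightarrow> bool" where
  "rc k f \<longleftrightarrow> (\<exists>r. \<forall>xs. length xs = k \<longrightarrow> computes r xs (f xs))"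

lemma rc_cong: "rc k f \<Longrightarrow> (\<And>xs. length xs = k \<Longrightarrow> f xs = g xs) \<Longrightarrow> rc k g"
  unfolding rc_def by metis

lemma rc_zero: "rc k (\<lambda>xs. 0)"
  unfolding rc_def by (blast intro: computes.Zero)

lemma rc_proj: "i < k \<Longrightarrow> rc k (\<lambda>xs. xs ! i)"
  unfolding rc_def by (blast intro: computes.Proj)

lemma rc_comp:
  assumes f: "rc m f" and gs: "\<forall>g \<in> set gs. rc k g" "length gs = m"
  shows "rc k (\<lambda>xs. f (map (\<lambda>g. g xs) gs))"
proof -
  obtain r where r: "\<forall>xs. length xs = m \<longrightarrow> computes r xs (f xs)"
    using f unfolding rc_def by blast
  have "\<exists>rs. length rs = length gs \<and>
      (\<forall>xs. length xs = k \<longrightarrow> list_all2 (\<lambda>g y. computes g xs y) rs (map (\<lambda>g. g xs) gs))"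
    using gs(1)
  proof (induction gs)
    case (Cons g gs)
    then obtain rs where rs: "length rs = length gs" "\<forall>xs. length xs = k \<longrightarrow>
        list_all2 (\<lambda>g y. computes g xs y) rs (map (\<lambda>g. g xs) gs)" by auto
    obtain s where "\<forall>xs. length xs = k \<longrightarrow> computes s xs (g xs)"
      using Cons.prems unfolding rc_def by auto
    with rs show ?case by (intro exI[of _ "s # rs"]) auto
  qed auto
  then obtain rs where "\<forall>xs. length xs = k \<longrightarrow>
      list_all2 (\<lambda>g y. computes g xs y) rs (map (\<lambda>g. g xs) gs)" by blast
  with r gs(2) have "\<forall>xs. length xs = k \<longrightarrow> computes (Comp r rs) xs (f (map (\<lambda>g. g xs) gs))"
    by (auto intro!: computes.Comp)
  then show ?thesis unfolding rc_def by blast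
qed

lemma rc_comp1: "rc (Suc 0) (\<lambda>xs. f (xs ! 0)) \<Longrightarrow> rc k g \<Longrightarrow> rc k (\<lambda>xs. f (g xs))"
  using rc_comp[of "Suc 0" "\<lambda>xs. f (xs ! 0)" "[g]" k] by simp

lemma rc_comp2: "rc 2 (\<lambda>xs. f (xs ! 0) (xs ! 1)) \<Longrightarrow> rc k g \<Longrightarrow> rc k h \<Longrightarrow> rc k (\<lambda>xs. f (g xs) (h xs))"
  using rc_comp[of 2 "\<lambda>xs. f (xs ! 0) (xs ! 1)" "[g, h]" k] by simp

lemma rc_Suc: "rc k f \<Longrightarrow> rc k (\<lambda>xs. Suc (f xs))"
proof (rule rc_comp1[where f = Suc])
  have "computes Succ xs (Suc (xs ! 0))" if "length xs = Suc 0" for xs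
    using that computes.Succ by (cases xs) auto
  then show "rc (Suc 0) (\<lambda>xs. Suc (xs ! 0))" unfolding rc_def by blast
qed

lemma rc_const: "rc k (\<lambda>xs. c)"
  by (induction c) (auto intro: rc_zero rc_Suc)

lemma map_nth_upt: "length xs = k \<Longrightarrow> map (\<lambda>g. g xs) (map (\<lambda>i xs. xs ! i) [0..<k]) = xs"
  by (auto intro: nth_equalityI)

text \<open>\<open>PrimRec\<close> takes the counter as first argument and passes counter,
  accumulator and parameters to the step function, so \<open>drop 2\<close> recovers the parameters.
  The counter is supplied by \<open>N\<close> through composition with the projections.\<close>

lemma rc_rec:
  assumes F: "rc k F" and G: "rc (Suc (Suc k)) (\<lambda>xs. G (xs ! 0) (xs ! 1) (drop 2 xs))" and N: "rc k N"
  shows "rc k (\<lambda>xs. rec_nat (F xs) (\<lambda>n y. G n y xs) (N xs))"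
proof -
  obtain f where f: "\<forall>xs. length xs = k \<longrightarrow> computes f xs (F xs)" using F unfolding rc_def by blast
  obtain g where g: "\<forall>xs. length xs = Suc (Suc k) \<longrightarrow> computes g xs (G (xs ! 0) (xs ! 1) (drop 2 xs))"
    using G unfolding rc_def by blast
  have *: "computes (PrimRec f g) (n # xs) (rec_nat (F xs) (\<lambda>n y. G n y xs) n)"
    if xs: "length xs = k" for n xs
  proof (induction n)
    case (Suc n)
    have "computes g (n # rec_nat (F xs) (\<lambda>n y. G n y xs) n # xs)
        (G n (rec_nat (F xs) (\<lambda>n y. G n y xs) n) xs)"
      using g[rule_format, of "n # rec_nat (F xs) (\<lambda>n y. G n y xs) n # xs"] xs by simp
    with Suc show ?case by (auto intro: computes.PrimRec_Suc)
  qed (use f xs in \<open>auto intro: computes.PrimRec_0\<close>)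
  have **: "computes (PrimRec f g) ys (rec_nat (F (tl ys)) (\<lambda>n y. G n y (tl ys)) (hd ys))"
    if "length ys = Suc k" for ys
    using *[of "tl ys" "hd ys"] that by (cases ys) auto
  have "rc (Suc k) (\<lambda>ys. rec_nat (F (tl ys)) (\<lambda>n y. G n y (tl ys)) (hd ys))"
    unfolding rc_def using ** by blast
  moreover have "\<forall>g \<in> set (N # map (\<lambda>i xs. xs ! i) [0..<k]). rc k g" using N by (auto intro: rc_proj)
  ultimately
  have "rc k (\<lambda>xs. rec_nat (F (map (\<lambda>g. g xs) (map (\<lambda>i xs. xs ! i) [0..<k])))
      (\<lambda>n y. G n y (map (\<lambda>g. g xs) (map (\<lambda>i xs. xs ! i) [0..<k]))) (N xs))"
    using rc_comp[of "Suc k" "\<lambda>ys. rec_nat (F (tl ys)) (\<lambda>n y. G n y (tl ys)) (hd ys)"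
        "N # map (\<lambda>i xs. xs ! i) [0..<k]" k] by (simp del: map_map)
  then show ?thesis by (rule rc_cong) (simp only: map_nth_upt)
qed

lemma rc_least:
  assumes f: "rc (Suc k) (\<lambda>xs. f (xs ! 0) (tl xs))" and ex: "\<And>xs. length xs = k \<Longrightarrow> \<exists>n. f n xs = (0::nat)"
  shows "rc k (\<lambda>xs. LEAST n. f n xs = 0)"
proof -
  obtain r where r: "\<forall>xs. length xs = Suc k \<longrightarrow> computes r xs (f (xs ! 0) (tl xs))"
    using f unfolding rc_def by blast
  have "computes (Mu r) xs (LEAST n. f n xs = 0)" if xs: "length xs = k" for xs
  proof (rule computes.Mu)
    have c: "computes r (n # xs) (f n xs)" for n using r[rule_format, of "n # xs"] xs by simp
    have "f (LEAST n. f n xs = 0) xs = 0" using ex[OF xs] by (metis (mono_tags, lifting) LeastI)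
    then show "computes r ((LEAST n. f n xs = 0) # xs) 0" using c by metis
    fix m assume "m < (LEAST n. f n xs = 0)"
    then have "f m xs \<noteq> 0" using not_less_Least by blast
    then obtain y where "f m xs = Suc y" using not0_implies_Suc by blast
    then show "\<exists>y. computes r (m # xs) (Suc y)" using c[of m] by auto
  qed
  then show ?thesis unfolding rc_def by blast
qed

lemma rc_add: "rc k f \<Longrightarrow> rc k g \<Longrightarrow> rc k (\<lambda>xs. f xs + g xs)"
proof -
  assume "rc k f" "rc k g"
  then have "rc k (\<lambda>xs. rec_nat (f xs) (\<lambda>n y. Suc y) (g xs))"
    by (intro rc_rec rc_Suc rc_proj) auto
  moreover have "rec_nat a (\<lambda>n y. Suc y) b = a + b" for a b by (induction b) auto
  ultimately show ?thesis by simp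
qed

lemma rc_pred: "rc k f \<Longrightarrow> rc k (\<lambda>xs. f xs - 1)"
proof -
  assume "rc k f"
  then have "rc k (\<lambda>xs. rec_nat 0 (\<lambda>n y. n) (f xs))"
    by (intro rc_rec rc_zero rc_proj) auto
  moreover have "rec_nat 0 (\<lambda>n y. n) b = b - 1" for b :: nat by (cases b) auto
  ultimately show ?thesis by simp
qed

lemma rc_diff: "rc k f \<Longrightarrow> rc k g \<Longrightarrow> rc k (\<lambda>xs. f xs - g xs)"
proof -
  assume "rc k f" "rc k g"
  then have "rc k (\<lambda>xs. rec_nat (f xs) (\<lambda>n y. y - 1) (g xs))"
    by (intro rc_rec rc_pred rc_proj) auto
  moreover have "rec_nat a (\<lambda>n y. y - 1) b = a - b" for a b :: nat by (induction b) auto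
  ultimately show ?thesis by simp
qed

lemma rc_mult: "rc k f \<Longrightarrow> rc k g \<Longrightarrow> rc k (\<lambda>xs. f xs * g xs)"
proof -
  assume fg: "rc k f" "rc k g"
  have "rc 2 (\<lambda>xs. rec_nat 0 (\<lambda>n y. y + xs ! 0) (xs ! 1))"
  proof (intro rc_rec rc_zero rc_add rc_proj)
    have "rc (Suc (Suc 2)) (\<lambda>xs. xs ! 2)" by (rule rc_proj) auto
    then show "rc (Suc (Suc 2)) (\<lambda>xs. drop 2 xs ! 0)" by (rule rc_cong) auto
  qed auto
  moreover have "rec_nat 0 (\<lambda>n y. y + a) b = a * b" for a b :: nat by (induction b) auto
  ultimately have "rc 2 (\<lambda>xs. xs ! 0 * xs ! 1)" by simp
  from rc_comp2[OF this fg] show ?thesis .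
qed

lemma rc_triangle: "rc k f \<Longrightarrow> rc k (\<lambda>xs. triangle (f xs))"
proof -
  assume "rc k f"
  then have "rc k (\<lambda>xs. rec_nat 0 (\<lambda>n y. y + Suc n) (f xs))"
    by (intro rc_rec rc_zero rc_add rc_Suc rc_proj) auto
  moreover have "rec_nat 0 (\<lambda>n y. y + Suc n) b = triangle b" for b by (induction b) auto
  ultimately show ?thesis by simp
qed

lemma rc_pair: "rc k f \<Longrightarrow> rc k g \<Longrightarrow> rc k (\<lambda>xs. prod_encode (f xs, g xs))"
  unfolding prod_encode_def by (simp add: rc_add rc_triangle)

lemma triangle_mono: "a \<le> b \<Longrightarrow> triangle a \<le> triangle b"
  by (induction b) (auto simp: le_Suc_eq)

text \<open>The Cantor code of a pair lies on the diagonal given by the sum of its components, and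
  this sum is the least \<open>s\<close> with \<open>z < triangle (Suc s)\<close>. Truncated
  subtraction expresses the inequality by operations already known to be computable.\<close>

lemma prod_decode_sum:
  "(LEAST s. Suc 0 - (triangle (Suc s) - z) = 0) = fst (prod_decode z) + snd (prod_decode z)"
proof -
  obtain m n where mn: "prod_decode z = (m, n)" by fastforce
  have "prod_encode (m, n) = z" using prod_decode_inverse[of z] mn by simp
  then have z: "z = triangle (m + n) + m" unfolding prod_encode_def by simp
  show ?thesis unfolding mn fst_conv snd_conv
  proof (rule Least_equality)
    show "Suc 0 - (triangle (Suc (m + n)) - z) = 0" using z triangle_Suc[of "m + n"] by linarith
    fix s assume s: "Suc 0 - (triangle (Suc s) - z) = 0"
    show "m + n \<le> s"
    proof (rule ccontr)
      assume "\<not> m + n \<le> s"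
      then have "triangle (Suc s) \<le> triangle (m + n)" by (intro triangle_mono) auto
      with s z show False by linarith
    qed
  qed
qed

lemma rc_decode_sum: "rc k f \<Longrightarrow> rc k (\<lambda>xs. fst (prod_decode (f xs)) + snd (prod_decode (f xs)))"
proof (rule rc_comp1[where f = "\<lambda>z. fst (prod_decode z) + snd (prod_decode z)"])
  have "rc (Suc 0) (\<lambda>xs. LEAST s. Suc 0 - (triangle (Suc s) - xs ! 0) = 0)"
  proof (rule rc_least)
    have "rc (Suc (Suc 0)) (\<lambda>xs. Suc 0 - (triangle (Suc (xs ! 0)) - xs ! 1))"
      by (intro rc_diff rc_const rc_triangle rc_Suc rc_proj) auto
    then show "rc (Suc (Suc 0)) (\<lambda>xs. Suc 0 - (triangle (Suc (xs ! 0)) - tl xs ! 0))"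
      by (rule rc_cong) (auto simp: nth_tl)
    fix xs :: "nat list"
    have "n \<le> triangle n" for n by (induction n) auto
    from this[of "Suc (xs ! 0)"] have "Suc 0 - (triangle (Suc (xs ! 0)) - xs ! 0) = 0" by linarith
    then show "\<exists>n. Suc 0 - (triangle (Suc n) - xs ! 0) = 0" by blast
  qed
  then show "rc (Suc 0) (\<lambda>xs. fst (prod_decode (xs ! 0)) + snd (prod_decode (xs ! 0)))"
    by (simp only: prod_decode_sum)
qed

lemma decode_fst: "fst (prod_decode z) = z - triangle (fst (prod_decode z) + snd (prod_decode z))"
proof -
  obtain m n where mn: "prod_decode z = (m, n)" by fastforce
  have "prod_encode (m, n) = z" using prod_decode_inverse[of z] mn by simp
  then have "z = triangle (m + n) + m" unfolding prod_encode_def by simp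
  then show ?thesis unfolding mn by simp
qed

lemma rc_fst: "rc k f \<Longrightarrow> rc k (\<lambda>xs. fst (prod_decode (f xs)))"
proof -
  assume f: "rc k f"
  have "rc k (\<lambda>xs. f xs - triangle (fst (prod_decode (f xs)) + snd (prod_decode (f xs))))"
    by (intro rc_diff rc_triangle rc_decode_sum f)
  then show ?thesis by (simp only: decode_fst[symmetric])
qed

lemma rc_snd: "rc k f \<Longrightarrow> rc k (\<lambda>xs. snd (prod_decode (f xs)))"
proof -
  assume "rc k f"
  then have "rc k (\<lambda>xs. (fst (prod_decode (f xs)) + snd (prod_decode (f xs))) - fst (prod_decode (f xs)))"
    by (intro rc_diff rc_decode_sum rc_fst)
  then show ?thesis by simp
qed

section \<open>Encodings and computable functions between encoded types\<close>

text \<open>A bijection, not just an injection: every number codes exactly one element, decoding is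
  total, and a quantifier over the type becomes a quantifier over the numbers.\<close>

class enc =
  fixes enc :: "'a \<Rightarrow> nat"
  assumes bij_enc: "bij enc"
begin

definition dec :: "nat \<Rightarrow> 'a" where "dec = inv enc"

lemma dec_enc [simp]: "dec (enc x) = x"
  unfolding dec_def using bij_enc by (simp add: bij_is_inj)

lemma enc_dec [simp]: "enc (dec n) = n"
  unfolding dec_def using bij_enc by (simp add: bij_is_surj surj_f_inv_f)

lemma enc_eq_iff [simp]: "enc x = enc y \<longleftrightarrow> x = y"
  by (metis dec_enc)

end

instantiation nat :: enc
begin
definition "enc_nat (n::nat) = n"
instance by standard (auto simp: enc_nat_def bij_def inj_def surj_def)
end

instantiation prod :: (enc, enc) enc
begin
definition "enc_prod p = prod_encode (enc (fst p), enc (snd p))"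
instance
proof
  show "bij (enc :: 'a \<times> 'b \<Rightarrow> nat)"
    by (rule o_bij[where g = "\<lambda>n. (dec (fst (prod_decode n)), dec (snd (prod_decode n)))"])
       (auto simp: enc_prod_def fun_eq_iff)
qed
end

instantiation list :: (enc) enc
begin
definition "enc_list xs = list_encode (map enc xs)"
instance
proof
  show "bij (enc :: 'a list \<Rightarrow> nat)"
    by (rule o_bij[where g = "\<lambda>n. map dec (list_decode n)"])
       (auto simp: enc_list_def fun_eq_iff o_def)
qed
end

instantiation var :: enc
begin
definition "enc_var v = prod_encode (vname v, vsort v)"
instance
proof
  show "bij (enc :: var \<Rightarrow> nat)"
    by (rule o_bij[where g = "\<lambda>n. V (fst (prod_decode n)) (snd (prod_decode n))"])
       (auto simp: enc_var_def fun_eq_iff)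
qed
end

instantiation gen :: enc
begin
definition "enc_gen g = enc (gname g, gres g, gargs g)"
instance
proof
  show "bij (enc :: gen \<Rightarrow> nat)"
    by (rule o_bij[where g = "\<lambda>n. Gen (fst (dec n :: nat \<times> nat \<times> nat list))
          (snd (snd (dec n :: nat \<times> nat \<times> nat list))) (fst (snd (dec n :: nat \<times> nat \<times> nat list)))"])
       (auto simp: enc_gen_def fun_eq_iff)
qed
end

lemma enc_Nil [simp]: "enc [] = 0" by (simp add: enc_list_def)
lemma enc_Cons: "enc (x # xs) = Suc (prod_encode (enc x, enc xs))" by (simp add: enc_list_def)
lemma enc_nat_list [simp]: "enc (xs :: nat list) = list_encode xs" by (simp add: enc_list_def enc_nat_def map_idI)

lemma le_prod_encode: "a \<le> prod_encode (a, b)" "b \<le> prod_encode (a, b)"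
  by (auto intro: le_prod_encode_1 le_prod_encode_2)

lemma length_le_enc: "length xs \<le> enc xs"
  by (induction xs) (auto simp: enc_Cons intro: le_trans[OF _ le_prod_encode(2)])

lemma mem_le_enc: "x \<in> set xs \<Longrightarrow> enc x < enc xs"
proof (induction xs)
  case (Cons y ys)
  have "enc y \<le> prod_encode (enc y, enc ys)" "enc ys \<le> prod_encode (enc y, enc ys)"
    by (rule le_prod_encode)+
  moreover have "enc x = enc y \<or> enc x < enc ys" using Cons by auto
  ultimately show ?case unfolding enc_Cons by linarith
qed simp

definition tc :: "('a::enc \<Rightarrow> 'b::enc) \<Rightarrow> bool" where
  "tc f \<longleftrightarrow> rc (Suc 0) (\<lambda>xs. enc (f (dec (xs ! 0))))"

lemma tc_id: "tc (\<lambda>x. x)"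
  unfolding tc_def by (simp add: rc_proj)

lemma tc_const: "tc (\<lambda>x. c)"
  unfolding tc_def by (rule rc_const)

lemma tc_comp: "tc f \<Longrightarrow> tc g \<Longrightarrow> tc (\<lambda>x. f (g x))"
  unfolding tc_def
  using rc_comp1[where f = "\<lambda>x. enc (f (dec x))" and g = "\<lambda>xs. enc (g (dec (xs ! 0)))"] by simp

lemma tc_pair: "tc f \<Longrightarrow> tc g \<Longrightarrow> tc (\<lambda>x. (f x, g x))"
  unfolding tc_def enc_prod_def by (simp add: rc_pair)

lemma enc_fst: "enc (fst p) = fst (prod_decode (enc p))"
  and enc_snd: "enc (snd p) = snd (prod_decode (enc p))"
  unfolding enc_prod_def[of p] by simp_all

lemma tc_fst: "tc f \<Longrightarrow> tc (\<lambda>x. fst (f x))"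
  unfolding tc_def enc_fst by (rule rc_fst)

lemma tc_snd: "tc f \<Longrightarrow> tc (\<lambda>x. snd (f x))"
  unfolding tc_def enc_snd by (rule rc_snd)

lemma tc_enc: "tc f \<Longrightarrow> tc (\<lambda>x. enc (f x))"
  unfolding tc_def by (simp add: enc_nat_def)

lemma tc_dec: "tc f \<Longrightarrow> tc (\<lambda>x. dec (f x))"
  unfolding tc_def by (simp add: enc_nat_def)

lemma tc_of_enc: "tc (\<lambda>x. enc (f x)) \<Longrightarrow> tc f"
  unfolding tc_def by (simp add: enc_nat_def)

lemma tc_Suc: "tc f \<Longrightarrow> tc (\<lambda>x. Suc (f x))"
  unfolding tc_def enc_nat_def by (rule rc_Suc)

lemma tc_add: "tc f \<Longrightarrow> tc g \<Longrightarrow> tc (\<lambda>x. f x + (g x :: nat))"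
  unfolding tc_def enc_nat_def by (rule rc_add)

lemma tc_mult: "tc f \<Longrightarrow> tc g \<Longrightarrow> tc (\<lambda>x. f x * (g x :: nat))"
  unfolding tc_def enc_nat_def by (rule rc_mult)

lemma tc_diff: "tc f \<Longrightarrow> tc g \<Longrightarrow> tc (\<lambda>x. f x - (g x :: nat))"
  unfolding tc_def enc_nat_def by (rule rc_diff)

lemma tc_rec:
  fixes F :: "'a::enc \<Rightarrow> 'b::enc"
  assumes F: "tc F" and G: "tc (\<lambda>z. G (fst z) (fst (snd z)) (snd (snd z)))" and N: "tc N"
  shows "tc (\<lambda>x. rec_nat (F x) (\<lambda>n y. G n y x) (N x))"
proof -
  define H where "H = (\<lambda>n y x. enc (G n (dec y) (dec x :: 'a)))"
  have H: "rc (Suc (Suc (Suc 0))) (\<lambda>xs. H (xs ! 0) (xs ! 1) (xs ! 2))"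
  proof -
    have "rc (Suc 0) (\<lambda>xs. enc ((\<lambda>z. G (fst z) (fst (snd z)) (snd (snd z)))
        (dec (xs ! 0) :: nat \<times> 'b \<times> 'a)))" using G unfolding tc_def .
    from rc_comp1[OF this, of "Suc (Suc (Suc 0))"
        "\<lambda>xs. prod_encode (xs ! 0, prod_encode (xs ! 1, xs ! 2))"]
    have "rc (Suc (Suc (Suc 0))) (\<lambda>xs. enc ((\<lambda>z. G (fst z) (fst (snd z)) (snd (snd z)))
        (dec (prod_encode (xs ! 0, prod_encode (xs ! 1, xs ! 2))) :: nat \<times> 'b \<times> 'a)))"
      by (simp add: rc_pair rc_proj)
    moreover have "dec (prod_encode (a, prod_encode (b, c))) = (a, dec b :: 'b, dec c :: 'a)" for a b c
    proof -
      have "prod_encode (a, prod_encode (b, c)) = enc (a, dec b :: 'b, dec c :: 'a)"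
        by (simp add: enc_prod_def enc_nat_def)
      then show ?thesis by (simp only: dec_enc)
    qed
    ultimately show ?thesis unfolding H_def by simp
  qed
  have eq: "enc (rec_nat (F x) (\<lambda>n y. G n y x) n) = rec_nat (enc (F x)) (\<lambda>n y. H n y (enc x)) n" for x n
  proof (induction n)
    case (Suc n)
    have "rec_nat (enc (F x)) (\<lambda>n y. H n y (enc x)) (Suc n) = H n (enc (rec_nat (F x) (\<lambda>n y. G n y x) n)) (enc x)"
      using Suc by simp
    then show ?case by (simp add: H_def)
  qed simp
  have "rc (Suc 0) (\<lambda>xs. rec_nat (enc (F (dec (xs ! 0)))) (\<lambda>n y. H n y (xs ! 0)) (N (dec (xs ! 0))))"
  proof (intro rc_rec)
    show "rc (Suc (Suc (Suc 0))) (\<lambda>xs. H (xs ! 0) (xs ! 1) (drop 2 xs ! 0))"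
      using H by (rule rc_cong) auto
  qed (use F N in \<open>auto simp: tc_def enc_nat_def\<close>)
  then show ?thesis unfolding tc_def by (simp add: eq)
qed

lemma tc_Cons: "tc f \<Longrightarrow> tc g \<Longrightarrow> tc (\<lambda>x. f x # g x)"
  unfolding tc_def enc_Cons by (intro rc_Suc rc_pair)

text \<open>The empty list has code 0, the truncated predecessor of 0 is 0, and 0 is the code of the
  pair \<open>(0, 0)\<close>; hence the formula for nonempty lists returns the empty list here as
  well.\<close>

lemma enc_tl: "enc (tl xs) = snd (prod_decode (enc xs - 1))"
proof (cases xs)
  case Nil
  have "prod_decode (prod_encode (0, 0)) = (0, 0)" by (rule prod_encode_inverse)
  then show ?thesis using Nil by (simp add: prod_encode_def)
qed (simp add: enc_Cons)

lemma tc_tl: "tc f \<Longrightarrow> tc (\<lambda>x. tl (f x))"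
  unfolding tc_def enc_tl by (intro rc_snd rc_pred)

lemma tc_drop: "tc n \<Longrightarrow> tc f \<Longrightarrow> tc (\<lambda>x. drop (n x) (f x))"
proof -
  assume "tc n" "tc f"
  then have "tc (\<lambda>x. rec_nat (f x) (\<lambda>_ y. tl y) (n x))"
    by (intro tc_rec tc_tl tc_fst tc_snd tc_id)
  moreover have "rec_nat xs (\<lambda>_ y. tl y) k = drop k xs" for xs :: "'b list" and k
    by (induction k) (auto simp: drop_Suc tl_drop)
  ultimately show ?thesis by simp
qed

lemma tc_list_encode: "tc f \<Longrightarrow> tc (\<lambda>x. list_encode (f x))"
  using tc_enc[of f] by simp

lemma enc_vname: "enc (vname v) = fst (prod_decode (enc v))"
  and enc_vsort: "enc (vsort v) = snd (prod_decode (enc v))"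
  unfolding enc_var_def[of v] enc_nat_def by simp_all

lemma tc_vname: "tc f \<Longrightarrow> tc (\<lambda>x. vname (f x))"
  unfolding tc_def enc_vname by (rule rc_fst)

lemma tc_vsort: "tc f \<Longrightarrow> tc (\<lambda>x. vsort (f x))"
  unfolding tc_def enc_vsort by (rule rc_snd)

lemma tc_V: "tc f \<Longrightarrow> tc g \<Longrightarrow> tc (\<lambda>x. V (f x) (g x))"
  unfolding tc_def by (simp add: enc_var_def enc_nat_def rc_pair)

lemma tc_gen: "tc f \<Longrightarrow> tc (\<lambda>x. (gname (f x), gres (f x), gargs (f x)))"
proof -
  assume "tc f"
  then have "rc (Suc 0) (\<lambda>xs. enc (f (dec (xs ! 0))))" unfolding tc_def .
  then show ?thesis unfolding tc_def enc_gen_def by simp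
qed

lemma tc_gname: "tc f \<Longrightarrow> tc (\<lambda>x. gname (f x))"
  using tc_fst[OF tc_gen[of f]] by simp

lemma tc_gres: "tc f \<Longrightarrow> tc (\<lambda>x. gres (f x))"
  using tc_fst[OF tc_snd[OF tc_gen[of f]]] by simp

lemma tc_gargs: "tc f \<Longrightarrow> tc (\<lambda>x. gargs (f x))"
  using tc_snd[OF tc_snd[OF tc_gen[of f]]] by simp

lemma tc_code_gen: "tc f \<Longrightarrow> tc (\<lambda>x. code_gen (f x))"
  unfolding code_gen_def by (intro tc_list_encode tc_Cons tc_gname tc_gres tc_gargs)

lemma tc_code_var: "tc f \<Longrightarrow> tc (\<lambda>x. code_var (f x))"
  using tc_enc[of f] by (simp add: enc_var_def code_var_def)

lemmas tc_intros = tc_id tc_const tc_pair tc_fst tc_snd tc_Cons tc_Suc tc_add tc_mult tc_diff tc_drop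
  tc_list_encode tc_vname tc_vsort tc_V tc_gname tc_gres tc_gargs tc_code_gen tc_code_var tc_enc

section \<open>Semi-decidable predicates\<close>

text \<open>Existential normal form: \<open>n\<close> is a witness, \<open>f\<close> checks it, and
  0 means acceptance. Sums of such functions then express conjunctions and products express
  disjunctions.\<close>

definition re :: "('a::enc \<Rightarrow> bool) \<Rightarrow> bool" where
  "re P \<longleftrightarrow> (\<exists>f :: nat \<times> 'a \<Rightarrow> nat. tc f \<and> (\<forall>x. P x \<longleftrightarrow> (\<exists>n::nat. f (n, x) = 0)))"

lemma reI: "tc f \<Longrightarrow> (\<And>x. P x \<longleftrightarrow> (\<exists>n::nat. f (n, x) = (0::nat))) \<Longrightarrow> re P"
  unfolding re_def by blast

lemma re_zero: assumes f: "tc f" shows "re (\<lambda>x. f x = (0::nat))"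
  by (rule reI[of "\<lambda>z. f (snd z)"]) (intro tc_comp[OF f] tc_intros, auto)

lemma re_comp:
  assumes "re P" "tc g" shows "re (\<lambda>x. P (g x))"
proof -
  obtain f where f: "tc f" "\<forall>x. P x \<longleftrightarrow> (\<exists>n::nat. f (n, x) = (0::nat))" using assms(1) unfolding re_def by blast
  show ?thesis
  proof (rule reI)
    show "tc (\<lambda>z. f (fst z, g (snd z)))" by (intro tc_comp[OF f(1)] tc_intros tc_comp[OF assms(2)])
  qed (use f(2) in simp)
qed

lemma re_eq: "tc f \<Longrightarrow> tc g \<Longrightarrow> re (\<lambda>x. f x = g x)"
proof -
  assume "tc f" "tc g"
  then have "re (\<lambda>x. (enc (f x) - enc (g x)) + (enc (g x) - enc (f x)) = 0)"
    by (intro re_zero tc_intros)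
  moreover have "(enc a - enc b) + (enc b - enc a) = 0 \<longleftrightarrow> a = b" for a b :: 'b
    by (metis add_is_0 diff_is_0_eq enc_eq_iff le_antisym order_refl)
  ultimately show ?thesis by simp
qed

lemma re_le: "tc f \<Longrightarrow> tc g \<Longrightarrow> re (\<lambda>x. f x \<le> (g x :: nat))"
  using re_zero[of "\<lambda>x. f x - g x"] tc_diff by force

lemma re_less: "tc f \<Longrightarrow> tc g \<Longrightarrow> re (\<lambda>x. f x < (g x :: nat))"
  using re_le[of "\<lambda>x. Suc (f x)" g] tc_Suc[of f] by (simp add: Suc_le_eq)

lemma re_conj:
  assumes "re P" "re Q" shows "re (\<lambda>x. P x \<and> Q x)"
proof -
  obtain f where f: "tc f" "\<forall>x. P x \<longleftrightarrow> (\<exists>n::nat. f (n, x) = (0::nat))" using assms(1) unfolding re_def by blast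
  obtain g where g: "tc g" "\<forall>x. Q x \<longleftrightarrow> (\<exists>n::nat. g (n, x) = (0::nat))" using assms(2) unfolding re_def by blast
  show ?thesis
  proof (rule reI)
    show "tc (\<lambda>z. f (fst (dec (fst z) :: nat \<times> nat), snd z) + g (snd (dec (fst z) :: nat \<times> nat), snd z))"
      by (intro tc_intros tc_comp[OF f(1)] tc_comp[OF g(1)] tc_dec)
    show "P x \<and> Q x \<longleftrightarrow> (\<exists>n. f (fst (dec (fst (n, x)) :: nat \<times> nat), snd (n, x)) +
        g (snd (dec (fst (n, x)) :: nat \<times> nat), snd (n, x)) = 0)" for x
    proof
      assume "P x \<and> Q x"
      then obtain a b :: nat where "f (a, x) = 0" "g (b, x) = 0" using f(2) g(2) by blast
      then show "\<exists>n. f (fst (dec (fst (n, x)) :: nat \<times> nat), snd (n, x)) +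
        g (snd (dec (fst (n, x)) :: nat \<times> nat), snd (n, x)) = 0"
        by (intro exI[of _ "enc (a, b)"]) (simp only: fst_conv snd_conv dec_enc)
    qed (use f(2) g(2) in auto)
  qed
qed

lemma re_disj:
  assumes "re P" "re Q" shows "re (\<lambda>x. P x \<or> Q x)"
proof -
  obtain f where f: "tc f" "\<forall>x. P x \<longleftrightarrow> (\<exists>n::nat. f (n, x) = (0::nat))" using assms(1) unfolding re_def by blast
  obtain g where g: "tc g" "\<forall>x. Q x \<longleftrightarrow> (\<exists>n::nat. g (n, x) = (0::nat))" using assms(2) unfolding re_def by blast
  show ?thesis
    by (rule reI[OF tc_mult[OF f(1) g(1)]]) (auto simp: f(2) g(2))
qed

lemma re_ex:
  assumes "re (\<lambda>z. P (fst z) (snd z))" shows "re (\<lambda>x. \<exists>y. P x y)"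
proof -
  obtain f where f: "tc f" "\<forall>z. P (fst z) (snd z) \<longleftrightarrow> (\<exists>n::nat. f (n, z) = (0::nat))"
    using assms unfolding re_def by blast
  show ?thesis
  proof (rule reI)
    show "tc (\<lambda>z. f (fst (dec (fst z) :: nat \<times> 'b), (snd z, snd (dec (fst z) :: nat \<times> 'b))))"
      by (intro tc_intros tc_comp[OF f(1)] tc_dec)
    have f2: "P x y \<longleftrightarrow> (\<exists>n::nat. f (n, (x, y)) = 0)" for x y using f(2)[rule_format, of "(x, y)"] by simp
    show "(\<exists>y. P x y) \<longleftrightarrow> (\<exists>n. f (fst (dec (fst (n, x)) :: nat \<times> 'b),
        (snd (n, x), snd (dec (fst (n, x)) :: nat \<times> 'b))) = 0)" for x
    proof
      assume "\<exists>y. P x y"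
      then obtain y n where "f (n, (x, y)) = 0" using f2 by blast
      then show "\<exists>n. f (fst (dec (fst (n, x)) :: nat \<times> 'b), (snd (n, x), snd (dec (fst (n, x)) :: nat \<times> 'b))) = 0"
        by (intro exI[of _ "enc (n, y)"]) (simp only: fst_conv snd_conv dec_enc)
    qed (auto simp: f2)
  qed
qed

text \<open>Finitely many witnesses have a common bound. For a bound \<open>m\<close>, the product
  of the values at \<open>0, ..., m\<close> vanishes iff some witness up to \<open>m\<close> is
  accepted, and the sum of these products over all \<open>i\<close> vanishes iff this holds for
  every \<open>i\<close>.\<close>

lemma re_all_less:
  assumes P: "re (\<lambda>z. P (fst z) (snd z))" and k: "tc k"
  shows "re (\<lambda>x. \<forall>i < (k x :: nat). P x i)"
proof -
  obtain f where f: "tc f" "\<forall>z. P (fst z) (snd z) \<longleftrightarrow> (\<exists>n::nat. f (n, z) = (0::nat))"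
    using P unfolding re_def by blast
  have f2: "P x y \<longleftrightarrow> (\<exists>n::nat. f (n, (x, y)) = 0)" for x y using f(2)[rule_format, of "(x, y)"] by simp
  define g where "g = (\<lambda>i m x. rec_nat (f (0, (x, i))) (\<lambda>n y. y * f (Suc n, (x, i))) m)"
  have g: "g i m x = 0 \<longleftrightarrow> (\<exists>n \<le> m. f (n, (x, i)) = 0)" for i m x
    unfolding g_def by (induction m) (auto simp: le_Suc_eq)
  define h where "h = (\<lambda>z. rec_nat 0 (\<lambda>i y. y + g i (fst z) (snd z)) (k (snd z)))"
  have "rec_nat 0 (\<lambda>i y. y + g i m x) j = 0 \<longleftrightarrow> (\<forall>i < j. g i m x = 0)" for j m x
    by (induction j) (auto simp: less_Suc_eq)
  then have h: "h (m, x) = 0 \<longleftrightarrow> (\<forall>i < k x. \<exists>n \<le> m. f (n, (x, i)) = 0)" for m x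
    unfolding h_def using g by simp
  show ?thesis
  proof (rule reI)
    show "tc h" unfolding h_def g_def
      by (intro tc_rec tc_intros tc_comp[OF f(1)] tc_comp[OF k])
    show "(\<forall>i < k x. P x i) \<longleftrightarrow> (\<exists>n. h (n, x) = 0)" for x
    proof
      assume "\<forall>i < k x. P x i"
      then obtain n where n: "\<forall>i < k x. f (n i, (x, i)) = 0" unfolding f2 by metis
      have "\<forall>i < k x. n i \<le> Max (n ` {..<k x})" by auto
      with n show "\<exists>n. h (n, x) = 0" unfolding h by blast
    qed (auto simp: h f2)
  qed
qed

lemma re_mem: "tc f \<Longrightarrow> tc l \<Longrightarrow> re (\<lambda>x. f x \<in> set (l x))"
proof -
  assume fl: "tc f" "tc l"
  have "re (\<lambda>x. \<exists>i. \<exists>zs. drop i (l x) = f x # zs)"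
    by (intro re_ex re_eq tc_intros tc_comp[OF fl(1)] tc_comp[OF fl(2)])
  moreover have "(\<exists>i zs. drop i xs = y # zs) \<longleftrightarrow> y \<in> set xs" for xs and y :: 'b
  proof
    assume "\<exists>i zs. drop i xs = y # zs"
    then show "y \<in> set xs" by (metis in_set_dropD list.set_intros(1))
  next
    assume "y \<in> set xs"
    then obtain i where "i < length xs" "xs ! i = y" by (auto simp: in_set_conv_nth)
    then show "\<exists>i zs. drop i xs = y # zs" using Cons_nth_drop_Suc by metis
  qed
  ultimately show ?thesis by simp
qed

text \<open>\<open>enc (l x)\<close> takes the place of the length of the list, which is not yet
  known to be computable; positions beyond the end see an empty \<open>drop\<close> and impose
  nothing.\<close>

lemma re_ball:
  assumes P: "re (\<lambda>z. P (fst z) (snd z))" and l: "tc l"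
  shows "re (\<lambda>x. \<forall>y \<in> set (l x). P x y)"
proof -
  have "re (\<lambda>x. \<forall>i < enc (l x). drop i (l x) = [] \<or> (\<exists>y zs. drop i (l x) = y # zs \<and> P x y))"
    by (intro re_all_less re_disj re_ex re_conj re_eq tc_intros tc_comp[OF l]
        re_comp[OF P, of "\<lambda>z. (fst (fst (fst z)), snd (fst z))", simplified])
  moreover have "(\<forall>i < enc xs. drop i xs = [] \<or> (\<exists>y zs. drop i xs = y # zs \<and> P x y))
      \<longleftrightarrow> (\<forall>y \<in> set xs. P x y)" (is "?L \<longleftrightarrow> ?R") for xs x
  proof
    assume ?L
    show ?R
    proof
      fix y assume "y \<in> set xs"
      then obtain i where i: "i < length xs" "xs ! i = y" by (auto simp: in_set_conv_nth)
      then have "i < enc xs" using length_le_enc[of xs] by simp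
      with \<open>?L\<close> i show "P x y" by (auto simp: Cons_nth_drop_Suc[symmetric])
    qed
  next
    assume ?R
    have "drop i xs = [] \<or> (\<exists>y zs. drop i xs = y # zs \<and> P x y)" for i
    proof (cases "drop i xs")
      case (Cons y zs)
      then have "y \<in> set xs" by (metis in_set_dropD list.set_intros(1))
      with \<open>?R\<close> Cons show ?thesis by blast
    qed blast
    then show ?L by blast
  qed
  ultimately show ?thesis by simp
qed

lemma re_neq: "tc f \<Longrightarrow> tc g \<Longrightarrow> re (\<lambda>x. f x \<noteq> g x)"
proof -
  assume "tc f" "tc g"
  then have "re (\<lambda>x. enc (f x) < enc (g x) \<or> enc (g x) < enc (f x))"
    by (intro re_disj re_less tc_intros)
  moreover have "enc a < enc b \<or> enc b < enc a \<longleftrightarrow> a \<noteq> b" for a b :: 'b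
    using enc_eq_iff nat_neq_iff by metis
  ultimately show ?thesis by simp
qed

lemma re_const: "re (\<lambda>x. b)"
proof (cases b)
  case True
  then show ?thesis using re_eq[OF tc_id tc_id] by simp
next
  case False
  then show ?thesis using re_neq[OF tc_id tc_id] by simp
qed

lemma re_finite: "finite A \<Longrightarrow> tc f \<Longrightarrow> re (\<lambda>x. f x \<in> A)"
proof (induction rule: finite_induct)
  case (insert a A)
  then show ?case by (auto intro!: re_disj re_eq tc_intros)
qed (auto intro: re_const)

lemma re_nmem: "tc f \<Longrightarrow> tc l \<Longrightarrow> re (\<lambda>x. f x \<notin> set (l x))"
proof -
  assume fl: "tc f" "tc l"
  have "re (\<lambda>x. \<forall>y \<in> set (l x). y \<noteq> f x)"
    by (intro re_ball re_neq tc_intros tc_comp[OF fl(1)] fl(2))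
  moreover have "(\<forall>y \<in> set xs. y \<noteq> z) \<longleftrightarrow> z \<notin> set xs" for xs and z :: 'b by blast
  ultimately show ?thesis by simp
qed

text \<open>Enumeration operators: the premise of a rule may use finitely many elements of the set being defined.\<close>

definition reop :: "(('b::enc \<Rightarrow> bool) \<Rightarrow> 'a::enc \<Rightarrow> bool) \<Rightarrow> bool" where
  "reop Q \<longleftrightarrow> re (\<lambda>z. Q (\<lambda>y. y \<in> set (fst z)) (snd z)) \<and>
     (\<forall>X Y x. (\<forall>y. X y \<longrightarrow> Y y) \<longrightarrow> Q X x \<longrightarrow> Q Y x) \<and>
     (\<forall>X x. Q X x \<longrightarrow> (\<exists>l. (\<forall>y \<in> set l. X y) \<and> Q (\<lambda>y. y \<in> set l) x))"

lemma reopD: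
  assumes "reop Q"
  shows "re (\<lambda>z. Q (\<lambda>y. y \<in> set (fst z)) (snd z))"
    "(\<And>y. X y \<Longrightarrow> Y y) \<Longrightarrow> Q X x \<Longrightarrow> Q Y x"
    "Q X x \<Longrightarrow> \<exists>l. (\<forall>y \<in> set l. X y) \<and> Q (\<lambda>y. y \<in> set l) x"
  using assms unfolding reop_def by blast+

lemma reop_X: "tc f \<Longrightarrow> reop (\<lambda>X x. X (f x))"
  unfolding reop_def
proof (intro conjI allI impI)
  assume f: "tc f"
  show "re (\<lambda>z. f (snd z) \<in> set (fst z))" by (intro re_mem tc_intros tc_comp[OF f])
  fix X and x :: 'a assume "X (f x)"
  then show "\<exists>l. (\<forall>y\<in>set l. X y) \<and> f x \<in> set l" by (intro exI[of _ "[f x]"]) auto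
qed auto

lemma reop_re: "re P \<Longrightarrow> reop (\<lambda>X x. P x)"
  unfolding reop_def
proof (intro conjI allI impI)
  assume P: "re P"
  show "re (\<lambda>z. P (snd z))" by (intro re_comp[OF P] tc_intros)
qed (auto intro: exI[of _ "[]"])

lemma reop_conj:
  assumes Q: "reop Q" and R: "reop R" shows "reop (\<lambda>X x. Q X x \<and> R X x)"
  unfolding reop_def
proof (intro conjI allI impI)
  show "re (\<lambda>z. Q (\<lambda>y. y \<in> set (fst z)) (snd z) \<and> R (\<lambda>y. y \<in> set (fst z)) (snd z))"
    by (intro re_conj reopD(1)[OF Q] reopD(1)[OF R])
next
  fix X Y x assume XY: "\<forall>y. X y \<longrightarrow> Y y" and Q': "Q X x \<and> R X x"
  show "Q Y x" using reopD(2)[OF Q, of X Y x] XY Q' by blast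
  show "R Y x" using reopD(2)[OF R, of X Y x] XY Q' by blast
next
  fix X x assume Q': "Q X x \<and> R X x"
  obtain l where l: "\<forall>y\<in>set l. X y" "Q (\<lambda>y. y \<in> set l) x" using reopD(3)[OF Q] Q' by blast
  obtain k where k: "\<forall>y\<in>set k. X y" "R (\<lambda>y. y \<in> set k) x" using reopD(3)[OF R] Q' by blast
  have "Q (\<lambda>y. y \<in> set (l @ k)) x" using l(2) by (rule reopD(2)[OF Q, rotated]) auto
  moreover have "R (\<lambda>y. y \<in> set (l @ k)) x" using k(2) by (rule reopD(2)[OF R, rotated]) auto
  ultimately show "\<exists>l. (\<forall>y\<in>set l. X y) \<and> Q (\<lambda>y. y \<in> set l) x \<and> R (\<lambda>y. y \<in> set l) x"
    using l(1) k(1) by (intro exI[of _ "l @ k"]) auto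
qed

lemma reop_disj:
  assumes Q: "reop Q" and R: "reop R" shows "reop (\<lambda>X x. Q X x \<or> R X x)"
  unfolding reop_def
proof (intro conjI allI impI)
  show "re (\<lambda>z. Q (\<lambda>y. y \<in> set (fst z)) (snd z) \<or> R (\<lambda>y. y \<in> set (fst z)) (snd z))"
    by (intro re_disj reopD(1)[OF Q] reopD(1)[OF R])
next
  fix X Y x assume "\<forall>y. X y \<longrightarrow> Y y" "Q X x \<or> R X x"
  then show "Q Y x \<or> R Y x" using reopD(2)[OF Q, of X Y x] reopD(2)[OF R, of X Y x] by blast
next
  fix X x assume "Q X x \<or> R X x"
  then show "\<exists>l. (\<forall>y\<in>set l. X y) \<and> (Q (\<lambda>y. y \<in> set l) x \<or> R (\<lambda>y. y \<in> set l) x)"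
    using reopD(3)[OF Q, of X x] reopD(3)[OF R, of X x] by blast
qed

lemma reop_ex:
  assumes Q: "reop (\<lambda>X z. Q X (fst z) (snd z))" shows "reop (\<lambda>X x. \<exists>y. Q X x y)"
  unfolding reop_def
proof (intro conjI allI impI)
  have "re (\<lambda>z. Q (\<lambda>y. y \<in> set (fst (fst (fst z), (snd (fst z), snd z))))
      (fst (snd (fst (fst z), (snd (fst z), snd z)))) (snd (snd (fst (fst z), (snd (fst z), snd z)))))"
    by (rule re_comp[OF reopD(1)[OF Q]]) (intro tc_intros)
  then show "re (\<lambda>z. \<exists>y. Q (\<lambda>y. y \<in> set (fst z)) (snd z) y)" by (intro re_ex) simp
next
  fix X Y x assume XY: "\<forall>y. X y \<longrightarrow> Y y" "\<exists>y. Q X x y"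
  then obtain y where "Q X x y" by blast
  then have "Q Y x y" using reopD(2)[OF Q, of X Y "(x, y)"] XY(1) by simp
  then show "\<exists>y. Q Y x y" by blast
next
  fix X x assume "\<exists>y. Q X x y"
  then obtain y where "Q X x y" by blast
  then show "\<exists>l. (\<forall>y\<in>set l. X y) \<and> (\<exists>y. Q (\<lambda>y. y \<in> set l) x y)"
    using reopD(3)[OF Q, of X "(x, y)"] by auto
qed

lemma reop_ball:
  assumes Q: "reop (\<lambda>X z. Q X (fst z) (snd z))" and k: "tc k"
  shows "reop (\<lambda>X x. \<forall>y \<in> set (k x). Q X x y)"
  unfolding reop_def
proof (intro conjI allI impI)
  have "re (\<lambda>z. Q (\<lambda>y. y \<in> set (fst (fst (fst z), (snd (fst z), snd z))))
      (fst (snd (fst (fst z), (snd (fst z), snd z)))) (snd (snd (fst (fst z), (snd (fst z), snd z)))))"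
    by (rule re_comp[OF reopD(1)[OF Q]]) (intro tc_intros)
  then show "re (\<lambda>z. \<forall>y\<in>set (k (snd z)). Q (\<lambda>y. y \<in> set (fst z)) (snd z) y)"
    by (intro re_ball tc_comp[OF k] tc_intros) simp
next
  fix X Y x assume XY: "\<forall>y. X y \<longrightarrow> Y y" "\<forall>y\<in>set (k x). Q X x y"
  then show "\<forall>y\<in>set (k x). Q Y x y" using reopD(2)[OF Q, of X Y "(x, y)" for y] by auto
next
  fix X x assume *: "\<forall>y\<in>set (k x). Q X x y"
  have "\<exists>l. (\<forall>y\<in>set l. X y) \<and> (\<forall>y\<in>set ys. Q (\<lambda>y. y \<in> set l) x y)" if "set ys \<subseteq> set (k x)" for ys
    using that
  proof (induction ys)
    case (Cons y ys)
    then obtain l where l: "\<forall>y\<in>set l. X y" "\<forall>y\<in>set ys. Q (\<lambda>y. y \<in> set l) x y" by auto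
    have "Q X x y" using * Cons.prems by auto
    then obtain m where m: "\<forall>y\<in>set m. X y" "Q (\<lambda>y. y \<in> set m) x y"
      using reopD(3)[OF Q, of X "(x, y)"] by auto
    have "Q (\<lambda>y. y \<in> set (l @ m)) x z" if "z \<in> set (y # ys)" for z
    proof (cases "z \<in> set ys")
      case True
      then show ?thesis using reopD(2)[OF Q, of "\<lambda>y. y \<in> set l" "\<lambda>y. y \<in> set (l @ m)" "(x, z)"] l(2) by auto
    next
      case False
      then show ?thesis using that m(2)
          reopD(2)[OF Q, of "\<lambda>y. y \<in> set m" "\<lambda>y. y \<in> set (l @ m)" "(x, z)"] by auto
    qed
    then show ?case using l(1) m(1) by (intro exI[of _ "l @ m"]) auto
  qed (auto intro: exI[of _ "[]"])
  then show "\<exists>l. (\<forall>y\<in>set l. X y) \<and> (\<forall>y\<in>set (k x). Q (\<lambda>y. y \<in> set l) x y)" by blast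
qed

text \<open>An element of the least fixed point is witnessed by a list in which every entry is derived
  from entries further down.\<close>

lemma re_lfp:
  fixes Q :: "('a::enc \<Rightarrow> bool) \<Rightarrow> 'a \<Rightarrow> bool"
  assumes Q: "reop Q"
  shows "re (\<lambda>x. lfp Q x)"
proof -
  have mono: "mono Q" by (intro monoI le_funI le_boolI) (use reopD(2)[OF Q] in blast)
  define valid where "valid = (\<lambda>T. \<forall>i < enc T. drop i T = [] \<or>
      (\<exists>z zs. drop i T = z # zs \<and> Q (\<lambda>y. y \<in> set zs) z))"
  have valid: "valid T \<longleftrightarrow> (\<forall>as z zs. T = as @ z # zs \<longrightarrow> Q (\<lambda>y. y \<in> set zs) z)" for T
  proof
    assume v: "valid T"
    show "\<forall>as z zs. T = as @ z # zs \<longrightarrow> Q (\<lambda>y. y \<in> set zs) z"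
    proof (intro allI impI)
      fix as z zs assume T: "T = as @ z # zs"
      have "length as < enc T" using length_le_enc[of T] T by simp
      then show "Q (\<lambda>y. y \<in> set zs) z" using v T unfolding valid_def by fastforce
    qed
  next
    assume *: "\<forall>as z zs. T = as @ z # zs \<longrightarrow> Q (\<lambda>y. y \<in> set zs) z"
    show "valid T" unfolding valid_def
    proof (intro allI impI)
      fix i
      show "drop i T = [] \<or> (\<exists>z zs. drop i T = z # zs \<and> Q (\<lambda>y. y \<in> set zs) z)"
      proof (cases "drop i T")
        case (Cons z zs)
        then have "T = take i T @ z # zs" by (metis append_take_drop_id)
        with * Cons show ?thesis by blast
      qed blast
    qed
  qed
  have app: "valid (S @ T)" if S: "valid S" and T: "valid T" for S T
    unfolding valid
  proof (intro allI impI)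
    fix as z zs assume "S @ T = as @ z # zs"
    then consider (1) bs where "as = S @ bs" "T = bs @ z # zs" | (2) bs where "S = as @ z # bs" "zs = bs @ T"
      by (auto simp: append_eq_append_conv2 append_eq_Cons_conv)
    then show "Q (\<lambda>y. y \<in> set zs) z"
    proof cases
      case (1 bs)
      show ?thesis using T[unfolded valid, rule_format, OF 1(2)] .
    next
      case (2 bs)
      have *: "Q (\<lambda>y. y \<in> set bs) z" by (rule S[unfolded valid, rule_format, OF 2(1)])
      show ?thesis by (rule reopD(2)[OF Q _ *]) (simp add: 2(2))
    qed
  qed
  have Cons: "valid (z # T)" if T: "valid T" and z: "Q (\<lambda>y. y \<in> set T) z" for z T
    unfolding valid
  proof (intro allI impI)
    fix as w zs assume "z # T = as @ w # zs"
    then show "Q (\<lambda>y. y \<in> set zs) w" using T z unfolding valid by (cases as) auto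
  qed
  have sound: "lfp Q x" if "valid T" "x \<in> set T" for T x
    using that
  proof (induction T arbitrary: x)
    case (Cons z T)
    have T: "valid T" using Cons.prems(1) unfolding valid by (metis append_Cons)
    have "Q (\<lambda>y. y \<in> set T) z" using Cons.prems(1) unfolding valid by (metis append_Nil)
    then have "Q (lfp Q) z" by (rule reopD(2)[OF Q, rotated]) (use Cons.IH T in blast)
    then have "lfp Q z" using lfp_unfold[OF mono] by metis
    then show ?case using Cons T by auto
  qed simp
  have complete: "\<exists>T. valid T \<and> x \<in> set T" if "lfp Q x" for x
  proof -
    \<comment> \<open>The elements having a witness list are closed under \<open>Q\<close>: by
      compactness only finitely many premises are used, and their witness lists can be concatenated
      below the new element.\<close>
    have "lfp Q \<le> (\<lambda>x. \<exists>T. valid T \<and> x \<in> set T)"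
    proof (rule lfp_lowerbound, intro le_funI le_boolI)
      fix x assume "Q (\<lambda>x. \<exists>T. valid T \<and> x \<in> set T) x"
      then obtain l where l: "\<forall>y\<in>set l. \<exists>T. valid T \<and> y \<in> set T" "Q (\<lambda>y. y \<in> set l) x"
        using reopD(3)[OF Q] by blast
      from l(1) have "\<exists>T. valid T \<and> set l \<subseteq> set T"
      proof (induction l)
        case Nil
        show ?case by (intro exI[of _ "[]"]) (auto simp: valid_def)
      next
        case (Cons y l)
        then obtain S T where "valid S" "set l \<subseteq> set S" "valid T" "y \<in> set T" by auto
        then show ?case using app[of S T] by (intro exI[of _ "S @ T"]) auto
      qed
      then obtain T where T: "valid T" "set l \<subseteq> set T" by blast
      have "Q (\<lambda>y. y \<in> set T) x" by (rule reopD(2)[OF Q _ l(2)]) (use T(2) in auto)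
      then show "\<exists>T. valid T \<and> x \<in> set T" using Cons[OF T(1)] by (intro exI[of _ "x # T"]) auto
    qed
    with that show ?thesis by (auto simp: le_fun_def)
  qed
  have "re (\<lambda>x. \<exists>T. (\<forall>i < enc T. drop i T = [] \<or>
      (\<exists>z zs. drop i T = z # zs \<and> Q (\<lambda>y. y \<in> set zs) z)) \<and> x \<in> set T)"
    by (intro re_ex re_conj re_all_less re_disj re_eq re_mem tc_intros
        re_comp[OF reopD(1)[OF Q], of "\<lambda>z. (snd z, snd (fst z))", simplified])
  moreover have "lfp Q x \<longleftrightarrow> (\<exists>T. (\<forall>i < enc T. drop i T = [] \<or>
      (\<exists>z zs. drop i T = z # zs \<and> Q (\<lambda>y. y \<in> set zs) z)) \<and> x \<in> set T)" for x
    using sound complete unfolding valid_def by blast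
  ultimately show ?thesis by simp
qed

lemmas re_intros = re_conj re_disj re_ex re_ball re_all_less re_eq re_neq re_le re_less re_mem re_nmem re_const

lemmas reop_intros = reop_X reop_conj reop_disj reop_ex reop_ball reop_re

text \<open>The search runs through pairs of a witness and a value and returns the value.
  \<open>D\<close> may be any predicate: it only says where the search is known to end, so it need
  not be semi-decidable.\<close>

lemma re_selection:
  assumes R: "re (\<lambda>z. R (fst z) (snd z) :: bool)" and total: "\<And>x. D x \<Longrightarrow> \<exists>y. R x y"
  shows "\<exists>r. \<forall>x :: nat. D x \<longrightarrow> (\<exists>y :: nat. computes r [x] y \<and> R x y)"
proof -
  obtain f where f: "tc f" "\<forall>z. R (fst z) (snd z) \<longleftrightarrow> (\<exists>n::nat. f (n, z) = (0::nat))"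
    using R unfolding re_def by blast
  have f2: "R x y \<longleftrightarrow> (\<exists>n::nat. f (n, (x, y)) = 0)" for x y using f(2)[rule_format, of "(x, y)"] by simp
  define g where "g = (\<lambda>w x. f (fst (dec w :: nat \<times> nat), (x, snd (dec w :: nat \<times> nat))))"
  have "tc (\<lambda>z. g (fst z) (snd z))" unfolding g_def by (intro tc_intros tc_comp[OF f(1)] tc_dec)
  then have "rc (Suc 0) (\<lambda>xs. g (fst (dec (xs ! 0) :: nat \<times> nat)) (snd (dec (xs ! 0) :: nat \<times> nat)))"
    unfolding tc_def enc_nat_def .
  from rc_comp1[where f = "\<lambda>p. g (fst (dec p :: nat \<times> nat)) (snd (dec p :: nat \<times> nat))", OF this,
      of "Suc (Suc 0)" "\<lambda>xs. prod_encode (xs ! 0, xs ! 1)"]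
  have "rc (Suc (Suc 0)) (\<lambda>xs. g (fst (dec (prod_encode (xs ! 0, xs ! 1)) :: nat \<times> nat))
      (snd (dec (prod_encode (xs ! 0, xs ! 1)) :: nat \<times> nat)))"
    by (simp add: rc_pair rc_proj)
  moreover have "(dec (prod_encode (a, b)) :: nat \<times> nat) = (a, b)" for a b
  proof -
    have "prod_encode (a, b) = enc (a, b)" by (simp add: enc_prod_def enc_nat_def)
    then show ?thesis by (simp only: dec_enc)
  qed
  ultimately have "rc (Suc (Suc 0)) (\<lambda>xs. g (xs ! 0) (xs ! 1))" by simp
  then obtain r where r: "\<forall>xs. length xs = Suc (Suc 0) \<longrightarrow> computes r xs (g (xs ! 0) (xs ! 1))"
    unfolding rc_def by blast
  have "rc (Suc 0) (\<lambda>xs. snd (prod_decode (xs ! 0)))" by (intro rc_snd rc_proj) auto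
  then obtain s where s: "\<forall>xs. length xs = Suc 0 \<longrightarrow> computes s xs (snd (prod_decode (xs ! 0)))"
    unfolding rc_def by blast
  have "\<exists>y. computes (Comp s [Mu r]) [x] y \<and> R x y" if D: "D x" for x
  proof -
    obtain y n where "f (n, (x, y)) = 0" using total[OF D] f2 by blast
    then have "g (enc (n, y)) x = 0" unfolding g_def by simp
    then have ex: "\<exists>w. g w x = 0" by blast
    define w where "w = (LEAST w. g w x = 0)"
    have w0: "g w x = 0" unfolding w_def using ex by (rule LeastI_ex)
    have r2: "computes r [m, x] (g m x)" for m using r[rule_format, of "[m, x]"] by simp
    have "computes (Mu r) [x] w"
    proof (rule computes.Mu)
      show "computes r [w, x] 0" using r2[of w] w0 by simp
      fix m assume "m < w"
      then have "g m x \<noteq> 0" unfolding w_def using not_less_Least by blast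
      then show "\<exists>y. computes r [m, x] (Suc y)" using r2[of m] by (metis not0_implies_Suc)
    qed
    then have "computes (Comp s [Mu r]) [x] (snd (prod_decode w))"
      using s[rule_format, of "[w]"] by (intro computes.Comp[where ys = "[w]"]) auto
    moreover have "R x (snd (prod_decode w))"
    proof -
      have "snd (dec w :: nat \<times> nat) = snd (prod_decode w)"
        by (metis dec_enc enc_dec enc_prod_def enc_nat_def prod_encode_inverse snd_conv)
      then show ?thesis using w0 unfolding g_def f2 by auto
    qed
    ultimately show ?thesis by blast
  qed
  then show ?thesis by blast
qed

section \<open>Trees of a sort and coinduction\<close>

lemma trees_iff:
  "t \<in> trees S s \<longleftrightarrow> root t \<in> gens S \<and> gres (root t) = s \<and>
     list_all2 (\<lambda>s t. t \<in> trees S s) (gargs (root t)) (children t)"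
proof -
  have "tree_of S s t \<longleftrightarrow> root t \<in> gens S \<and> gres (root t) = s \<and> list_all2 (tree_of S) (gargs (root t)) (children t)"
    by (subst tree_of.simps) (metis tree.collapse tree.sel)
  then show ?thesis by (simp add: trees_def)
qed

lemma trees_coinduct [consumes 1, case_names step]:
  assumes "X s t" and step: "\<And>s t. X s t \<Longrightarrow> root t \<in> gens S \<and> gres (root t) = s \<and>
     list_all2 (\<lambda>s t. X s t \<or> t \<in> trees S s) (gargs (root t)) (children t)"
  shows "t \<in> trees S s"
  unfolding trees_def mem_Collect_eq
  using assms(1)
proof (coinduction arbitrary: s t rule: tree_of.coinduct)
  case (tree_of s t)
  from step[OF this] show ?case
    by (intro exI[of _ "root t"] exI[of _ "children t"]) (auto simp: trees_def elim!: list_all2_mono)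
qed

lemma tree_eq_coinduct:
  assumes "R t u" and "\<And>t u. R t u \<Longrightarrow> root t = root u \<and> list_all2 (\<lambda>t u. R t u \<or> t = u) (children t) (children u)"
  shows "t = u"
proof -
  have "R t u \<or> t = u" using assms(1) by blast
  then show ?thesis
  proof (coinduction arbitrary: t u)
    case (Eq_tree t u)
    then show ?case using assms(2)[of t u] by (auto simp: list_all2_refl)
  qed
qed

subsection \<open>Trees\<close>

fun sub :: "tree \<Rightarrow> nat list \<Rightarrow> tree option" where
  "sub t [] = Some t"
| "sub t (i # p) = (if i < length (children t) then sub (children t ! i) p else None)"

fun rep :: "tree \<Rightarrow> nat list \<Rightarrow> tree \<Rightarrow> tree" where
  "rep t [] u = u"
| "rep t (i # p) u = Node (root t) ((children t)[i := rep (children t ! i) p u])"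

lemma sub_append: "sub t (p @ q) = (case sub t p of None \<Rightarrow> None | Some u \<Rightarrow> sub u q)"
  by (induction t p rule: sub.induct) auto

lemma positions_eq:
  "{p. position t p} = insert [] (\<Union>i < length (children t). (#) i ` {p. position (children t ! i) p})"
proof (intro equalityI subsetI)
  fix p assume "p \<in> {p. position t p}"
  then show "p \<in> insert [] (\<Union>i < length (children t). (#) i ` {p. position (children t ! i) p})"
    by (cases p) (auto elim: position.cases)
qed (auto intro: position.intros)

lemma finite_tree_iff: "finite_tree t \<longleftrightarrow> (\<forall>c \<in> set (children t). finite_tree c)"
proof -
  have "finite_tree t \<longleftrightarrow> (\<forall>i < length (children t). finite ((#) i ` {p. position (children t ! i) p}))"
    unfolding finite_tree_def by (subst positions_eq) auto
  also have "\<dots> \<longleftrightarrow> (\<forall>i < length (children t). finite_tree (children t ! i))"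
    unfolding finite_tree_def by (auto simp: finite_image_iff)
  finally show ?thesis by (auto simp: all_set_conv_all_nth)
qed

lemma finite_tree_induct [consumes 1, case_names node]:
  assumes "finite_tree t"
    and step: "\<And>t. finite_tree t \<Longrightarrow> (\<And>c. c \<in> set (children t) \<Longrightarrow> P c) \<Longrightarrow> P t"
  shows "P t"
  using assms(1)
proof (induction "card {p. position t p}" arbitrary: t rule: less_induct)
  case less
  show ?case
  proof (rule step[OF less.prems])
    fix c assume "c \<in> set (children t)"
    then obtain i where i: "i < length (children t)" "children t ! i = c" by (auto simp: in_set_conv_nth)
    have "(#) i ` {p. position c p} \<subseteq> {p. position t p}"
      using i by (auto intro: position.intros)
    moreover have "[] \<in> {p. position t p} - (#) i ` {p. position c p}" by (auto intro: position.intros)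
    ultimately have "(#) i ` {p. position c p} \<subset> {p. position t p}" by blast
    then have "card ((#) i ` {p. position c p}) < card {p. position t p}"
      using less.prems unfolding finite_tree_def by (rule psubset_card_mono[rotated])
    then have "card {p. position c p} < card {p. position t p}" by (simp add: card_image)
    moreover have "finite_tree c" using less.prems \<open>c \<in> _\<close> finite_tree_iff by blast
    ultimately show "P c" using less.hyps by blast
  qed
qed

lemma finite_tree_sub: "sub t p = Some u \<Longrightarrow> finite_tree t \<Longrightarrow> finite_tree u"
proof (induction t p rule: sub.induct)
  case (2 t i p)
  then show ?case using finite_tree_iff[of t] by (auto split: if_splits)
qed simp

lemma finite_no_self_sub: "finite_tree t \<Longrightarrow> p \<noteq> [] \<Longrightarrow> sub t p \<noteq> Some t"
proof (induction t arbitrary: p rule: finite_tree_induct)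
  case (node t)
  show ?case
  proof
    assume s: "sub t p = Some t"
    obtain i q where p: "p = i # q" using node.prems by (cases p) auto
    let ?c = "children t ! i"
    have i: "i < length (children t)" and q: "sub ?c q = Some t" using s p by (auto split: if_splits)
    then have "sub ?c (q @ [i]) = Some ?c" by (simp add: sub_append)
    moreover have "?c \<in> set (children t)" using i by simp
    ultimately show False using node.IH by blast
  qed
qed

lemma same_kind_update:
  assumes "i < length ts" "finite_tree u = finite_tree (ts ! i)"
  shows "finite_tree (Node g (ts[i := u])) = finite_tree (Node g ts)"
  unfolding finite_tree_iff[of "Node g ts"] finite_tree_iff[of "Node g (ts[i := u])"] using assms
  by (auto simp: all_set_conv_all_nth nth_list_update)

lemma trees_child: "t \<in> trees S s \<Longrightarrow> i < length (children t) \<Longrightarrow> children t ! i \<in> trees S (gargs (root t) ! i)"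
  by (simp add: trees_iff[of t] list_all2_conv_all_nth)

lemma trees_length: "t \<in> trees S s \<Longrightarrow> length (children t) = length (gargs (root t))"
  by (simp add: trees_iff[of t] list_all2_conv_all_nth)

lemma trees_sort: "t \<in> trees S s \<Longrightarrow> gres (root t) = s"
  by (simp add: trees_iff[of t])

lemma trees_root: "t \<in> trees S s \<Longrightarrow> root t \<in> gens S"
  by (simp add: trees_iff[of t])

lemma trees_child_mem: "t \<in> trees S s \<Longrightarrow> c \<in> set (children t) \<Longrightarrow> c \<in> trees S (gres (root c))"
  by (metis in_set_conv_nth trees_child trees_sort)

lemma trees_update:
  assumes "Node g ts \<in> trees S s" "i < length ts" "u \<in> trees S (gargs g ! i)"
  shows "Node g (ts[i := u]) \<in> trees S s"
  using assms unfolding trees_iff[of "Node g ts"] trees_iff[of "Node g (ts[i := u])"]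
  by (simp add: list_all2_conv_all_nth nth_list_update)

section \<open>Solutions of systems of tree equations\<close>

text \<open>\<open>Inl\<close> marks unknowns of the system. A finished tree travels as
  \<open>Inr\<close> and unfolds to itself, which allows given trees to be plugged into a
  corecursively defined one.\<close>

primcorec unf :: "('x \<Rightarrow> gen) \<Rightarrow> ('x \<Rightarrow> ('x + tree) list) \<Rightarrow> 'x + tree \<Rightarrow> tree" where
  "root (unf lab kids z) = (case z of Inl x \<Rightarrow> lab x | Inr t \<Rightarrow> root t)"
| "children (unf lab kids z) = map (unf lab kids) (case z of Inl x \<Rightarrow> kids x | Inr t \<Rightarrow> map Inr (children t))"

lemma unf_Inr [simp]: "unf lab kids (Inr t) = t"
proof -
  have "u = unf lab kids (Inr t) \<Longrightarrow> u = t" for u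
  proof (coinduction arbitrary: u t)
    case Eq_tree
    then show ?case by (auto simp: list_all2_map1 list.rel_refl_strong)
  qed
  then show ?thesis by simp
qed

text \<open>The solution of the system \<open>x = lab x (kids x)\<close> for \<open>x \<in> Z\<close>, the remaining unknowns
  being given by \<open>h\<close>.\<close>

definition slv :: "'x set \<Rightarrow> ('x \<Rightarrow> gen) \<Rightarrow> ('x \<Rightarrow> 'x list) \<Rightarrow> ('x \<Rightarrow> tree) \<Rightarrow> 'x \<Rightarrow> tree" where
  "slv Z lab kids h x = (if x \<in> Z then
     unf lab (\<lambda>x. map (\<lambda>c. if c \<in> Z then Inl c else Inr (h c)) (kids x)) (Inl x) else h x)"

definition solves :: "'x set \<Rightarrow> ('x \<Rightarrow> gen) \<Rightarrow> ('x \<Rightarrow> 'x list) \<Rightarrow> ('x \<Rightarrow> tree) \<Rightarrow> bool" where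
  "solves Z lab kids h \<longleftrightarrow> (\<forall>x \<in> Z. h x = Node (lab x) (map h (kids x)))"

lemma slv_solves: "solves Z lab kids (slv Z lab kids h)"
  unfolding solves_def
proof
  fix x assume x: "x \<in> Z"
  let ?k = "\<lambda>x. map (\<lambda>c. if c \<in> Z then Inl c else Inr (h c)) (kids x)"
  have "unf lab ?k (if c \<in> Z then Inl c else Inr (h c)) = slv Z lab kids h c" for c
    by (simp add: slv_def)
  then have "children (unf lab ?k (Inl x)) = map (slv Z lab kids h) (kids x)"
    by (simp add: o_def)
  then show "slv Z lab kids h x = Node (lab x) (map (slv Z lab kids h) (kids x))"
    using x by (intro tree.expand) (simp add: slv_def[of Z lab kids h x])
qed

lemma slv_outside: "x \<notin> Z \<Longrightarrow> slv Z lab kids h x = h x"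
  by (simp add: slv_def)

text \<open>Every equation is guarded by a generator, so the pairs of corresponding values form a
  bisimulation, as long as the unknowns outside \<open>Z\<close> have equal values.\<close>

lemma solves_unique:
  assumes h: "solves Z lab kids h" and k: "solves Z lab kids k"
    and out: "\<And>x y. x \<in> Z \<Longrightarrow> y \<in> set (kids x) \<Longrightarrow> y \<in> Z \<or> h y = k y" and x: "x \<in> Z"
  shows "h x = k x"
proof (rule tree_eq_coinduct[where R = "\<lambda>t u. \<exists>x \<in> Z. t = h x \<and> u = k x"])
  show "\<exists>y \<in> Z. h x = h y \<and> k x = k y" using x by blast
  fix t u assume "\<exists>x \<in> Z. t = h x \<and> u = k x"
  then obtain x where x: "x \<in> Z" and tu: "t = h x" "u = k x" by blast
  have "h x = Node (lab x) (map h (kids x))" "k x = Node (lab x) (map k (kids x))"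
    using h k x unfolding solves_def by auto
  then show "root t = root u \<and> list_all2 (\<lambda>t u. (\<exists>x \<in> Z. t = h x \<and> u = k x) \<or> t = u) (children t) (children u)"
    unfolding tu by (simp add: list_all2_conv_all_nth) (metis out[OF x] nth_mem)
qed

lemma solves_trees:
  assumes h: "solves Z lab kids h"
    and wf: "\<And>x. x \<in> Z \<Longrightarrow> lab x \<in> gens S \<and> gres (lab x) = st x \<and> map st (kids x) = gargs (lab x)"
    and out: "\<And>x y. x \<in> Z \<Longrightarrow> y \<in> set (kids x) \<Longrightarrow> y \<in> Z \<or> h y \<in> trees S (st y)" and x: "x \<in> Z"
  shows "h x \<in> trees S (st x)"
proof (rule trees_coinduct[where X = "\<lambda>s t. \<exists>x \<in> Z. t = h x \<and> s = st x"])
  show "\<exists>y \<in> Z. h x = h y \<and> st x = st y" using x by blast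
  fix s t assume "\<exists>x \<in> Z. t = h x \<and> s = st x"
  then obtain x where x: "x \<in> Z" and ts: "t = h x" "s = st x" by blast
  have hx: "h x = Node (lab x) (map h (kids x))" using h x unfolding solves_def by auto
  have "list_all2 (\<lambda>s t. (\<exists>x \<in> Z. t = h x \<and> s = st x) \<or> t \<in> trees S s) (map st (kids x)) (map h (kids x))"
    by (simp add: list_all2_conv_all_nth) (metis out[OF x] nth_mem)
  then show "root t \<in> gens S \<and> gres (root t) = s \<and>
      list_all2 (\<lambda>s t. (\<exists>x\<in>Z. t = h x \<and> s = st x) \<or> t \<in> trees S s) (gargs (root t)) (children t)"
    using wf[OF x] unfolding ts hx by simp
qed

text \<open>Choosing one generator for each sort gives a system with one unknown per sort. Its
  solution may be infinite, which does no harm.\<close>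

lemma trees_nonempty:
  assumes S: "tree_signature S" and s: "s \<in> sorts S"
  shows "trees S s \<noteq> {}"
proof -
  define lab where "lab s = (SOME g. g \<in> gens_of S s)" for s
  have lab: "lab s \<in> gens_of S s" if "s \<in> sorts S" for s
  proof -
    have "\<exists>g. g \<in> gens_of S s" using S that unfolding tree_signature_def by blast
    then show ?thesis unfolding lab_def by (rule someI_ex)
  qed
  have "slv (sorts S) lab (\<lambda>s. gargs (lab s)) h s \<in> trees S s" for h
  proof (rule solves_trees[where st = "\<lambda>s. s", OF slv_solves])
    show "lab x \<in> gens S \<and> gres (lab x) = x \<and> map (\<lambda>s. s) (gargs (lab x)) = gargs (lab x)"
      if "x \<in> sorts S" for x using lab[OF that] by (auto simp: gens_of_def)
    show "y \<in> sorts S \<or> slv (sorts S) lab (\<lambda>s. gargs (lab s)) h y \<in> trees S y"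
      if "x \<in> sorts S" "y \<in> set (gargs (lab x))" for x y
      using lab[OF that(1)] that(2) S by (auto simp: gens_of_def tree_signature_def)
  qed (rule s)
  then show ?thesis by blast
qed

lemma gens_trees:
  assumes S: "tree_signature S" and g: "g \<in> gens S"
  shows "\<exists>t \<in> trees S (gres g). root t = g"
proof -
  have "\<forall>s \<in> set (gargs g). \<exists>t. t \<in> trees S s"
    using trees_nonempty[OF S] S g unfolding tree_signature_def by blast
  then obtain f where "\<forall>s \<in> set (gargs g). f s \<in> trees S s" by metis
  then have "Node g (map f (gargs g)) \<in> trees S (gres g)"
    using g by (subst trees_iff) (auto simp: list_all2_conv_all_nth)
  then show ?thesis by force
qed

section \<open>Kinds of trees with few members or few roots\<close>

text \<open>A kind is a sort together with finiteness or infiniteness. Case distinctions are made by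
  kinds, because a sort may have few trees of one kind and many of the other.\<close>

definition KT :: "signature \<Rightarrow> srt \<Rightarrow> bool \<Rightarrow> tree set" where
  "KT S s b = {t \<in> trees S s. finite_tree t = b}"

definition small :: "signature \<Rightarrow> srt \<Rightarrow> bool \<Rightarrow> bool" where
  "small S s b \<longleftrightarrow> finite (KT S s b)"

definition small_trees :: "signature \<Rightarrow> tree set" where
  "small_trees S = (\<Union>s \<in> sorts S. \<Union>b \<in> {b. small S s b}. KT S s b)"

text \<open>To be contained in every \<open>G\<close> under consideration: a tree with root outside
  \<open>G\<close> then belongs to a kind with infinitely many roots, so that further trees of its
  kind with roots outside \<open>G\<close> are available.\<close>

definition base_gens :: "signature \<Rightarrow> gen set" where
  "base_gens S = (\<Union>s \<in> sorts S. \<Union>b \<in> {b. finite (root ` KT S s b)}. root ` KT S s b)"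

lemma small_S_FF: "s \<in> S_FF S \<longleftrightarrow> s \<in> sorts S \<and> small S s True"
  by (simp add: S_FF_def small_def KT_def finite_trees_def)

lemma small_S_FI: "s \<in> S_FI S \<longleftrightarrow> s \<in> sorts S \<and> small S s False"
  by (simp add: S_FI_def small_def KT_def infinite_trees_def)

lemma trees_sorts: "tree_signature S \<Longrightarrow> t \<in> trees S s \<Longrightarrow> s \<in> sorts S"
  unfolding tree_signature_def using trees_root trees_sort by metis

lemma small_treesI: "tree_signature S \<Longrightarrow> t \<in> trees S s \<Longrightarrow> small S s (finite_tree t) \<Longrightarrow> t \<in> small_trees S"
  unfolding small_trees_def using trees_sorts[of S t s] by (auto simp: KT_def)

lemma small_treesD: "t \<in> small_trees S \<Longrightarrow>
   t \<in> trees S (gres (root t)) \<and> gres (root t) \<in> sorts S \<and> small S (gres (root t)) (finite_tree t)"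
  unfolding small_trees_def by (auto simp: KT_def dest: trees_sort)

lemma finite_small_trees: "tree_signature S \<Longrightarrow> finite (small_trees S)"
  unfolding small_trees_def by (auto simp: small_def tree_signature_def)

lemma finite_base_gens: "tree_signature S \<Longrightarrow> finite (base_gens S)"
  unfolding base_gens_def by (auto simp: tree_signature_def)

lemma base_gens_sub: "base_gens S \<subseteq> gens S"
  unfolding base_gens_def by (auto simp: KT_def trees_root)

text \<open>Replacing a child by trees of the same kind does not change the kind, so a sort with
  few trees of one kind only uses children of sorts with few trees.\<close>

lemma small_child:
  assumes t: "Node g ts \<in> trees S s" and sm: "small S s (finite_tree (Node g ts))" and i: "i < length ts"
  shows "small S (gargs g ! i) (finite_tree (ts ! i))"
  unfolding small_def
proof (rule ccontr)
  let ?X = "KT S (gargs g ! i) (finite_tree (ts ! i))"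
  assume "infinite ?X"
  moreover have "inj_on (\<lambda>u. Node g (ts[i := u])) ?X"
    using i by (auto intro!: inj_onI dest: arg_cong[of _ _ "\<lambda>xs. xs ! i"])
  ultimately have "infinite ((\<lambda>u. Node g (ts[i := u])) ` ?X)" by (simp add: finite_image_iff)
  moreover have "(\<lambda>u. Node g (ts[i := u])) ` ?X \<subseteq> KT S s (finite_tree (Node g ts))"
    using trees_update[OF t i] same_kind_update[OF i] by (auto simp: KT_def)
  ultimately show False using sm finite_subset unfolding small_def by blast
qed

lemma small_trees_child:
  assumes S: "tree_signature S" and t: "t \<in> small_trees S" and c: "c \<in> set (children t)"
  shows "c \<in> small_trees S"
proof -
  obtain i where i: "i < length (children t)" "c = children t ! i" using c by (auto simp: in_set_conv_nth)
  have t': "Node (root t) (children t) \<in> trees S (gres (root t))"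
    "small S (gres (root t)) (finite_tree (Node (root t) (children t)))" using small_treesD[OF t] by auto
  have "small S (gargs (root t) ! i) (finite_tree (children t ! i))" using small_child[OF t' i(1)] .
  then show ?thesis using trees_child[of t S _ i] t'(1) i by (intro small_treesI[OF S]) auto
qed

lemma small_trees_root: "t \<in> small_trees S \<Longrightarrow> root t \<in> base_gens S"
  unfolding small_trees_def base_gens_def by (auto simp: small_def)

text \<open>Every generator is the root of some tree, and in a sort with finitely many generators
  the kind of this tree has finitely many roots.\<close>

lemma gens_of_base:
  assumes S: "tree_signature S" and fin: "finite (gens_of S s)"
  shows "gens_of S s \<subseteq> base_gens S"
proof
  fix g assume g: "g \<in> gens_of S s"
  obtain t where t: "t \<in> trees S s" "root t = g" using gens_trees[OF S, of g] g by (auto simp: gens_of_def)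
  have "root ` KT S s (finite_tree t) \<subseteq> gens_of S s" by (auto simp: KT_def gens_of_def trees_root trees_sort)
  then have "finite (root ` KT S s (finite_tree t))" using fin finite_subset by blast
  moreover have "g \<in> root ` KT S s (finite_tree t)" using t by (auto simp: KT_def)
  ultimately show "g \<in> base_gens S" using trees_sorts[OF S t(1)] unfolding base_gens_def by blast
qed

text \<open>Each generator is the root of some tree, so finitely many trees leave room for finitely
  many generators only. Thus a conjunct excluding a generator in a sort with infinitely many of them
  never concerns a sort with finitely many trees.\<close>

lemma FF_FI_finite_gens:
  assumes S: "tree_signature S" and s: "s \<in> S_FF S" "s \<in> S_FI S"
  shows "finite (gens_of S s)"
proof -
  have "gens_of S s \<subseteq> root ` (KT S s True \<union> KT S s False)"
    using gens_trees[OF S] by (force simp: gens_of_def KT_def)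
  moreover have "finite (KT S s True \<union> KT S s False)" using s by (simp add: small_S_FF small_S_FI small_def)
  ultimately show ?thesis using finite_surj by blast
qed

section \<open>Replacement of subtrees and trees that do not repeat themselves\<close>

lemma rep_trees:
  assumes "sub t p = Some v" "t \<in> trees S s" "u \<in> trees S (gres (root v))"
  shows "rep t p u \<in> trees S s"
  using assms
proof (induction t p u arbitrary: s rule: rep.induct)
  case (1 t u)
  then show ?case using trees_sort by auto
next
  case (2 t i p u)
  then have i: "i < length (children t)" "sub (children t ! i) p = Some v" by (auto split: if_splits)
  have "rep (children t ! i) p u \<in> trees S (gargs (root t) ! i)"
    using 2 i trees_child[OF 2(3) i(1)] by blast
  then have "Node (root t) ((children t)[i := rep (children t ! i) p u]) \<in> trees S s"
    using 2(3) i(1) by (intro trees_update) auto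
  then show ?case by simp
qed

lemma sub_rep: "sub t p \<noteq> None \<Longrightarrow> sub (rep t p u) p = Some u"
  by (induction t p u rule: rep.induct) (auto split: if_splits)

lemma sub_rep_other:
  "sub t w \<noteq> None \<Longrightarrow> length q = length w \<Longrightarrow> q \<noteq> w \<Longrightarrow> sub (rep t w u) q = sub t q"
proof (induction t w u arbitrary: q rule: rep.induct)
  case (2 t i p u)
  then obtain j q' where q: "q = j # q'" by (cases q) auto
  from 2 q show ?case by (cases "i = j") (auto split: if_splits)
qed auto

text \<open>Both \<open>x0\<close> and \<open>x\<close> satisfy \<open>z = rep x0 w z\<close>. As
  \<open>w\<close> is nonempty this equation is guarded, so it has only one solution; the relation
  below follows the path \<open>w\<close> and starts again from the root when its end is
  reached.\<close>

lemma rep_fixpoint: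
  assumes x0: "sub x0 w = Some x0" and w: "w \<noteq> []" and x: "x = rep x0 w x"
  shows "x = x0"
proof (rule tree_eq_coinduct[where R = "\<lambda>a b. \<exists>v w'. w = v @ w' \<and> w' \<noteq> [] \<and> sub x0 v = Some b \<and> a = rep b w' x"])
  show "\<exists>v w'. w = v @ w' \<and> w' \<noteq> [] \<and> sub x0 v = Some x0 \<and> x = rep x0 w' x"
    using w x by (intro exI[of _ "[]"] exI[of _ w]) auto
next
  fix a b assume "\<exists>v w'. w = v @ w' \<and> w' \<noteq> [] \<and> sub x0 v = Some b \<and> a = rep b w' x"
  then obtain v i w' where w: "w = v @ i # w'" and v: "sub x0 v = Some b" and a: "a = rep b (i # w') x"
    by (metis neq_Nil_conv)
  have i: "i < length (children b)" "sub (children b ! i) w' = Some x0"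
    using x0 v unfolding w sub_append by (auto split: if_splits)
  have vi: "sub x0 (v @ [i]) = Some (children b ! i)" using v i by (simp add: sub_append)
  have "(\<exists>v w'. w = v @ w' \<and> w' \<noteq> [] \<and> sub x0 v = Some (children b ! i) \<and> rep (children b ! i) w'' x = rep (children b ! i) w' x)"
    if "w' = w''" "w'' \<noteq> []" for w''
    using w vi that by (intro exI[of _ "v @ [i]"] exI[of _ w'']) auto
  then have *: "\<exists>v z. w = v @ z \<and> z \<noteq> [] \<and> sub x0 v = Some (children b ! i) \<and> rep (children b ! i) w' x = rep (children b ! i) z x"
  proof (cases "w' = []")
    case True
    then have "children b ! i = x0" using i by simp
    then show ?thesis using True assms by (intro exI[of _ "[]"] exI[of _ w]) auto
  qed blast
  then show "root a = root b \<and> list_all2 (\<lambda>a b. (\<exists>v w'. w = v @ w' \<and> w' \<noteq> [] \<and> sub x0 v = Some b \<and>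
      a = rep b w' x) \<or> a = b) (children a) (children b)"
    unfolding a list_all2_conv_all_nth
  proof (intro conjI allI impI)
    fix j assume "j < length (children (rep b (i # w') x))"
    then have j: "j < length (children b)" by simp
    show "(\<exists>v w'a. w = v @ w'a \<and> w'a \<noteq> [] \<and> sub x0 v = Some (children b ! j) \<and>
        children (rep b (i # w') x) ! j = rep (children b ! j) w'a x) \<or>
        children (rep b (i # w') x) ! j = children b ! j"
      using * j by (cases "j = i") simp_all
  qed simp_all
qed

lemma sub_concat_replicate: "sub t p = Some t \<Longrightarrow> sub t (concat (replicate n p)) = Some t"
  by (induction n) (auto simp: sub_append)

lemma length_concat_replicate: "length (concat (replicate n p)) = n * length p"
  by (induction n) auto

text \<open>If \<open>x0\<close> repeats itself along \<open>p0\<close>, planting other trees far enough along this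
  path destroys every repetition along the finitely many paths in \<open>P\<close>.\<close>

lemma avoid_self_similar:
  assumes inf: "infinite A" and A: "A = KT S s False" and fin: "finite E" "finite P" and P: "[] \<notin> P"
  shows "\<exists>u \<in> A. u \<notin> E \<and> (\<forall>p \<in> P. sub u p \<noteq> Some u)"
proof (rule ccontr)
  assume "\<not> ?thesis"
  then have neg: "u \<in> A \<Longrightarrow> u \<notin> E \<Longrightarrow> \<exists>p \<in> P. sub u p = Some u" for u by blast
  obtain x0 where x0: "x0 \<in> A" "x0 \<notin> E" using inf fin(1) by (meson finite_subset subsetI)
  then obtain p0 where p0: "p0 \<in> P" "sub x0 p0 = Some x0" using neg by blast
  \<comment> \<open>A common multiple of the lengths of the paths in \<open>P\<close>: each
    \<open>q\<close> in \<open>P\<close> then has a power \<open>pw q\<close> of exactly the length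
    of \<open>w\<close>, which is either \<open>w\<close> itself or a position not affected by the
    replacement at \<open>w\<close>.\<close>
  define L where "L = (\<Prod>q \<in> P. length q)"
  have L: "L \<noteq> 0" unfolding L_def using fin(2) P by auto
  define w where "w = concat (replicate L p0)"
  have w: "sub x0 w = Some x0" unfolding w_def using p0 by (intro sub_concat_replicate)
  have p0ne: "p0 \<noteq> []" using p0 P by auto
  have w_ne: "w \<noteq> []" unfolding w_def using L p0ne by (cases L) auto
  define pw where "pw q = concat (replicate (length w div length q) q)" for q :: "nat list"
  have pw: "length (pw q) = length w" if "q \<in> P" for q
  proof -
    have "length q dvd L" unfolding L_def using fin(2) that by (intro dvd_prodI)
    then have "length q dvd length w" unfolding w_def length_concat_replicate by simp
    then show ?thesis unfolding pw_def length_concat_replicate by simp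
  qed
  let ?y = "\<lambda>x. rep x0 w x"
  have yw: "sub (?y x) w = Some x" for x using sub_rep[of x0 w x] w by simp
  have sx0: "x0 \<in> trees S s" using x0 A by (simp add: KT_def)
  have yA: "?y x \<in> A" if "x \<in> A" for x
  proof -
    have "?y x \<in> trees S s" using that sx0 A trees_sort[OF sx0] by (intro rep_trees[OF w]) (auto simp: KT_def)
    moreover have "\<not> finite_tree (?y x)" using finite_tree_sub[OF yw] that A by (auto simp: KT_def)
    ultimately show ?thesis using A by (simp add: KT_def)
  qed
  \<comment> \<open>If \<open>pw q = w\<close>, the subtree of \<open>?y x\<close> at
    \<open>w\<close> is both \<open>x\<close> and \<open>?y x\<close>, which forces
    \<open>x = x0\<close>. Otherwise \<open>?y x\<close> already is the subtree of \<open>x0\<close>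
    at \<open>pw q\<close>. Either way the injective \<open>?y\<close> would have a finite image on
    an infinite set.\<close>
  have "?y x \<in> E \<union> (\<Union>q \<in> P. {u. sub x0 (pw q) = Some u})" if x: "x \<in> A - {x0}" for x
  proof (cases "?y x \<in> E")
    case False
    then obtain q where q: "q \<in> P" "sub (?y x) q = Some (?y x)" using neg yA x by blast
    then have s: "sub (?y x) (pw q) = Some (?y x)" unfolding pw_def by (intro sub_concat_replicate)
    have "pw q \<noteq> w"
    proof
      assume "pw q = w"
      then have "?y x = x" using s yw[of x] by simp
      then show False using rep_fixpoint[OF w w_ne, of x] x by auto
    qed
    then have "sub (?y x) (pw q) = sub x0 (pw q)" using w pw[OF q(1)] by (intro sub_rep_other) auto
    then show ?thesis using s q(1) by auto
  qed blast
  then have "?y ` (A - {x0}) \<subseteq> E \<union> (\<Union>q \<in> P. {u. sub x0 (pw q) = Some u})" by blast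
  moreover have "finite {u. sub x0 (pw q) = Some u}" for q by (cases "sub x0 (pw q)") auto
  ultimately have "finite (?y ` (A - {x0}))" using fin by (meson finite_UN_I finite_UnI finite_subset)
  moreover have "inj ?y" using yw by (metis injI option.inject)
  ultimately have "finite (A - {x0})" by (simp add: finite_image_iff inj_on_def inj_def)
  then show False using inf by simp
qed

text \<open>A finite tree is never a proper subtree of itself; for infinite trees the repetitions
  along the given paths have to be avoided by planting.\<close>

lemma generic_tree:
  assumes big: "\<not> small S s b" and fin: "finite E" "finite P" and P: "[] \<notin> P"
  shows "\<exists>u \<in> KT S s b. u \<notin> E \<and> (\<forall>p \<in> P. sub u p \<noteq> Some u)"
proof (cases b)
  case False
  then show ?thesis using avoid_self_similar[of "KT S s b" S s E P] assms by (simp add: small_def)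
next
  case True
  obtain u where u: "u \<in> KT S s b" "u \<notin> E" using big fin(1) unfolding small_def by (meson finite_subset subsetI)
  then have "finite_tree u" using True by (simp add: KT_def)
  have "sub u p \<noteq> Some u" if "p \<in> P" for p
    using that P by (intro finite_no_self_sub[OF \<open>finite_tree u\<close>]) auto
  with u show ?thesis by blast
qed

lemma fresh_root_tree:
  assumes big: "infinite (root ` KT S s b)" and fin: "finite E" "finite G"
  shows "\<exists>u \<in> KT S s b. u \<notin> E \<and> root u \<notin> G"
proof -
  have "finite (G \<union> root ` E)" using fin by simp
  then obtain g where "g \<in> root ` KT S s b" "g \<notin> G \<union> root ` E" using big by (meson finite_subset subsetI)
  then show ?thesis by blast
qed

subsection \<open>Back-and-forth between trees\<close>

definition W :: "signature \<Rightarrow> tree set" where "W S = {t. t \<in> trees S (gres (root t))}"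

lemma W_trees: "t \<in> trees S s \<Longrightarrow> t \<in> W S" by (simp add: W_def trees_sort)

lemma W_child: "t \<in> W S \<Longrightarrow> c \<in> set (children t) \<Longrightarrow> c \<in> W S"
  unfolding W_def using trees_child_mem by blast

lemma W_length: "t \<in> W S \<Longrightarrow> length (children t) = length (gargs (root t))"
  unfolding W_def using trees_length by blast

text \<open>Matching is passed on to children only below equal roots in \<open>G\<close>; what lies
  below an invisible generator is never compared.\<close>

definition nx :: "gen set \<Rightarrow> (tree \<times> tree) set \<Rightarrow> (tree \<times> tree) set" where
  "nx G M = {p. \<exists>t u. (t, u) \<in> M \<and> root t \<in> G \<and> root u = root t \<and> p \<in> set (zip (children t) (children u))}"

primrec lev :: "gen set \<Rightarrow> nat \<Rightarrow> (tree \<times> tree) set \<Rightarrow> (tree \<times> tree) set" where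
  "lev G 0 M = M"
| "lev G (Suc k) M = lev G k M \<union> nx G (lev G k M)"

definition good :: "(tree \<times> tree) set \<Rightarrow> bool" where
  "good M \<longleftrightarrow> (\<forall>t u. (t, u) \<in> M \<longrightarrow> gres (root t) = gres (root u) \<and> finite_tree t = finite_tree u) \<and>
     (\<forall>t u t' u'. (t, u) \<in> M \<longrightarrow> (t', u') \<in> M \<longrightarrow> t = t' \<longleftrightarrow> u = u')"

definition lab :: "gen set \<Rightarrow> (tree \<times> tree) set \<Rightarrow> bool" where
  "lab G M \<longleftrightarrow> (\<forall>t u. (t, u) \<in> M \<longrightarrow> root t \<in> G \<or> root u \<in> G \<longrightarrow> root t = root u)"

text \<open>\<open>M\<close> matches trees with trees that look the same down to depth \<open>n\<close>; generators outside
  \<open>G\<close> are invisible.\<close>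

definition eqv :: "gen set \<Rightarrow> nat \<Rightarrow> (tree \<times> tree) set \<Rightarrow> bool" where
  "eqv G n M \<longleftrightarrow> good (lev G n M) \<and> (\<forall>k<n. lab G (lev G k M))"

lemma lev_mono: "k \<le> n \<Longrightarrow> lev G k M \<subseteq> lev G n M"
  by (induction n) (auto simp: le_Suc_eq)

lemma nx_mono: "M \<subseteq> M' \<Longrightarrow> nx G M \<subseteq> nx G M'"
  unfolding nx_def by blast

lemma good_mono: "M \<subseteq> M' \<Longrightarrow> good M' \<Longrightarrow> good M"
  unfolding good_def by blast

lemma lab_mono: "M \<subseteq> M' \<Longrightarrow> lab G M' \<Longrightarrow> lab G M"
  unfolding lab_def by (simp add: subset_iff)

lemma eqv_good: "eqv G n M \<Longrightarrow> k \<le> n \<Longrightarrow> good (lev G k M)"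
  unfolding eqv_def by (rule good_mono[OF lev_mono[of k n]], simp_all)

lemma eqv_lab: "eqv G n M \<Longrightarrow> k < n \<Longrightarrow> lab G (lev G k M)"
  unfolding eqv_def by simp

lemma eqv_le: "eqv G n M \<Longrightarrow> k \<le> n \<Longrightarrow> eqv G k M"
  using eqv_good eqv_lab unfolding eqv_def by (meson order_less_le_trans)

lemma nx_converse: "nx G (M\<inverse>) = (nx G M)\<inverse>"
  unfolding nx_def by (auto simp: set_zip) force+

lemma lev_converse: "lev G k (M\<inverse>) = (lev G k M)\<inverse>"
  by (induction k) (auto simp: nx_converse)

lemma good_converse: "good M \<Longrightarrow> good (M\<inverse>)"
  unfolding good_def converse_iff by (intro conjI allI impI) simp_all

lemma lab_converse: "lab G M \<Longrightarrow> lab G (M\<inverse>)"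
  unfolding lab_def converse_iff by metis

text \<open>Symmetry halves the work: the step from left to right, applied to the converse matching,
  is the step from right to left.\<close>

lemma eqv_converse: "eqv G n M \<Longrightarrow> eqv G n (M\<inverse>)"
  unfolding eqv_def lev_converse by (auto intro: good_converse lab_converse)

lemma goodD:
  assumes "good M" "(t, u) \<in> M"
  shows "gres (root t) = gres (root u)" "finite_tree t = finite_tree u"
    "(t, u') \<in> M \<Longrightarrow> u' = u" "(t', u) \<in> M \<Longrightarrow> t' = t"
  using assms unfolding good_def by blast+

lemma lev_W: "M \<subseteq> W S1 \<times> W S2 \<Longrightarrow> lev G k M \<subseteq> W S1 \<times> W S2"
proof (induction k)
  case (Suc k)
  have "nx G (lev G k M) \<subseteq> W S1 \<times> W S2"
  proof
    fix p assume "p \<in> nx G (lev G k M)"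
    then obtain t u where tu: "(t, u) \<in> lev G k M" "p \<in> set (zip (children t) (children u))"
      unfolding nx_def by blast
    then have "t \<in> W S1" "u \<in> W S2" using Suc by auto
    moreover have "fst p \<in> set (children t)" "snd p \<in> set (children u)"
      using tu(2) by (metis prod.collapse set_zip_leftD, metis prod.collapse set_zip_rightD)
    ultimately have "fst p \<in> W S1" "snd p \<in> W S2" using W_child by blast+
    then show "p \<in> W S1 \<times> W S2" by (simp add: mem_Times_iff)
  qed
  with Suc show ?case by auto
qed simp

lemma finite_nx: "finite M \<Longrightarrow> finite (nx G M)"
proof -
  assume "finite M"
  moreover have "nx G M \<subseteq> (\<Union>(t, u) \<in> M. set (zip (children t) (children u)))" unfolding nx_def by auto
  ultimately show ?thesis by (auto intro: finite_subset)
qed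

lemma finite_lev: "finite M \<Longrightarrow> finite (lev G k M)"
  by (induction k) (auto intro: finite_nx)

section \<open>Subtrees visible through \<open>G\<close>\<close>

primrec rch :: "gen set \<Rightarrow> nat \<Rightarrow> tree \<Rightarrow> tree set" where
  "rch G 0 c = {c}"
| "rch G (Suc n) c = rch G n c \<union> (\<Union>t \<in> {t \<in> rch G n c. root t \<in> G}. set (children t))"

text \<open>The nodes reached in fewer than \<open>n\<close> steps. Their roots are compared,
  whereas at depth exactly \<open>n\<close> only equality, sort and finiteness count; for
  \<open>n = 0\<close> there are none.\<close>

definition inn :: "gen set \<Rightarrow> nat \<Rightarrow> tree \<Rightarrow> tree set" where
  "inn G n c = (case n of 0 \<Rightarrow> {} | Suc k \<Rightarrow> rch G k c)"

lemma rch_mono: "k \<le> n \<Longrightarrow> rch G k c \<subseteq> rch G n c"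
  by (induction n) (auto simp: le_Suc_eq)

lemma rch_self: "c \<in> rch G n c"
  by (induction n) auto

lemma inn_rch: "inn G n c \<subseteq> rch G n c"
  unfolding inn_def by (auto split: nat.splits)

lemma rch_inn: "k < n \<Longrightarrow> rch G k c \<subseteq> inn G n c"
  unfolding inn_def using rch_mono by (auto split: nat.splits)

lemma inn_child: "t \<in> inn G n c \<Longrightarrow> root t \<in> G \<Longrightarrow> d \<in> set (children t) \<Longrightarrow> d \<in> rch G n c"
  unfolding inn_def by (auto split: nat.splits)

lemma rch_W: "c \<in> W S \<Longrightarrow> rch G n c \<subseteq> W S"
  by (induction n) (auto dest: W_child)

lemma finite_rch: "finite (rch G n c)"
  by (induction n) auto

text \<open>One step keeps the nodes found so far and adds at most \<open>r\<close> children for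
  each of them, hence the factor \<open>Suc r\<close> per level.\<close>

lemma card_rch:
  assumes c: "c \<in> W S" and r: "\<And>g. g \<in> G \<Longrightarrow> length (gargs g) \<le> r"
  shows "card (rch G n c) \<le> Suc r ^ n"
proof (induction n)
  case (Suc n)
  let ?A = "{t \<in> rch G n c. root t \<in> G}"
  have fin: "finite (rch G n c)" by (rule finite_rch)
  have "card (\<Union>t \<in> ?A. set (children t)) \<le> (\<Sum>t \<in> ?A. card (set (children t)))"
    using fin by (intro card_UN_le) auto
  also have "\<dots> \<le> (\<Sum>t \<in> ?A. r)"
  proof (rule sum_mono)
    fix t assume t: "t \<in> ?A"
    then have "t \<in> W S" using rch_W[OF c] by blast
    then have "length (children t) \<le> r" using W_length r t by auto
    then show "card (set (children t)) \<le> r" using card_length le_trans by blast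
  qed
  also have "\<dots> \<le> card (rch G n c) * r" using fin by (auto intro!: mult_le_mono1 card_mono)
  finally have "card (rch G (Suc n) c) \<le> card (rch G n c) + card (rch G n c) * r"
    using card_Un_le[of "rch G n c" "\<Union>t \<in> ?A. set (children t)"] by simp
  also have "\<dots> \<le> Suc r ^ n * Suc r" using Suc by (metis mult_Suc_right mult_le_mono1)
  finally show ?case by (simp add: mult.commute)
qed simp

text \<open>Each strict inclusion adds an element of \<open>X\<close>, so there cannot be
  \<open>B + 1\<close> strict ones in a row.\<close>

lemma chain_stable:
  fixes A :: "nat \<Rightarrow> 'a set"
  assumes X: "finite X" "card X \<le> B" and sub: "\<And>i. A i \<subseteq> X" and mono: "\<And>i. A i \<subseteq> A (Suc i)"
  shows "\<exists>i \<le> B. A (Suc i) = A i"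
proof (rule ccontr)
  assume neg: "\<not> ?thesis"
  have "i \<le> Suc B \<Longrightarrow> i \<le> card (A i)" for i
  proof (induction i)
    case (Suc i)
    then have "A i \<subset> A (Suc i)" using neg mono[of i] by auto
    moreover have "finite (A (Suc i))" using sub X finite_subset by blast
    ultimately have "card (A i) < card (A (Suc i))" by (rule psubset_card_mono[rotated])
    with Suc show ?case by simp
  qed simp
  from this[of "Suc B"] have "Suc B \<le> card (A (Suc B))" by simp
  also have "\<dots> \<le> card X" using sub X by (intro card_mono) auto
  finally show False using X by simp
qed

text \<open>First use of the chain argument: at some level between \<open>n\<close> and
  \<open>n + B\<close>, going one level deeper matches no further visible subtree of
  \<open>c\<close>. This level decides which subtrees count as matched.\<close>

lemma ef_stable:
  assumes "card (rch G n c) \<le> B"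
  shows "\<exists>m \<ge> n. m \<le> n + B \<and> rch G n c \<inter> Domain (lev G (Suc m) M) \<subseteq> Domain (lev G m M)"
proof -
  have "\<exists>i \<le> B. rch G n c \<inter> Domain (lev G (n + Suc i) M) = rch G n c \<inter> Domain (lev G (n + i) M)"
    using finite_rch assms by (rule chain_stable) auto
  then obtain i where "i \<le> B" "rch G n c \<inter> Domain (lev G (n + Suc i) M) = rch G n c \<inter> Domain (lev G (n + i) M)" by blast
  then show ?thesis by (intro exI[of _ "n + i"]) auto
qed

definition newt :: "gen set \<Rightarrow> nat \<Rightarrow> tree \<Rightarrow> (tree \<times> tree) set \<Rightarrow> tree set" where
  "newt G n c D = rch G n c - Domain D"

text \<open>Unmatched nodes whose root is visible and will be compared; they have to keep their
  generator. All other unmatched nodes receive generic values, among them those at depth exactly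
  \<open>n\<close> with a root in \<open>G\<close>.\<close>

definition innert :: "gen set \<Rightarrow> nat \<Rightarrow> tree \<Rightarrow> (tree \<times> tree) set \<Rightarrow> tree set" where
  "innert G n c D = {t \<in> newt G n c D. root t \<in> G \<and> t \<in> inn G n c}"

definition leaft :: "gen set \<Rightarrow> nat \<Rightarrow> tree \<Rightarrow> (tree \<times> tree) set \<Rightarrow> tree set" where
  "leaft G n c D = newt G n c D - innert G n c D"

text \<open>The back-and-forth step. The subtrees of \<open>c\<close> that are already matched keep their partners,
  the others are rebuilt from generic leaves.\<close>

lemma ef_core:
  assumes M: "M \<subseteq> W S1 \<times> W S2" and N: "eqv G N M" "m + B + 1 \<le> N" "n \<le> m"
    and c: "c \<in> W S1" and B: "card (rch G n c) \<le> B"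
    and D: "D = lev G m M"
    and stable: "rch G n c \<inter> Domain (lev G (Suc m) M) \<subseteq> Domain D"
    and h_old: "\<And>t. t \<in> rch G n c \<Longrightarrow> t \<in> Domain D \<Longrightarrow> (t, h t) \<in> D"
    and h_inner: "solves (innert G n c D) root children h"
    and h_leaf: "\<And>y. y \<in> leaft G n c D \<Longrightarrow> gres (root (h y)) = gres (root y) \<and> finite_tree (h y) = finite_tree y \<and>
        (y \<in> inn G n c \<longrightarrow> root (h y) \<notin> G) \<and> h y \<notin> Range (lev G (m + B + 1) M)"
    and h_dist: "\<And>y x. y \<in> leaft G n c D \<Longrightarrow> x \<in> newt G n c D \<Longrightarrow> x \<noteq> y \<Longrightarrow> h x \<noteq> h y"
  shows "eqv G n (insert (c, h c) M)"
proof -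
  define R where "R = rch G n c"
  define X where "X = newt G n c D"
  define Z where "Z = innert G n c D"
  define Y where "Y = leaft G n c D"
  have X: "X = R - Domain D" unfolding X_def newt_def R_def ..
  have Z: "Z = {t \<in> X. root t \<in> G \<and> t \<in> inn G n c}" unfolding Z_def innert_def X_def ..
  have Y: "Y = X - Z" unfolding Y_def leaft_def X_def Z_def ..
  have hZ: "h t = Node (root t) (map h (children t))" if "t \<in> Z" for t
    using h_inner that unfolding solves_def Z_def by blast
  have Zch: "d \<in> R" if "t \<in> Z" "d \<in> set (children t)" for t d
    using that inn_child unfolding Z R_def by blast
  have RW: "R \<subseteq> W S1" unfolding R_def using rch_W[OF c] .
  have levW: "lev G k M \<subseteq> W S1 \<times> W S2" for k using lev_W[OF M] .
  have goodl: "good (lev G k M)" if "k \<le> m + B + 1" for k using eqv_good[OF N(1)] N(2) that by simp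
  have labl: "lab G (lev G k M)" if "k \<le> m + B" for k using eqv_lab[OF N(1)] N(2) that by simp
  have Dsub: "D \<subseteq> lev G k M" if "m \<le> k" for k unfolding D using lev_mono[OF that] .
  have old: "(t, h t) \<in> D" if "t \<in> R" "t \<notin> X" for t using h_old that unfolding R_def X by blast
  have ch_eq: "(children a ! j, children u ! j) \<in> lev G (Suc k) M"
    if "(a, u) \<in> lev G k M" "root a \<in> G" "root u = root a" "j < length (children a)" for a u k j
  proof -
    have "length (children u) = length (children a)"
      using that levW W_length by (metis mem_Sigma_iff subsetD)
    then have "(children a ! j, children u ! j) \<in> set (zip (children a) (children u))"
      using that(4) by (auto simp: set_zip)
    then show ?thesis using that by (auto simp: nx_def)
  qed
  \<comment> \<open>Second use of the chain argument. Suppose the image of an unmatched node is a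
    partner. \<open>A i\<close> collects the nodes of \<open>X\<close> whose images are partners at
    level \<open>m + i\<close>; where this chain stands still, \<open>g\<close> sends each such node
    to the tree that is matched with its image.\<close>
  have new: "(a, h t) \<notin> D" if tX: "t \<in> X" for t a
  proof
    assume at: "(a, h t) \<in> D"
    define A where "A i = {t \<in> X. \<exists>a. (a, h t) \<in> lev G (m + i) M}" for i
    have "\<exists>i \<le> B. A (Suc i) = A i"
    proof (rule chain_stable[where X = R])
      show "finite R" "card R \<le> B" using B unfolding R_def by (auto intro: finite_rch)
    qed (auto simp: A_def X)
    then obtain i where i: "i \<le> B" "A (Suc i) = A i" by blast
    define g where "g t = (if t \<in> A i then SOME a. (a, h t) \<in> lev G (m + i) M else t)" for t
    have g: "(g t, h t) \<in> lev G (m + i) M" if "t \<in> A i" for t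
      using that unfolding g_def A_def by (auto intro: someI2_ex)
    \<comment> \<open>Leaf values avoid the partners up to level \<open>m + B + 1\<close>, so a
      colliding node is an inner one.\<close>
    have AZ: "A i \<subseteq> Z"
    proof
      fix t assume t: "t \<in> A i"
      then have "h t \<in> Range (lev G (m + B + 1) M)"
        using lev_mono[of "m + i" "m + B + 1" G M] i(1) unfolding A_def by auto
      then show "t \<in> Z" using h_leaf[of t] t unfolding A_def Y[symmetric] using Y Y_def by blast
    qed
    \<comment> \<open>The children of \<open>g t\<close> are matched with the images of the children
      of \<open>t\<close>. An unmatched child lies in \<open>A (Suc i) = A i\<close>, and a matched
      child already has its image as partner, so \<open>g\<close> satisfies the equations that the
      identity satisfies. Uniqueness then gives \<open>g t = t\<close>, so that \<open>t\<close>
      would be matched after all.\<close>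
    have sol: "solves (A i) root children g"
      unfolding solves_def
    proof
      fix t assume t: "t \<in> A i"
      then have tZ: "t \<in> Z" "t \<in> R" using AZ Z X by auto
      have rh: "root (h t) = root t" "children (h t) = map h (children t)" using hZ[OF tZ(1)] by (metis tree.sel)+
      have rt: "root t \<in> G" using tZ Z by blast
      have rg: "root (g t) = root t" using labl[of "m + i"] i(1) g[OF t] rt rh unfolding lab_def by auto
      have len: "length (children (g t)) = length (children t)"
        using g[OF t] levW tZ RW W_length rg by (metis mem_Sigma_iff subsetD)
      have "children (g t) ! j = g (children t ! j)" if j: "j < length (children t)" for j
      proof -
        let ?d = "children t ! j"
        have d: "?d \<in> R" using Zch[OF tZ(1)] j by simp
        have p: "(children (g t) ! j, h ?d) \<in> lev G (Suc (m + i)) M"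
          using ch_eq[OF g[OF t], of j] rt rg rh len j by simp
        show ?thesis
        proof (cases "?d \<in> X")
          case True
          then have "?d \<in> A (Suc i)" unfolding A_def using p by auto
          then have "?d \<in> A i" using i(2) by simp
          then have "(g ?d, h ?d) \<in> lev G (Suc (m + i)) M" using g by auto
          then show ?thesis using p goodD(4)[OF goodl[of "Suc (m + i)"]] i(1) by auto
        next
          case False
          then have "(?d, h ?d) \<in> lev G (Suc (m + i)) M" using old[OF d] Dsub[of "Suc (m + i)"] by auto
          then have "children (g t) ! j = ?d" using p goodD(4)[OF goodl[of "Suc (m + i)"]] i(1) by auto
          moreover have "?d \<notin> A i" using False unfolding A_def by blast
          ultimately show ?thesis by (simp add: g_def)
        qed
      qed
      then show "g t = Node (root t) (map g (children t))"
        using rg len by (intro tree.expand) (auto intro: nth_equalityI)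
    qed
    have gt: "g t = t" if "t \<in> A i" for t
    proof (rule solves_unique[OF sol, of "\<lambda>t. t"])
      show "solves (A i) root children (\<lambda>t. t)" unfolding solves_def by simp
    qed (use that in \<open>auto simp: g_def\<close>)
    have "(a, h t) \<in> lev G (m + i) M" using at Dsub[of "m + i"] by auto
    moreover then have "t \<in> A i" using tX unfolding A_def by blast
    ultimately have "a = t" using g[of t] gt[of t] goodD(4)[OF goodl[of "m + i"]] i(1) by auto
    then show False using at tX unfolding X by blast
  qed
  \<comment> \<open>Two different nodes with equal images are both inner: matched nodes have
    different partners, no rebuilt tree is a partner, and leaf values differ from all other new
    values. Inner nodes pass the equality of images on to their children, which makes this a
    coinduction.\<close>
  have inj: "t = u" if tu: "t \<in> R" "u \<in> R" "h t = h u" for t u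
  proof (rule tree_eq_coinduct[where R = "\<lambda>t u. t \<in> R \<and> u \<in> R \<and> h t = h u"])
    fix t u assume tu: "t \<in> R \<and> u \<in> R \<and> h t = h u"
    show "root t = root u \<and> list_all2 (\<lambda>t u. (t \<in> R \<and> u \<in> R \<and> h t = h u) \<or> t = u) (children t) (children u)"
    proof (cases "t = u")
      case False
      have tX: "t \<in> X" if "u \<in> X"
      proof (rule ccontr)
        assume "t \<notin> X" then have "(t, h u) \<in> D" using old[of t] tu by auto
        then show False using new[OF that] by blast
      qed
      have uX: "u \<in> X" if "t \<in> X"
      proof (rule ccontr)
        assume "u \<notin> X" then have "(u, h t) \<in> D" using old[of u] tu by auto
        then show False using new[OF that] by blast
      qed
      have "t \<in> X"
      proof (rule ccontr)
        assume "t \<notin> X"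
        then have "u \<notin> X" using tX by blast
        then have "(t, h t) \<in> D" "(u, h t) \<in> D" using old[of t] old[of u] tu \<open>t \<notin> X\<close> by auto
        then show False using goodD(4)[OF goodl[of m]] False unfolding D by auto
      qed
      then have "u \<in> X" using uX by blast
      have "t \<notin> Y" using h_dist[of t u] False tu \<open>u \<in> X\<close> unfolding X_def Y_def by metis
      moreover have "u \<notin> Y" using h_dist[of u t] False tu \<open>t \<in> X\<close> unfolding X_def Y_def by metis
      ultimately have "t \<in> Z" "u \<in> Z" using \<open>t \<in> X\<close> \<open>u \<in> X\<close> unfolding Y by blast+
      then have "root t = root u" "map h (children t) = map h (children u)"
        using hZ[of t] hZ[of u] tu by auto
      moreover have "length (children t) = length (children u)" using calculation(2) map_eq_imp_length_eq by blast
      ultimately show ?thesis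
        using Zch[OF \<open>t \<in> Z\<close>] Zch[OF \<open>u \<in> Z\<close>]
        by (auto simp: list_all2_conv_all_nth) (metis nth_map)
    qed (auto simp: list_all2_refl)
  qed (use tu in blast)
  \<comment> \<open>Finiteness is compared by induction on whichever side is assumed finite: here on
    the given tree, in \<open>fin2\<close> on its image.\<close>
  have fin1: "finite_tree (h t)" if "finite_tree t" "t \<in> R" for t
    using that
  proof (induction t rule: finite_tree_induct)
    case (node t)
    consider "t \<notin> X" | "t \<in> Y" | "t \<in> Z" unfolding Y by blast
    then show ?case
    proof cases
      case 1
      then show ?thesis using goodD(2)[OF goodl[of m]] old[of t] node unfolding D by auto
    next
      case 2
      then show ?thesis using h_leaf[of t] node unfolding Y_def by blast
    next
      case 3
      then have "\<forall>d \<in> set (children (h t)). finite_tree d" using node.IH Zch[OF 3] hZ[OF 3] by (metis (no_types, lifting) imageE list.set_map tree.sel(2))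
      then show ?thesis using finite_tree_iff by blast
    qed
  qed
  have fin2: "finite_tree t" if "finite_tree u" "t \<in> R" "u = h t" for t u
    using that
  proof (induction u arbitrary: t rule: finite_tree_induct)
    case (node u)
    consider "t \<notin> X" | "t \<in> Y" | "t \<in> Z" unfolding Y by blast
    then show ?case
    proof cases
      case 1
      then show ?thesis using goodD(2)[OF goodl[of m]] old[of t] node unfolding D by auto
    next
      case 2
      then show ?thesis using h_leaf[of t] node unfolding Y_def by blast
    next
      case 3
      have "finite_tree d" if "d \<in> set (children t)" for d
      proof -
        have "h d \<in> set (children u)" using that hZ[OF 3] node.prems by (metis image_eqI list.set_map tree.sel(2))
        then show ?thesis using node.IH Zch[OF 3 that] by blast
      qed
      then show ?thesis using finite_tree_iff by blast
    qed
  qed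
  \<comment> \<open>An upper bound for the levels of the extended matching, given by
    \<open>h\<close> instead of by iteration. Being good and respecting roots are inherited by
    subsets, so it suffices to check them for \<open>H\<close>.\<close>
  define H where "H k = (\<lambda>t. (t, h t)) ` rch G k c \<union> lev G k M" for k
  have nxH: "nx G (H k) \<subseteq> H (Suc k)" if k: "k < n" for k
  proof
    fix p assume "p \<in> nx G (H k)"
    then obtain t u where tu: "(t, u) \<in> H k" "root t \<in> G" "root u = root t" "p \<in> set (zip (children t) (children u))"
      unfolding nx_def by blast
    show "p \<in> H (Suc k)"
    proof (cases "(t, u) \<in> lev G k M")
      case True
      then have "p \<in> nx G (lev G k M)" using tu unfolding nx_def by blast
      then show ?thesis unfolding H_def by simp
    next
      case False
      then have t: "t \<in> rch G k c" "u = h t" using tu(1) unfolding H_def by auto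
      then have tR: "t \<in> R" "t \<in> inn G n c" using rch_inn[OF k] inn_rch unfolding R_def by blast+
      obtain j where j: "j < length (children t)" "j < length (children u)" "p = (children t ! j, children u ! j)"
        using tu(4) by (auto simp: set_zip)
      have d: "children t ! j \<in> rch G (Suc k) c" using t(1) tu(2) j(1) by auto
      have dR: "children t ! j \<in> R" using d rch_mono[of "Suc k" n G c] k unfolding R_def by auto
      have "children u ! j = h (children t ! j)"
      proof (cases "t \<in> X")
        case True
        then have "t \<in> Z" unfolding Z using tR tu(2) by blast
        then show ?thesis using hZ[of t] t(2) j by (metis nth_map tree.sel(2))
      next
        case False
        then have "(t, u) \<in> lev G m M" using old[of t] tR t(2) unfolding D by auto
        then have p: "(children t ! j, children u ! j) \<in> lev G (Suc m) M" using ch_eq tu j by metis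
        \<comment> \<open>Here the choice of \<open>m\<close> enters: the child is matched at level
          \<open>Suc m\<close>, so by stability it was matched at level \<open>m\<close> already and
          its image under \<open>h\<close> is that very partner.\<close>
        then have "children t ! j \<in> Domain D" using stable dR unfolding R_def by blast
        then have "(children t ! j, h (children t ! j)) \<in> lev G (Suc m) M"
          using h_old[of "children t ! j"] dR Dsub[of "Suc m"] unfolding R_def by auto
        then show ?thesis using p goodD(3)[OF goodl[of "Suc m"]] by auto
      qed
      then show ?thesis using d j(3) unfolding H_def by auto
    qed
  qed
  have levH: "lev G k (insert (c, h c) M) \<subseteq> H k" if "k \<le> n" for k
    using that
  proof (induction k)
    case (Suc k)
    have "nx G (lev G k (insert (c, h c) M)) \<subseteq> H (Suc k)" using Suc nx_mono nxH[of k] by (meson Suc_le_lessD less_imp_le_nat order_trans)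
    moreover have "H k \<subseteq> H (Suc k)" unfolding H_def by auto
    ultimately show ?case using Suc by auto
  qed (auto simp: H_def)
  have levD: "lev G n M \<subseteq> D" unfolding D using lev_mono[OF N(3)] .
  have "good (H n)"
    unfolding good_def
  proof (intro conjI allI impI)
    fix t u assume tu: "(t, u) \<in> H n"
    have "gres (root t) = gres (root u) \<and> finite_tree t = finite_tree u"
    proof (cases "(t, u) \<in> lev G n M")
      case True
      then show ?thesis using goodl[of n] N(3) unfolding good_def by auto
    next
      case False
      then have t: "t \<in> R" "u = h t" using tu unfolding H_def R_def by auto
      have "gres (root t) = gres (root (h t))"
      proof -
        consider "t \<notin> X" | "t \<in> Y" | "t \<in> Z" unfolding Y by blast
        then show ?thesis
        proof cases
          case 1
          then show ?thesis using goodD(1)[OF goodl[of m]] old[of t] t unfolding D by auto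
        next
          case 2
          then show ?thesis using h_leaf[of t] unfolding Y_def by simp
        next
          case 3
          then show ?thesis using hZ[of t] by (metis tree.sel(1))
        qed
      qed
      then show ?thesis using fin1 fin2 t by blast
    qed
    then show "gres (root t) = gres (root u)" "finite_tree t = finite_tree u" by auto
  next
    fix t u t' u' assume tu: "(t, u) \<in> H n" "(t', u') \<in> H n"
    have key: "(a, h t) \<in> D \<longleftrightarrow> a = t" if "t \<in> R" "(a, b) \<in> D" "a = t \<or> b = h t" for a b t
    proof (cases "t \<in> X")
      case True
      then show ?thesis using new[of t] that unfolding X by blast
    next
      case False
      then show ?thesis using old[OF that(1)] goodD(4)[OF goodl[of m]] unfolding D by auto
    qed
    have mixed: "t = a \<longleftrightarrow> h t = b" if "t \<in> R" "(a, b) \<in> D" for t a b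
    proof
      assume "t = a"
      then have "(t, h t) \<in> D" using key[OF that] by blast
      then show "h t = b" using that(2) \<open>t = a\<close> goodD(3)[OF goodl[of m]] unfolding D by auto
    next
      assume "h t = b"
      then show "t = a" using key[OF that] that(2) by blast
    qed
    show "t = t' \<longleftrightarrow> u = u'"
    proof (cases "(t, u) \<in> lev G n M")
      case True
      show ?thesis
      proof (cases "(t', u') \<in> lev G n M")
        case True
        then show ?thesis using \<open>(t, u) \<in> lev G n M\<close> goodl[of n] N(3) unfolding good_def by auto
      next
        case False
        then have "t' \<in> R" "u' = h t'" using tu unfolding H_def R_def by auto
        then show ?thesis using mixed[of t' t u] True levD by auto
      qed
    next
      case False
      then have t: "t \<in> R" "u = h t" using tu unfolding H_def R_def by auto
      show ?thesis
      proof (cases "(t', u') \<in> lev G n M")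
        case True
        then show ?thesis using mixed[of t t' u'] t levD by auto
      next
        case False
        then have "t' \<in> R" "u' = h t'" using tu unfolding H_def R_def by auto
        then show ?thesis using inj[of t t'] t by auto
      qed
    qed
  qed
  moreover have "lab G (H k)" if k: "k < n" for k
    unfolding lab_def
  proof (intro allI impI)
    fix t u assume tu: "(t, u) \<in> H k" "root t \<in> G \<or> root u \<in> G"
    show "root t = root u"
    proof (cases "(t, u) \<in> lev G k M")
      case True
      then show ?thesis using labl[of k] N(3) k tu(2) unfolding lab_def by auto
    next
      case False
      then have t: "t \<in> rch G k c" "u = h t" using tu unfolding H_def by auto
      then have tR: "t \<in> R" "t \<in> inn G n c" using rch_inn[OF k] inn_rch unfolding R_def by blast+
      consider "t \<notin> X" | "t \<in> Y" | "t \<in> Z" unfolding Y by blast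
      then show ?thesis
      proof cases
        case 1
        then show ?thesis using labl[of m] old[OF tR(1)] tu(2) t unfolding lab_def D by auto
      next
        case 2
        then have "root (h t) \<notin> G" using h_leaf[of t] tR unfolding Y_def by blast
        moreover have "root t \<notin> G" using 2 tR unfolding Y Z by blast
        ultimately show ?thesis using tu t by auto
      next
        case 3
        then show ?thesis using hZ[of t] t(2) by (metis tree.sel(1))
      qed
    qed
  qed
  ultimately show ?thesis unfolding eqv_def using levH good_mono lab_mono by (meson le_refl less_imp_le_nat)
qed


text \<open>Generic values for the leaves are chosen one after the other. A later leaf avoids the subtrees
  of the earlier ones, so only the inner nodes without later leaves below them can collide.\<close>

lemma generic_leaves:
  fixes kids :: "'x \<Rightarrow> 'x list" and lb :: "'x \<Rightarrow> gen"
  assumes Z: "finite Z" "\<And>z. z \<in> Z \<Longrightarrow> lb z \<in> G" and Y: "finite Y" "Y \<inter> Z = {}" and E: "finite E"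
    and sup: "\<And>y E P. y \<in> Y \<Longrightarrow> finite E \<Longrightarrow> finite P \<Longrightarrow> [] \<notin> P \<Longrightarrow>
      \<exists>u \<in> A y. u \<notin> E \<and> (root u \<notin> G \<or> (\<forall>p \<in> P. sub u p \<noteq> Some u))"
  shows "\<exists>h. solves Z lb kids h \<and> (\<forall>x. x \<notin> Z \<longrightarrow> x \<notin> Y \<longrightarrow> h x = h0 x) \<and>
    (\<forall>y \<in> Y. h y \<in> A y \<and> h y \<notin> E \<and> (\<forall>x \<in> Z \<union> Y. x \<noteq> y \<longrightarrow> h x \<noteq> h y))"
  using Y E sup
proof (induction Y arbitrary: h0 E rule: finite_induct)
  case empty
  then show ?case using slv_solves[of Z lb kids h0] slv_outside[of _ Z lb kids h0] by blast
next
  case (insert y0 Y)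
  \<comment> \<open>In every solution, the subtree at \<open>p\<close> of the value of
    \<open>z\<close> is the value of \<open>y\<close>. Quantifying over all solutions spares a
    separate notion of path through the system, and the statement can be applied both before and
    after the leaves have been chosen.\<close>
  define pth where "pth z p y \<longleftrightarrow> (\<forall>h. solves Z lb kids h \<longrightarrow> sub (h z) p = Some (h y))" for z p y
  define ref where "ref = slv Z lb kids h0"
  have pth1: "pth z [i] (kids z ! i)" if "z \<in> Z" "i < length (kids z)" for z i
    using that unfolding pth_def solves_def by simp
  have pthC: "pth z (i # p) y" if "z \<in> Z" "i < length (kids z)" "pth (kids z ! i) p y" for z i p y
    using that unfolding pth_def solves_def by simp
  define a where "a z = (SOME p. \<exists>y \<in> Y. pth z p y)" for z
  define b where "b z = (SOME p. p \<noteq> [] \<and> pth z p y0)" for z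
  \<comment> \<open>The inner nodes are divided into those above a leaf still to be chosen, those
    above \<open>y0\<close>, and the rest; the values of the rest do not depend on any of these
    choices, so they can be read off the reference solution \<open>ref\<close>.\<close>
  define ZA where "ZA = {z \<in> Z. \<exists>p. \<exists>y \<in> Y. pth z p y}"
  define ZB where "ZB = {z \<in> Z. \<exists>p. p \<noteq> [] \<and> pth z p y0}"
  define ZC where "ZC = Z - ZA - ZB"
  have a: "\<exists>y \<in> Y. pth z (a z) y" if "z \<in> ZA" for z
    using that someI_ex[of "\<lambda>p. \<exists>y \<in> Y. pth z p y"] unfolding a_def ZA_def by simp
  have b: "b z \<noteq> [] \<and> pth z (b z) y0" if "z \<in> ZB" for z
    using that someI_ex[of "\<lambda>p. p \<noteq> [] \<and> pth z p y0"] unfolding b_def ZB_def by simp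
  have "finite (ref ` ZC)" "finite (b ` ZB)" using Z(1) unfolding ZC_def ZB_def by auto
  moreover have "[] \<notin> b ` ZB" using b by (metis imageE)
  \<comment> \<open>An inner node above \<open>y0\<close> with value \<open>u\<close> would make
    \<open>u\<close> a proper subtree of itself along \<open>b z\<close>. A root outside
    \<open>G\<close> excludes this equally well, since inner nodes have roots in
    \<open>G\<close>.\<close>
  ultimately obtain u where u: "u \<in> A y0" "u \<notin> E \<union> ref ` ZC"
      "root u \<notin> G \<or> (\<forall>p \<in> b ` ZB. sub u p \<noteq> Some u)"
    using insert.prems(3)[of y0 "E \<union> ref ` ZC" "b ` ZB"] insert.prems(2) by auto
  \<comment> \<open>If an inner node above a later leaf had the value \<open>u\<close>, the value of
    that leaf would be the subtree of \<open>u\<close> at \<open>a z\<close>; so the later leaves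
    are told to avoid these subtrees.\<close>
  let ?E = "E \<union> {u} \<union> {v. \<exists>z \<in> ZA. sub u (a z) = Some v}"
  have "{v. \<exists>z \<in> ZA. sub u (a z) = Some v} \<subseteq> (\<lambda>z. the (sub u (a z))) ` ZA" by force
  moreover have "finite ZA" using Z(1) unfolding ZA_def by auto
  ultimately have "finite {v. \<exists>z \<in> ZA. sub u (a z) = Some v}" using finite_surj by blast
  then have finE: "finite ?E" using insert.prems(2) by simp
  have "\<exists>h. solves Z lb kids h \<and> (\<forall>x. x \<notin> Z \<longrightarrow> x \<notin> Y \<longrightarrow> h x = (h0(y0 := u)) x) \<and>
    (\<forall>y \<in> Y. h y \<in> A y \<and> h y \<notin> ?E \<and> (\<forall>x \<in> Z \<union> Y. x \<noteq> y \<longrightarrow> h x \<noteq> h y))"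
    by (rule insert.IH) (use insert.prems finE in auto)
  then obtain h where h: "solves Z lb kids h" "\<forall>x. x \<notin> Z \<longrightarrow> x \<notin> Y \<longrightarrow> h x = (h0(y0 := u)) x"
      "\<forall>y \<in> Y. h y \<in> A y \<and> h y \<notin> ?E \<and> (\<forall>x \<in> Z \<union> Y. x \<noteq> y \<longrightarrow> h x \<noteq> h y)" by blast
  have hy0: "h y0 = u" using h(2) insert by auto
  \<comment> \<open>A child that is one of these leaves, or lies above one, would put its parent
    into \<open>ZA\<close> or \<open>ZB\<close>. So the equations of \<open>ZC\<close> refer only to
    \<open>ZC\<close> and to unknowns with prescribed values, and have a unique solution.\<close>
  have C: "h z = ref z" if "z \<in> ZC" for z
  proof (rule solves_unique[where Z = ZC and lab = lb and kids = kids])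
    show "solves ZC lb kids h" using h(1) unfolding solves_def ZC_def by blast
    show "solves ZC lb kids ref" using slv_solves[of Z lb kids h0] unfolding ref_def solves_def ZC_def by blast
    fix x c assume x: "x \<in> ZC" "c \<in> set (kids x)"
    then obtain i where i: "i < length (kids x)" "c = kids x ! i" by (auto simp: in_set_conv_nth)
    have xZ: "x \<in> Z" "x \<notin> ZA" "x \<notin> ZB" using x unfolding ZC_def by auto
    have cA: "c \<notin> ZA"
    proof
      assume "c \<in> ZA"
      then obtain p y where "y \<in> Y" "pth c p y" unfolding ZA_def by blast
      then have "x \<in> ZA" using pthC[OF xZ(1) i(1), of p y] i(2) xZ(1) unfolding ZA_def by blast
      then show False using xZ(2) by blast
    qed
    have cB: "c \<notin> ZB"
    proof
      assume "c \<in> ZB"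
      then obtain p where "pth c p y0" unfolding ZB_def by blast
      then have "x \<in> ZB" using pthC[OF xZ(1) i(1), of p y0] i(2) xZ(1) unfolding ZB_def by blast
      then show False using xZ(3) by blast
    qed
    have "c \<notin> Y" using pth1[OF xZ(1) i(1)] i(2) xZ unfolding ZA_def by blast
    moreover have "c \<noteq> y0" using pth1[OF xZ(1) i(1)] i(2) xZ unfolding ZB_def by blast
    ultimately show "c \<in> ZC \<or> h c = ref c"
      using cA cB h(2) slv_outside[of c Z lb kids h0] unfolding ZC_def ref_def by (cases "c \<in> Z") auto
  qed (rule that)
  have hz: "h z \<noteq> u" if zZ: "z \<in> Z" for z
  proof
    assume eq: "h z = u"
    consider "z \<in> ZA" | "z \<in> ZB" | "z \<in> ZC" using zZ unfolding ZC_def by blast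
    then show False
    proof cases
      case 1
      then obtain y where "y \<in> Y" "sub u (a z) = Some (h y)" using a h(1) eq unfolding pth_def by blast
      then show False using h(3) 1 by blast
    next
      case 2
      then have "sub u (b z) = Some u" using b h(1) eq hy0 unfolding pth_def by metis
      then have "root u \<notin> G" using u(3) 2 by blast
      moreover have "root u = lb z" using h(1) zZ eq unfolding solves_def by (metis tree.sel(1))
      ultimately show False using Z(2)[OF zZ] by simp
    next
      case 3
      then show False using C[OF 3] eq u(2) by auto
    qed
  qed
  show ?case
  proof (intro exI[of _ h] conjI allI impI ballI)
    fix y assume y: "y \<in> insert y0 Y"
    show "h y \<in> A y" "h y \<notin> E" using y h(3) hy0 u by auto
    fix x assume x: "x \<in> Z \<union> insert y0 Y" "x \<noteq> y"
    show "h x \<noteq> h y"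
    proof (cases "y = y0")
      case True
      then show ?thesis using x hz h(3) hy0 by auto
    next
      case False
      then show ?thesis using x y h(3) hy0 by auto
    qed
  qed (use h in auto)
qed

text \<open>With \<open>B = Suc r ^ n\<close>, the stable level is at most \<open>n + B\<close>, and
  \<open>B + 1\<close> further levels serve to exclude coincidences. The two sides may have
  different signatures, because one of them will be a symbolic state. New trees are demanded only
  for subtrees outside \<open>U\<close>, as those in \<open>U\<close> are matched from the
  start.\<close>

lemma ef_extend:
  assumes M: "M \<subseteq> W S1 \<times> W S2" "finite M" and N: "eqv G N M" "n + 2 * Suc r ^ n + 1 \<le> N"
    and c: "c \<in> trees S1 s" and G: "G \<subseteq> gens S2" "\<And>g. g \<in> G \<Longrightarrow> length (gargs g) \<le> r"
    and U: "U \<subseteq> Domain M"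
    and sup: "\<And>y E P. y \<in> rch G n c \<Longrightarrow> y \<notin> U \<Longrightarrow> finite E \<Longrightarrow> finite P \<Longrightarrow> [] \<notin> P \<Longrightarrow>
      \<exists>u \<in> KT S2 (gres (root y)) (finite_tree y). u \<notin> E \<and> (y \<in> inn G n c \<longrightarrow> root y \<notin> G \<longrightarrow> root u \<notin> G) \<and>
        (root u \<notin> G \<or> (\<forall>p \<in> P. sub u p \<noteq> Some u))"
  shows "\<exists>d \<in> trees S2 s. eqv G n (insert (c, d) M)"
proof -
  define B where "B = Suc r ^ n"
  have cW: "c \<in> W S1" using c by (rule W_trees)
  have card: "card (rch G n c) \<le> B" unfolding B_def by (rule card_rch[OF cW G(2)])
  obtain m where m: "n \<le> m" "m \<le> n + B" "rch G n c \<inter> Domain (lev G (Suc m) M) \<subseteq> Domain (lev G m M)"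
    using ef_stable[OF card] by blast
  define D where "D = lev G m M"
  define Z where "Z = innert G n c D"
  define Y where "Y = leaft G n c D"
  define h0 where "h0 t = (SOME u. (t, u) \<in> D)" for t
  have h0: "(t, h0 t) \<in> D" if "t \<in> Domain D" for t
    using that unfolding h0_def by (auto intro: someI)
  have XZY: "newt G n c D = Z \<union> Y" "Y \<inter> Z = {}" unfolding Z_def Y_def leaft_def innert_def by auto
  have Xr: "newt G n c D \<subseteq> rch G n c" unfolding newt_def by blast
  have fin: "finite Z" "finite Y" using finite_rch[of G n c] Xr XZY(1) finite_subset by (metis finite_Un)+
  have YU: "y \<notin> U" if "y \<in> Y" for y
  proof -
    have "y \<notin> Domain D" using that unfolding Y_def leaft_def newt_def by blast
    moreover have "Domain M \<subseteq> Domain D" unfolding D_def using lev_mono[of 0 m G M] by auto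
    ultimately show ?thesis using U by blast
  qed
  let ?A = "\<lambda>y. {u \<in> KT S2 (gres (root y)) (finite_tree y). y \<in> inn G n c \<longrightarrow> root y \<notin> G \<longrightarrow> root u \<notin> G}"
  let ?E = "Range (lev G (m + B + 1) M)"
  have "finite ?E" using finite_lev[OF M(2)] by (rule finite_Range)
  have "\<exists>h. solves Z root children h \<and> (\<forall>x. x \<notin> Z \<longrightarrow> x \<notin> Y \<longrightarrow> h x = h0 x) \<and>
    (\<forall>y \<in> Y. h y \<in> ?A y \<and> h y \<notin> ?E \<and> (\<forall>x \<in> Z \<union> Y. x \<noteq> y \<longrightarrow> h x \<noteq> h y))"
  proof (rule generic_leaves[OF fin(1) _ fin(2) XZY(2) \<open>finite ?E\<close>])
    show "root z \<in> G" if "z \<in> Z" for z using that unfolding Z_def innert_def by blast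
    fix y and E :: "tree set" and P :: "nat list set" assume y: "y \<in> Y" and EP: "finite E" "finite P" "[] \<notin> P"
    show "\<exists>u \<in> ?A y. u \<notin> E \<and> (root u \<notin> G \<or> (\<forall>p \<in> P. sub u p \<noteq> Some u))"
      using sup[OF _ YU[OF y] EP] y Xr XZY(1) by blast
  qed
  then obtain h where h: "solves Z root children h" "\<forall>x. x \<notin> Z \<longrightarrow> x \<notin> Y \<longrightarrow> h x = h0 x"
    "\<forall>y \<in> Y. h y \<in> ?A y \<and> h y \<notin> ?E \<and> (\<forall>x \<in> Z \<union> Y. x \<noteq> y \<longrightarrow> h x \<noteq> h y)" by blast
  have old: "(t, h t) \<in> D" if "t \<in> Domain D" for t
  proof -
    have "t \<notin> Z \<union> Y" using that XZY(1) unfolding newt_def by auto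
    then show ?thesis using h(2) h0[OF that] by simp
  qed
  have goodD': "good D" unfolding D_def using m N by (intro eqv_good[OF N(1)]) (auto simp: B_def)
  have "eqv G n (insert (c, h c) M)"
  proof (rule ef_core[OF M(1) N(1) _ m(1) cW card D_def m(3)[folded D_def]])
    show "m + B + 1 \<le> N" using m N(2) unfolding B_def by simp
    show "solves (innert G n c D) root children h" using h(1) unfolding Z_def .
    show "(t, h t) \<in> D" if "t \<in> Domain D" for t using old[OF that] .
    fix y assume y: "y \<in> leaft G n c D"
    then have hy: "h y \<in> ?A y" "h y \<notin> ?E" using h(3) unfolding Y_def by blast+
    have "y \<in> inn G n c \<Longrightarrow> root y \<notin> G" using y unfolding leaft_def innert_def by blast
    then show "gres (root (h y)) = gres (root y) \<and> finite_tree (h y) = finite_tree y \<and>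
        (y \<in> inn G n c \<longrightarrow> root (h y) \<notin> G) \<and> h y \<notin> Range (lev G (m + B + 1) M)"
      using hy by (auto simp: KT_def trees_sort)
    fix x assume "x \<in> newt G n c D" "x \<noteq> y"
    then show "h x \<noteq> h y" using h(3) y XZY(1) unfolding Y_def by blast
  qed
  moreover have "h c \<in> trees S2 s"
  proof -
    have leafT: "h y \<in> trees S2 (gres (root y))" if "y \<in> Y" for y using h(3) that by (auto simp: KT_def)
    have oldT: "h t \<in> trees S2 (gres (root t))" if "t \<in> Domain D" for t
    proof -
      have "(t, h t) \<in> D" using old[OF that] .
      then have "h t \<in> W S2" "gres (root t) = gres (root (h t))"
        using lev_W[OF M(1)] goodD(1)[OF goodD'] unfolding D_def by blast+
      then show ?thesis by (simp add: W_def)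
    qed
    have rW: "rch G n c \<subseteq> W S1" using rch_W[OF cW] .
    have nonZ: "h t \<in> trees S2 (gres (root t))" if "t \<in> rch G n c" "t \<notin> Z" for t
      using that leafT oldT XZY(1) unfolding newt_def by blast
    have "h c \<in> trees S2 (gres (root c))"
    proof (cases "c \<in> Z")
      case True
      show ?thesis
      proof (rule solves_trees[where st = "\<lambda>t. gres (root t)", OF h(1) _ _ True])
        fix t assume t: "t \<in> Z"
        then have tt: "t \<in> rch G n c" "root t \<in> G" "t \<in> inn G n c"
          using Xr unfolding Z_def innert_def by auto
        have "t \<in> trees S1 (gres (root t))" using tt rW unfolding W_def by blast
        then have "map (\<lambda>t. gres (root t)) (children t) = gargs (root t)"
          using trees_length[of t] trees_child[of t, THEN trees_sort] by (auto intro: nth_equalityI)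
        then show "root t \<in> gens S2 \<and> gres (root t) = gres (root t) \<and>
            map (\<lambda>t. gres (root t)) (children t) = gargs (root t)" using tt(2) G(1) by blast
        fix d assume "d \<in> set (children t)"
        then have "d \<in> rch G n c" using inn_child tt by blast
        then show "d \<in> Z \<or> h d \<in> trees S2 (gres (root d))" using nonZ by blast
      qed
    next
      case False
      then show ?thesis using nonZ rch_self by blast
    qed
    then show ?thesis using trees_sort[OF c] by simp
  qed
  ultimately show ?thesis by blast
qed

section \<open>Satisfaction, blocks of quantifiers, and lists of conjuncts\<close>

lemma sat_cong: "(\<And>v. v \<in> fv p \<Longrightarrow> e v = e' v) \<Longrightarrow> sat S e p = sat S e' p"
proof (induction p arbitrary: e e')
  case (Eq t u)
  have ev: "eval_trm e t = eval_trm e' t" if "\<And>v. v \<in> vars_trm t \<Longrightarrow> e v = e' v" for t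
    using that by (induction t) auto
  show ?case using ev[of t] ev[of u] Eq by simp
next
  case (Fin s t)
  have ev: "eval_trm e t = eval_trm e' t" if "\<And>v. v \<in> vars_trm t \<Longrightarrow> e v = e' v" for t
    using that by (induction t) auto
  show ?case using ev[of t] Fin by simp
next
  case (Exists v p)
  then have "sat S (e(v := t)) p = sat S (e'(v := t)) p" for t by (intro Exists.IH) auto
  then show ?case by simp
next
  case (Forall v p)
  then have "sat S (e(v := t)) p = sat S (e'(v := t)) p" for t by (intro Forall.IH) auto
  then show ?case by simp
next
  case (And p q)
  then show ?case unfolding sat.simps by (intro arg_cong2[where f = "(\<and>)"] And.IH) simp_all
next
  case (Or p q)
  then show ?case unfolding sat.simps by (intro arg_cong2[where f = "(\<or>)"] Or.IH) simp_all
next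
  case (Imp p q)
  then show ?case unfolding sat.simps by (intro arg_cong2[where f = "(\<longrightarrow>)"] Imp.IH) simp_all
next
  case (Iff p q)
  then show ?case unfolding sat.simps by (intro arg_cong2[where f = "(=)"] Iff.IH) simp_all
next
  case (Neg p)
  then show ?case unfolding sat.simps by (intro arg_cong[where f = Not] Neg.IH) simp
qed auto

definition agree :: "signature \<Rightarrow> var list \<Rightarrow> (var \<Rightarrow> tree) \<Rightarrow> (var \<Rightarrow> tree) \<Rightarrow> bool" where
  "agree S xs e w \<longleftrightarrow> (\<forall>v. v \<notin> set xs \<longrightarrow> w v = e v) \<and> (\<forall>v \<in> set xs. w v \<in> trees S (vsort v))"

lemma agree_Nil [simp]: "agree S [] e w \<longleftrightarrow> w = e"
  by (auto simp: agree_def)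

lemma sat_Exs: "sat S e (foldr Exists xs p) \<longleftrightarrow> (\<exists>w. agree S xs e w \<and> sat S w p)"
proof (induction xs arbitrary: e)
  case (Cons x xs)
  show ?case
  proof
    assume "sat S e (foldr Exists (x # xs) p)"
    then obtain t where t: "t \<in> trees S (vsort x)" and "sat S (e(x := t)) (foldr Exists xs p)" by auto
    then obtain w where w: "agree S xs (e(x := t)) w" "sat S w p" using Cons[of "e(x := t)"] by blast
    have "agree S (x # xs) e w"
      unfolding agree_def
    proof (intro conjI allI impI ballI)
      fix v assume "v \<in> set (x # xs)"
      then show "w v \<in> trees S (vsort v)" using w(1) t by (cases "v \<in> set xs") (auto simp: agree_def)
    qed (use w(1) in \<open>auto simp: agree_def\<close>)
    with w show "\<exists>w. agree S (x # xs) e w \<and> sat S w p" by blast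
  next
    assume "\<exists>w. agree S (x # xs) e w \<and> sat S w p"
    then obtain w where w: "agree S (x # xs) e w" "sat S w p" by blast
    then have "agree S xs (e(x := w x)) w" "w x \<in> trees S (vsort x)" by (auto simp: agree_def)
    then show "sat S e (foldr Exists (x # xs) p)" proof -
      have "sat S (e(x := w x)) (foldr Exists xs p)" using Cons[of "e(x := w x)"] \<open>agree S xs _ w\<close> w(2) by blast
      then show ?thesis using \<open>w x \<in> _\<close> by auto
    qed
  qed
qed auto

lemma sat_Alls: "sat S e (foldr Forall xs p) \<longleftrightarrow> (\<forall>w. agree S xs e w \<longrightarrow> sat S w p)"
proof -
  have "sat S e (foldr Forall xs p) \<longleftrightarrow> \<not> sat S e (foldr Exists xs (Neg p))"
    by (induction xs arbitrary: e) auto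
  then show ?thesis by (simp add: sat_Exs)
qed

lemma sat_conj_list: "sat S e (conj_list ps) \<longleftrightarrow> (\<forall>p \<in> set ps. sat S e p)"
  by (induction ps rule: conj_list.induct) auto

lemma sat_disj_list: "sat S e (disj_list ps) \<longleftrightarrow> (\<exists>p \<in> set ps. sat S e p)"
  by (induction ps rule: disj_list.induct) auto

lemma fv_conj_list: "fv (conj_list ps) = (\<Union>p \<in> set ps. fv p)"
  by (induction ps rule: conj_list.induct) auto

lemma fv_disj_list: "fv (disj_list ps) = (\<Union>p \<in> set ps. fv p)"
  by (induction ps rule: disj_list.induct) auto

lemma wf_conj_list: "wf_fm S (conj_list ps) \<longleftrightarrow> (\<forall>p \<in> set ps. wf_fm S p)"
  by (induction ps rule: conj_list.induct) auto

lemma wf_disj_list: "wf_fm S (disj_list ps) \<longleftrightarrow> (\<forall>p \<in> set ps. wf_fm S p)"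
  by (induction ps rule: disj_list.induct) auto

lemma fv_Exs: "fv (foldr Exists xs p) = fv p - set xs"
  by (induction xs) auto

lemma fv_Alls: "fv (foldr Forall xs p) = fv p - set xs"
  by (induction xs) auto

lemma wf_Exs: "wf_fm S (foldr Exists xs p) \<longleftrightarrow> (\<forall>x \<in> set xs. vsort x \<in> sorts S) \<and> wf_fm S p"
  by (induction xs) auto

lemma wf_Alls: "wf_fm S (foldr Forall xs p) \<longleftrightarrow> (\<forall>x \<in> set xs. vsort x \<in> sorts S) \<and> wf_fm S p"
  by (induction xs) auto

lemma fv_wf: "wf_fm S p \<Longrightarrow> v \<in> fv p \<Longrightarrow> vsort v \<in> sorts S"
proof -
  have tr: "wf_trm S t \<Longrightarrow> v \<in> vars_trm t \<Longrightarrow> vsort v \<in> sorts S" for t by (induction t) auto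
  show "wf_fm S p \<Longrightarrow> v \<in> fv p \<Longrightarrow> vsort v \<in> sorts S"
    by (induction p) (auto dest: tr)
qed

lemma finite_fv: "finite (fv p)"
proof -
  have "finite (vars_trm t)" for t by (induction t) auto
  then show ?thesis by (induction p) auto
qed

lemma equivalentI:
  assumes wf: "wf_fm S p" "wf_fm S q" and eq: "\<And>e. valuation S e \<Longrightarrow> sat S e p = sat S e q"
  shows "equivalent S p q"
proof -
  obtain xs where xs: "set xs = fv (Iff p q)" using finite_list[OF finite_fv] by blast
  have "sat S e (foldr Forall xs (Iff p q))" if e: "valuation S e" for e
    unfolding sat_Alls
  proof (intro allI impI)
    fix w assume "agree S xs e w"
    then have "valuation S w" using e unfolding agree_def valuation_def by metis
    then show "sat S w (Iff p q)" using eq by simp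
  qed
  moreover have "sentence S (foldr Forall xs (Iff p q))"
    unfolding sentence_def wf_Alls fv_Alls xs using wf fv_wf[of S "Iff p q"] by auto
  ultimately show ?thesis unfolding equivalent_def extended_theory_of_trees_def using xs by blast
qed

subsection \<open>Formulae of solved shape\<close>

text \<open>Phrased with \<open>drop\<close> so that it is visibly semi-decidable;
  \<open>before_nth\<close> gives the usual form with indices.\<close>

definition before :: "'a list \<Rightarrow> 'a \<Rightarrow> 'a \<Rightarrow> bool" where
  "before l y v \<longleftrightarrow> (\<exists>i zs. drop i l = y # zs \<and> v \<in> set zs)"

type_synonym eqn = "var \<times> flat"
text \<open>Bound variables, further equations and finiteness constraints of a negated conjunct. The
  equations of the positive part, which a solved formula repeats in each negated conjunct, are left
  implicit.\<close>

type_synonym negc = "var list \<times> eqn list \<times> var list"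

definition shape_nf :: "var list \<Rightarrow> eqn list \<Rightarrow> var list \<Rightarrow> negc list \<Rightarrow> nf" where
  "shape_nf xs E F Ns = NF xs (Basic E F) (map (\<lambda>(ys, ex, fs). NF ys (Basic (E @ ex) fs) []) Ns)"

definition shape_fm :: "var list \<Rightarrow> eqn list \<Rightarrow> var list \<Rightarrow> negc list \<Rightarrow> fm" where
  "shape_fm xs E F Ns = foldr Exists xs (conj_list (atoms_of_basic (Basic E F) @
     map (\<lambda>(ys, ex, fs). Neg (foldr Exists ys (conj_list (atoms_of_basic (Basic (E @ ex) fs))))) Ns))"

lemma shape_fm_nf: "fm_of_nf (shape_nf xs E F Ns) = Neg (shape_fm xs E F Ns)"
  by (simp add: shape_nf_def shape_fm_def o_def case_prod_unfold)

definition mixed :: "signature \<Rightarrow> srt \<Rightarrow> bool" where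
  "mixed S s \<longleftrightarrow> KT S s True \<noteq> {} \<and> KT S s False \<noteq> {}"

lemma mixed_iff: "mixed S s \<longleftrightarrow> finite_trees S s \<noteq> {} \<and> infinite_trees S s \<noteq> {}"
  by (simp add: mixed_def KT_def finite_trees_def infinite_trees_def)

definition eqn_ok :: "gen set \<Rightarrow> var list \<Rightarrow> eqn \<Rightarrow> bool" where
  "eqn_ok G ord E \<longleftrightarrow> fst E \<in> set ord \<and>
     ((\<exists>y. snd E = FVar y \<and> before ord y (fst E) \<and> vsort y = vsort (fst E)) \<or>
      (\<exists>g ws. snd E = FApp g ws \<and> g \<in> G \<and> gres g = vsort (fst E) \<and> map vsort ws = gargs g \<and> set ws \<subseteq> set ord))"

text \<open>Three kinds of negated conjuncts suffice: an inequation between variables, the exclusion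
  of a generator as root, and infiniteness. The conditions on sorts are there to prevent
  instantiability: a generator is excluded only where there are infinitely many, and no constraint
  is put on a variable of a sort that has finitely many trees altogether.\<close>

definition neg_ok :: "signature \<Rightarrow> gen set \<Rightarrow> var list \<Rightarrow> eqn list \<Rightarrow> var list \<Rightarrow> negc \<Rightarrow> bool" where
  "neg_ok S G ord E F n \<longleftrightarrow>
     (\<exists>y z. n = ([], [(y, FVar z)], []) \<and> y \<in> set ord \<and> y \<notin> fst ` set E \<and> before ord z y \<and> vsort y = vsort z \<and>
        \<not> (small S (vsort y) True \<and> small S (vsort y) False)) \<or>
     (\<exists>y g ys. n = (ys, [(y, FApp g ys)], []) \<and> y \<in> set ord \<and> y \<notin> fst ` set E \<and> g \<in> G \<and> gres g = vsort y \<and>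
        map vsort ys = gargs g \<and> distinct ys \<and> set ys \<inter> set ord = {} \<and> infinite (gens_of S (vsort y))) \<or>
     (\<exists>y. n = ([], [], [y]) \<and> y \<in> set ord \<and> y \<notin> fst ` set E \<and> y \<notin> set F \<and> mixed S (vsort y) \<and> \<not> small S (vsort y) False)"

text \<open>A sufficient condition for being solved that can be checked on lists: the order of the
  variables is their order in \<open>us @ xs\<close>, instead of an ordering of all
  variables.\<close>

definition shape :: "signature \<Rightarrow> gen set \<Rightarrow> var list \<Rightarrow> var list \<Rightarrow> eqn list \<Rightarrow> var list \<Rightarrow> negc list \<Rightarrow> bool" where
  "shape S G us xs E F Ns \<longleftrightarrow> distinct (us @ xs) \<and> (\<forall>v \<in> set (us @ xs). vsort v \<in> sorts S) \<and>
     (\<forall>q \<in> set E. eqn_ok G (us @ xs) q) \<and> distinct (map fst E @ F) \<and>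
     (\<forall>u \<in> set F. u \<in> set (us @ xs) \<and> mixed S (vsort u) \<and> \<not> small S (vsort u) True) \<and>
     (\<forall>x \<in> set xs. \<exists>u \<in> set us. (u, x) \<in> (edges (Basic E F))\<^sup>+) \<and>
     (\<forall>n \<in> set Ns. neg_ok S G (us @ xs) E F n)"

lemma before_nth: "before l y v \<longleftrightarrow> (\<exists>i j. i < j \<and> j < length l \<and> l ! i = y \<and> l ! j = v)"
proof
  assume "before l y v"
  then obtain i zs where i: "drop i l = y # zs" "v \<in> set zs" unfolding before_def by blast
  then obtain k where k: "k < length zs" "zs ! k = v" by (auto simp: in_set_conv_nth)
  have len: "i < length l" using i(1) by (metis drop_eq_Nil list.distinct(1) not_le)
  have "length (drop i l) = Suc (length zs)" using i(1) by simp
  then have lookup: "i + Suc k < length l" using k(1) by simp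
  have "l ! i = y" using i(1) len by (metis Cons_nth_drop_Suc list.inject)
  moreover have "l ! (i + Suc k) = v" using i(1) k len lookup nth_drop[of i l "Suc k"] by simp
  ultimately show "\<exists>i j. i < j \<and> j < length l \<and> l ! i = y \<and> l ! j = v" using lookup by (intro exI[of _ i] exI[of _ "i + Suc k"]) auto
next
  assume "\<exists>i j. i < j \<and> j < length l \<and> l ! i = y \<and> l ! j = v"
  then obtain i j where ij: "i < j" "j < length l" "l ! i = y" "l ! j = v" by blast
  then have "drop i l = y # drop (Suc i) l" using Cons_nth_drop_Suc[of i l] by simp
  moreover have "v = drop (Suc i) l ! (j - Suc i)" using ij by simp
  then have "v \<in> set (drop (Suc i) l)" using ij by (metis diff_less_mono length_drop nth_mem Suc_leI)
  ultimately show "before l y v" unfolding before_def by blast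
qed

lemma before_set: "before l y v \<Longrightarrow> y \<in> set l \<and> v \<in> set l"
  unfolding before_nth by auto

lemma edges_scope:
  assumes "shape S G us xs E F Ns" "(v, w) \<in> edges (Basic E F)"
  shows "v \<in> set (us @ xs)" "w \<in> set (us @ xs)"
proof -
  obtain t where t: "(v, t) \<in> set E" "w \<in> vars_flat t" using assms(2) unfolding edges_def by auto
  then have ok: "eqn_ok G (us @ xs) (v, t)" using assms(1) unfolding shape_def by blast
  then show "v \<in> set (us @ xs)" unfolding eqn_ok_def by simp
  show "w \<in> set (us @ xs)" using ok t(2) before_set[of "us @ xs" w v] unfolding eqn_ok_def by auto
qed

lemma fv_atoms: "(\<Union>p \<in> set (atoms_of_basic (Basic E F)). fv p) = vars_basic (Basic E F)"
proof -
  have "vars_trm (trm_of_flat t) = vars_flat t" for t by (cases t) auto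
  then show ?thesis unfolding atoms_of_basic_def vars_basic_def by (auto simp: case_prod_unfold)
qed

lemma vars_scope:
  assumes sh: "shape S G us xs E F Ns"
  shows "vars_basic (Basic E F) \<subseteq> set (us @ xs)"
proof
  fix v assume "v \<in> vars_basic (Basic E F)"
  then consider t where "(v, t) \<in> set E" | w t where "(w, t) \<in> set E" "v \<in> vars_flat t" | "v \<in> set F"
    unfolding vars_basic_def by auto
  then show "v \<in> set (us @ xs)"
  proof cases
    case 1
    then have "eqn_ok G (us @ xs) (v, t)" using sh unfolding shape_def by blast
    then show ?thesis unfolding eqn_ok_def by simp
  next
    case 2
    then have "(w, v) \<in> edges (Basic E F)" unfolding edges_def by auto
    then show ?thesis using edges_scope[OF sh] by blast
  next
    case 3
    then show ?thesis using sh unfolding shape_def by blast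
  qed
qed

lemma vars_basic_app: "vars_basic (Basic (E @ ex) fs) = vars_basic (Basic E []) \<union> vars_basic (Basic ex fs)"
  unfolding vars_basic_def by auto

lemma vars_basic_F: "vars_basic (Basic E []) \<subseteq> vars_basic (Basic E F)"
  unfolding vars_basic_def by auto

lemma neg_scope:
  assumes "neg_ok S G ord E F (ys, ex, fs)"
  shows "vars_basic (Basic ex fs) - set ys \<subseteq> set ord" "set ys \<inter> set ord = {}"
proof -
  show "vars_basic (Basic ex fs) - set ys \<subseteq> set ord"
    using assms before_set[of ord] unfolding neg_ok_def vars_basic_def by auto
  show "set ys \<inter> set ord = {}" using assms unfolding neg_ok_def by auto
qed

lemma fv_shape_fm:
  assumes sh: "shape S G us xs E F Ns"
  shows "fv (shape_fm xs E F Ns) \<subseteq> set us"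
proof -
  have "fv (foldr Exists ys (conj_list (atoms_of_basic (Basic (E @ ex) fs)))) \<subseteq> set (us @ xs)"
    if "(ys, ex, fs) \<in> set Ns" for ys ex fs
  proof -
    have "neg_ok S G (us @ xs) E F (ys, ex, fs)" using sh that unfolding shape_def by blast
    from neg_scope[OF this] vars_scope[OF sh] vars_basic_F[of E F] show ?thesis
      unfolding fv_Exs fv_conj_list fv_atoms vars_basic_app by blast
  qed
  note neg = this
  have "(\<Union>n \<in> set Ns. fv ((\<lambda>(ys, ex, fs). Neg (foldr Exists ys (conj_list (atoms_of_basic (Basic (E @ ex) fs))))) n)) \<subseteq> set (us @ xs)"
  proof (intro UN_least)
    fix n assume n: "n \<in> set Ns"
    obtain ys ex fs where "n = (ys, ex, fs)" by (cases n)
    then show "fv (case n of (ys, ex, fs) \<Rightarrow> Neg (foldr Exists ys (conj_list (atoms_of_basic (Basic (E @ ex) fs))))) \<subseteq> set (us @ xs)"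
      using neg[of ys ex fs] n by simp
  qed
  then show ?thesis
    using vars_scope[OF sh] unfolding shape_fm_def fv_Exs fv_conj_list set_append UN_Un fv_atoms by auto
qed

lemma wf_eqn: "eqn_ok G ord (v, t) \<Longrightarrow> G \<subseteq> gens S \<Longrightarrow> \<forall>v \<in> set ord. vsort v \<in> sorts S \<Longrightarrow>
    wf_fm S (Eq (Var v) (trm_of_flat t))"
  unfolding eqn_ok_def using before_set[of ord _ v] by (auto simp: o_def subset_iff)

lemma wf_shape_fm:
  assumes S: "tree_signature S" and G: "G \<subseteq> gens S" and sh: "shape S G us xs E F Ns"
  shows "wf_fm S (shape_fm xs E F Ns)"
proof -
  have srt: "\<forall>v \<in> set (us @ xs). vsort v \<in> sorts S" using sh unfolding shape_def by blast
  have eqs: "wf_fm S (Eq (Var v) (trm_of_flat t))" if "(v, t) \<in> set E" for v t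
    using sh that wf_eqn[OF _ G srt] unfolding shape_def by blast
  have neg: "wf_fm S (foldr Exists ys (conj_list (atoms_of_basic (Basic (E @ ex) fs))))"
    if "(ys, ex, fs) \<in> set Ns" for ys ex fs
  proof -
    have ok: "neg_ok S G (us @ xs) E F (ys, ex, fs)" using sh that unfolding shape_def by blast
    have 1: "vsort y \<in> sorts S" if y: "y \<in> set ys" for y
    proof -
      obtain g where g: "g \<in> G" "map vsort ys = gargs g" using ok y unfolding neg_ok_def by auto
      then have "vsort y \<in> set (gargs g)" using y by (metis image_eqI list.set_map)
      then show ?thesis using g G S unfolding tree_signature_def by blast
    qed
    have 2: "wf_fm S (Eq (Var v) (trm_of_flat t))" if "(v, t) \<in> set ex" for v t
      using ok that srt before_set[of "us @ xs"] G 1 unfolding neg_ok_def by (auto simp: o_def)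
    have 3: "vsort v \<in> sorts S" if "v \<in> set fs" for v
      using ok that srt unfolding neg_ok_def by auto
    show ?thesis unfolding wf_Exs wf_conj_list using 1 2 3 eqs
      by (auto simp: atoms_of_basic_def simp del: wf_fm.simps) (auto simp: 3)
  qed
  have F: "vsort v \<in> sorts S" if "v \<in> set F" for v using sh srt that unfolding shape_def by blast
  have xs: "\<forall>x \<in> set xs. vsort x \<in> sorts S" using srt by auto
  show ?thesis unfolding shape_fm_def wf_Exs wf_conj_list using xs eqs neg F
    by (auto simp: atoms_of_basic_def simp del: wf_fm.simps(3))
qed

text \<open>Being solved refers to a total order on all variables. Those of the list come first, in
  their order; the others follow, ordered by their codes, so that the bound variables of negated
  conjuncts are larger.\<close>

definition rnk :: "var list \<Rightarrow> var \<Rightarrow> nat" where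
  "rnk l v = (if v \<in> set l then (LEAST i. i < length l \<and> l ! i = v) else length l + enc v)"

lemma rnk_nth: "distinct l \<Longrightarrow> i < length l \<Longrightarrow> rnk l (l ! i) = i"
  unfolding rnk_def by (auto intro!: Least_equality simp: nth_eq_iff_index_eq)

lemma rnk_inj: "distinct l \<Longrightarrow> rnk l v = rnk l w \<Longrightarrow> v = w"
proof -
  assume l: "distinct l" and eq: "rnk l v = rnk l w"
  have in_l: "\<exists>i < length l. v = l ! i \<and> rnk l v = i" if "v \<in> set l" for v
    using that rnk_nth[OF l] by (metis in_set_conv_nth)
  have out: "rnk l v = length l + enc v" if "v \<notin> set l" for v using that unfolding rnk_def by (rule if_not_P)
  show "v = w"
  proof (cases "v \<in> set l")
    case True
    then obtain i where i: "i < length l" "v = l ! i" "rnk l v = i" using in_l by blast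
    show ?thesis
    proof (cases "w \<in> set l")
      case True
      then obtain j where "w = l ! j" "rnk l w = j" using in_l by blast
      then show ?thesis using i eq by simp
    next
      case False
      then show ?thesis using out[of w] i eq by simp
    qed
  next
    case v: False
    show ?thesis
    proof (cases "w \<in> set l")
      case True
      then obtain j where "j < length l" "rnk l w = j" using in_l by blast
      then show ?thesis using out[OF v] eq by simp
    next
      case False
      then have "enc v = enc w" using out[OF v] out[OF False] eq by linarith
      then show ?thesis by (simp only: enc_eq_iff)
    qed
  qed
qed

lemma rnk_before: "distinct l \<Longrightarrow> before l y v \<Longrightarrow> rnk l y < rnk l v"
  unfolding before_nth using rnk_nth by fastforce

lemma rnk_out: "distinct l \<Longrightarrow> v \<in> set l \<Longrightarrow> w \<notin> set l \<Longrightarrow> rnk l v < rnk l w"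
proof -
  assume l: "distinct l" and v: "v \<in> set l" and w: "w \<notin> set l"
  obtain i where "i < length l" "l ! i = v" using v by (auto simp: in_set_conv_nth)
  then have "rnk l v < length l" using rnk_nth[OF l] by auto
  moreover have "rnk l w = length l + enc w" using w unfolding rnk_def by (rule if_not_P)
  ultimately show ?thesis by simp
qed

lemma shape_minus:
  assumes "neg_ok S G ord E F (ys, ex, fs)"
  shows "minus_basic (Basic (E @ ex) fs) (Basic E F) = Basic ex fs"
proof -
  have "filter (\<lambda>e. e \<notin> set E) ex = ex" "filter (\<lambda>u. u \<notin> set F) fs = fs"
    using assms unfolding neg_ok_def by force+
  then show ?thesis by (simp add: minus_basic_def)
qed

lemma shape_solved:
  assumes S: "tree_signature S" and sh: "shape S G us xs E F Ns"
  shows "solved S (shape_nf xs E F Ns)"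
proof -
  let ?N = "shape_nf xs E F Ns"
  have dist: "distinct (us @ xs)" using sh unfolding shape_def by blast
  let ?r = "{(a, b). rnk (us @ xs) a < rnk (us @ xs) b}"
  have bv: "bvars ?N = xs" "base ?N = Basic E F"
    and sb: "set (subs ?N) = (\<lambda>(ys, ex, fs). NF ys (Basic (E @ ex) fs) []) ` set Ns"
    by (auto simp: shape_nf_def)
  have sub: "\<exists>ys ex fs. n = NF ys (Basic (E @ ex) fs) [] \<and> neg_ok S G (us @ xs) E F (ys, ex, fs)" if "n \<in> set (subs ?N)" for n
    using that sh unfolding sb shape_def by fastforce
  have fvN: "fv (fm_of_nf ?N) \<subseteq> set us" unfolding shape_fm_nf using fv_shape_fm[OF sh] by simp
  have dep: "depth ?N \<le> 2"
  proof -
    have "depth n \<le> 1" if "n \<in> set (subs ?N)" for n using sub[OF that] by auto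
    then show ?thesis by (cases ?N) (auto simp: Max_le_iff)
  qed
  have lin: "strict_linear_order ?r"
    unfolding strict_linear_order_on_def trans_def irrefl_def total_on_def
    by auto (metis linorder_neqE_nat rnk_inj[OF dist])
  have o1: "(u, x) \<in> ?r" if "u \<in> fv (fm_of_nf ?N)" "x \<in> set (bvars ?N)" for u x
  proof -
    have "u \<in> set us" "x \<in> set xs" using that fvN bv by auto
    then obtain i j where "i < length us" "us ! i = u" "j < length xs" "xs ! j = x" by (auto simp: in_set_conv_nth)
    then have "before (us @ xs) u x" unfolding before_nth
      by (intro exI[of _ i] exI[of _ "length us + j"]) (auto simp: nth_append)
    then show ?thesis using rnk_before[OF dist] by simp
  qed
  have o2: "(u, y) \<in> ?r" if "n \<in> set (subs ?N)" "u \<in> fv (fm_of_nf ?N) \<union> set (bvars ?N)" "y \<in> set (bvars n)" for n u y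
  proof -
    have "u \<in> set (us @ xs)" using that fvN bv by auto
    moreover have "y \<notin> set (us @ xs)" using sub[OF that(1)] neg_scope(2) that(3) by fastforce
    ultimately show ?thesis using rnk_out[OF dist] by simp
  qed
  have eqo: "(y, x) \<in> ?r" if "(x, FVar y) \<in> set E" for x y
  proof -
    have "eqn_ok G (us @ xs) (x, FVar y)" using sh that unfolding shape_def by blast
    then show ?thesis using rnk_before[OF dist] unfolding eqn_ok_def by auto
  qed
  have sol1: "solved_basic S ?r (base ?N)"
    using sh eqo unfolding solved_basic_def bv mixed_iff shape_def by auto
  have sol2: "solved_basic S ?r (base n)" if nN: "n \<in> set (subs ?N)" for n
  proof -
    obtain ys ex fs where n: "n = NF ys (Basic (E @ ex) fs) []" and ok: "neg_ok S G (us @ xs) E F (ys, ex, fs)"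
      using sub[OF nN] by blast
    have dE: "distinct (map fst E)" using sh unfolding shape_def by auto
    have "set (map fst ex) \<inter> set (map fst E) = {} \<and> distinct (map fst ex) \<and> distinct fs \<and>
        set fs \<inter> (set (map fst E) \<union> set (map fst ex)) = {}" using ok unfolding neg_ok_def by fastforce
    then have "distinct (map fst (E @ ex) @ fs)" using dE by auto
    moreover have "(y, x) \<in> ?r" if "(x, FVar y) \<in> set (E @ ex)" for x y
    proof (cases "(x, FVar y) \<in> set E")
      case False
      then have "before (us @ xs) y x" using that ok unfolding neg_ok_def by auto
      then show ?thesis using rnk_before[OF dist] by auto
    qed (rule eqo)
    moreover have "\<forall>u \<in> set fs. mixed S (vsort u)" using ok unfolding neg_ok_def by auto
    ultimately show ?thesis unfolding solved_basic_def n mixed_iff by simp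
  qed
  have mn: "minus_basic (base n) (base ?N) \<noteq> Basic [] []" if nN: "n \<in> set (subs ?N)" for n
  proof -
    obtain ys ex fs where n: "n = NF ys (Basic (E @ ex) fs) []" and ok: "neg_ok S G (us @ xs) E F (ys, ex, fs)"
      using sub[OF nN] by blast
    have "Basic ex fs \<noteq> Basic [] []" using ok unfolding neg_ok_def by auto
    then show ?thesis using shape_minus[OF ok] n bv by simp
  qed
  have inst: "\<not> instantiable S ?N v" for v
  proof
    assume "instantiable S ?N v"
    then have v: "v \<in> fv (fm_of_nf ?N) \<union> set (bvars ?N)"
      and c: "finite (gens_of S (vsort v)) \<and>
         (\<exists>b \<in> base ` set (subs ?N). (\<exists>g ws. (v, FApp g ws) \<in> set (eqs (minus_basic b (base ?N)))) \<and> \<not> properly_reachable b v v) \<or>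
       vsort v \<in> S_FF S \<inter> S_FI S \<and> (\<exists>b \<in> base ` set (subs ?N). v \<in> vars_basic (minus_basic b (base ?N))) \<and>
         v \<notin> fst ` set (eqs (base ?N)) \<or>
       vsort v \<in> S_FF S \<and> v \<in> set (fins (base ?N)) \<and> (\<exists>b \<in> base ` set (subs ?N). v \<in> vars_basic (minus_basic b (base ?N))) \<or>
       vsort v \<in> S_FI S \<and>
         (\<exists>b \<in> base ` set (subs ?N). eqs (minus_basic b (base ?N)) = [] \<and> v \<in> set (fins (minus_basic b (base ?N))))"
      unfolding instantiable_def Let_def by blast+
    have vord: "v \<in> set (us @ xs)" using v fvN bv by auto
    have M: "\<exists>ys ex fs. neg_ok S G (us @ xs) E F (ys, ex, fs) \<and> minus_basic b (base ?N) = Basic ex fs"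
      if bN: "b \<in> base ` set (subs ?N)" for b
    proof -
      obtain n where n: "n \<in> set (subs ?N)" "b = base n" using bN by blast
      then show ?thesis using sub[OF n(1)] shape_minus bv by fastforce
    qed
    show False
      using c
    proof (elim disjE conjE bexE exE)
      fix b g ws assume "finite (gens_of S (vsort v))" "b \<in> base ` set (subs ?N)"
        "(v, FApp g ws) \<in> set (eqs (minus_basic b (base ?N)))"
      then show False using M[of b] unfolding neg_ok_def by fastforce
    next
      fix b assume a: "vsort v \<in> S_FF S \<inter> S_FI S" "b \<in> base ` set (subs ?N)" "v \<in> vars_basic (minus_basic b (base ?N))"
      obtain ys ex fs where ok: "neg_ok S G (us @ xs) E F (ys, ex, fs)" and m: "minus_basic b (base ?N) = Basic ex fs"
        using M[OF a(2)] by blast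
      have sm: "small S (vsort v) True" "small S (vsort v) False" using a(1) by (simp_all add: small_S_FF small_S_FI)
      \<comment> \<open>Settles the conjuncts that exclude a generator: they occur only in sorts
        with infinitely many generators, which \<open>S_FF\<close> and \<open>S_FI\<close> together
        rule out.\<close>
      have fg: "finite (gens_of S (vsort v))" using FF_FI_finite_gens[OF S] a(1) by blast
      have "v \<in> vars_basic (Basic ex fs)" using a(3) m by simp
      moreover have "v \<notin> set ys" using neg_scope(2)[OF ok] vord by blast
      ultimately show False using ok sm fg unfolding neg_ok_def vars_basic_def by auto
    next
      assume "vsort v \<in> S_FF S" "v \<in> set (fins (base ?N))"
      then show False using sh unfolding shape_def bv small_S_FF by auto
    next
      fix b assume a: "vsort v \<in> S_FI S" "b \<in> base ` set (subs ?N)"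
        "eqs (minus_basic b (base ?N)) = []" "v \<in> set (fins (minus_basic b (base ?N)))"
      then show False using M[OF a(2)] unfolding neg_ok_def small_S_FI by auto
    qed
  qed
  have rx: "all_reachable (bvars ?N) (base ?N)"
    unfolding all_reachable_def bv
  proof
    fix x assume "x \<in> set xs"
    then obtain u where u: "u \<in> set us" "(u, x) \<in> (edges (Basic E F))\<^sup>+" using sh unfolding shape_def by blast
    obtain w where "(u, w) \<in> edges (Basic E F)" using tranclD[OF u(2)] by blast
    then have "u \<in> vars_basic (Basic E F)" unfolding edges_def vars_basic_def by auto
    moreover have "u \<notin> set xs" using u(1) dist by auto
    ultimately show "\<exists>u \<in> vars_basic (Basic E F) - set xs. reachable (Basic E F) u x"
      using u(2) unfolding reachable_def by (intro bexI[of _ u]) auto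
  qed
  have ry: "all_reachable (bvars n) (base n)" if nN: "n \<in> set (subs ?N)" for n
  proof -
    obtain ys ex fs where n: "n = NF ys (Basic (E @ ex) fs) []" and ok: "neg_ok S G (us @ xs) E F (ys, ex, fs)"
      using sub[OF nN] by blast
    show ?thesis unfolding all_reachable_def n nf.sel
    proof
      fix z assume z: "z \<in> set ys"
      then obtain y g where y: "ex = [(y, FApp g ys)]" "y \<in> set (us @ xs)" using ok unfolding neg_ok_def by auto
      have "y \<notin> set ys" using y(2) neg_scope(2)[OF ok] by blast
      moreover have "(y, z) \<in> edges (Basic (E @ ex) fs)" using y(1) z unfolding edges_def by auto
      moreover have "y \<in> vars_basic (Basic (E @ ex) fs)" using y(1) unfolding vars_basic_def by auto
      ultimately show "\<exists>x \<in> vars_basic (Basic (E @ ex) fs) - set ys. reachable (Basic (E @ ex) fs) x z"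
        unfolding reachable_def by blast
    qed
  qed
  have sE: "\<forall>n \<in> set (subs ?N). set (eqs (base ?N)) \<subseteq> set (eqs (base n))" using sub bv by fastforce
  show ?thesis unfolding solved_def
    using dep lin o1 o2 sol1 sol2 sE mn inst rx ry by (intro conjI exI[of _ ?r] ballI allI) auto
qed

lemma shape_fully_simplified:
  assumes "tree_signature S" "G \<subseteq> gens S" "shape S G us xs E F Ns"
  shows "fully_simplified S (shape_fm xs E F Ns)"
  unfolding fully_simplified_def
  using wf_shape_fm[OF assms] shape_solved[OF assms(1,3)] shape_fm_nf by blast

subsection \<open>Back-and-forth for formulae\<close>

fun gens_trm :: "trm \<Rightarrow> gen set" where
  "gens_trm (Var v) = {}"
| "gens_trm (App g ts) = insert g (\<Union>t \<in> set ts. gens_trm t)"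

primrec gens_fm :: "fm \<Rightarrow> gen set" where
  "gens_fm Tru = {}"
| "gens_fm Fls = {}"
| "gens_fm (Eq t u) = gens_trm t \<union> gens_trm u"
| "gens_fm (Fin s t) = gens_trm t"
| "gens_fm (Neg p) = gens_fm p"
| "gens_fm (And p q) = gens_fm p \<union> gens_fm q"
| "gens_fm (Or p q) = gens_fm p \<union> gens_fm q"
| "gens_fm (Imp p q) = gens_fm p \<union> gens_fm q"
| "gens_fm (Iff p q) = gens_fm p \<union> gens_fm q"
| "gens_fm (Exists v p) = gens_fm p"
| "gens_fm (Forall v p) = gens_fm p"

lemma gens_fm_sub: "wf_fm S p \<Longrightarrow> gens_fm p \<subseteq> gens S"
proof -
  have "wf_trm S t \<Longrightarrow> gens_trm t \<subseteq> gens S" for t by (induction t) auto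
  then show "wf_fm S p \<Longrightarrow> gens_fm p \<subseteq> gens S" by (induction p) auto
qed

text \<open>The code of a term will serve as a bound for its depth. It is a wasteful bound, but the
  evaluation sees codes only and can compare them with the available depth.\<close>

lemma code_arg: "t \<in> set ts \<Longrightarrow> code_trm t < code_trm (App g ts)"
  using mem_le_enc[of "code_trm t" "1 # code_gen g # map code_trm ts"]
  by (simp del: list_encode.simps add: enc_nat_def)

lemma code_App: "0 < code_trm (App g ts)" by simp

lemma tree_eq_Node: "t = Node g ts \<longleftrightarrow> root t = g \<and> children t = ts"
  by (metis tree.collapse tree.sel)

text \<open>Going to an argument uses up one level of the matching and decreases the code by at
  least one, so the sum stays within \<open>N\<close>. As \<open>g\<close> is in \<open>G\<close>,
  one of two matched trees has root \<open>g\<close> iff the other does.\<close>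

lemma trm_match:
  assumes M: "M \<subseteq> W S1 \<times> W S2" and N: "eqv G N M" and VV: "\<And>v. v \<in> VV \<Longrightarrow> (e v, e' v) \<in> M"
  shows "(a, a') \<in> lev G k M \<Longrightarrow> k + code_trm t \<le> N \<Longrightarrow> wf_trm S t \<Longrightarrow> vars_trm t \<subseteq> VV \<Longrightarrow> gens_trm t \<subseteq> G \<Longrightarrow>
    a = eval_trm e t \<longleftrightarrow> a' = eval_trm e' t"
proof (induction t arbitrary: a a' k)
  case (Var v)
  then have "(e v, e' v) \<in> lev G k M" using VV lev_mono[of 0 k G M] by auto
  moreover have "good (lev G k M)" using Var by (intro eqv_good[OF N]) simp
  ultimately show ?case using Var(1) unfolding good_def by auto
next
  case (App g ts)
  have kN: "k < N" by (rule order.strict_trans2[OF _ App.prems(2)]) (simp only: less_add_same_cancel1 code_App)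
  have gG: "g \<in> G" using App.prems(5) by simp
  have rt: "root a = g \<longleftrightarrow> root a' = g"
    using eqv_lab[OF N kN] App.prems(1) gG unfolding lab_def by metis
  have len: "length ts = length (gargs g)" using App.prems(3) by (metis length_map wf_trm.simps(2))
  show ?case
  proof (cases "root a = g")
    case True
    then have ra: "root a = g" "root a' = g" "g \<in> G" using rt App.prems(5) by auto
    have aW: "a \<in> W S1" "a' \<in> W S2" using App.prems(1) lev_W[OF M] by blast+
    then have l: "length (children a) = length ts" "length (children a') = length ts"
      using W_length ra len by metis+
    have "children a ! i = eval_trm e (ts ! i) \<longleftrightarrow> children a' ! i = eval_trm e' (ts ! i)" if i: "i < length ts" for i
    proof (rule App.IH[of "ts ! i" _ _ "Suc k"])
      show mem: "ts ! i \<in> set ts" using i by simp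
      show "wf_trm S (ts ! i)" using App.prems(3) mem by simp
      show "vars_trm (ts ! i) \<subseteq> VV" "gens_trm (ts ! i) \<subseteq> G" using App.prems(4,5) mem by (simp_all add: UN_subset_iff)
      have "(children a ! i, children a' ! i) \<in> set (zip (children a) (children a'))"
        using i l by (auto simp: set_zip)
      then have "(children a ! i, children a' ! i) \<in> nx G (lev G k M)"
        unfolding nx_def using App.prems(1) ra by blast
      then show "(children a ! i, children a' ! i) \<in> lev G (Suc k) M" by simp
      show "Suc k + code_trm (ts ! i) \<le> N" using code_arg[of "ts ! i" ts g] i App.prems(2) by (simp del: code_trm.simps)
    qed
    then have "children a = map (eval_trm e) ts \<longleftrightarrow> children a' = map (eval_trm e') ts"
      using l by (simp add: list_eq_iff_nth_eq)
    then show ?thesis using ra by (simp add: tree_eq_Node)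
  next
    case False
    then show ?thesis using rt by (auto simp: tree_eq_Node)
  qed
qed

text \<open>Two applications are compared argument by argument. As soon as one side is a variable,
  its value is a matched tree compared with a term.\<close>

lemma trm_eq_match:
  assumes M: "M \<subseteq> W S1 \<times> W S2" and N: "eqv G N M" and VV: "\<And>v. v \<in> VV \<Longrightarrow> (e v, e' v) \<in> M"
  shows "code_trm t \<le> N \<Longrightarrow> code_trm u \<le> N \<Longrightarrow> wf_trm S t \<Longrightarrow> wf_trm S u \<Longrightarrow> vars_trm t \<union> vars_trm u \<subseteq> VV \<Longrightarrow>
    gens_trm t \<union> gens_trm u \<subseteq> G \<Longrightarrow> eval_trm e t = eval_trm e u \<longleftrightarrow> eval_trm e' t = eval_trm e' u"
proof (induction t arbitrary: u)
  case (Var v)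
  then have "(e v, e' v) \<in> lev G 0 M" using VV by auto
  from trm_match[OF M N VV this, where t = u and S = S] Var show ?case by auto
next
  case (App g ts)
  show ?case
  proof (cases u)
    case (Var v)
    have "v \<in> VV" using App.prems(5) by (simp only: Var vars_trm.simps Un_subset_iff insert_subset)
    then have ev: "(e v, e' v) \<in> lev G 0 M" using VV by simp
    have "e v = eval_trm e (App g ts) \<longleftrightarrow> e' v = eval_trm e' (App g ts)"
    proof (rule trm_match[OF M N, where VV = VV and k = 0 and S = S])
      show "(e v, e' v) \<in> lev G 0 M" by (rule ev)
      show "(e v, e' v) \<in> M" if "v \<in> VV" for v using that by (rule VV)
      show "0 + code_trm (App g ts) \<le> N" using App.prems(1) by (simp only: add_0)
      show "wf_trm S (App g ts)" by (rule App.prems(3))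
      show "vars_trm (App g ts) \<subseteq> VV" "gens_trm (App g ts) \<subseteq> G"
        using App.prems(5,6) by (simp_all only: Un_subset_iff)
    qed
    then show ?thesis unfolding Var eval_trm.simps(1) by metis
  next
    case u: (App h us)
    show ?thesis
    proof (cases "g = h")
      case True
      have "length ts = length us" using App.prems(3,4) u True by (metis length_map wf_trm.simps(2))
      moreover have "eval_trm e (ts ! i) = eval_trm e (us ! i) \<longleftrightarrow> eval_trm e' (ts ! i) = eval_trm e' (us ! i)"
        if i: "i < length ts" "i < length us" for i
      proof (rule App.IH)
        show "code_trm (ts ! i) \<le> N" using code_arg[of "ts ! i" ts g] i App.prems(1) by (simp del: code_trm.simps)
        show "code_trm (us ! i) \<le> N" using code_arg[of "us ! i" us h] i App.prems(2) u by (simp del: code_trm.simps)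
        have "ts ! i \<in> set ts" "us ! i \<in> set us" using i by auto
        then show "wf_trm S (ts ! i)" "wf_trm S (us ! i)" "vars_trm (ts ! i) \<union> vars_trm (us ! i) \<subseteq> VV"
          "gens_trm (ts ! i) \<union> gens_trm (us ! i) \<subseteq> G" "ts ! i \<in> set ts"
          using App.prems(3-6) u by (auto simp: UN_subset_iff)
      qed
      ultimately show ?thesis using u True by (simp add: list_eq_iff_nth_eq)
    next
      case False
      then show ?thesis using u by simp
    qed
  qed
qed

lemma trm_fin_match:
  assumes N: "eqv G N M" and VV: "\<And>v. v \<in> VV \<Longrightarrow> (e v, e' v) \<in> M"
  shows "vars_trm t \<subseteq> VV \<Longrightarrow> finite_tree (eval_trm e t) = finite_tree (eval_trm e' t)"
proof (induction t)
  case (Var v)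
  have "good M" using eqv_good[OF N, of 0] by simp
  then show ?case using goodD(2)[of M "e v" "e' v"] VV Var by simp
next
  case (App g ts)
  then have "\<forall>t \<in> set ts. finite_tree (eval_trm e t) = finite_tree (eval_trm e' t)" by auto
  then show ?case using finite_tree_iff[of "Node g (map (eval_trm e) ts)"] finite_tree_iff[of "Node g (map (eval_trm e') ts)"]
    by auto
qed

text \<open>Two sources of new trees: if the kind has infinitely many roots, a root outside
  \<open>G\<close> can be had; otherwise a tree that does not repeat itself along the given
  paths.\<close>

lemma big_sort_supply:
  assumes G: "finite G" and big: "\<not> small S s b" and Q: "Q \<Longrightarrow> infinite (root ` KT S s b)"
    and fin: "finite E" "finite P" "[] \<notin> P"
  shows "\<exists>u \<in> KT S s b. u \<notin> E \<and> (Q \<longrightarrow> root u \<notin> G) \<and> (root u \<notin> G \<or> (\<forall>p \<in> P. sub u p \<noteq> Some u))"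
proof (cases "infinite (root ` KT S s b)")
  case True
  then show ?thesis using fresh_root_tree[OF True fin(1) G] by blast
next
  case False
  then show ?thesis using generic_tree[OF big fin] Q by blast
qed

lemma not_base_infinite:
  assumes "tree_signature S" "base_gens S \<subseteq> G" "t \<in> trees S s" "root t \<notin> G"
  shows "infinite (root ` KT S s (finite_tree t))"
proof
  assume "finite (root ` KT S s (finite_tree t))"
  then have "root ` KT S s (finite_tree t) \<subseteq> base_gens S"
    using trees_sorts[OF assms(1,3)] unfolding base_gens_def by blast
  moreover have "t \<in> KT S s (finite_tree t)" using assms(3) by (simp add: KT_def)
  ultimately show False using assms by blast
qed

definition ef_pre :: "signature \<Rightarrow> gen set \<Rightarrow> bool" where
  "ef_pre S G \<longleftrightarrow> tree_signature S \<and> finite G \<and> base_gens S \<subseteq> G \<and> G \<subseteq> gens S"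

lemma ef_supply_self:
  assumes pre: "ef_pre S G" and c: "c \<in> trees S s" and y: "y \<in> rch G n c" "y \<notin> small_trees S"
    and fin: "finite E" "finite P" "[] \<notin> P"
  shows "\<exists>u \<in> KT S (gres (root y)) (finite_tree y). u \<notin> E \<and> (y \<in> inn G n c \<longrightarrow> root y \<notin> G \<longrightarrow> root u \<notin> G) \<and>
        (root u \<notin> G \<or> (\<forall>p \<in> P. sub u p \<noteq> Some u))"
proof -
  have S: "tree_signature S" "base_gens S \<subseteq> G" "finite G" using pre unfolding ef_pre_def by auto
  have yt: "y \<in> trees S (gres (root y))" using rch_W[OF W_trees[OF c]] y(1) unfolding W_def by blast
  have "\<not> small S (gres (root y)) (finite_tree y)" using small_treesI[OF S(1) yt] y(2) by blast
  from big_sort_supply[OF S(3) this _ fin, of "y \<in> inn G n c \<and> root y \<notin> G"] not_base_infinite[OF S(1,2) yt]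
  show ?thesis by blast
qed

lemma gens_bound: "finite G \<Longrightarrow> \<exists>r. \<forall>g \<in> G. length (gargs g) \<le> r"
  using finite_nat_set_iff_bounded_le[of "(\<lambda>g. length (gargs g)) ` G"] by auto

text \<open>Small trees have to be matched with themselves from the start, since their kinds may
  have no generic trees to offer.\<close>

definition insensitive :: "signature \<Rightarrow> gen set \<Rightarrow> nat \<Rightarrow> fm \<Rightarrow> bool" where
  "insensitive S G N p \<longleftrightarrow> (\<forall>M e e'. finite M \<longrightarrow> M \<subseteq> W S \<times> W S \<longrightarrow> Id_on (small_trees S) \<subseteq> M \<longrightarrow>
    eqv G N M \<longrightarrow> (\<forall>v \<in> fv p. (e v, e' v) \<in> M) \<longrightarrow> sat S e p = sat S e' p)"

lemma insensitiveD:
  "insensitive S G N p \<Longrightarrow> finite M \<Longrightarrow> M \<subseteq> W S \<times> W S \<Longrightarrow> Id_on (small_trees S) \<subseteq> M \<Longrightarrow> eqv G N M \<Longrightarrow>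
    (\<And>v. v \<in> fv p \<Longrightarrow> (e v, e' v) \<in> M) \<Longrightarrow> sat S e p = sat S e' p"
  unfolding insensitive_def by blast

lemma insensitive_Neg: "insensitive S G N p \<Longrightarrow> insensitive S G N (Neg p)"
  unfolding insensitive_def fv.simps sat.simps by metis

lemma insensitive_bin:
  assumes p: "insensitive S G N p" and q: "insensitive S G N' q"
    and r: "fv r = fv p \<union> fv q" "\<And>e. sat S e r = f (sat S e p) (sat S e q)"
  shows "insensitive S G (max N N') r"
  unfolding insensitive_def
proof (intro allI impI)
  fix M e e' assume M: "finite M" "M \<subseteq> W S \<times> W S" "Id_on (small_trees S) \<subseteq> M" "eqv G (max N N') M"
    "\<forall>v\<in>fv r. (e v, e' v) \<in> M"
  have "sat S e p = sat S e' p" by (rule insensitiveD[OF p M(1-3) eqv_le[OF M(4)]]) (use M(5) r(1) in auto)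
  moreover have "sat S e q = sat S e' q" by (rule insensitiveD[OF q M(1-3) eqv_le[OF M(4)]]) (use M(5) r(1) in auto)
  ultimately show "sat S e r = sat S e' r" unfolding r(2) by (simp only:)
qed

text \<open>A witness on one side is matched with a tree on the other by one back-and-forth step,
  which consumes the additional depth. The converse matching yields the other implication.\<close>

lemma insensitive_Exists:
  assumes pre: "ef_pre S G" and r: "\<forall>g \<in> G. length (gargs g) \<le> r" and n: "insensitive S G n p"
  shows "insensitive S G (n + 2 * Suc r ^ n + 1) (Exists v p)"
  unfolding insensitive_def
proof (intro allI impI)
  let ?N = "n + 2 * Suc r ^ n + 1"
  have one: "sat S e' (Exists v p)"
    if M: "finite M" "M \<subseteq> W S \<times> W S" "Id_on (small_trees S) \<subseteq> M" "eqv G ?N M"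
      and e: "\<forall>w\<in>fv (Exists v p). (e w, e' w) \<in> M" and s: "sat S e (Exists v p)" for M e e'
  proof -
    obtain t where t: "t \<in> trees S (vsort v)" "sat S (e(v := t)) p" using s by auto
    have Gs: "G \<subseteq> gens S" using pre unfolding ef_pre_def by blast
    have U: "small_trees S \<subseteq> Domain M" using M(3) by auto
    obtain d where d: "d \<in> trees S (vsort v)" "eqv G n (insert (t, d) M)"
      using ef_extend[OF M(2,1,4) le_refl t(1) Gs _ U ef_supply_self[OF pre t(1)]] r by blast
    have "sat S (e(v := t)) p = sat S (e'(v := d)) p"
    proof (rule insensitiveD[OF n _ _ _ d(2)])
      show "insert (t, d) M \<subseteq> W S \<times> W S" using M(2) t(1) d(1) W_trees by blast
      show "((e(v := t)) w, (e'(v := d)) w) \<in> insert (t, d) M" if "w \<in> fv p" for w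
        using e that by auto
    qed (use M in auto)
    then show ?thesis using d(1) t(2) by auto
  qed
  fix M e e' assume M: "finite M" "M \<subseteq> W S \<times> W S" "Id_on (small_trees S) \<subseteq> M" "eqv G ?N M"
    "\<forall>w\<in>fv (Exists v p). (e w, e' w) \<in> M"
  have "sat S e (Exists v p) \<Longrightarrow> sat S e' (Exists v p)" by (rule one[OF M])
  moreover have "sat S e' (Exists v p) \<Longrightarrow> sat S e (Exists v p)"
    by (rule one[where M = "M\<inverse>"]) (use M eqv_converse[OF M(4)] in auto)
  ultimately show "sat S e (Exists v p) = sat S e' (Exists v p)" by blast
qed

lemma insensitive_fm:
  assumes pre: "ef_pre S G"
  shows "wf_fm S p \<Longrightarrow> gens_fm p \<subseteq> G \<Longrightarrow> \<exists>N. insensitive S G N p"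
proof (induction p)
  case (Eq t u)
  have "insensitive S G (max (code_trm t) (code_trm u)) (Eq t u)"
    unfolding insensitive_def
  proof (intro allI impI)
    fix M e e' assume M: "M \<subseteq> W S \<times> W S" "eqv G (max (code_trm t) (code_trm u)) M" "\<forall>v\<in>fv (Eq t u). (e v, e' v) \<in> M"
    have "eval_trm e t = eval_trm e u \<longleftrightarrow> eval_trm e' t = eval_trm e' u"
      by (rule trm_eq_match[OF M(1,2), where VV = "fv (Eq t u)" and S = S]) (use M(3) Eq in auto)
    then show "sat S e (Eq t u) = sat S e' (Eq t u)" by simp
  qed
  then show ?case by blast
next
  case (Fin s t)
  have "insensitive S G 0 (Fin s t)"
    unfolding insensitive_def
  proof (intro allI impI)
    fix M e e' assume M: "eqv G 0 M" "\<forall>v\<in>fv (Fin s t). (e v, e' v) \<in> M"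
    have "finite_tree (eval_trm e t) = finite_tree (eval_trm e' t)"
      by (rule trm_fin_match[OF M(1), where VV = "fv (Fin s t)"]) (use M(2) in auto)
    then show "sat S e (Fin s t) = sat S e' (Fin s t)" by simp
  qed
  then show ?case by blast
next
  case (Neg p)
  then obtain N where "insensitive S G N p" by auto
  from insensitive_Neg[OF this] show ?case by blast
next
  case (And p q)
  then obtain N N' where "insensitive S G N p" "insensitive S G N' q" by auto
  from insensitive_bin[OF this, of "And p q" "(\<and>)"] show ?case by auto
next
  case (Or p q)
  then obtain N N' where "insensitive S G N p" "insensitive S G N' q" by auto
  from insensitive_bin[OF this, of "Or p q" "(\<or>)"] show ?case by auto
next
  case (Imp p q)
  then obtain N N' where "insensitive S G N p" "insensitive S G N' q" by auto
  from insensitive_bin[OF this, of "Imp p q" "(\<longrightarrow>)"] show ?case by auto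
next
  case (Iff p q)
  then obtain N N' where "insensitive S G N p" "insensitive S G N' q" by auto
  from insensitive_bin[OF this, of "Iff p q" "(=)"] show ?case by auto
next
  case (Exists v p)
  obtain r where "\<forall>g \<in> G. length (gargs g) \<le> r" using gens_bound pre unfolding ef_pre_def by blast
  then show ?case using Exists insensitive_Exists[OF pre] by fastforce
next
  case (Forall v p)
  obtain r where r: "\<forall>g \<in> G. length (gargs g) \<le> r" using gens_bound pre unfolding ef_pre_def by blast
  obtain n where "insensitive S G n p" using Forall by auto
  then have "insensitive S G (n + 2 * Suc r ^ n + 1) (Neg (Exists v (Neg p)))"
    by (intro insensitive_Neg insensitive_Exists[OF pre r])
  then have "insensitive S G (n + 2 * Suc r ^ n + 1) (Forall v p)" unfolding insensitive_def by simp
  then show ?case by blast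
qed (auto simp: insensitive_def)

subsection \<open>Descriptions of tuples of trees\<close>

primrec flv :: "(var \<Rightarrow> tree) \<Rightarrow> flat \<Rightarrow> tree" where
  "flv w (FVar x) = w x"
| "flv w (FApp g zs) = Node g (map w zs)"

definition bsat :: "(var \<Rightarrow> tree) \<Rightarrow> eqn list \<Rightarrow> var list \<Rightarrow> bool" where
  "bsat w E F \<longleftrightarrow> (\<forall>q \<in> set E. w (fst q) = flv w (snd q)) \<and> (\<forall>u \<in> set F. finite_tree (w u))"

lemma sat_atoms: "(\<forall>p \<in> set (atoms_of_basic (Basic E F)). sat S w p) \<longleftrightarrow> bsat w E F"
proof -
  have "eval_trm w (trm_of_flat t) = flv w t" for t by (cases t) auto
  then show ?thesis unfolding atoms_of_basic_def bsat_def set_append ball_Un by (simp add: case_prod_unfold)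
qed

lemma sat_shape_fm: "sat S e (shape_fm xs E F Ns) \<longleftrightarrow> (\<exists>w. agree S xs e w \<and> bsat w E F \<and>
    (\<forall>(ys, ex, fs) \<in> set Ns. \<not> (\<exists>w'. agree S ys w w' \<and> bsat w' (E @ ex) fs)))"
proof -
  have "(\<forall>p \<in> set (map (\<lambda>(ys, ex, fs). Neg (foldr Exists ys (conj_list (atoms_of_basic (Basic (E @ ex) fs))))) Ns). sat S w p)
    \<longleftrightarrow> (\<forall>(ys, ex, fs) \<in> set Ns. \<not> (\<exists>w'. agree S ys w w' \<and> bsat w' (E @ ex) fs))" for w
    unfolding set_map ball_simps
  proof (intro ball_cong refl)
    fix n assume "n \<in> set Ns"
    obtain ys ex fs where n: "n = (ys, ex, fs)" by (cases n)
    show "sat S w (case n of (ys, ex, fs) \<Rightarrow> Neg (foldr Exists ys (conj_list (atoms_of_basic (Basic (E @ ex) fs))))) =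
        (case n of (ys, ex, fs) \<Rightarrow> \<not> (\<exists>w'. agree S ys w w' \<and> bsat w' (E @ ex) fs))"
      unfolding n prod.case sat.simps sat_Exs sat_conj_list sat_atoms ..
  qed
  then show ?thesis unfolding shape_fm_def sat_Exs sat_conj_list set_append ball_Un sat_atoms by simp
qed

definition lst :: "'a set \<Rightarrow> 'a list" where "lst A = (SOME l. set l = A \<and> distinct l)"

lemma lst: "finite A \<Longrightarrow> set (lst A) = A" "finite A \<Longrightarrow> distinct (lst A)" "finite A \<Longrightarrow> length (lst A) = card A"
proof -
  assume "finite A"
  then have "\<exists>l. set l = A \<and> distinct l" by (rule finite_distinct_list)
  then have *: "set (lst A) = A \<and> distinct (lst A)" unfolding lst_def by (rule someI_ex)
  then show "set (lst A) = A" "distinct (lst A)" by auto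
  show "length (lst A) = card A" using * distinct_card by metis
qed

lemma before_Cons: "before (a # l) y v \<longleftrightarrow> (a = y \<and> v \<in> set l) \<or> before l y v"
proof
  assume "before (a # l) y v"
  then obtain i zs where "drop i (a # l) = y # zs" "v \<in> set zs" unfolding before_def by blast
  then show "(a = y \<and> v \<in> set l) \<or> before l y v" unfolding before_def by (cases i) auto
next
  assume "(a = y \<and> v \<in> set l) \<or> before l y v"
  then show "before (a # l) y v"
  proof
    assume "a = y \<and> v \<in> set l"
    then show ?thesis unfolding before_def by (intro exI[of _ 0]) auto
  next
    assume "before l y v"
    then obtain i zs where "drop i l = y # zs" "v \<in> set zs" unfolding before_def by blast
    then show ?thesis unfolding before_def by (intro exI[of _ "Suc i"]) auto
  qed
qed

lemma before_append: "before (l @ k) y v \<longleftrightarrow> before l y v \<or> before k y v \<or> (y \<in> set l \<and> v \<in> set k)"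
proof (induction l)
  case Nil
  have "\<not> before [] y v" unfolding before_def by simp
  then show ?case by simp
qed (auto simp: before_Cons)

lemma before_total: "y \<in> set l \<Longrightarrow> v \<in> set l \<Longrightarrow> y \<noteq> v \<Longrightarrow> before l y v \<or> before l v y"
  by (induction l) (auto simp: before_Cons)

lemma before_hd_filter: "u \<in> set l \<Longrightarrow> P u \<Longrightarrow> hd (filter P l) \<noteq> u \<Longrightarrow> before l (hd (filter P l)) u"
  by (induction l) (auto simp: before_Cons)

lemma hd_filter: "u \<in> set l \<Longrightarrow> P u \<Longrightarrow> hd (filter P l) \<in> set l \<and> P (hd (filter P l))"
  by (induction l) auto

definition frs :: "nat \<Rightarrow> gen \<Rightarrow> var list" where
  "frs k g = map (\<lambda>i. V (k + i) (gargs g ! i)) [0..<length (gargs g)]"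

lemma frs: "map vsort (frs k g) = gargs g" "distinct (frs k g)" "y \<in> set (frs k g) \<Longrightarrow> k \<le> vname y"
  by (auto simp: frs_def distinct_map inj_on_def intro: nth_equalityI)

text \<open>\<open>e\<close> is the tuple of trees to be described. \<open>K\<close> lies above the
  names of the free variables and \<open>C\<close> bounds the number of nodes; both are meant to be
  chosen for all \<open>e\<close> at once, so that only finitely many descriptions arise.
  \<open>0 < N\<close> makes the roots of the values of the free variables visible.\<close>

locale descr =
  fixes S :: signature and G :: "gen set" and N :: nat and us :: "var list" and K C :: nat and e :: "var \<Rightarrow> tree"
  assumes pre: "ef_pre S G" and N: "0 < N" and us: "distinct us" "\<forall>u \<in> set us. vsort u \<in> sorts S"
    and val: "valuation S e" and K: "\<forall>u \<in> set us. vname u < K"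
    and C: "\<forall>T. T \<subseteq> (\<Union>u \<in> set us. rch G N (e u)) \<union> small_trees S \<longrightarrow> card T \<le> C"
begin

lemma S: "tree_signature S" "finite G" "base_gens S \<subseteq> G" "G \<subseteq> gens S"
  using pre unfolding ef_pre_def by auto

abbreviation "U \<equiv> small_trees S"

text \<open>The description follows generators in \<open>G\<close> down to depth \<open>N\<close>.
  Below small trees it continues without limit, because these have to be determined completely; all
  their subtrees are small, so this adds finitely many nodes only.\<close>

inductive nd :: "nat \<Rightarrow> tree \<Rightarrow> bool" where
  nd_0: "u \<in> set us \<Longrightarrow> nd 0 (e u)"
| nd_Suc: "nd k t \<Longrightarrow> root t \<in> G \<Longrightarrow> k < N \<or> t \<in> U \<Longrightarrow> c \<in> set (children t) \<Longrightarrow> nd (Suc k) c"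

definition "T = {t. \<exists>k. nd k t}"
definition "Dt = {t. \<exists>k. nd k t \<and> root t \<in> G \<and> (k < N \<or> t \<in> U)}"
definition "Lf = T - Dt"
definition "Fr = e ` set us"
definition "idx = (SOME f. inj_on f T \<and> f ` T \<subseteq> {..<C})"
text \<open>A value shared by several free variables is named by the first of them; the others are
  equated with it in \<open>EE\<close>. The remaining nodes are named from \<open>K\<close>
  on.\<close>

definition "nm t = (if t \<in> Fr then hd (filter (\<lambda>u. e u = t) us) else V (K + idx t) (gres (root t)))"
text \<open>Bound determined nodes precede bound leaves, since an inequation must have the later
  variable on its left: a bound leaf can thus be separated from every determined node.\<close>

definition "xs = map nm (lst (Dt - Fr) @ lst (Lf - Fr))"
definition "EE = map (\<lambda>u. (u, FVar (nm (e u)))) (filter (\<lambda>u. u \<noteq> nm (e u)) us) @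
   map (\<lambda>t. (nm t, FApp (root t) (map nm (children t)))) (lst Dt)"
text \<open>Finiteness, and infiniteness in \<open>NC\<close>, is stated only for sorts having both
  finite and infinite trees; in any other sort it follows from the sort.\<close>

definition "FF = map nm (lst {t \<in> Lf. finite_tree t \<and> mixed S (gres (root t))})"
definition "NA = {(y, z). y \<in> Lf \<and> z \<in> T \<and> gres (root y) = gres (root z) \<and> before (us @ xs) (nm z) (nm y)}"
definition "NB = {(y, g). y \<in> Lf \<and> root y \<notin> G \<and> g \<in> G \<and> gres g = gres (root y)}"
definition "NC = {y \<in> Lf. \<not> finite_tree y \<and> mixed S (gres (root y))}"
definition "NN = map (\<lambda>(y, z). ([], [(nm y, FVar (nm z))], [])) (lst NA) @
   map (\<lambda>(y, g). (frs (K + C) g, [(nm y, FApp g (frs (K + C) g))], [])) (lst NB) @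
   map (\<lambda>y. ([], [], [nm y])) (lst NC)"

lemma us_tree: "u \<in> set us \<Longrightarrow> e u \<in> trees S (vsort u)"
  using val us unfolding valuation_def by blast

lemma nd_W: "nd k t \<Longrightarrow> t \<in> W S"
  by (induction rule: nd.induct) (auto intro: W_trees us_tree W_child)

lemma nd_bound: "nd k t \<Longrightarrow> (k \<le> N \<and> (\<exists>u \<in> set us. t \<in> rch G k (e u))) \<or> t \<in> U"
proof (induction rule: nd.induct)
  case (nd_Suc k t c)
  show ?case
  proof (cases "t \<in> U")
    case True
    then show ?thesis using small_trees_child[OF S(1)] nd_Suc by blast
  next
    case False
    then obtain u where "k < N" "u \<in> set us" "t \<in> rch G k (e u)" using nd_Suc by blast
    then have "Suc k \<le> N \<and> (\<exists>u \<in> set us. c \<in> rch G (Suc k) (e u))" using nd_Suc by auto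
    then show ?thesis by blast
  qed
qed auto

lemma T_sub: "T \<subseteq> (\<Union>u \<in> set us. rch G N (e u)) \<union> U"
proof
  fix t assume "t \<in> T"
  then obtain k where "nd k t" unfolding T_def by blast
  then show "t \<in> (\<Union>u \<in> set us. rch G N (e u)) \<union> U" using nd_bound rch_mono[of k N G] by blast
qed

lemma finite_T: "finite T"
  by (rule finite_subset[OF T_sub]) (auto intro: finite_rch finite_small_trees[OF S(1)])

lemma T_W: "t \<in> T \<Longrightarrow> t \<in> trees S (gres (root t))"
  unfolding T_def using nd_W unfolding W_def by blast

lemma T_sort: "t \<in> T \<Longrightarrow> gres (root t) \<in> sorts S"
  using T_W trees_sorts[OF S(1)] by blast

lemma Dt_T: "Dt \<subseteq> T" unfolding Dt_def T_def by blast
lemma Lf_T: "Lf \<subseteq> T" unfolding Lf_def by blast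
lemma T_cases: "t \<in> T \<Longrightarrow> t \<in> Dt \<or> t \<in> Lf" unfolding Lf_def by blast
lemma finite_Dt: "finite Dt" using finite_subset[OF Dt_T finite_T] .
lemma finite_Lf: "finite Lf" using finite_subset[OF Lf_T finite_T] .
lemma Fr_T: "Fr \<subseteq> T" unfolding Fr_def T_def using nd_0 by blast

lemma Dt_child: "t \<in> Dt \<Longrightarrow> c \<in> set (children t) \<Longrightarrow> c \<in> T"
  unfolding Dt_def T_def using nd_Suc by blast

lemma Dt_root: "t \<in> Dt \<Longrightarrow> root t \<in> G" unfolding Dt_def by blast

lemma U_Dt: "t \<in> T \<Longrightarrow> t \<in> U \<Longrightarrow> t \<in> Dt"
  unfolding T_def Dt_def using small_trees_root S(3) by blast

text \<open>Small trees are expanded to the end, so no leaf is one of them. This is what keeps the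
  variables of leaves from being instantiable.\<close>

lemma Lf_big: "t \<in> Lf \<Longrightarrow> \<not> small S (gres (root t)) (finite_tree t)"
  using small_treesI[OF S(1) T_W, of t] U_Dt[of t] unfolding Lf_def by blast

lemma Lf_gens: "t \<in> Lf \<Longrightarrow> root t \<notin> G \<Longrightarrow> infinite (gens_of S (gres (root t)))"
  using gens_of_base[OF S(1), of "gres (root t)"] S(3) trees_root[OF T_W, of t] Lf_T
  unfolding gens_of_def by blast

text \<open>Because \<open>0 < N\<close>, the value of a free variable is expanded whenever its root
  is in \<open>G\<close>.\<close>

lemma Fr_Lf: "t \<in> Fr \<Longrightarrow> t \<in> Lf \<Longrightarrow> root t \<notin> G"
  using N nd_0 unfolding Fr_def Lf_def Dt_def by blast

lemma idx: "inj_on idx T" "t \<in> T \<Longrightarrow> idx t < C"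
proof -
  have "card T \<le> C" using C T_sub by blast
  then obtain f where "inj_on f T" "f ` T \<subseteq> {..<C}"
    using finite_T by (metis card_lessThan card_le_inj finite_lessThan)
  then have "\<exists>f. inj_on f T \<and> f ` T \<subseteq> {..<C}" by blast
  then have *: "inj_on idx T \<and> idx ` T \<subseteq> {..<C}" unfolding idx_def by (rule someI_ex)
  then show "inj_on idx T" by blast
  show "t \<in> T \<Longrightarrow> idx t < C" using * by blast
qed

lemma nm_Fr: "t \<in> Fr \<Longrightarrow> nm t \<in> set us \<and> e (nm t) = t"
proof -
  assume t: "t \<in> Fr"
  then obtain u where "u \<in> set us" "e u = t" unfolding Fr_def by blast
  from hd_filter[of u us "\<lambda>u. e u = t", OF this] t show ?thesis unfolding nm_def by simp
qed

lemma nm_notFr: "t \<in> T \<Longrightarrow> t \<notin> Fr \<Longrightarrow> nm t = V (K + idx t) (gres (root t)) \<and> K \<le> vname (nm t) \<and> vname (nm t) < K + C \<and> nm t \<notin> set us"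
  using idx(2) K unfolding nm_def by auto

lemma nm_sort: "t \<in> T \<Longrightarrow> vsort (nm t) = gres (root t)"
proof (cases "t \<in> Fr")
  case True
  then show ?thesis using nm_Fr[OF True] us_tree trees_sort by metis
qed (use nm_notFr in auto)

lemma nm_inj: "inj_on nm T"
proof (rule inj_onI)
  fix t t' assume t: "t \<in> T" "t' \<in> T" "nm t = nm t'"
  show "t = t'"
  proof (cases "t \<in> Fr")
    case True
    then have "t' \<in> Fr" using nm_Fr[OF True] nm_notFr[of t'] t by auto
    then show ?thesis using nm_Fr True t(3) by metis
  next
    case False
    then have "t' \<notin> Fr" using nm_Fr[of t'] nm_notFr[of t] t by auto
    then have "idx t = idx t'" using nm_notFr[of t] nm_notFr[of t'] False t by auto
    then show ?thesis using idx(1) t unfolding inj_on_def by blast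
  qed
qed

lemma set_xs: "set xs = nm ` (T - Fr)"
  unfolding xs_def using lst(1)[of "Dt - Fr"] lst(1)[of "Lf - Fr"] finite_Dt finite_Lf Dt_T
  by (auto simp: Lf_def)

lemma nm_ord: "t \<in> T \<Longrightarrow> nm t \<in> set (us @ xs)"
  using nm_Fr[of t] set_xs by (cases "t \<in> Fr") auto

lemma distinct_ord: "distinct (us @ xs)"
proof -
  have "distinct (lst (Dt - Fr) @ lst (Lf - Fr))" "set (lst (Dt - Fr) @ lst (Lf - Fr)) \<subseteq> T"
    using lst[of "Dt - Fr"] lst[of "Lf - Fr"] finite_Dt finite_Lf Dt_T by (auto simp: Lf_def)
  then have "distinct xs" unfolding xs_def distinct_map using nm_inj inj_on_subset by blast
  moreover have "set us \<inter> set xs = {}" unfolding set_xs using nm_notFr by blast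
  ultimately show ?thesis using us by simp
qed

lemma set_EE: "set EE = {(u, FVar (nm (e u))) |u. u \<in> set us \<and> u \<noteq> nm (e u)} \<union>
    {(nm t, FApp (root t) (map nm (children t))) |t. t \<in> Dt}"
  unfolding EE_def using lst(1)[OF finite_Dt] by auto

lemma e_us_T: "u \<in> set us \<Longrightarrow> e u \<in> T" using Fr_T unfolding Fr_def by blast

lemma Lf_lhs: "y \<in> Lf \<Longrightarrow> nm y \<notin> fst ` set EE"
proof
  assume y: "y \<in> Lf" and "nm y \<in> fst ` set EE"
  then consider u where "nm y = u" "u \<in> set us" "u \<noteq> nm (e u)" | t where "nm y = nm t" "t \<in> Dt"
    unfolding set_EE by auto
  then show False
  proof cases
    case (1 u)
    then have "y \<in> Fr" using nm_notFr[of y] y Lf_T by blast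
    then show False using nm_Fr[of y] 1 by auto
  next
    case (2 t)
    then have "y = t" using nm_inj y Lf_T Dt_T unfolding inj_on_def by blast
    then show False using y 2 unfolding Lf_def by blast
  qed
qed

lemma set_FF: "set FF = nm ` {t \<in> Lf. finite_tree t \<and> mixed S (gres (root t))}"
proof -
  have "finite {t \<in> Lf. finite_tree t \<and> mixed S (gres (root t))}" using finite_Lf by simp
  from lst(1)[OF this] show ?thesis unfolding FF_def by simp
qed

lemma finite_N: "finite NA" "finite NB" "finite NC"
proof -
  have "NA \<subseteq> T \<times> T" unfolding NA_def using Lf_T by blast
  then show "finite NA" using finite_T finite_subset by blast
  have "NB \<subseteq> T \<times> G" unfolding NB_def using Lf_T by blast
  then show "finite NB" using finite_T S(2) finite_subset by blast
  show "finite NC" unfolding NC_def using finite_Lf by simp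
qed

lemma set_NN: "set NN = {([], [(nm y, FVar (nm z))], []) |y z. (y, z) \<in> NA} \<union>
   {(frs (K + C) g, [(nm y, FApp g (frs (K + C) g))], []) |y g. (y, g) \<in> NB} \<union> {([], [], [nm y]) |y. y \<in> NC}"
  unfolding NN_def using lst(1)[OF finite_N(1)] lst(1)[OF finite_N(2)] lst(1)[OF finite_N(3)]
  by (auto simp: image_iff)

lemma reach: "nd k t \<Longrightarrow> t \<in> Fr \<or> (\<exists>u \<in> set us. (u, nm t) \<in> (edges (Basic EE FF))\<^sup>+)"
proof (induction rule: nd.induct)
  case (nd_Suc k t c)
  then have "t \<in> Dt" unfolding Dt_def by blast
  then have "(nm t, FApp (root t) (map nm (children t))) \<in> set EE" unfolding set_EE by blast
  then have ed: "(nm t, nm c) \<in> edges (Basic EE FF)" unfolding edges_def using nd_Suc by force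
  show ?case
  proof (cases "t \<in> Fr")
    case True
    then show ?thesis using nm_Fr ed by blast
  next
    case False
    then show ?thesis using nd_Suc ed by (meson trancl.trancl_into_trancl)
  qed
qed (auto simp: Fr_def)

lemma descr_shape: "shape S G us xs EE FF NN"
  unfolding shape_def
proof (intro conjI)
  show "distinct (us @ xs)" by (rule distinct_ord)
  show "\<forall>v \<in> set (us @ xs). vsort v \<in> sorts S" using us nm_sort T_sort set_xs by auto
  show "\<forall>q \<in> set EE. eqn_ok G (us @ xs) q"
  proof
    fix q assume "q \<in> set EE"
    then consider u where "q = (u, FVar (nm (e u)))" "u \<in> set us" "u \<noteq> nm (e u)"
      | t where "q = (nm t, FApp (root t) (map nm (children t)))" "t \<in> Dt" unfolding set_EE by auto
    then show "eqn_ok G (us @ xs) q"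
    proof cases
      case (1 u)
      have "nm (e u) = hd (filter (\<lambda>v. e v = e u) us)" unfolding nm_def Fr_def using 1 by simp
      then have "before us (nm (e u)) u" using before_hd_filter[of u us "\<lambda>v. e v = e u"] 1 by simp
      moreover have "vsort (nm (e u)) = vsort u"
        using nm_sort[OF e_us_T[OF 1(2)]] trees_sort[OF us_tree[OF 1(2)]] by simp
      ultimately show ?thesis using 1 unfolding eqn_ok_def before_append by auto
    next
      case (2 t)
      have tT: "t \<in> T" using 2 Dt_T by blast
      have "map vsort (map nm (children t)) = gargs (root t)"
        using trees_length[OF T_W[OF tT]] nm_sort Dt_child[OF 2(2)] trees_child[OF T_W[OF tT], THEN trees_sort]
        by (auto intro!: nth_equalityI)
      moreover have "set (map nm (children t)) \<subseteq> set (us @ xs)" using nm_ord Dt_child[OF 2(2)] by auto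
      ultimately show ?thesis using 2 nm_ord[OF tT] nm_sort[OF tT] Dt_root unfolding eqn_ok_def by auto
    qed
  qed
  show "distinct (map fst EE @ FF)"
  proof -
    have 1: "distinct (filter (\<lambda>u. u \<noteq> nm (e u)) us)" using us by simp
    have 2: "distinct (map nm (lst Dt))"
      unfolding distinct_map using lst[OF finite_Dt] nm_inj inj_on_subset[OF _ Dt_T] by auto
    have 3: "set (filter (\<lambda>u. u \<noteq> nm (e u)) us) \<inter> set (map nm (lst Dt)) = {}"
    proof -
      have "u = nm (e u)" if "u = nm t" "u \<in> set us" "t \<in> Dt" for u t
      proof -
        have "t \<in> Fr" using nm_notFr[of t] that Dt_T by blast
        then show ?thesis using nm_Fr that by auto
      qed
      then show ?thesis using lst(1)[OF finite_Dt] by auto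
    qed
    have m: "map fst EE = filter (\<lambda>u. u \<noteq> nm (e u)) us @ map nm (lst Dt)"
      unfolding EE_def by (simp add: o_def)
    have "set FF \<inter> set (map fst EE) = {}" using Lf_lhs unfolding set_FF by auto
    moreover have "distinct FF"
    proof -
      let ?A = "{t \<in> Lf. finite_tree t \<and> mixed S (gres (root t))}"
      have "finite ?A" using finite_Lf by simp
      moreover have "?A \<subseteq> T" using Lf_T by blast
      ultimately show ?thesis unfolding FF_def distinct_map using lst[of ?A] inj_on_subset[OF nm_inj] by auto
    qed
    ultimately show ?thesis using 1 2 3 m by auto
  qed
  show "\<forall>u \<in> set FF. u \<in> set (us @ xs) \<and> mixed S (vsort u) \<and> \<not> small S (vsort u) True"
    using nm_ord nm_sort Lf_big Lf_T unfolding set_FF by fastforce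
  show "\<forall>x \<in> set xs. \<exists>u \<in> set us. (u, x) \<in> (edges (Basic EE FF))\<^sup>+"
    using reach unfolding set_xs T_def by blast
  show "\<forall>n \<in> set NN. neg_ok S G (us @ xs) EE FF n"
  proof
    fix n assume "n \<in> set NN"
    then consider y z where "n = ([], [(nm y, FVar (nm z))], [])" "(y, z) \<in> NA"
      | y g where "n = (frs (K + C) g, [(nm y, FApp g (frs (K + C) g))], [])" "(y, g) \<in> NB"
      | y where "n = ([], [], [nm y])" "y \<in> NC" unfolding set_NN by blast
    then show "neg_ok S G (us @ xs) EE FF n"
    proof cases
      case (1 y z)
      then have yz: "y \<in> Lf" "y \<in> T" "z \<in> T" "gres (root y) = gres (root z)" "before (us @ xs) (nm z) (nm y)"
        using Lf_T unfolding NA_def by auto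
      have "\<not> (small S (vsort (nm y)) True \<and> small S (vsort (nm y)) False)"
        using Lf_big[OF yz(1)] nm_sort[OF yz(2)] by (cases "finite_tree y") auto
      then show ?thesis unfolding neg_ok_def using 1 yz nm_ord nm_sort Lf_lhs by auto
    next
      case (2 y g)
      then have y: "y \<in> Lf" "y \<in> T" "root y \<notin> G" "g \<in> G" "gres g = gres (root y)"
        using Lf_T unfolding NB_def by auto
      have "set (frs (K + C) g) \<inter> set (us @ xs) = {}"
      proof -
        have "vname v < K + C" if "v \<in> set (us @ xs)" for v
          using that K nm_notFr unfolding set_append set_xs by fastforce
        then show ?thesis using frs(3) by (meson disjoint_iff not_le)
      qed
      then show ?thesis unfolding neg_ok_def
        using 2 y nm_ord[OF y(2)] nm_sort[OF y(2)] Lf_lhs[OF y(1)] frs(1,2) Lf_gens[OF y(1,3)] by auto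
    next
      case (3 y)
      then have y: "y \<in> Lf" "y \<in> T" "\<not> finite_tree y" "mixed S (gres (root y))" using Lf_T unfolding NC_def by auto
      have "nm y \<notin> set FF" using y nm_inj Lf_T unfolding set_FF inj_on_def by blast
      then show ?thesis unfolding neg_ok_def using 3 y nm_ord nm_sort Lf_lhs Lf_big[OF y(1)] by auto
    qed
  qed
qed

lemma descr_sat: "sat S e (shape_fm xs EE FF NN)"
proof -
  define w where "w v = (if v \<in> set xs then inv_into T nm v else e v)" for v
  have w: "w (nm t) = t" if t: "t \<in> T" for t
  proof (cases "t \<in> Fr")
    case True
    then show ?thesis using nm_Fr[OF True] distinct_ord unfolding w_def by auto
  next
    case False
    then have "nm t \<in> set xs" using t set_xs by blast
    then show ?thesis unfolding w_def using inv_into_f_f[OF nm_inj t] by simp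
  qed
  have wu: "w u = e u" if "u \<in> set us" for u using that distinct_ord unfolding w_def by auto
  have ag: "agree S xs e w"
    unfolding agree_def
  proof (intro conjI allI impI ballI)
    fix v assume "v \<in> set xs"
    then obtain t where t: "v = nm t" "t \<in> T" unfolding set_xs by blast
    then show "w v \<in> trees S (vsort v)" using w nm_sort T_W by simp
  qed (simp add: w_def)
  have E: "w (fst q) = flv w (snd q)" if "q \<in> set EE" for q
  proof -
    consider u where "q = (u, FVar (nm (e u)))" "u \<in> set us"
      | t where "q = (nm t, FApp (root t) (map nm (children t)))" "t \<in> Dt" using \<open>q \<in> set EE\<close> unfolding set_EE by auto
    then show ?thesis
    proof cases
      case (1 u)
      then show ?thesis using w[OF e_us_T] wu by simp
    next
      case (2 t)
      have "map w (map nm (children t)) = children t" using w Dt_child[OF 2(2)] by (auto intro: map_idI)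
      then show ?thesis using 2 w[of t] Dt_T by auto
    qed
  qed
  have "bsat w EE FF" unfolding bsat_def using E w Lf_T unfolding set_FF by auto
  moreover have "\<not> (\<exists>w'. agree S ys w w' \<and> bsat w' (EE @ ex) fs)" if n: "(ys, ex, fs) \<in> set NN" for ys ex fs
  proof
    assume "\<exists>w'. agree S ys w w' \<and> bsat w' (EE @ ex) fs"
    then obtain w' where w': "agree S ys w w'" "bsat w' (EE @ ex) fs" by blast
    consider y z where "ys = []" "ex = [(nm y, FVar (nm z))]" "(y, z) \<in> NA"
      | y g where "ys = frs (K + C) g" "ex = [(nm y, FApp g (frs (K + C) g))]" "(y, g) \<in> NB"
      | y where "ys = []" "fs = [nm y]" "y \<in> NC" using n unfolding set_NN by blast
    then show False
    proof cases
      case (1 y z)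
      then have yz: "y \<in> T" "z \<in> T" "before (us @ xs) (nm z) (nm y)" using Lf_T unfolding NA_def by auto
      have "w (nm y) = w (nm z)" using w' 1 unfolding bsat_def by simp
      then have "y = z" using w yz by simp
      then show False using yz(3) distinct_ord rnk_before by blast
    next
      case (2 y g)
      then have y: "y \<in> T" "root y \<notin> G" "g \<in> G" using Lf_T unfolding NB_def by auto
      have "nm y \<notin> set ys"
      proof
        assume "nm y \<in> set ys"
        then have "K + C \<le> vname (nm y)" using frs(3) 2(1) by blast
        then show False using nm_notFr[OF y(1)] nm_Fr[of y] K by (cases "y \<in> Fr") force+
      qed
      then have "w' (nm y) = y" using w' w[OF y(1)] unfolding agree_def by simp
      moreover have "root (w' (nm y)) = g" using w' 2 unfolding bsat_def by simp
      ultimately show False using y by simp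
    next
      case (3 y)
      then show False using w' w[of y] Lf_T unfolding bsat_def NC_def by auto
    qed
  qed
  ultimately show ?thesis unfolding sat_shape_fm using ag by blast
qed

text \<open>Any tuple satisfying the description is matched with \<open>e\<close>. The map
  \<open>h\<close> sends a node to the value of its variable; equations make it respect the
  structure of determined nodes, and the constraints on leaves make it injective and let it preserve
  finiteness and invisibility of roots.\<close>

lemma descr_eqv:
  assumes val': "valuation S e'" and sat': "sat S e' (shape_fm xs EE FF NN)"
  shows "eqv G N ((\<lambda>u. (e u, e' u)) ` set us \<union> Id_on U)"
proof -
  obtain w where ag: "agree S xs e' w" and bs: "bsat w EE FF"
    and ng: "\<And>ys ex fs w'. (ys, ex, fs) \<in> set NN \<Longrightarrow> agree S ys w w' \<Longrightarrow> \<not> bsat w' (EE @ ex) fs"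
    using sat' unfolding sat_shape_fm by blast
  define h where "h t = w (nm t)" for t
  have sol: "solves Dt root children h"
    unfolding solves_def
  proof
    fix t assume "t \<in> Dt"
    then have "(nm t, FApp (root t) (map nm (children t))) \<in> set EE" unfolding set_EE by blast
    then have "w (nm t) = flv w (FApp (root t) (map nm (children t)))" using bs unfolding bsat_def by fastforce
    then show "h t = Node (root t) (map h (children t))" unfolding h_def by (simp add: o_def)
  qed
  have hD: "h t = Node (root t) (map h (children t))" if "t \<in> Dt" for t using sol that unfolding solves_def by blast
  have us_xs: "u \<notin> set xs" if "u \<in> set us" for u using that distinct_ord by auto
  have hu: "h (e u) = e' u" if u: "u \<in> set us" for u
  proof -
    have wu: "w u = e' u" using ag us_xs[OF u] unfolding agree_def by blast
    show ?thesis
    proof (cases "u = nm (e u)")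
      case True
      then show ?thesis using wu unfolding h_def by simp
    next
      case False
      then have "(u, FVar (nm (e u))) \<in> set EE" unfolding set_EE using u by blast
      then have "w u = flv w (FVar (nm (e u)))" using bs unfolding bsat_def by fastforce
      then show ?thesis using wu unfolding h_def by simp
    qed
  qed
  have hT: "h t \<in> trees S (gres (root t))" if t: "t \<in> T" for t
  proof (cases "t \<in> Fr")
    case True
    then obtain u where u: "u \<in> set us" "t = e u" unfolding Fr_def by blast
    have "e' u \<in> trees S (vsort u)" using val' us u unfolding valuation_def by blast
    then show ?thesis using hu u trees_sort[OF us_tree[OF u(1)]] by simp
  next
    case False
    then have "nm t \<in> set xs" using t set_xs by blast
    then have "w (nm t) \<in> trees S (vsort (nm t))" using ag unfolding agree_def by blast
    then show ?thesis using nm_sort[OF t] unfolding h_def by simp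
  qed
  have h_sort: "gres (root (h t)) = gres (root t)" if "t \<in> T" for t using trees_sort[OF hT[OF that]] .
  have leaf_fin: "finite_tree (h y) = finite_tree y" if y: "y \<in> Lf" for y
  proof -
    have yT: "y \<in> T" using y Lf_T by blast
    show ?thesis
    proof (cases "mixed S (gres (root y))")
      case True
      show ?thesis
      proof (cases "finite_tree y")
        case True
        then have "nm y \<in> set FF" unfolding set_FF using y \<open>mixed S _\<close> by blast
        then show ?thesis using bs True unfolding bsat_def h_def by blast
      next
        case False
        then have "([], [], [nm y]) \<in> set NN" unfolding set_NN NC_def using y True by blast
        then have "\<not> bsat w (EE @ []) [nm y]" using ng[of "[]" "[]" "[nm y]" w] by simp
        then show ?thesis using bs False unfolding bsat_def h_def by simp
      qed
    next
      case False
      have "y \<in> KT S (gres (root y)) (finite_tree y)" "h y \<in> KT S (gres (root y)) (finite_tree (h y))"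
        using T_W[OF yT] hT[OF yT] by (auto simp: KT_def)
      then show ?thesis using False unfolding mixed_def by (cases "finite_tree y"; cases "finite_tree (h y)") auto
    qed
  qed
  \<comment> \<open>If the value had a root \<open>g\<close> in \<open>G\<close>, its children would
    be values for the variables \<open>?ys\<close> satisfying the conjunct that \<open>NB\<close>
    negates.\<close>
  have leaf_root: "root (h y) \<notin> G" if y: "y \<in> Lf" "root y \<notin> G" for y
  proof
    assume g: "root (h y) \<in> G"
    have yT: "y \<in> T" using y Lf_T by blast
    define g where "g = root (h y)"
    let ?ys = "frs (K + C) g"
    have "(?ys, [(nm y, FApp g ?ys)], []) \<in> set NN"
      unfolding set_NN NB_def using y g h_sort[OF yT] unfolding g_def by blast
    note no = ng[OF this]
    have len: "length ?ys = length (children (h y))"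
      using trees_length[OF hT[OF yT]] frs(1)[of "K + C" g] unfolding g_def by (metis length_map)
    define w' where "w' v = (if v \<in> set ?ys then the (map_of (zip ?ys (children (h y))) v) else w v)" for v
    have w'ys: "map w' ?ys = children (h y)"
    proof (rule nth_equalityI)
      fix i assume "i < length (map w' ?ys)"
      then have i: "i < length ?ys" by simp
      have "map_of (zip ?ys (children (h y))) (?ys ! i) = Some (children (h y) ! i)"
        using map_of_zip_nth[OF len frs(2)] i len by simp
      then show "map w' ?ys ! i = children (h y) ! i" using i unfolding w'_def by simp
    qed (use len in simp)
    have "agree S ?ys w w'"
      unfolding agree_def
    proof (intro conjI allI impI ballI)
      fix v assume "v \<in> set ?ys"
      then obtain i where i: "i < length ?ys" "v = ?ys ! i" by (auto simp: in_set_conv_nth)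
      have "w' v = children (h y) ! i" using w'ys i by (metis nth_map)
      moreover have "vsort v = gargs g ! i" using frs(1)[of "K + C" g] i by (metis nth_map)
      ultimately show "w' v \<in> trees S (vsort v)"
        using trees_child[OF hT[OF yT], of i] i len unfolding g_def by simp
    qed (simp add: w'_def)
    moreover have "bsat w' (EE @ [(nm y, FApp g ?ys)]) []"
    proof -
      have lt: "vname v < K + C" if "v \<in> set (us @ xs)" for v
        using that K nm_notFr unfolding set_append set_xs by fastforce
      have same: "w' v = w v" if "v \<in> set (us @ xs)" for v
      proof -
        have "v \<notin> set ?ys" using lt[OF that] frs(3) by (meson not_le)
        then show ?thesis unfolding w'_def by simp
      qed
      have "w' (fst q) = flv w' (snd q)" if q: "q \<in> set EE" for q
      proof -
        have ok: "eqn_ok G (us @ xs) q" using descr_shape q unfolding shape_def by blast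
        then have "w' (fst q) = w (fst q)" using same unfolding eqn_ok_def by blast
        moreover have "flv w' (snd q) = flv w (snd q)"
          using ok same before_set[of "us @ xs"] unfolding eqn_ok_def by (auto simp: subset_iff)
        ultimately show ?thesis using bs q unfolding bsat_def by simp
      qed
      moreover have "w' (nm y) = Node g (map w' ?ys)"
        using same[OF nm_ord[OF yT]] w'ys unfolding g_def h_def by simp
      ultimately show ?thesis unfolding bsat_def by auto
    qed
    ultimately show False using no by blast
  qed
  have leaf_pair: "h y \<noteq> h z" if "(y, z) \<in> NA" for y z
  proof
    assume "h y = h z"
    have "([], [(nm y, FVar (nm z))], []) \<in> set NN" unfolding set_NN using that by blast
    from ng[OF this, of w] bs \<open>h y = h z\<close> show False unfolding bsat_def h_def by auto
  qed
  have leaf_inj: "h y \<noteq> h z" if y: "y \<in> Lf" and z: "z \<in> T" and ne: "z \<noteq> y" for y z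
  proof
    assume eq: "h y = h z"
    have yT: "y \<in> T" using y Lf_T by blast
    have srt: "gres (root y) = gres (root z)" using h_sort[OF yT] h_sort[OF z] eq by simp
    have "nm y \<noteq> nm z" using nm_inj yT z ne unfolding inj_on_def by blast
    then consider "before (us @ xs) (nm z) (nm y)" | "before (us @ xs) (nm y) (nm z)"
      using before_total[OF nm_ord[OF yT] nm_ord[OF z]] by blast
    then show False
    proof cases
      case 1
      then show False using leaf_pair[of y z] y z srt eq unfolding NA_def by auto
    next
      \<comment> \<open>The leaf \<open>y\<close> comes first, so \<open>NA\<close> need not
        separate it from \<open>z\<close>. If \<open>z\<close> is a leaf too, \<open>NA\<close> has
        the inequation with the roles exchanged. Otherwise the order of the variables forces
        \<open>y\<close> to be the value of a free variable; its root is then outside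
        \<open>G\<close> while that of \<open>z\<close> is in \<open>G\<close>, and these properties
        carry over to the images.\<close>
      case 2
      show False
      proof (cases "z \<in> Lf")
        case True
        then show False using leaf_pair[of z y] 2 yT srt eq unfolding NA_def by auto
      next
        case False
        then have zD: "z \<in> Dt" using T_cases z by blast
        have "y \<in> Fr"
        proof (rule ccontr)
          assume yF: "y \<notin> Fr"
          then have yl: "nm y \<in> set (map nm (lst (Lf - Fr)))" using y lst(1)[of "Lf - Fr"] finite_Lf by auto
          have "nm z \<in> set us \<or> nm z \<in> set (map nm (lst (Dt - Fr)))"
            using zD nm_Fr[of z] lst(1)[of "Dt - Fr"] finite_Dt by auto
          then have "before (us @ xs) (nm z) (nm y)" using yl unfolding xs_def map_append before_append set_append by blast
          then show False using 2 distinct_ord rnk_before by (metis less_asym)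
        qed
        then have "root (h y) \<notin> G" using leaf_root[OF y] Fr_Lf y by blast
        moreover have "root (h z) \<in> G" using hD[OF zD] Dt_root[OF zD] by (metis tree.sel(1))
        ultimately show False using eq by simp
      qed
    qed
  qed
  have inj: "t = u" if tu: "t \<in> T" "u \<in> T" "h t = h u" for t u
  proof (rule tree_eq_coinduct[where R = "\<lambda>t u. t \<in> T \<and> u \<in> T \<and> h t = h u"])
    fix t u assume tu: "t \<in> T \<and> u \<in> T \<and> h t = h u"
    show "root t = root u \<and> list_all2 (\<lambda>t u. (t \<in> T \<and> u \<in> T \<and> h t = h u) \<or> t = u) (children t) (children u)"
    proof (cases "t = u")
      case False
      then have D: "t \<in> Dt" "u \<in> Dt" using tu leaf_inj[of t u] leaf_inj[of u t] T_cases by metis+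
      then have *: "root t = root u" "map h (children t) = map h (children u)" using hD[of t] hD[of u] tu by auto
      moreover have "length (children t) = length (children u)" using *(2) map_eq_imp_length_eq by blast
      ultimately show ?thesis
        using Dt_child[OF D(1)] Dt_child[OF D(2)] by (auto simp: list_all2_conv_all_nth) (metis nth_map)
    qed (auto simp: list_all2_refl)
  qed (use tu in blast)
  have fin1: "finite_tree (h t)" if "finite_tree t" "t \<in> T" for t
    using that
  proof (induction t rule: finite_tree_induct)
    case (node t)
    show ?case
    proof (cases "t \<in> Dt")
      case True
      then have "\<forall>d \<in> set (children (h t)). finite_tree d"
        using node.IH Dt_child[OF True] hD[OF True] by (metis (no_types, lifting) imageE list.set_map tree.sel(2))
      then show ?thesis using finite_tree_iff by blast
    next
      case False
      then show ?thesis using leaf_fin node T_cases by blast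
    qed
  qed
  have fin2: "finite_tree t" if "finite_tree u" "t \<in> T" "u = h t" for t u
    using that
  proof (induction u arbitrary: t rule: finite_tree_induct)
    case (node u)
    show ?case
    proof (cases "t \<in> Dt")
      case True
      have "finite_tree d" if "d \<in> set (children t)" for d
      proof -
        have "h d \<in> set (children u)" using that hD[OF True] node.prems by (metis image_eqI list.set_map tree.sel(2))
        then show ?thesis using node.IH Dt_child[OF True that] by blast
      qed
      then show ?thesis using finite_tree_iff by blast
    next
      case False
      then show ?thesis using leaf_fin node T_cases by blast
    qed
  qed
  \<comment> \<open>The small trees among the nodes satisfy a system of equations closed under
    children, so uniqueness of solutions leaves them no other value than themselves.\<close>
  have hU: "h t = t" if t: "t \<in> T" "t \<in> U" for t
  proof (rule solves_unique[of "T \<inter> U" root children h "\<lambda>t. t"])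
    show "solves (T \<inter> U) root children h" using sol U_Dt unfolding solves_def by blast
    show "solves (T \<inter> U) root children (\<lambda>t. t)" unfolding solves_def by simp
    fix x y assume "x \<in> T \<inter> U" "y \<in> set (children x)"
    then have "y \<in> T \<inter> U" using U_Dt Dt_child small_trees_child[OF S(1)] by blast
    then show "y \<in> T \<inter> U \<or> h y = y" by blast
  qed (use t in blast)
  \<comment> \<open>Sort and finiteness carry over, and belonging to a small kind depends on nothing
    else.\<close>
  have hU2: "t \<in> U" if t: "t \<in> T" "h t \<in> U" for t
  proof -
    have "small S (gres (root (h t))) (finite_tree (h t))" using small_treesD[OF t(2)] by blast
    then have "small S (gres (root t)) (finite_tree t)" using h_sort[OF t(1)] fin1[OF _ t(1)] fin2[OF _ t(1) refl] by (cases "finite_tree t"; cases "finite_tree (h t)") auto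
    then show ?thesis using small_treesI[OF S(1) T_W[OF t(1)]] by blast
  qed
  define H where "H k = {(t, h t) |t j. nd j t \<and> j \<le> k} \<union> Id_on U" for k
  have nxH: "nx G (H k) \<subseteq> H (Suc k)" if k: "k < N" for k
  proof
    fix p assume "p \<in> nx G (H k)"
    then obtain t u where tu: "(t, u) \<in> H k" "root t \<in> G" "root u = root t" "p \<in> set (zip (children t) (children u))"
      unfolding nx_def by blast
    obtain i where i: "i < length (children t)" "i < length (children u)" "p = (children t ! i, children u ! i)"
      using tu(4) by (auto simp: set_zip)
    show "p \<in> H (Suc k)"
    proof (cases "(t, u) \<in> Id_on U")
      case True
      then have "t = u" "t \<in> U" by auto
      then have "children t ! i \<in> U" using small_trees_child[OF S(1)] i(1) by simp
      then show ?thesis using i \<open>t = u\<close> unfolding H_def by auto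
    next
      case False
      then obtain j where j: "nd j t" "j \<le> k" "u = h t" using tu(1) unfolding H_def by blast
      then have "t \<in> Dt" unfolding Dt_def using tu(2) k by auto
      have "nd (Suc j) (children t ! i)" using nd_Suc[OF j(1) tu(2)] j(2) k i(1) by simp
      moreover have "children u ! i = h (children t ! i)" using hD[OF \<open>t \<in> Dt\<close>] j(3) i(1) by (metis nth_map tree.sel(2))
      ultimately show ?thesis using i(3) j(2) unfolding H_def by auto
    qed
  qed
  let ?M = "(\<lambda>u. (e u, e' u)) ` set us \<union> Id_on U"
  have levH: "lev G k ?M \<subseteq> H k" if "k \<le> N" for k
    using that
  proof (induction k)
    case 0
    show ?case unfolding H_def using hu nd_0 by auto
  next
    case (Suc k)
    have "nx G (lev G k ?M) \<subseteq> H (Suc k)" using Suc nx_mono nxH[of k] by (meson Suc_le_lessD less_imp_le_nat order_trans)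
    moreover have "H k \<subseteq> H (Suc k)" unfolding H_def using le_SucI by blast
    ultimately show ?case using Suc by auto
  qed
  have HT: "(t \<in> T \<and> u = h t) \<or> (t = u \<and> t \<in> U)" if "(t, u) \<in> H k" for t u k
    using that unfolding H_def T_def by auto
  have "good (H N)"
    unfolding good_def
  proof (intro conjI allI impI)
    fix t u assume "(t, u) \<in> H N"
    then show "gres (root t) = gres (root u)" "finite_tree t = finite_tree u"
      using HT h_sort fin1 fin2 by metis+
  next
    fix t u t' u' assume "(t, u) \<in> H N" "(t', u') \<in> H N"
    then show "t = t' \<longleftrightarrow> u = u'" using HT[of t u] HT[of t' u'] inj hU hU2 by metis
  qed
  moreover have "lab G (H k)" if k: "k < N" for k
    unfolding lab_def
  proof (intro allI impI)
    fix t u assume tu: "(t, u) \<in> H k" "root t \<in> G \<or> root u \<in> G"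
    show "root t = root u"
    proof (cases "(t, u) \<in> Id_on U")
      case False
      then obtain j where j: "nd j t" "j \<le> k" "u = h t" using tu(1) unfolding H_def by blast
      show ?thesis
      proof (cases "root t \<in> G")
        case True
        then have "t \<in> Dt" unfolding Dt_def using j k by auto
        then show ?thesis using hD j(3) by (metis tree.sel(1))
      next
        case False
        then have "t \<in> Lf" unfolding Lf_def T_def Dt_def using j by blast
        then show ?thesis using leaf_root False tu(2) j(3) by blast
      qed
    qed auto
  qed
  ultimately show ?thesis unfolding eqv_def using levH good_mono lab_mono by (meson le_refl less_imp_le_nat)
qed


text \<open>All names that a node can get, whatever the tuple \<open>e\<close> is.\<close>

definition "pool = set us \<union> (\<lambda>(i, s). V (K + i) s) ` ({..<C} \<times> sorts S)"

lemma nm_pool: "t \<in> T \<Longrightarrow> nm t \<in> pool"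
proof (cases "t \<in> Fr")
  case True
  then show ?thesis using nm_Fr unfolding pool_def by blast
next
  case False
  assume t: "t \<in> T"
  have "(idx t, gres (root t)) \<in> {..<C} \<times> sorts S" using idx(2)[OF t] T_sort[OF t] by simp
  then show ?thesis using nm_notFr[OF t False] unfolding pool_def by force
qed

lemma card_T: "card T \<le> C" using C T_sub by blast

end

definition fpool :: "gen set \<Rightarrow> nat \<Rightarrow> var set \<Rightarrow> flat set" where
  "fpool G r P = FVar ` P \<union> (\<lambda>(g, ws). FApp g ws) ` (G \<times> {ws. set ws \<subseteq> P \<and> length ws \<le> r})"

definition npool :: "gen set \<Rightarrow> nat \<Rightarrow> var set \<Rightarrow> negc set" where
  "npool G k P = (\<lambda>(y, z). ([], [(y, FVar z)], [])) ` (P \<times> P) \<union>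
     (\<lambda>(y, g). (frs k g, [(y, FApp g (frs k g))], [])) ` (P \<times> G) \<union> (\<lambda>y. ([], [], [y])) ` P"

lemma finite_pools: "finite G \<Longrightarrow> finite P \<Longrightarrow> finite (fpool G r P)" "finite G \<Longrightarrow> finite P \<Longrightarrow> finite (npool G k P)"
  unfolding fpool_def npool_def by (auto simp: finite_lists_length_le)

text \<open>All constituents come from finite sets that do not depend on \<open>e\<close>. The
  bounds on the lengths count nodes, pairs of nodes, and pairs of a node and a generator.\<close>

lemma (in descr) descr_pools:
  assumes r: "\<forall>g \<in> G. length (gargs g) \<le> r"
  shows "set xs \<subseteq> pool" "length xs \<le> C" "set EE \<subseteq> pool \<times> fpool G r pool" "length EE \<le> length us + C"
    "set FF \<subseteq> pool" "length FF \<le> C" "set NN \<subseteq> npool G (K + C) pool" "length NN \<le> C * C + C * card G + C"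
proof -
  have us_pool: "set us \<subseteq> pool" unfolding pool_def by blast
  show "set xs \<subseteq> pool" using nm_pool set_xs by auto
  have fT: "finite A \<Longrightarrow> A \<subseteq> T \<Longrightarrow> card A \<le> C" for A using card_mono[OF finite_T, of A] card_T by simp
  have "length xs = card (Dt - Fr) + card (Lf - Fr)"
    unfolding xs_def using lst(3)[of "Dt - Fr"] lst(3)[of "Lf - Fr"] finite_Dt finite_Lf by simp
  also have "\<dots> = card ((Dt - Fr) \<union> (Lf - Fr))"
    using finite_Dt finite_Lf unfolding Lf_def by (intro card_Un_disjoint[symmetric]) auto
  also have "\<dots> \<le> C" using finite_Dt finite_Lf Dt_T Lf_T by (intro fT) auto
  finally show "length xs \<le> C" .
  have "FApp (root t) (map nm (children t)) \<in> fpool G r pool" if t: "t \<in> Dt" for t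
  proof -
    have "length (map nm (children t)) \<le> r" "set (map nm (children t)) \<subseteq> pool"
      using r Dt_root[OF t] trees_length[OF T_W, of t] Dt_T t nm_pool Dt_child[OF t] by auto
    then have "(root t, map nm (children t)) \<in> G \<times> {ws. set ws \<subseteq> pool \<and> length ws \<le> r}" using Dt_root[OF t] by blast
    then show ?thesis unfolding fpool_def by force
  qed
  moreover have "FVar (nm (e u)) \<in> fpool G r pool" if "u \<in> set us" for u
    using nm_pool[OF e_us_T[OF that]] unfolding fpool_def by blast
  ultimately show "set EE \<subseteq> pool \<times> fpool G r pool"
    unfolding set_EE using us_pool nm_pool Dt_T by auto
  have "length (filter (\<lambda>u. u \<noteq> nm (e u)) us) \<le> length us" by simp
  moreover have "length (lst Dt) \<le> C" using lst(3)[OF finite_Dt] fT[OF finite_Dt Dt_T] by simp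
  ultimately show "length EE \<le> length us + C" unfolding EE_def length_append length_map by (rule add_mono)
  show "set FF \<subseteq> pool" using nm_pool Lf_T unfolding set_FF by auto
  let ?A = "{t \<in> Lf. finite_tree t \<and> mixed S (gres (root t))}"
  have finA: "finite ?A" using finite_Lf by simp
  have "length FF = card ?A" unfolding FF_def using lst(3)[OF finA] by simp
  also have "\<dots> \<le> card T" using Lf_T by (intro card_mono[OF finite_T]) auto
  finally show "length FF \<le> C" using card_T by simp
  have "(nm y, nm z) \<in> pool \<times> pool" if "(y, z) \<in> NA" for y z using that nm_pool Lf_T unfolding NA_def by auto
  moreover have "(nm y, g) \<in> pool \<times> G" if "(y, g) \<in> NB" for y g using that nm_pool Lf_T unfolding NB_def by auto
  moreover have "nm y \<in> pool" if "y \<in> NC" for y using that nm_pool Lf_T unfolding NC_def by auto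
  ultimately show "set NN \<subseteq> npool G (K + C) pool" unfolding set_NN npool_def by (fastforce simp: image_iff)
  have "card NA \<le> card (T \<times> T)" unfolding NA_def using Lf_T finite_T by (intro card_mono) auto
  also have "\<dots> \<le> C * C" using card_T by (simp add: card_cartesian_product mult_le_mono)
  finally have 1: "card NA \<le> C * C" .
  have "card NB \<le> card (T \<times> G)" unfolding NB_def using Lf_T finite_T S(2) by (intro card_mono) auto
  also have "\<dots> \<le> C * card G" using card_T by (simp add: card_cartesian_product)
  finally have 2: "card NB \<le> C * card G" .
  have 3: "card NC \<le> C" using finite_N(3) Lf_T unfolding NC_def by (intro fT) auto
  show "length NN \<le> C * C + C * card G + C" unfolding NN_def using 1 2 3 lst(3)[OF finite_N(1)] lst(3)[OF finite_N(2)] lst(3)[OF finite_N(3)]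
    by simp
qed

text \<open>Two tuples with the same description cannot be told apart by \<open>p\<close>, so
  \<open>p\<close> is equivalent to the disjunction of the descriptions of the tuples satisfying it,
  and there are finitely many descriptions. Nothing is computed here: the lemma only guarantees that
  a search for such a disjunction ends.\<close>

lemma nf_exists:
  assumes pre: "ef_pre S G" and wf: "wf_fm S p" "gens_fm p \<subseteq> G" and fvs: "distinct us" "set us = fv p"
  shows "\<exists>ps. (\<forall>q \<in> set ps. \<exists>xs E F Ns. q = shape_fm xs E F Ns \<and> shape S G us xs E F Ns) \<and>
    (\<forall>e. valuation S e \<longrightarrow> sat S e p = (\<exists>q \<in> set ps. sat S e q))"
proof -
  obtain N0 where N0: "\<forall>M e e'. finite M \<longrightarrow> M \<subseteq> W S \<times> W S \<longrightarrow> Id_on (small_trees S) \<subseteq> M \<longrightarrow>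
    eqv G N0 M \<longrightarrow> (\<forall>v \<in> fv p. (e v, e' v) \<in> M) \<longrightarrow> sat S e p = sat S e' p"
    using insensitive_fm[OF pre wf] unfolding insensitive_def by blast
  \<comment> \<open>The successor ensures \<open>0 < N\<close>, so that the values of the free
    variables are expanded at least once.\<close>
  define N where "N = Suc N0"
  have S: "tree_signature S" "finite G" using pre unfolding ef_pre_def by auto
  obtain r where r: "\<forall>g \<in> G. length (gargs g) \<le> r" using gens_bound[OF S(2)] by blast
  obtain K where K: "\<forall>u \<in> set us. vname u < K"
    using finite_nat_set_iff_bounded[of "vname ` set us"] by auto
  \<comment> \<open>For each free variable at most \<open>Suc r ^ N\<close> visible subtrees, and in
    addition the small trees.\<close>
  define C where "C = length us * Suc r ^ N + card (small_trees S)"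
  have srt: "\<forall>u \<in> set us. vsort u \<in> sorts S" using fvs fv_wf[OF wf(1)] by blast
  have loc: "descr S G N us K C e" if e: "valuation S e" for e
  proof
    show "\<forall>T. T \<subseteq> (\<Union>u \<in> set us. rch G N (e u)) \<union> small_trees S \<longrightarrow> card T \<le> C"
    proof (intro allI impI)
      fix T assume T: "T \<subseteq> (\<Union>u \<in> set us. rch G N (e u)) \<union> small_trees S"
      have "card (rch G N (e u)) \<le> Suc r ^ N" if "u \<in> set us" for u
        using e srt that r unfolding valuation_def by (intro card_rch[where S = S]) (auto intro: W_trees)
      then have "(\<Sum>u \<in> set us. card (rch G N (e u))) \<le> (\<Sum>u \<in> set us. Suc r ^ N)" by (intro sum_mono)
      also have "\<dots> \<le> length us * Suc r ^ N" using card_length[of us] by (simp add: mult_le_mono1)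
      finally have "card (\<Union>u \<in> set us. rch G N (e u)) \<le> length us * Suc r ^ N"
        using card_UN_le[of "set us" "\<lambda>u. rch G N (e u)"] by simp
      then have "card ((\<Union>u \<in> set us. rch G N (e u)) \<union> small_trees S) \<le> C"
        unfolding C_def using card_Un_le[of "\<Union>u \<in> set us. rch G N (e u)" "small_trees S"] by linarith
      moreover have "finite ((\<Union>u \<in> set us. rch G N (e u)) \<union> small_trees S)"
        using finite_rch finite_small_trees[OF S(1)] by auto
      ultimately show "card T \<le> C" using card_mono[OF _ T] le_trans by blast
    qed
  qed (use pre fvs srt K e in \<open>auto simp: N_def\<close>)
  define P where "P = set us \<union> (\<lambda>(i, s). V (K + i) s) ` ({..<C} \<times> sorts S)"
  have finP: "finite P" unfolding P_def using S(1) by (auto simp: tree_signature_def)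
  define lists where "lists A n = {l. set l \<subseteq> A \<and> length l \<le> n}" for A :: "'z set" and n
  have fl: "finite A \<Longrightarrow> finite {l. set l \<subseteq> A \<and> length l \<le> n}" for A :: "'z set" and n by (rule finite_lists_length_le)
  define D where "D = {l. set l \<subseteq> P \<and> length l \<le> C} \<times> {l. set l \<subseteq> P \<times> fpool G r P \<and> length l \<le> length us + C} \<times>
    {l. set l \<subseteq> P \<and> length l \<le> C} \<times> {l. set l \<subseteq> npool G (K + C) P \<and> length l \<le> C * C + C * card G + C}"
  have finD: "finite D" unfolding D_def
    by (intro finite_cartesian_product finite_lists_length_le finP finite_pools S)
  define chi where "chi e = shape_fm (descr.xs S G N us K C e) (descr.EE S G N us K C e) (descr.FF S G N us K C e) (descr.NN S G N us K C e)" for e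
  define X where "X = {chi e |e. valuation S e \<and> sat S e p}"
  have "X \<subseteq> (\<lambda>(xs, E, F, Ns). shape_fm xs E F Ns) ` D"
  proof
    fix q assume "q \<in> X"
    then obtain e where e: "valuation S e" "q = chi e" unfolding X_def by blast
    interpret descr S G N us K C e using loc[OF e(1)] .
    have "(xs, EE, FF, NN) \<in> D" unfolding D_def using descr_pools[OF r] unfolding pool_def P_def[symmetric] by simp
    then show "q \<in> (\<lambda>(xs, E, F, Ns). shape_fm xs E F Ns) ` D" unfolding e(2) chi_def by force
  qed
  then have "finite X" using finD finite_surj by blast
  then obtain ps where ps: "set ps = X" using finite_list by blast
  show ?thesis
  proof (intro exI[of _ ps] conjI ballI allI impI)
    fix q assume "q \<in> set ps"
    then obtain e where e: "valuation S e" "q = chi e" using ps unfolding X_def by blast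
    interpret descr S G N us K C e using loc[OF e(1)] .
    show "\<exists>xs E F Ns. q = shape_fm xs E F Ns \<and> shape S G us xs E F Ns"
      using descr_shape e(2) unfolding chi_def by blast
  next
    fix e' assume e': "valuation S e'"
    show "sat S e' p = (\<exists>q \<in> set ps. sat S e' q)"
    proof
      assume "sat S e' p"
      then have in_ps: "chi e' \<in> set ps" using e' ps unfolding X_def by blast
      interpret descr S G N us K C e' using loc[OF e'] .
      have "sat S e' (chi e')" using descr_sat unfolding chi_def .
      then show "\<exists>q \<in> set ps. sat S e' q" using in_ps by (rule bexI)
    next
      assume "\<exists>q \<in> set ps. sat S e' q"
      then obtain q where q: "q \<in> X" "sat S e' q" using ps by auto
      then obtain e where "valuation S e \<and> sat S e p" "q = chi e" unfolding X_def by auto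
      with q(2) have e: "valuation S e" "sat S e p" "sat S e' (chi e)" by auto
      interpret descr S G N us K C e using loc[OF e(1)] .
      let ?M = "(\<lambda>u. (e u, e' u)) ` set us \<union> Id_on (small_trees S)"
      have "eqv G N ?M" using descr_eqv[OF e'] e(3) unfolding chi_def by blast
      then have m1: "eqv G N0 ?M" by (rule eqv_le) (simp add: N_def)
      have m2: "finite ?M" using finite_small_trees[OF S(1)] by (simp add: Id_on_def)
      have UW: "small_trees S \<subseteq> W S" using small_treesD unfolding W_def by blast
      have m3: "?M \<subseteq> W S \<times> W S"
        using e(1) e' srt UW unfolding valuation_def by (auto intro: W_trees)
      have "sat S e p = sat S e' p"
      proof (rule N0[rule_format, OF m2 m3 _ m1])
        show "(e v, e' v) \<in> ?M" if "v \<in> fv p" for v using that fvs(2) by blast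
      qed blast
      then show "sat S e' p" using e(2) by blast
    qed
  qed
qed

subsection \<open>Symbolic states\<close>

text \<open>\<open>(v, g, ws)\<close> stands for the equation \<open>v = g(ws)\<close>, and
  \<open>(v, b)\<close> for an opaque leaf \<open>v\<close>, finite iff \<open>b = 1\<close>. A
  number instead of a truth value keeps states within the encoded types.\<close>

type_synonym det = "var \<times> gen \<times> var list"
type_synonym opq = "var \<times> nat"

text \<open>Part of the finite data through which the signature enters. For the remaining kinds no
  opaque leaves are needed, because all their trees are nodes from the start.\<close>

definition big_kinds :: "signature \<Rightarrow> (srt \<times> nat) set" where
  "big_kinds S = {(s, b). s \<in> sorts S \<and> b < 2 \<and> \<not> small S s (b = 1)}"

text \<open>The kinds having trees with roots outside any given finite set, as an opaque leaf at a
  depth where roots are compared requires.\<close>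

definition wide_kinds :: "signature \<Rightarrow> (srt \<times> nat) set" where
  "wide_kinds S = {(s, b). s \<in> sorts S \<and> b < 2 \<and> infinite (root ` KT S s (b = 1))}"

definition det_ok :: "gen set \<Rightarrow> var list \<Rightarrow> det \<Rightarrow> bool" where
  "det_ok G ns p \<longleftrightarrow> fst p \<in> set ns \<and> fst (snd p) \<in> G \<and> gres (fst (snd p)) = vsort (fst p) \<and>
     list_all2 (\<lambda>w s. vsort w = s) (snd (snd p)) (gargs (fst (snd p))) \<and> (\<forall>w \<in> set (snd (snd p)). w \<in> set ns)"

definition wf_state :: "signature \<Rightarrow> gen set \<Rightarrow> nat \<Rightarrow> var list \<Rightarrow> det list \<Rightarrow> opq list \<Rightarrow> bool" where
  "wf_state S G k ns d op \<longleftrightarrow>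
     (\<forall>v \<in> set ns. vname v < k \<and> vsort v \<in> sorts S \<and> ((\<exists>q. (v, q) \<in> set d) \<or> (\<exists>b. (v, b) \<in> set op))) \<and>
     (\<forall>p \<in> set d. det_ok G ns p) \<and> (\<forall>p \<in> set op. fst p \<in> set ns \<and> (vsort (fst p), snd p) \<in> big_kinds S) \<and>
     (\<forall>p \<in> set d. \<forall>q \<in> set d. fst p \<noteq> fst q \<or> p = q) \<and> (\<forall>p \<in> set d. \<forall>q \<in> set op. fst p \<noteq> fst q) \<and>
     (\<forall>p \<in> set op. \<forall>q \<in> set op. fst p \<noteq> fst q \<or> p = q)"

text \<open>A state is a finite system of equations, with opaque leaves standing for generic trees. An
  opaque leaf is realised by a generator of its own: a constant, or a loop if it is to be infinite.\<close>

definition opq_gen :: "nat \<Rightarrow> var \<Rightarrow> nat \<Rightarrow> gen" where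
  "opq_gen K v b = Gen (K + vname v) (if b = 1 then [] else [vsort v]) (vsort v)"

definition node_lab :: "nat \<Rightarrow> det list \<Rightarrow> opq list \<Rightarrow> var \<Rightarrow> gen" where
  "node_lab K d op v = (case map_of d v of Some q \<Rightarrow> fst q | None \<Rightarrow> opq_gen K v (the (map_of op v)))"

definition node_kids :: "det list \<Rightarrow> opq list \<Rightarrow> var \<Rightarrow> var list" where
  "node_kids d op v = (case map_of d v of Some q \<Rightarrow> snd q | None \<Rightarrow> if the (map_of op v) = 1 then [] else [v])"

definition sol :: "nat \<Rightarrow> det list \<Rightarrow> opq list \<Rightarrow> var \<Rightarrow> tree" where
  "sol K d op = slv UNIV (node_lab K d op) (node_kids d op) undefined"

text \<open>The signature in which states are solved. If \<open>K\<close> is above the names in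
  \<open>G\<close>, the generators of opaque leaves are new and differ from leaf to leaf, so opaque
  leaves are generic by construction.\<close>

definition opq_sig :: "signature \<Rightarrow> gen set \<Rightarrow> nat \<Rightarrow> signature" where
  "opq_sig S G K = \<lparr>sorts = sorts S, gens = G \<union> {opq_gen K v b |v b. vsort v \<in> sorts S}\<rparr>"

lemma wf_stateD:
  assumes "wf_state S G k ns d op"
  shows "v \<in> set ns \<Longrightarrow> vname v < k" "v \<in> set ns \<Longrightarrow> vsort v \<in> sorts S"
    "v \<in> set ns \<Longrightarrow> (\<exists>q. (v, q) \<in> set d) \<or> (\<exists>b. (v, b) \<in> set op)"
    "p \<in> set d \<Longrightarrow> det_ok G ns p" "(v, b) \<in> set op \<Longrightarrow> v \<in> set ns \<and> (vsort v, b) \<in> big_kinds S"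
    "(v, q) \<in> set d \<Longrightarrow> (v, q') \<in> set d \<Longrightarrow> q = q'" "(v, q) \<in> set d \<Longrightarrow> (v, b) \<notin> set op"
    "(v, b) \<in> set op \<Longrightarrow> (v, b') \<in> set op \<Longrightarrow> b = b'"
proof -
  show "v \<in> set ns \<Longrightarrow> vname v < k" "v \<in> set ns \<Longrightarrow> vsort v \<in> sorts S"
    "v \<in> set ns \<Longrightarrow> (\<exists>q. (v, q) \<in> set d) \<or> (\<exists>b. (v, b) \<in> set op)"
    "p \<in> set d \<Longrightarrow> det_ok G ns p"
    using assms unfolding wf_state_def by blast+
  show "(v, b) \<in> set op \<Longrightarrow> v \<in> set ns \<and> (vsort v, b) \<in> big_kinds S"
    using assms unfolding wf_state_def by (metis fst_conv snd_conv)
  show "(v, q) \<in> set d \<Longrightarrow> (v, q') \<in> set d \<Longrightarrow> q = q'" "(v, q) \<in> set d \<Longrightarrow> (v, b) \<notin> set op"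
    "(v, b) \<in> set op \<Longrightarrow> (v, b') \<in> set op \<Longrightarrow> b = b'"
    using assms unfolding wf_state_def by (metis fst_conv snd_conv)+
qed

lemma wf_state_map_of:
  assumes v: "wf_state S G k ns d op"
  shows "(v, q) \<in> set d \<Longrightarrow> map_of d v = Some q" "(v, b) \<in> set op \<Longrightarrow> map_of d v = None \<and> map_of op v = Some b"
proof -
  show "(v, q) \<in> set d \<Longrightarrow> map_of d v = Some q"
    using wf_stateD(6)[OF v] map_of_SomeD[of d v] weak_map_of_SomeI[of v q d] by blast
  assume b: "(v, b) \<in> set op"
  have "map_of op v = Some b" using wf_stateD(8)[OF v] map_of_SomeD[of op v] weak_map_of_SomeI[OF b] b by blast
  moreover have "map_of d v = None"
  proof (cases "map_of d v")
    case (Some q)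
    then show ?thesis using wf_stateD(7)[OF v map_of_SomeD[OF Some]] b by blast
  qed
  ultimately show "map_of d v = None \<and> map_of op v = Some b" by blast
qed

lemma sol_solves: "solves UNIV (node_lab K d op) (node_kids d op) (sol K d op)"
  unfolding sol_def by (rule slv_solves)

lemma sol_det:
  assumes "wf_state S G k ns d op" "(v, g, ws) \<in> set d"
  shows "sol K d op v = Node g (map (sol K d op) ws)"
proof -
  have "map_of d v = Some (g, ws)" using wf_state_map_of(1)[OF assms] .
  then have "node_lab K d op v = g" "node_kids d op v = ws" by (simp_all add: node_lab_def node_kids_def)
  then show ?thesis using sol_solves[of K d op] unfolding solves_def by auto
qed

lemma sol_opq:
  assumes "wf_state S G k ns d op" "(v, b) \<in> set op"
  shows "root (sol K d op v) = opq_gen K v b" "finite_tree (sol K d op v) \<longleftrightarrow> b = 1"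
proof -
  have m: "map_of d v = None" "map_of op v = Some b" using wf_state_map_of(2)[OF assms] by auto
  have s: "sol K d op v = Node (node_lab K d op v) (map (sol K d op) (node_kids d op v))"
    using sol_solves[of K d op] unfolding solves_def by auto
  show r: "root (sol K d op v) = opq_gen K v b" using m by (subst s) (simp add: node_lab_def)
  show "finite_tree (sol K d op v) \<longleftrightarrow> b = 1"
  proof (cases "b = 1")
    case True
    have "children (sol K d op v) = []" using m True by (subst s) (simp add: node_kids_def)
    then show ?thesis using True finite_tree_iff[of "sol K d op v"] by simp
  next
    case False
    have c: "children (sol K d op v) = [sol K d op v]" using m False by (subst s) (simp add: node_kids_def)
    have "sub (sol K d op v) [0] = Some (sol K d op v)" using c by simp
    then have "\<not> finite_tree (sol K d op v)" using finite_no_self_sub by blast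
    then show ?thesis using False by simp
  qed
qed

lemma det_okD:
  assumes "det_ok G ns (v, g, ws)"
  shows "v \<in> set ns" "g \<in> G" "gres g = vsort v" "map vsort ws = gargs g" "set ws \<subseteq> set ns"
  using assms unfolding det_ok_def by (auto simp: list_all2_conv_all_nth intro: nth_equalityI)

lemma sol_trees:
  assumes v: "wf_state S G k ns d op" and x: "x \<in> set ns"
  shows "sol K d op x \<in> trees (opq_sig S G K) (vsort x)"
proof (rule solves_trees[where Z = "set ns" and lab = "node_lab K d op" and kids = "node_kids d op"])
  show "solves (set ns) (node_lab K d op) (node_kids d op) (sol K d op)"
    using sol_solves[of K d op] unfolding solves_def by blast
  fix y assume y: "y \<in> set ns"
  have ys: "vsort y \<in> sorts S" using wf_stateD(2)[OF v y] .
  have *: "node_lab K d op y \<in> gens (opq_sig S G K) \<and> gres (node_lab K d op y) = vsort y \<and>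
      map vsort (node_kids d op y) = gargs (node_lab K d op y) \<and> set (node_kids d op y) \<subseteq> set ns"
  proof (cases "\<exists>q. (y, q) \<in> set d")
    case True
    then obtain g ws where q: "(y, g, ws) \<in> set d" by auto
    have "map_of d y = Some (g, ws)" using wf_state_map_of(1)[OF v q] .
    then show ?thesis using det_okD[OF wf_stateD(4)[OF v q]] by (simp add: node_lab_def node_kids_def opq_sig_def)
  next
    case False
    then obtain b where b: "(y, b) \<in> set op" using wf_stateD(3)[OF v y] by blast
    have "map_of d y = None" "map_of op y = Some b" using wf_state_map_of(2)[OF v b] by auto
    then show ?thesis using y ys by (auto simp: node_lab_def node_kids_def opq_sig_def opq_gen_def)
  qed
  then show "node_lab K d op y \<in> gens (opq_sig S G K) \<and> gres (node_lab K d op y) = vsort y \<and>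
      map vsort (node_kids d op y) = gargs (node_lab K d op y)" by blast
  fix z assume "z \<in> set (node_kids d op y)"
  then show "z \<in> set ns \<or> sol K d op z \<in> trees (opq_sig S G K) (vsort z)" using * by blast
qed (rule x)

lemma sol_sort: "wf_state S G k ns d op \<Longrightarrow> x \<in> set ns \<Longrightarrow> gres (root (sol K d op x)) = vsort x"
  by (rule trees_sort[OF sol_trees])

lemma opq_gen_inj: "opq_gen K v b = opq_gen K w b' \<Longrightarrow> v = w"
  by (cases v; cases w) (auto simp: opq_gen_def)

lemma opq_gen_notin: "\<forall>g \<in> G. gname g < K \<Longrightarrow> opq_gen K v b \<notin> G"
  unfolding opq_gen_def by (metis gen.sel(1) not_add_less1)

lemma root_cases:
  assumes v: "wf_state S G k ns d op" and K: "\<forall>g \<in> G. gname g < K" and x: "x \<in> set ns"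
  shows "(root (sol K d op x) \<in> G \<and> (\<exists>g ws. (x, g, ws) \<in> set d \<and> root (sol K d op x) = g)) \<or>
    (root (sol K d op x) \<notin> G \<and> (\<exists>b. (x, b) \<in> set op \<and> root (sol K d op x) = opq_gen K x b))"
  using wf_stateD(3)[OF v x]
proof
  assume "\<exists>q. (x, q) \<in> set d"
  then obtain g ws where q: "(x, g, ws) \<in> set d" by auto
  then show ?thesis using sol_det[OF v q, of K] det_okD(2)[OF wf_stateD(4)[OF v q]] by auto
next
  assume "\<exists>b. (x, b) \<in> set op"
  then obtain b where b: "(x, b) \<in> set op" by blast
  then show ?thesis using sol_opq(1)[OF v b, of K] opq_gen_notin[OF K] by auto
qed

lemma sol_children:
  assumes v: "wf_state S G k ns d op" and K: "\<forall>g \<in> G. gname g < K" and x: "x \<in> set ns"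
    and r: "root (sol K d op x) \<in> G" and c: "c \<in> set (children (sol K d op x))"
  shows "c \<in> sol K d op ` set ns"
proof -
  obtain g ws where q: "(x, g, ws) \<in> set d" using root_cases[OF v K x] r by blast
  show ?thesis using sol_det[OF v q, of K] det_okD(5)[OF wf_stateD(4)[OF v q]] c by auto
qed

lemma rch_sol:
  assumes v: "wf_state S G k ns d op" and K: "\<forall>g \<in> G. gname g < K" and x: "x \<in> set ns"
  shows "rch G n (sol K d op x) \<subseteq> sol K d op ` set ns"
proof (induction n)
  case 0
  show ?case using x by simp
next
  case (Suc n)
  have "c \<in> sol K d op ` set ns" if t: "t \<in> rch G n (sol K d op x)" "root t \<in> G" "c \<in> set (children t)" for t c
  proof -
    obtain y where "y \<in> set ns" "t = sol K d op y" using Suc t(1) by blast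
    then show ?thesis using sol_children[OF v K, of y c] t by blast
  qed
  then show ?case using Suc by auto
qed

lemma lev_sol:
  assumes v: "wf_state S G k ns d op" and K: "\<forall>g \<in> G. gname g < K" and M: "Range M \<subseteq> sol K d op ` set ns"
  shows "Range (lev G n M) \<subseteq> sol K d op ` set ns"
proof (induction n)
  case (Suc n)
  have "snd p \<in> sol K d op ` set ns" if p: "p \<in> nx G (lev G n M)" for p
  proof -
    obtain t u where tu: "(t, u) \<in> lev G n M" "root t \<in> G" "root u = root t" "p \<in> set (zip (children t) (children u))"
      using p unfolding nx_def by blast
    obtain y where y: "y \<in> set ns" "u = sol K d op y" using Suc tu(1) by blast
    have "snd p \<in> set (children u)" using tu(4) by (metis prod.collapse set_zip_rightD)
    then show ?thesis using sol_children[OF v K y(1)] y(2) tu(2,3) by simp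
  qed
  then show ?case using Suc by force
qed (use M in simp)

text \<open>The old nodes form a subsystem closed under children, so adding nodes does not change
  their values.\<close>

lemma sol_extend:
  assumes v: "wf_state S G k ns d op" and v': "wf_state S G k' ns' d' op'" and sub: "set d \<subseteq> set d'" "set op \<subseteq> set op'"
    and x: "x \<in> set ns"
  shows "sol K d' op' x = sol K d op x"
proof (rule solves_unique[where Z = "set ns" and lab = "node_lab K d op" and kids = "node_kids d op"])
  have eq: "map_of d' y = map_of d y \<and> (map_of d y = None \<longrightarrow> map_of op' y = map_of op y)" if y: "y \<in> set ns" for y
    using wf_stateD(3)[OF v y]
  proof
    assume "\<exists>q. (y, q) \<in> set d"
    then obtain q where q: "(y, q) \<in> set d" by blast
    then have "map_of d y = Some q" using wf_state_map_of(1)[OF v] by blast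
    moreover have "map_of d' y = Some q" using wf_state_map_of(1)[OF v', of y q] q sub by blast
    ultimately show ?thesis by simp
  next
    assume "\<exists>b. (y, b) \<in> set op"
    then obtain b where b: "(y, b) \<in> set op" by blast
    then have "map_of d y = None \<and> map_of op y = Some b" using wf_state_map_of(2)[OF v] by blast
    moreover have "map_of d' y = None \<and> map_of op' y = Some b" using wf_state_map_of(2)[OF v', of y b] b sub by blast
    ultimately show ?thesis by simp
  qed
  then have "node_lab K d' op' y = node_lab K d op y" "node_kids d' op' y = node_kids d op y" if "y \<in> set ns" for y
    using eq[OF that] unfolding node_lab_def node_kids_def by (auto split: option.splits)
  then show "solves (set ns) (node_lab K d op) (node_kids d op) (sol K d' op')"
    using sol_solves[of K d' op'] unfolding solves_def by auto
  show "solves (set ns) (node_lab K d op) (node_kids d op) (sol K d op)"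
    using sol_solves[of K d op] unfolding solves_def by blast
  fix y z assume y: "y \<in> set ns" "z \<in> set (node_kids d op y)"
  have "set (node_kids d op y) \<subseteq> set ns"
  proof (cases "\<exists>q. (y, q) \<in> set d")
    case True
    then obtain g ws where q: "(y, g, ws) \<in> set d" by auto
    then show ?thesis using wf_state_map_of(1)[OF v q] det_okD(5)[OF wf_stateD(4)[OF v q]] by (simp add: node_kids_def)
  next
    case False
    then obtain b where b: "(y, b) \<in> set op" using wf_stateD(3)[OF v y(1)] by blast
    then show ?thesis using wf_state_map_of(2)[OF v b] y(1) by (simp add: node_kids_def)
  qed
  then show "z \<in> set ns \<or> sol K d' op' z = sol K d op z" using y by blast
qed (rule x)

text \<open>Induction on the finite tree \<open>h x\<close>; it serves to compare two solutions of
  the same equations, where nodes without equation are compared by assumption.\<close>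

lemma finite_same:
  assumes step: "\<And>x. x \<in> R \<Longrightarrow> (finite_tree (h x) \<longrightarrow> finite_tree (k x)) \<or>
    (set (kids x) \<subseteq> R \<and> children (h x) = map h (kids x) \<and> children (k x) = map k (kids x))"
  shows "x \<in> R \<Longrightarrow> finite_tree (h x) \<Longrightarrow> finite_tree (k x)"
proof -
  have "finite_tree t \<Longrightarrow> x \<in> R \<Longrightarrow> t = h x \<Longrightarrow> finite_tree (k x)" for t
  proof (induction t arbitrary: x rule: finite_tree_induct)
    case (node t)
    from step[OF node.prems(1)] show ?case
    proof
      assume "finite_tree (h x) \<longrightarrow> finite_tree (k x)"
      then show ?thesis using node by blast
    next
      assume s: "set (kids x) \<subseteq> R \<and> children (h x) = map h (kids x) \<and> children (k x) = map k (kids x)"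
      have "finite_tree (k y)" if "y \<in> set (kids x)" for y
        using node.IH[of "h y" y] node.prems(2) s that by auto
      then show ?thesis using finite_tree_iff[of "k x"] s by auto
    qed
  qed
  then show "x \<in> R \<Longrightarrow> finite_tree (h x) \<Longrightarrow> finite_tree (k x)" by blast
qed

text \<open>Opaque leaves stand for kinds with infinitely many trees, so that they do not enlarge the sorts
  with finitely many trees of a kind.\<close>

lemma sol_small:
  assumes S: "tree_signature S" and G: "G \<subseteq> gens S" and v: "wf_state S G k ns d op" and K: "\<forall>g \<in> G. gname g < K"
    and x: "x \<in> set ns" and sm: "small S (vsort x) (finite_tree (sol K d op x))"
  shows "sol K d op x \<in> small_trees S"
proof -
  define Z where "Z = {y \<in> set ns. \<exists>q. (y, q) \<in> set d}"
  \<comment> \<open>A second solution, with trees of \<open>S\<close> of the right kinds at the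
    opaque leaves. It has the same finiteness at every node but lies within \<open>S\<close>, where
    \<open>small_child\<close> passes smallness on to children.\<close>
  define h0 where "h0 y = (SOME u. u \<in> KT S (vsort y) (finite_tree (sol K d op y)))" for y
  define h where "h = slv Z (node_lab K d op) (node_kids d op) h0"
  have hs: "solves Z (node_lab K d op) (node_kids d op) h" unfolding h_def by (rule slv_solves)
  have Zd: "\<exists>g ws. (y, g, ws) \<in> set d \<and> node_lab K d op y = g \<and> node_kids d op y = ws \<and> det_ok G ns (y, g, ws)" if "y \<in> Z" for y
  proof -
    obtain g ws where q: "(y, g, ws) \<in> set d" using \<open>y \<in> Z\<close> unfolding Z_def by auto
    then show ?thesis using wf_state_map_of(1)[OF v q] wf_stateD(4)[OF v q] by (auto simp: node_lab_def node_kids_def)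
  qed
  have out: "h y \<in> KT S (vsort y) (finite_tree (sol K d op y))" if y: "y \<in> set ns" "y \<notin> Z" for y
  proof -
    obtain b where b: "(y, b) \<in> set op" using wf_stateD(3)[OF v y(1)] y unfolding Z_def by blast
    have "(vsort y, b) \<in> big_kinds S" using wf_stateD(5)[OF v b] by blast
    then have "\<not> small S (vsort y) (finite_tree (sol K d op y))"
      using sol_opq(2)[OF v b, of K] unfolding big_kinds_def by simp
    then have "KT S (vsort y) (finite_tree (sol K d op y)) \<noteq> {}" unfolding small_def by (metis finite.emptyI)
    then obtain u where "u \<in> KT S (vsort y) (finite_tree (sol K d op y))" by (meson ex_in_conv)
    then have "h0 y \<in> KT S (vsort y) (finite_tree (sol K d op y))" unfolding h0_def by (rule someI)
    then show ?thesis unfolding h_def using slv_outside[OF y(2)] by metis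
  qed
  have hT: "h y \<in> trees S (vsort y)" if y: "y \<in> set ns" for y
  proof (cases "y \<in> Z")
    case True
    show ?thesis
    proof (rule solves_trees[OF hs _ _ True])
      fix z assume z: "z \<in> Z"
      obtain g ws where q: "node_lab K d op z = g" "node_kids d op z = ws" "det_ok G ns (z, g, ws)" using Zd[OF z] by blast
      show "node_lab K d op z \<in> gens S \<and> gres (node_lab K d op z) = vsort z \<and> map vsort (node_kids d op z) = gargs (node_lab K d op z)"
        using det_okD[OF q(3)] q G by auto
      fix y assume "y \<in> set (node_kids d op z)"
      then have "y \<in> set ns" using det_okD(5)[OF q(3)] q(2) by blast
      then show "y \<in> Z \<or> h y \<in> trees S (vsort y)" using out by (auto simp: KT_def)
    qed
  next
    case False
    then show ?thesis using out[OF y] by (simp add: KT_def)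
  qed
  have solZ: "children (sol K d op y) = map (sol K d op) (node_kids d op y) \<and> children (h y) = map h (node_kids d op y) \<and>
      set (node_kids d op y) \<subseteq> set ns" if y: "y \<in> Z" for y
  proof -
    obtain g ws where q: "(y, g, ws) \<in> set d" "node_kids d op y = ws" "det_ok G ns (y, g, ws)" using Zd[OF y] by blast
    then show ?thesis using sol_det[OF v q(1), of K] det_okD(5)[OF q(3)] hs y unfolding solves_def by (metis tree.sel(2))
  qed
  have fin1: "finite_tree (sol K d op y) \<Longrightarrow> finite_tree (h y)" if y: "y \<in> set ns" for y
  proof (rule finite_same[where h = "sol K d op" and R = "set ns" and kids = "node_kids d op"])
    fix z assume z: "z \<in> set ns"
    show "(finite_tree (sol K d op z) \<longrightarrow> finite_tree (h z)) \<or> (set (node_kids d op z) \<subseteq> set ns \<and>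
      children (sol K d op z) = map (sol K d op) (node_kids d op z) \<and> children (h z) = map h (node_kids d op z))"
      using solZ[of z] out[OF z] by (cases "z \<in> Z") (auto simp: KT_def)
  qed (use y in auto)
  have fin2: "finite_tree (h y) \<Longrightarrow> finite_tree (sol K d op y)" if y: "y \<in> set ns" for y
  proof (rule finite_same[where h = h and R = "set ns" and kids = "node_kids d op"])
    fix z assume z: "z \<in> set ns"
    show "(finite_tree (h z) \<longrightarrow> finite_tree (sol K d op z)) \<or> (set (node_kids d op z) \<subseteq> set ns \<and>
      children (h z) = map h (node_kids d op z) \<and> children (sol K d op z) = map (sol K d op) (node_kids d op z))"
      using solZ[of z] out[OF z] by (cases "z \<in> Z") (auto simp: KT_def)
  qed (use y in auto)
  have fin: "finite_tree (h y) = finite_tree (sol K d op y)" if "y \<in> set ns" for y using fin1 fin2 that by blast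
  \<comment> \<open>A node of a small kind is determined and has children of small kinds, so no
    opaque leaf is ever reached from \<open>x\<close>.\<close>
  have "sol K d op x \<in> trees S (vsort x)"
  proof (rule trees_coinduct[where X = "\<lambda>s t. \<exists>y \<in> set ns. t = sol K d op y \<and> s = vsort y \<and> small S s (finite_tree t)"])
    show "\<exists>y \<in> set ns. sol K d op x = sol K d op y \<and> vsort x = vsort y \<and> small S (vsort x) (finite_tree (sol K d op x))"
      using x sm by blast
    fix s t assume "\<exists>y \<in> set ns. t = sol K d op y \<and> s = vsort y \<and> small S s (finite_tree t)"
    then obtain y where y: "y \<in> set ns" "t = sol K d op y" "s = vsort y" "small S (vsort y) (finite_tree (sol K d op y))" by blast
    have yZ: "y \<in> Z"
    proof (rule ccontr)
      assume "y \<notin> Z"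
      then obtain b where b: "(y, b) \<in> set op" using wf_stateD(3)[OF v y(1)] y(1) unfolding Z_def by blast
      have "(vsort y, b) \<in> big_kinds S" using wf_stateD(5)[OF v b] by blast
      then show False using sol_opq(2)[OF v b, of K] y(4) unfolding big_kinds_def by simp
    qed
    obtain g ws where q: "(y, g, ws) \<in> set d" "node_lab K d op y = g" "node_kids d op y = ws" "det_ok G ns (y, g, ws)"
      using Zd[OF yZ] by blast
    have sy: "sol K d op y = Node g (map (sol K d op) ws)" using sol_det[OF v q(1)] .
    have hy: "h y = Node g (map h ws)" using hs yZ q unfolding solves_def by auto
    have hyT: "Node g (map h ws) \<in> trees S (vsort y)" using hT[OF y(1)] hy by simp
    have smh: "small S (vsort y) (finite_tree (Node g (map h ws)))" using y(4) fin[OF y(1)] hy by simp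
    have ck: "(\<exists>z \<in> set ns. sol K d op (ws ! i) = sol K d op z \<and> gargs g ! i = vsort z \<and>
        small S (gargs g ! i) (finite_tree (sol K d op (ws ! i))))" if i: "i < length ws" for i
    proof -
      have wi: "ws ! i \<in> set ns" using det_okD(5)[OF q(4)] i nth_mem by blast
      have gi: "gargs g ! i = vsort (ws ! i)" using det_okD(4)[OF q(4)] i by (metis nth_map)
      have "small S (gargs g ! i) (finite_tree (map h ws ! i))" using small_child[OF hyT smh] i by simp
      then have "small S (gargs g ! i) (finite_tree (sol K d op (ws ! i)))" using fin[OF wi] i by simp
      then show ?thesis using wi gi by blast
    qed
    have len: "length (gargs g) = length ws" using det_okD(4)[OF q(4)] by (metis length_map)
    show "root t \<in> gens S \<and> gres (root t) = s \<and> list_all2 (\<lambda>s t. (\<exists>y \<in> set ns. t = sol K d op y \<and> s = vsort y \<and>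
        small S s (finite_tree t)) \<or> t \<in> trees S s) (gargs (root t)) (children t)"
      unfolding y(2) sy y(3) tree.sel list_all2_conv_all_nth
      using det_okD(2,3)[OF q(4)] G len ck by auto
  qed
  then show ?thesis using small_treesI[OF S] sm by blast
qed

text \<open>Small trees contain only generators from \<open>base_gens\<close>, so they also are
  trees of the signature of the states.\<close>

lemma small_opq_sig:
  assumes S: "tree_signature S" and G: "base_gens S \<subseteq> G"
  shows "small_trees S \<subseteq> W (opq_sig S G K)"
proof
  fix t assume t: "t \<in> small_trees S"
  have "t \<in> trees (opq_sig S G K) (gres (root t))"
  proof (rule trees_coinduct[where X = "\<lambda>s t. t \<in> small_trees S \<and> s = gres (root t)"])
    fix s t assume t: "t \<in> small_trees S \<and> s = gres (root t)"
    have r: "root t \<in> gens (opq_sig S G K)" using small_trees_root[of t S] t G unfolding opq_sig_def by auto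
    have tt: "t \<in> trees S (gres (root t))" using small_treesD[of t] t by blast
    have "list_all2 (\<lambda>s t. t \<in> trees S s) (gargs (root t)) (children t)" using tt trees_iff by blast
    then have "list_all2 (\<lambda>s t. (t \<in> small_trees S \<and> s = gres (root t)) \<or> t \<in> trees (opq_sig S G K) s) (gargs (root t)) (children t)"
      using small_trees_child[OF S, of t] t by (auto simp: list_all2_conv_all_nth trees_sort)
    then show "root t \<in> gens (opq_sig S G K) \<and> gres (root t) = s \<and>
        list_all2 (\<lambda>s t. (t \<in> small_trees S \<and> s = gres (root t)) \<or> t \<in> trees (opq_sig S G K) s) (gargs (root t)) (children t)"
      using r t by blast
  qed (use t in blast)
  then show "t \<in> W (opq_sig S G K)" unfolding W_def by blast
qed

section \<open>Links between trees and symbolic states\<close>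

text \<open>The invariant of the evaluation. The last clause keeps all partners among the values of
  nodes; this is inherited by deeper levels, so that a partner can always be named by a
  node.\<close>

definition link :: "signature \<Rightarrow> gen set \<Rightarrow> nat \<Rightarrow> nat \<Rightarrow> var list \<Rightarrow> det list \<Rightarrow> opq list \<Rightarrow> (tree \<times> tree) set \<Rightarrow> bool" where
  "link S G K N ns d op M \<longleftrightarrow> finite M \<and> M \<subseteq> W S \<times> W (opq_sig S G K) \<and> Id_on (small_trees S) \<subseteq> M \<and> eqv G N M \<and>
     Range M \<subseteq> sol K d op ` set ns"

lemma link_extend:
  assumes l: "link S G K N ns d op M" and v: "wf_state S G k ns d op" and v': "wf_state S G k' ns' d' op'"
    and sub: "set d \<subseteq> set d'" "set op \<subseteq> set op'" "set ns \<subseteq> set ns'" and c: "c \<in> trees S (vsort x)"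
    and x: "x \<in> set ns'" and e: "eqv G n (insert (c, sol K d' op' x) M)"
  shows "link S G K n ns' d' op' (insert (c, sol K d' op' x) M)"
proof -
  have "sol K d op ` set ns \<subseteq> sol K d' op' ` set ns'"
  proof
    fix t assume "t \<in> sol K d op ` set ns"
    then obtain y where "y \<in> set ns" "t = sol K d op y" by blast
    then show "t \<in> sol K d' op' ` set ns'" using sol_extend[OF v v' sub(1,2), of y K] sub(3) by force
  qed
  moreover have "sol K d' op' x \<in> W (opq_sig S G K)" using sol_trees[OF v' x] by (rule W_trees)
  moreover have "Range (insert (c, sol K d' op' x) M) = insert (sol K d' op' x) (Range M)" by auto
  moreover have "sol K d' op' x \<in> sol K d' op' ` set ns'" using x by blast
  ultimately show ?thesis using l e W_trees[OF c] unfolding link_def by (simp add: insert_absorb subset_insertI2) blast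
qed

text \<open>From a node to a tree of \<open>S\<close>, by the back-and-forth step for the converse
  matching. An opaque leaf at depth less than \<open>n\<close> has a root outside \<open>G\<close>,
  hence its partner needs one, too; \<open>ok\<close> says that there are enough of them.\<close>

lemma sym_back:
  assumes pre: "ef_pre S G" and v: "wf_state S G k ns d op" and v': "wf_state S G k' ns' d' op'" and K: "\<forall>g \<in> G. gname g < K"
    and r: "\<And>g. g \<in> G \<Longrightarrow> length (gargs g) \<le> r" and N: "n + 2 * Suc r ^ n + 1 \<le> N"
    and l: "link S G K N ns d op M" and x: "x \<in> set ns'"
    and ok: "\<And>t. t \<in> inn G n (sol K d' op' x) \<Longrightarrow> root t \<notin> G \<Longrightarrow> infinite (root ` KT S (gres (root t)) (finite_tree t))"
  shows "\<exists>c \<in> trees S (vsort x). eqv G n (insert (c, sol K d' op' x) M)"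
proof -
  have S: "tree_signature S" "finite G" "base_gens S \<subseteq> G" "G \<subseteq> gens S" using pre unfolding ef_pre_def by auto
  have M: "finite M" "M \<subseteq> W S \<times> W (opq_sig S G K)" "Id_on (small_trees S) \<subseteq> M" "eqv G N M"
    using l unfolding link_def by auto
  have "\<exists>c \<in> trees S (vsort x). eqv G n (insert (sol K d' op' x, c) (M\<inverse>))"
  proof (rule ef_extend[where U = "small_trees S" and N = N])
    show "M\<inverse> \<subseteq> W (opq_sig S G K) \<times> W S" using M(2) by blast
    show "finite (M\<inverse>)" using M(1) by simp
    show "eqv G N (M\<inverse>)" using eqv_converse[OF M(4)] .
    show "n + 2 * Suc r ^ n + 1 \<le> N" by (rule N)
    show "sol K d' op' x \<in> trees (opq_sig S G K) (vsort x)" by (rule sol_trees[OF v' x])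
    show "G \<subseteq> gens S" by (rule S(4))
    show "length (gargs g) \<le> r" if "g \<in> G" for g using r that .
    show "small_trees S \<subseteq> Domain (M\<inverse>)" using M(3) by blast
    fix y and E :: "tree set" and P :: "nat list set"
    assume y: "y \<in> rch G n (sol K d' op' x)" "y \<notin> small_trees S" and fin: "finite E" "finite P" "[] \<notin> P"
    obtain z where z: "z \<in> set ns'" "y = sol K d' op' z" using rch_sol[OF v' K x] y(1) by blast
    have "\<not> small S (gres (root y)) (finite_tree y)"
      using sol_small[OF S(1,4) v' K z(1)] y(2) z sol_sort[OF v' z(1)] by auto
    from big_sort_supply[OF S(2) this _ fin, of "y \<in> inn G n (sol K d' op' x) \<and> root y \<notin> G"] ok[of y]
    show "\<exists>u\<in>KT S (gres (root y)) (finite_tree y). u \<notin> E \<and> (y \<in> inn G n (sol K d' op' x) \<longrightarrow> root y \<notin> G \<longrightarrow> root u \<notin> G) \<and>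
       (root u \<notin> G \<or> (\<forall>p\<in>P. sub u p \<noteq> Some u))" by blast
  qed
  then obtain c where c: "c \<in> trees S (vsort x)" "eqv G n (insert (sol K d' op' x, c) (M\<inverse>))" by blast
  have "(insert (sol K d' op' x, c) (M\<inverse>))\<inverse> = insert (c, sol K d' op' x) M" by auto
  then show ?thesis using eqv_converse[OF c(2)] c(1) by auto
qed

definition fresh_names :: "nat \<Rightarrow> signature \<Rightarrow> nat \<Rightarrow> var list \<Rightarrow> bool" where
  "fresh_names k S q nn \<longleftrightarrow> length nn = q \<and> (\<forall>i < q. vname (nn ! i) = k + i \<and> vsort (nn ! i) \<in> sorts S)"

fun completions :: "signature \<Rightarrow> gen set \<Rightarrow> var list \<Rightarrow> var list \<Rightarrow> (det list \<times> opq list) set" where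
  "completions S G ns [] = {([], [])}"
| "completions S G ns (v # nn) = {((v, q) # d, op) |q d op. det_ok G ns (v, q) \<and> (d, op) \<in> completions S G ns nn} \<union>
     {(d, (v, b) # op) |b d op. (vsort v, b) \<in> big_kinds S \<and> (d, op) \<in> completions S G ns nn}"

lemma completionsD:
  "(d, op) \<in> completions S G ns nn \<Longrightarrow> (\<forall>p \<in> set d. det_ok G ns p \<and> fst p \<in> set nn) \<and>
     (\<forall>p \<in> set op. (vsort (fst p), snd p) \<in> big_kinds S \<and> fst p \<in> set nn) \<and>
     (\<forall>v \<in> set nn. v \<in> fst ` set d \<or> v \<in> fst ` set op) \<and> (distinct nn \<longrightarrow> distinct (map fst d @ map fst op))"
proof (induction nn arbitrary: d op)
  case (Cons v nn)
  from Cons.prems consider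
      (det) q d0 where "d = (v, q) # d0" "det_ok G ns (v, q)" "(d0, op) \<in> completions S G ns nn"
    | (opq) b op0 where "op = (v, b) # op0" "(vsort v, b) \<in> big_kinds S" "(d, op0) \<in> completions S G ns nn"
    by auto
  then show ?case
  proof cases
    case det
    have "v \<notin> fst ` set d0 \<and> v \<notin> fst ` set op" if "v \<notin> set nn" using Cons.IH[OF det(3)] that by blast
    then show ?thesis using Cons.IH[OF det(3)] det(1,2) by auto
  next
    case opq
    have "v \<notin> fst ` set d \<and> v \<notin> fst ` set op0" if "v \<notin> set nn" using Cons.IH[OF opq(3)] that by blast
    then show ?thesis using Cons.IH[OF opq(3)] opq(1,2) by auto
  qed
qed simp

lemma completions_ex:
  assumes "\<And>v. v \<in> set nn \<Longrightarrow> P v \<Longrightarrow> det_ok G ns (v, f v)" "\<And>v. v \<in> set nn \<Longrightarrow> \<not> P v \<Longrightarrow> (vsort v, b v) \<in> big_kinds S"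
  shows "(map (\<lambda>v. (v, f v)) (filter P nn), map (\<lambda>v. (v, b v)) (filter (\<lambda>v. \<not> P v) nn)) \<in> completions S G ns nn"
  using assms
proof (induction nn)
  case (Cons a nn)
  have "(map (\<lambda>v. (v, f v)) (filter P nn), map (\<lambda>v. (v, b v)) (filter (\<lambda>v. \<not> P v) nn)) \<in> completions S G ns nn"
    using Cons by simp
  moreover have "det_ok G ns (a, q) \<Longrightarrow> (d, op) \<in> completions S G ns nn \<Longrightarrow> ((a, q) # d, op) \<in> completions S G ns (a # nn)"
    "(vsort a, b') \<in> big_kinds S \<Longrightarrow> (d, op) \<in> completions S G ns nn \<Longrightarrow> (d, (a, b') # op) \<in> completions S G ns (a # nn)" for d op q b'
    unfolding completions.simps by blast+
  ultimately show ?case using Cons.prems(1)[of a] Cons.prems(2)[of a] by (cases "P a") simp_all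
qed simp

lemma fresh_namesD:
  assumes "fresh_names k S q nn" and "v \<in> set nn"
  shows "k \<le> vname v" "vname v < k + q" "vsort v \<in> sorts S"
  using assms unfolding fresh_names_def by (auto simp: in_set_conv_nth)

lemma fresh_distinct: "fresh_names k S q nn \<Longrightarrow> distinct nn"
  unfolding fresh_names_def distinct_conv_nth by (metis nat_add_left_cancel_less nat_neq_iff)

lemma wf_state_unique:
  "wf_state S G k ns d op \<longleftrightarrow>
     (\<forall>v \<in> set ns. vname v < k \<and> vsort v \<in> sorts S \<and> (v \<in> fst ` set d \<or> v \<in> fst ` set op)) \<and>
     (\<forall>p \<in> set d. det_ok G ns p) \<and> (\<forall>p \<in> set op. fst p \<in> set ns \<and> (vsort (fst p), snd p) \<in> big_kinds S) \<and>
     inj_on fst (set d) \<and> inj_on fst (set op) \<and> fst ` set d \<inter> fst ` set op = {}"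
proof -
  have 1: "(\<exists>q. (v, q) \<in> set d) \<longleftrightarrow> v \<in> fst ` set d" "(\<exists>b. (v, b) \<in> set op) \<longleftrightarrow> v \<in> fst ` set op" for v
    by force+
  have 2: "inj_on fst A \<longleftrightarrow> (\<forall>p \<in> A. \<forall>q \<in> A. fst p \<noteq> fst q \<or> p = q)" for A :: "('a \<times> 'b) set"
    unfolding inj_on_def by blast
  have 3: "fst ` set d \<inter> fst ` set op = {} \<longleftrightarrow> (\<forall>p \<in> set d. \<forall>q \<in> set op. fst p \<noteq> fst q)"
    by blast
  show ?thesis unfolding wf_state_def 1 3 inj_on_def by blast
qed

lemma det_ok_mono: "det_ok G ns p \<Longrightarrow> set ns \<subseteq> set ns' \<Longrightarrow> det_ok G ns' p"
  unfolding det_ok_def by blast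

lemma completions_wf_state:
  assumes v: "wf_state S G k ns d op" and nn: "fresh_names k S q nn" and c: "(d', op') \<in> completions S G (nn @ ns) nn"
  shows "wf_state S G (k + q) (nn @ ns) (d' @ d) (op' @ op)"
proof -
  have C: "\<And>p. p \<in> set d' \<Longrightarrow> det_ok G (nn @ ns) p \<and> fst p \<in> set nn"
    "\<And>p. p \<in> set op' \<Longrightarrow> (vsort (fst p), snd p) \<in> big_kinds S \<and> fst p \<in> set nn"
    "\<And>v. v \<in> set nn \<Longrightarrow> v \<in> fst ` set d' \<or> v \<in> fst ` set op'"
    "distinct (map fst d' @ map fst op')"
    using completionsD[OF c] fresh_distinct[OF nn] by blast+
  have V: "\<And>v. v \<in> set ns \<Longrightarrow> vname v < k \<and> vsort v \<in> sorts S \<and> (v \<in> fst ` set d \<or> v \<in> fst ` set op)"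
    "\<And>p. p \<in> set d \<Longrightarrow> det_ok G ns p" "\<And>p. p \<in> set op \<Longrightarrow> fst p \<in> set ns \<and> (vsort (fst p), snd p) \<in> big_kinds S"
    "inj_on fst (set d)" "inj_on fst (set op)" "fst ` set d \<inter> fst ` set op = {}"
    using v unfolding wf_state_unique by blast+
  have old: "fst ` set d \<subseteq> set ns" "fst ` set op \<subseteq> set ns" using V(2,3) unfolding det_ok_def by blast+
  have new: "fst ` set d' \<subseteq> set nn" "fst ` set op' \<subseteq> set nn" using C(1,2) by blast+
  have dis: "set ns \<inter> set nn = {}"
  proof -
    have "x \<notin> set nn" if "x \<in> set ns" for x using V(1)[OF that] fresh_namesD(1)[OF nn] by (meson leD)
    then show ?thesis by blast
  qed
  have inj: "inj_on fst (set d')" "inj_on fst (set op')" "fst ` set d' \<inter> fst ` set op' = {}"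
    using C(4) by (auto simp: distinct_map)
  show ?thesis unfolding wf_state_unique
  proof (intro conjI ballI)
    fix v assume v: "v \<in> set (nn @ ns)"
    show "vname v < k + q" "vsort v \<in> sorts S" "v \<in> fst ` set (d' @ d) \<or> v \<in> fst ` set (op' @ op)"
      using v V(1)[of v] C(3)[of v] fresh_namesD(2,3)[OF nn, of v] by auto
  next
    fix p assume "p \<in> set (d' @ d)"
    then show "det_ok G (nn @ ns) p" using C(1)[of p] det_ok_mono[OF V(2), of p "nn @ ns"]
      by (auto simp del: split_paired_All)
  next
    fix p assume "p \<in> set (op' @ op)"
    then show "fst p \<in> set (nn @ ns)" "(vsort (fst p), snd p) \<in> big_kinds S" using C(2)[of p] V(3)[of p] by auto
  next
    have dj: "fst ` set d' \<inter> fst ` set d = {}" "fst ` set op' \<inter> fst ` set op = {}"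
      "fst ` set d' \<inter> fst ` set op = {}" "fst ` set d \<inter> fst ` set op' = {}"
      using old new dis unfolding disjoint_iff subset_iff by metis+
    have "fst ` (set d' - set d) \<inter> fst ` (set d - set d') = {}" "fst ` (set op' - set op) \<inter> fst ` (set op - set op') = {}"
      using dj(1,2) image_mono[OF Diff_subset] unfolding disjoint_iff subset_iff by metis+
    then show "inj_on fst (set (d' @ d))" "inj_on fst (set (op' @ op))"
      using inj V(4,5) by (simp_all add: inj_on_Un)
    show "fst ` set (d' @ d) \<inter> fst ` set (op' @ op) = {}"
      unfolding set_append image_Un Int_Un_distrib Int_Un_distrib2 using inj(3) V(6) dj(3,4) by simp
  qed
qed

text \<open>A visible path below \<open>d\<close> can be followed below \<open>c\<close>, because
  roots in \<open>G\<close> agree at all levels on the way.\<close>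

lemma eqv_inn_partner:
  assumes e: "eqv G n M" and cd: "(c, d) \<in> M" and W: "c \<in> W S1" "d \<in> W S2"
  shows "k < n \<Longrightarrow> u \<in> rch G k d \<Longrightarrow> \<exists>t \<in> rch G k c. (t, u) \<in> lev G k M"
proof (induction k arbitrary: u)
  case 0
  then show ?case using cd by simp
next
  case (Suc k)
  show ?case
  proof (cases "u \<in> rch G k d")
    case True
    then obtain t where "t \<in> rch G k c" "(t, u) \<in> lev G k M"
      using Suc.IH[OF Suc_lessD[OF Suc.prems(1)]] by blast
    then show ?thesis by auto
  next
    case False
    then obtain w where w: "w \<in> rch G k d" "root w \<in> G" "u \<in> set (children w)" using Suc.prems by auto
    obtain t where t: "t \<in> rch G k c" "(t, w) \<in> lev G k M" using Suc.IH[OF Suc_lessD[OF Suc.prems(1)] w(1)] by blast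
    have rt: "root t = root w" 
      using eqv_lab[OF e Suc_lessD[OF Suc.prems(1)]] t(2) w(2) unfolding lab_def by metis
    have tw: "t \<in> W S1" "w \<in> W S2" using rch_W[OF W(1)] rch_W[OF W(2)] t(1) w(1) by blast+
    obtain i where i: "i < length (children w)" "u = children w ! i" using w(3) by (auto simp: in_set_conv_nth)
    have len: "length (children t) = length (children w)" using W_length[OF tw(1)] W_length[OF tw(2)] rt by simp
    have "(children t ! i, u) \<in> set (zip (children t) (children w))" using i len by (auto simp: set_zip)
    then have "(children t ! i, u) \<in> nx G (lev G k M)" 
      unfolding nx_def mem_Collect_eq using t(2) w(2) rt by metis
    moreover have "children t ! i \<in> rch G (Suc k) c" using t(1) rt w(2) i(1) len by auto
    ultimately show ?thesis by auto
  qed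
qed

text \<open>From a tree to a node: the unmatched visible subtrees of \<open>c\<close> become new
  nodes, inner ones with an equation and the others opaque, and there are at most
  \<open>Suc r ^ n\<close> of them. No generic trees have to be found, since each opaque leaf has a
  root of its own.\<close>

lemma sym_step:
  assumes pre: "ef_pre S G" and v: "wf_state S G k ns d op" and K: "\<forall>g \<in> G. gname g < K"
    and r: "\<And>g. g \<in> G \<Longrightarrow> length (gargs g) \<le> r" and N: "n + 2 * Suc r ^ n + 1 \<le> N"
    and l: "link S G K N ns d op M" and c: "c \<in> trees S s"
  shows "\<exists>q nn d' op' x. q \<le> Suc r ^ n \<and> fresh_names k S q nn \<and> (d', op') \<in> completions S G (nn @ ns) nn \<and>
     x \<in> set (nn @ ns) \<and> vsort x = s \<and> eqv G n (insert (c, sol K (d' @ d) (op' @ op) x) M)"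
proof -
  have S: "tree_signature S" "finite G" "base_gens S \<subseteq> G" "G \<subseteq> gens S" using pre unfolding ef_pre_def by auto
  have M: "finite M" "M \<subseteq> W S \<times> W (opq_sig S G K)" "Id_on (small_trees S) \<subseteq> M" "eqv G N M" "Range M \<subseteq> sol K d op ` set ns"
    using l unfolding link_def by auto
  define B where "B = Suc r ^ n"
  have cW: "c \<in> W S" using c by (rule W_trees)
  have card: "card (rch G n c) \<le> B" unfolding B_def by (rule card_rch[OF cW r])
  obtain m where m: "n \<le> m" "m \<le> n + B" "rch G n c \<inter> Domain (lev G (Suc m) M) \<subseteq> Domain (lev G m M)"
    using ef_stable[OF card] by blast
  define D where "D = lev G m M"
  define X where "X = newt G n c D"
  define Z where "Z = innert G n c D"
  have ZX: "Z \<subseteq> X" unfolding Z_def X_def innert_def by blast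
  have Xr: "X \<subseteq> rch G n c" unfolding X_def newt_def by blast
  have finX: "finite X" using Xr finite_rch finite_subset by blast
  have XW: "X \<subseteq> W S" using Xr rch_W[OF cW] by blast
  have Wsort: "gres (root t) \<in> sorts S" if "t \<in> W S" for t
    using trees_sorts[OF S(1)] \<open>t \<in> W S\<close> unfolding W_def by blast
  obtain xl where xl: "set xl = X" "distinct xl" using finite_distinct_list[OF finX] by blast
  define q where "q = length xl"
  have qB: "q \<le> B" using card_mono[OF finite_rch Xr] card distinct_card[OF xl(2)] xl(1) unfolding q_def by simp
  \<comment> \<open>The new nodes are numbered from \<open>k\<close> on in the order of
    \<open>xl\<close>, so that \<open>iv\<close> can recover the subtree from the number in the
    name.\<close>
  define nn where "nn = map (\<lambda>i. V (k + i) (gres (root (xl ! i)))) [0..<q]"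
  have "\<forall>t \<in> X. \<exists>i. i < q \<and> xl ! i = t" using xl(1) unfolding q_def by (auto simp: in_set_conv_nth)
  then obtain f where f: "\<And>t. t \<in> X \<Longrightarrow> f t < q \<and> xl ! f t = t" by metis
  define nmX where "nmX t = V (k + f t) (gres (root t))" for t
  define iv where "iv w = xl ! (vname w - k)" for w
  have iv: "iv (nmX t) = t" if "t \<in> X" for t using f[OF that] unfolding iv_def nmX_def by simp
  have nmX: "nmX t \<in> set nn" if "t \<in> X" for t
    using f[OF that] unfolding nmX_def nn_def by (auto intro!: image_eqI[of _ _ "f t"])
  have nn_ex: "iv w \<in> X \<and> w = nmX (iv w) \<and> vsort w = gres (root (iv w))" if w: "w \<in> set nn" for w
  proof -
    obtain i where i: "i < q" "w = V (k + i) (gres (root (xl ! i)))" using w unfolding nn_def by auto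
    have iX: "xl ! i \<in> X" using xl(1) i(1) unfolding q_def by (metis nth_mem)
    have "f (xl ! i) = i" 
      using f[OF iX] i(1) nth_eq_iff_index_eq[OF xl(2), of "f (xl ! i)" i] unfolding q_def by simp
    then show ?thesis using i iX unfolding iv_def nmX_def by simp
  qed
  have fresh: "fresh_names k S q nn"
    unfolding fresh_names_def
  proof (intro conjI allI impI)
    fix i assume i: "i < q"
    have "xl ! i \<in> X" using xl(1) i unfolding q_def by (metis nth_mem)
    then show "vsort (nn ! i) \<in> sorts S" using i Wsort XW unfolding nn_def by auto
  qed (simp_all add: nn_def)
  have goodD': "good D" unfolding D_def using m N by (intro eqv_good[OF M(4)]) (auto simp: B_def)
  have DW: "D \<subseteq> W S \<times> W (opq_sig S G K)" unfolding D_def by (rule lev_W[OF M(2)])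
  have levR: "Range (lev G j M) \<subseteq> sol K d op ` set ns" for j by (rule lev_sol[OF v K M(5)])
  have "\<forall>t \<in> Domain D. \<exists>w \<in> set ns. (t, sol K d op w) \<in> D" using levR[of m] unfolding D_def by blast
  then obtain f0 where f0: "\<And>t. t \<in> Domain D \<Longrightarrow> f0 t \<in> set ns \<and> (t, sol K d op (f0 t)) \<in> D" by metis
  define nm where "nm t = (if t \<in> X then nmX t else f0 t)" for t
  have nm_in: "nm t \<in> set (nn @ ns) \<and> vsort (nm t) = gres (root t)" if "t \<in> rch G n c" for t
  proof (cases "t \<in> X")
    case True
    then show ?thesis using nmX unfolding nm_def by (simp add: nmX_def)
  next
    case False
    then have t: "t \<in> Domain D" using that unfolding X_def newt_def by blast
    have "gres (root t) = gres (root (sol K d op (f0 t)))" using goodD(1)[OF goodD'] f0[OF t] by blast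
    then show ?thesis using f0[OF t] sol_sort[OF v, of "f0 t" K] False unfolding nm_def by simp
  qed
  define isd where "isd w \<longleftrightarrow> iv w \<in> Z" for w
  define fq where "fq w = (root (iv w), map nm (children (iv w)))" for w
  define fb where "fb w = (if finite_tree (iv w) then 1 else 0 :: nat)" for w
  define d' where "d' = map (\<lambda>w. (w, fq w)) (filter isd nn)"
  define op' where "op' = map (\<lambda>w. (w, fb w)) (filter (\<lambda>w. \<not> isd w) nn)"
  have UD: "small_trees S \<subseteq> Domain D" using M(3) lev_mono[of 0 m G M] unfolding D_def by auto
  have Zin: "t \<in> X \<and> root t \<in> G \<and> t \<in> inn G n c" if "t \<in> Z" for t
    using that unfolding Z_def X_def innert_def by blast
  have cp: "(d', op') \<in> completions S G (nn @ ns) nn"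
    unfolding d'_def op'_def
  proof (rule completions_ex)
    fix w assume w: "w \<in> set nn"
    have wX: "iv w \<in> X" "vsort w = gres (root (iv w))" using nn_ex[OF w] by auto
    have wT: "iv w \<in> trees S (gres (root (iv w)))" using XW wX unfolding W_def by blast
    show "det_ok G (nn @ ns) (w, fq w)" if "isd w"
    proof -
      have z: "root (iv w) \<in> G" "iv w \<in> inn G n c" using Zin \<open>isd w\<close> unfolding isd_def by auto
      have ch: "u \<in> rch G n c" if "u \<in> set (children (iv w))" for u using inn_child[OF z(2,1) that] .
      have "list_all2 (\<lambda>s t. t \<in> trees S s) (gargs (root (iv w))) (children (iv w))" using wT trees_iff by blast
      then have "list_all2 (\<lambda>w s. vsort w = s) (map nm (children (iv w))) (gargs (root (iv w)))"
        using nm_in ch by (auto simp: list_all2_conv_all_nth trees_sort)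
      then show ?thesis using w wX z(1) nm_in ch unfolding det_ok_def fq_def by auto
    qed
    show "(vsort w, fb w) \<in> big_kinds S" if "\<not> isd w"
    proof -
      have "iv w \<notin> small_trees S" using wX(1) UD unfolding X_def newt_def by blast
      then have "\<not> small S (vsort w) (finite_tree (iv w))" 
        using small_treesI[OF S(1) wT] wX(2) by metis
      then show ?thesis using trees_sorts[OF S(1) wT] wX(2) unfolding big_kinds_def fb_def
        by (cases "finite_tree (iv w)") simp_all
    qed
  qed
  have v': "wf_state S G (k + q) (nn @ ns) (d' @ d) (op' @ op)" by (rule completions_wf_state[OF v fresh cp])
  have ext: "sol K (d' @ d) (op' @ op) x = sol K d op x" if "x \<in> set ns" for x
    by (rule sol_extend[OF v v' _ _ that]) auto
  define h where "h t = sol K (d' @ d) (op' @ op) (nm t)" for t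
  have hZ: "h t = Node (root t) (map h (children t))" if t: "t \<in> Z" for t
  proof -
    have tX: "t \<in> X" using ZX t by blast
    have "nmX t \<in> set nn" "isd (nmX t)" using nmX[OF tX] t iv[OF tX] unfolding isd_def by auto
    then have "(nmX t, root t, map nm (children t)) \<in> set (d' @ d)"
      using iv[OF tX] unfolding d'_def fq_def by (auto intro!: image_eqI[of _ _ "nmX t"])
    then show ?thesis using sol_det[OF v', of "nmX t" "root t" "map nm (children t)" K] tX
      unfolding h_def nm_def[of t] by (simp add: h_def comp_def)
  qed
  have hY: "root (h t) = opq_gen K (nmX t) (fb (nmX t)) \<and> finite_tree (h t) = finite_tree t" if t: "t \<in> X" "t \<notin> Z" for t
  proof -
    have "nmX t \<in> set nn" "\<not> isd (nmX t)" using nmX[OF t(1)] t iv[OF t(1)] unfolding isd_def by auto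
    then have o: "(nmX t, fb (nmX t)) \<in> set (op' @ op)" unfolding op'_def by auto
    have ht: "h t = sol K (d' @ d) (op' @ op) (nmX t)" unfolding h_def nm_def using t(1) by simp
    show ?thesis using sol_opq[OF v' o, of K] iv[OF t(1)] unfolding ht fb_def by simp
  qed
  have nmX_inj: "t = t'" if "t \<in> X" "t' \<in> X" "nmX t = nmX t'" for t t' using iv that by metis
  have Yin: "y \<in> X \<and> y \<notin> Z" if "y \<in> leaft G n c D" for y
    using that unfolding leaft_def X_def Z_def by blast
  have "eqv G n (insert (c, h c) M)"
  proof (rule ef_core[OF M(2,4) _ m(1) cW card D_def m(3)[folded D_def]])
    show "m + B + 1 \<le> N" using m N unfolding B_def by simp
    show "solves (innert G n c D) root children h" using hZ unfolding Z_def solves_def by blast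
    show "(t, h t) \<in> D" if t: "t \<in> Domain D" for t
    proof -
      have "t \<notin> X" using t unfolding X_def newt_def by blast
      then show ?thesis using f0[OF t] ext unfolding h_def nm_def by simp
    qed
    fix y assume y: "y \<in> leaft G n c D"
    have yX: "y \<in> X" "y \<notin> Z" using Yin[OF y] by auto
    \<comment> \<open>Partners at any level are values of old nodes, whose names are below
      \<open>k\<close>, while the root of \<open>h y\<close> records a name from \<open>k\<close>
      on.\<close>
    have "h y \<notin> Range (lev G (m + B + 1) M)"
    proof
      assume "h y \<in> Range (lev G (m + B + 1) M)"
      then obtain x where x: "x \<in> set ns" "h y = sol K d op x" using levR by blast
      have "root (h y) \<notin> G" using hY[OF yX] opq_gen_notin[OF K] by simp
      then obtain b where "root (h y) = opq_gen K x b" using root_cases[OF v K x(1)] x(2) by auto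
      then have "nmX y = x" using hY[OF yX] opq_gen_inj[of K "nmX y" "fb (nmX y)" x b] by auto
      then have "vname x = k + f y" unfolding nmX_def by auto
      then show False using wf_stateD(1)[OF v x(1)] by simp
    qed
    moreover have "root (h y) \<notin> G" using hY[OF yX] opq_gen_notin[OF K] by simp
    moreover have "gres (root (h y)) = gres (root y)" using hY[OF yX] by (simp add: opq_gen_def nmX_def)
    ultimately show "gres (root (h y)) = gres (root y) \<and> finite_tree (h y) = finite_tree y \<and>
        (y \<in> inn G n c \<longrightarrow> root (h y) \<notin> G) \<and> h y \<notin> Range (lev G (m + B + 1) M)"
      using hY[OF yX] by blast
    fix x assume x: "x \<in> newt G n c D" "x \<noteq> y"
    have xX: "x \<in> X" using x(1) unfolding X_def .
    show "h x \<noteq> h y"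
    proof
      assume e: "h x = h y"
      show False
      proof (cases "x \<in> Z")
        case True
        then have "root (h x) \<in> G" using hZ[OF True] Zin[OF True] by simp
        then show False using e hY[OF yX] opq_gen_notin[OF K] by simp
      next
        case False
        then have "opq_gen K (nmX x) (fb (nmX x)) = opq_gen K (nmX y) (fb (nmX y))" using e hY[OF yX] hY[OF xX False] by simp
        then show False using opq_gen_inj nmX_inj[OF xX yX(1)] x(2) by blast
      qed
    qed
  qed
  moreover have "h c = sol K (d' @ d) (op' @ op) (nm c)" unfolding h_def ..
  moreover have "nm c \<in> set (nn @ ns)" "vsort (nm c) = s" using nm_in[OF rch_self] trees_sort[OF c] by auto
  ultimately show ?thesis using qB fresh cp unfolding B_def by metis
qed

text \<open>The condition under which a node can be realised by a tree also is necessary: the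
  invisible root of a shallow node is matched with an invisible root, which exists only in a kind
  with infinitely many roots. Hence nodes violating it may be skipped when a formula is
  refuted.\<close>

lemma eqv_shallow:
  assumes pre: "ef_pre S G" and e: "eqv G n M" and cd: "(c, d) \<in> M" and W: "c \<in> W S" "d \<in> W S2"
    and u: "u \<in> inn G n d" "root u \<notin> G"
  shows "infinite (root ` KT S (gres (root u)) (finite_tree u))"
proof -
  have S: "tree_signature S" "base_gens S \<subseteq> G" using pre unfolding ef_pre_def by auto
  obtain k where k: "n = Suc k" "u \<in> rch G k d" using u(1) unfolding inn_def by (cases n) auto
  obtain t where t: "t \<in> rch G k c" "(t, u) \<in> lev G k M" using eqv_inn_partner[OF e cd W, of k u] k by auto
  have tT: "t \<in> trees S (gres (root t))" using rch_W[OF W(1)] t(1) unfolding W_def by blast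
  have g: "good (lev G k M)" using eqv_good[OF e] k(1) by simp
  have "lab G (lev G k M)" using eqv_lab[OF e] k(1) by simp
  then have "root t \<notin> G" using t(2) u(2) unfolding lab_def by metis
  then show ?thesis using not_base_infinite[OF S tT] goodD(1,2)[OF g t(2)] by simp
qed

subsection \<open>Finitely enumerable families\<close>

text \<open>A total function with semi-decidable graph is computed by searching for its value. This
  replaces explicit recursions: it suffices to describe the value.\<close>

lemma tc_graph:
  assumes "re (\<lambda>z. f (fst z) = snd z)"
  shows "tc f"
proof -
  have R: "re (\<lambda>z. enc (f (dec (fst z))) = (snd z :: nat))"
  proof -
    have "re (\<lambda>z :: nat \<times> nat. f (dec (fst z)) = dec (snd z))"
      using re_comp[OF assms, of "\<lambda>z :: nat \<times> nat. (dec (fst z), dec (snd z))"] by (simp add: tc_intros tc_dec)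
    moreover have "f (dec a) = dec b \<longleftrightarrow> enc (f (dec a)) = b" for a b :: nat by (metis dec_enc enc_dec)
    ultimately show ?thesis by simp
  qed
  obtain r where r: "\<And>x :: nat. \<exists>y :: nat. computes r [x] y \<and> enc (f (dec x)) = y"
    using re_selection[OF R, of "\<lambda>x. True"] by blast
  have "computes r xs (enc (f (dec (xs ! 0))))" if "length xs = Suc 0" for xs
    using r[of "xs ! 0"] that by (cases xs) auto
  then show ?thesis unfolding tc_def rc_def by blast
qed

lemma re_length: "tc f \<Longrightarrow> tc g \<Longrightarrow> re (\<lambda>x. length (f x) = g x)"
proof -
  assume fg: "tc f" "tc g"
  have "re (\<lambda>x. drop (g x) (f x) = [] \<and> (\<forall>i < g x. drop i (f x) \<noteq> []))"
    by (intro re_intros tc_intros tc_comp[OF fg(1)] tc_comp[OF fg(2)])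
  moreover have "drop n xs = [] \<and> (\<forall>i < n. drop i xs \<noteq> []) \<longleftrightarrow> length xs = n" for n and xs :: "'b list"
    by (auto simp: not_le) (metis le_neq_implies_less less_irrefl)
  ultimately show ?thesis by simp
qed

lemma tc_length: "tc f \<Longrightarrow> tc (\<lambda>x. length (f x))"
proof (rule tc_graph)
  assume f: "tc f"
  show "re (\<lambda>z. length (f (fst z)) = snd z)" by (intro re_length tc_intros tc_comp[OF f])
qed

lemma re_nth: "tc f \<Longrightarrow> tc g \<Longrightarrow> tc h \<Longrightarrow> re (\<lambda>x. f x < length (g x) \<and> g x ! f x = h x)"
proof -
  assume fgh: "tc f" "tc g" "tc h"
  have "re (\<lambda>x. \<exists>zs. drop (f x) (g x) = h x # zs)"
    by (intro re_intros tc_intros tc_comp[OF fgh(1)] tc_comp[OF fgh(2)] tc_comp[OF fgh(3)])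
  moreover have "(\<exists>zs. drop i xs = y # zs) \<longleftrightarrow> i < length xs \<and> xs ! i = y" for i y and xs :: "'b list"
  proof
    assume "\<exists>zs. drop i xs = y # zs"
    then obtain zs where z: "drop i xs = y # zs" by blast
    then have "i < length xs" by (metis drop_all leI list.distinct(1))
    then show "i < length xs \<and> xs ! i = y" using z by (metis Cons_nth_drop_Suc list.inject)
  qed (metis Cons_nth_drop_Suc)
  ultimately show ?thesis by simp
qed

lemma re_comp2: "re (\<lambda>z. P (fst z) (snd z)) \<Longrightarrow> tc a \<Longrightarrow> tc b \<Longrightarrow> re (\<lambda>x. P (a x) (b x))"
  using re_comp[of "\<lambda>z. P (fst z) (snd z)" "\<lambda>x. (a x, b x)"] by (simp add: tc_pair)

lemma re_comp3: "re (\<lambda>z. P (fst z) (fst (snd z)) (snd (snd z))) \<Longrightarrow> tc a \<Longrightarrow> tc b \<Longrightarrow> tc c \<Longrightarrow> re (\<lambda>x. P (a x) (b x) (c x))"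
  using re_comp[of "\<lambda>z. P (fst z) (fst (snd z)) (snd (snd z))" "\<lambda>x. (a x, b x, c x)"] by (simp add: tc_pair)

lemma re_list_all2:
  assumes P: "re (\<lambda>z. P (fst z) (fst (snd z)) (snd (snd z)))" and fg: "tc f" "tc g"
  shows "re (\<lambda>x. list_all2 (P x) (f x) (g x))"
proof -
  have "re (\<lambda>x. length (f x) = length (g x) \<and> (\<forall>i < length (f x). \<exists>a b. (i < length (f x) \<and> f x ! i = a) \<and>
      (i < length (g x) \<and> g x ! i = b) \<and> P x a b))"
    by (intro re_conj re_all_less re_ex re_length re_nth re_comp3[OF P] tc_length tc_intros
        tc_comp[OF fg(1)] tc_comp[OF fg(2)])
  moreover have "length xs = length ys \<and> (\<forall>i < length xs. \<exists>a b. (i < length xs \<and> xs ! i = a) \<and>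
      (i < length ys \<and> ys ! i = b) \<and> P x a b) \<longleftrightarrow> list_all2 (P x) xs ys" for x xs ys
    by (auto simp: list_all2_conv_all_nth)
  ultimately show ?thesis by simp
qed

lemma tc_append: "tc f \<Longrightarrow> tc g \<Longrightarrow> tc (\<lambda>x. f x @ g x)"
proof (rule tc_graph)
  assume fg: "tc f" "tc g"
  have "re (\<lambda>z. length (snd z) = length (f (fst z)) + length (g (fst z)) \<and> drop (length (f (fst z))) (snd z) = g (fst z) \<and>
      (\<forall>i < length (f (fst z)). \<exists>a. (i < length (f (fst z)) \<and> f (fst z) ! i = a) \<and> (i < length (snd z) \<and> snd z ! i = a)))"
    by (intro re_conj re_all_less re_ex re_length re_nth re_eq tc_length tc_intros tc_comp[OF fg(1)] tc_comp[OF fg(2)])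
  moreover have "length l = length xs + length ys \<and> drop (length xs) l = ys \<and>
      (\<forall>i < length xs. \<exists>a. (i < length xs \<and> xs ! i = a) \<and> (i < length l \<and> l ! i = a)) \<longleftrightarrow> xs @ ys = l" for xs ys l :: "'b list"
  proof
    assume l: "length l = length xs + length ys \<and> drop (length xs) l = ys \<and>
      (\<forall>i < length xs. \<exists>a. (i < length xs \<and> xs ! i = a) \<and> (i < length l \<and> l ! i = a))"
    then have "take (length xs) l = xs" by (intro nth_equalityI) auto
    then show "xs @ ys = l" using l append_take_drop_id[of "length xs" l] by simp
  qed (auto simp: nth_append)
  ultimately show "re (\<lambda>z. f (fst z) @ g (fst z) = snd z)" by simp
qed

lemma tc_power: "tc f \<Longrightarrow> tc g \<Longrightarrow> tc (\<lambda>x. f x ^ (g x :: nat) :: nat)"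
proof -
  assume fg: "tc f" "tc g"
  have "tc (\<lambda>x. rec_nat 1 (\<lambda>n y. y * f x) (g x))"
    by (rule tc_rec[where G = "\<lambda>n y x. y * f x"]) (intro tc_intros tc_comp[OF fg(1)] fg(2))+
  moreover have "rec_nat 1 (\<lambda>n y. y * b) m = b ^ m" for b m :: nat by (induction m) auto
  ultimately show ?thesis by simp
qed

lemma tc_upt: "tc f \<Longrightarrow> tc g \<Longrightarrow> tc (\<lambda>x. [f x..<g x])"
proof (rule tc_graph)
  assume fg: "tc f" "tc g"
  have "re (\<lambda>z. length (snd z) = g (fst z) - f (fst z) \<and>
      (\<forall>i < g (fst z) - f (fst z). i < length (snd z) \<and> snd z ! i = f (fst z) + i))"
    by (intro re_conj re_all_less re_length re_nth tc_intros tc_comp[OF fg(1)] tc_comp[OF fg(2)])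
  moreover have "length l = b - a \<and> (\<forall>i < b - a. i < length l \<and> l ! i = a + i) \<longleftrightarrow> [a..<b] = l" for a b and l :: "nat list"
    by (auto intro!: nth_equalityI)
  ultimately show "re (\<lambda>z. [f (fst z)..<g (fst z)] = snd z)" by simp
qed

lemma reop_all_less: "reop (\<lambda>X z. Q X (fst z) (snd z)) \<Longrightarrow> tc k \<Longrightarrow> reop (\<lambda>X x. \<forall>i < (k x :: nat). Q X x i)"
  using reop_ball[of Q "\<lambda>x. [0..<k x]"] by (simp add: tc_upt tc_const atLeast0LessThan Ball_def lessThan_def)

text \<open>Families of finite sets for which "the list enumerates the set" is semi-decidable. Both
  membership and quantification over such a set are then semi-decidable.\<close>

definition fen :: "('a::enc \<Rightarrow> 'b::enc set) \<Rightarrow> bool" where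
  "fen A \<longleftrightarrow> (\<forall>x. finite (A x)) \<and> re (\<lambda>z. set (snd z) = A (fst z))"

lemma fen_list:
  assumes "fen A" shows "\<exists>l. set l = A x"
  using assms finite_list unfolding fen_def by blast

lemma re_fen: "fen A \<Longrightarrow> tc f \<Longrightarrow> tc g \<Longrightarrow> re (\<lambda>x. set (f x) = A (g x))"
  unfolding fen_def using re_comp2[of "\<lambda>a b. set b = A a" g f] by simp

lemma fen_comp: "fen A \<Longrightarrow> tc f \<Longrightarrow> fen (\<lambda>x. A (f x))"
proof -
  assume A: "fen A" and f: "tc f"
  have "re (\<lambda>z. set (snd z) = A (f (fst z)))" by (intro re_fen[OF A] tc_intros tc_comp[OF f])
  then show ?thesis using A unfolding fen_def by blast
qed

lemma re_fen_mem: "fen A \<Longrightarrow> tc f \<Longrightarrow> tc g \<Longrightarrow> re (\<lambda>x. f x \<in> A (g x))"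
proof -
  assume A: "fen A" and fg: "tc f" "tc g"
  have "re (\<lambda>x. \<exists>l. set l = A (g x) \<and> f x \<in> set l)"
    by (intro re_ex re_conj re_fen[OF A] re_mem tc_intros tc_comp[OF fg(1)] tc_comp[OF fg(2)])
  moreover have "(\<exists>l. set l = A (g x) \<and> f x \<in> set l) \<longleftrightarrow> f x \<in> A (g x)" for x using fen_list[OF A, of "g x"] by blast
  ultimately show ?thesis by simp
qed

lemma re_fen_ball:
  assumes A: "fen A" and P: "re (\<lambda>z. P (fst z) (snd z))" shows "re (\<lambda>x. \<forall>y \<in> A x. P x y)"
proof -
  have "re (\<lambda>x. \<exists>l. set l = A x \<and> (\<forall>y \<in> set l. P x y))"
    by (intro re_ex re_conj re_fen[OF A] re_ball re_comp2[OF P] tc_intros)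
  moreover have "(\<exists>l. set l = A x \<and> (\<forall>y \<in> set l. P x y)) \<longleftrightarrow> (\<forall>y \<in> A x. P x y)" for x using fen_list[OF A, of x] by metis
  ultimately show ?thesis by simp
qed

lemma re_fen_bex:
  assumes A: "fen A" and P: "re (\<lambda>z. P (fst z) (snd z))" shows "re (\<lambda>x. \<exists>y \<in> A x. P x y)"
  unfolding Bex_def by (intro re_ex re_conj re_fen_mem[OF A] re_comp2[OF P] tc_intros)

lemma reop_comp: "reop Q \<Longrightarrow> tc f \<Longrightarrow> reop (\<lambda>X x. Q X (f x))"
  unfolding reop_def
proof (intro conjI allI impI)
  assume Q: "re (\<lambda>z. Q (\<lambda>y. y \<in> set (fst z)) (snd z)) \<and> (\<forall>X Y x. (\<forall>y. X y \<longrightarrow> Y y) \<longrightarrow> Q X x \<longrightarrow> Q Y x) \<and>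
     (\<forall>X x. Q X x \<longrightarrow> (\<exists>l. (\<forall>y\<in>set l. X y) \<and> Q (\<lambda>y. y \<in> set l) x))" and f: "tc f"
  show "re (\<lambda>z. Q (\<lambda>y. y \<in> set (fst z)) (f (snd z)))"
    using re_comp[of "\<lambda>z. Q (\<lambda>y. y \<in> set (fst z)) (snd z)" "\<lambda>z. (fst z, f (snd z))"] Q
    by (simp add: tc_intros tc_comp[OF f])
qed blast+

lemma reop_fen_ball:
  assumes A: "fen A" and Q: "reop (\<lambda>X z. Q X (fst z) (snd z))" shows "reop (\<lambda>X x. \<forall>y \<in> A x. Q X x y)"
proof -
  have Q': "reop (\<lambda>X z. Q X (fst (fst z)) (snd z))"
    using reop_comp[OF Q, of "\<lambda>z. (fst (fst z), snd z)"] by (simp add: tc_intros)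
  have "reop (\<lambda>X x. \<exists>l. set l = A x \<and> (\<forall>y \<in> set l. Q X x y))"
    by (intro reop_ex reop_conj reop_re re_fen[OF A] reop_ball Q' tc_intros)
  moreover have "(\<exists>l. set l = A x \<and> (\<forall>y \<in> set l. Q X x y)) \<longleftrightarrow> (\<forall>y \<in> A x. Q X x y)" for x X using fen_list[OF A, of x] by metis
  ultimately show ?thesis by simp
qed

lemma fen_set: "tc f \<Longrightarrow> fen (\<lambda>x. set (f x))"
proof -
  assume f: "tc f"
  have "re (\<lambda>z. (\<forall>y \<in> set (snd z). y \<in> set (f (fst z))) \<and> (\<forall>y \<in> set (f (fst z)). y \<in> set (snd z)))"
    by (intro re_conj re_ball re_mem tc_intros tc_comp[OF f])
  moreover have "(\<forall>y \<in> A. y \<in> B) \<and> (\<forall>y \<in> B. y \<in> A) \<longleftrightarrow> A = B" for A B :: "'b set" by blast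
  ultimately show ?thesis unfolding fen_def by simp
qed

lemma fen_const: "finite A \<Longrightarrow> fen (\<lambda>x. A)"
  using fen_set[of "\<lambda>x. SOME l. set l = A"] finite_list[of A] tc_const someI_ex[of "\<lambda>l. set l = A"] by metis

lemma fen_single: "tc f \<Longrightarrow> fen (\<lambda>x. {f x})"
  using fen_set[of "\<lambda>x. [f x]"] by (simp add: tc_Cons tc_const)

text \<open>The equality of sets is split into two inclusions, each of which only quantifies over
  sets known to be enumerable.\<close>

lemma fen_UN:
  assumes A: "fen A" and B: "fen (\<lambda>z. B (fst z) (snd z))"
  shows "fen (\<lambda>x. \<Union>y \<in> A x. B x y)"
proof -
  have Bf: "finite (B x y)" for x y using B unfolding fen_def by (metis fst_conv snd_conv)
  have "re (\<lambda>z. (\<forall>y \<in> A (fst z). \<forall>u \<in> B (fst z) y. u \<in> set (snd z)) \<and> (\<forall>u \<in> set (snd z). \<exists>y \<in> A (fst z). u \<in> B (fst z) y))"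
  proof -
    have B': "fen (\<lambda>x. B (fst (fst x)) (snd x))"
      using fen_comp[OF B, of "\<lambda>x. (fst (fst x), snd x)"] by (simp add: tc_intros)
    have m: "re (\<lambda>z. snd (fst z) \<in> B (fst (fst (fst z))) (snd z))"
      using re_fen_mem[OF B, of "\<lambda>z. snd (fst z)" "\<lambda>z. (fst (fst (fst z)), snd z)"] by (simp add: tc_intros)
    show ?thesis
      by (intro re_conj re_fen_ball[OF fen_comp[OF A]] re_fen_ball[OF B'] re_ball re_fen_bex[OF fen_comp[OF A]] re_mem m tc_intros)
  qed
  moreover have "(\<forall>y \<in> A'. \<forall>u \<in> B' y. u \<in> L) \<and> (\<forall>u \<in> L. \<exists>y \<in> A'. u \<in> B' y) \<longleftrightarrow> L = (\<Union>y \<in> A'. B' y)"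
    for A' :: "'b set" and B' and L :: "'c set" by blast
  ultimately have "re (\<lambda>z. set (snd z) = (\<Union>y \<in> A (fst z). B (fst z) y))" by simp
  moreover have "finite (A x)" for x using A unfolding fen_def by blast
  ultimately show ?thesis unfolding fen_def using Bf by blast
qed

lemma fen_Un: "fen A \<Longrightarrow> fen B \<Longrightarrow> fen (\<lambda>x. A x \<union> B x)"
proof -
  assume A: "fen A" and B: "fen B"
  have "re (\<lambda>z. (\<forall>y \<in> A (fst z). y \<in> set (snd z)) \<and> (\<forall>y \<in> B (fst z). y \<in> set (snd z)) \<and>
      (\<forall>y \<in> set (snd z). y \<in> A (fst z) \<or> y \<in> B (fst z)))"
    by (intro re_conj re_disj re_fen_ball fen_comp[OF A] fen_comp[OF B] re_ball re_mem re_fen_mem[OF A] re_fen_mem[OF B] tc_intros)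
  moreover have "(\<forall>y \<in> A'. y \<in> L) \<and> (\<forall>y \<in> B'. y \<in> L) \<and> (\<forall>y \<in> L. y \<in> A' \<or> y \<in> B') \<longleftrightarrow> L = A' \<union> B'"
    for A' B' L :: "'b set" by blast
  ultimately show ?thesis using A B unfolding fen_def by simp
qed

text \<open>A list enumerates the filtered set iff each element of \<open>A x\<close> is listed or
  fails \<open>P\<close>, and each listed element belongs to \<open>A x\<close> and satisfies
  \<open>P\<close>. For the first part the negation of \<open>P\<close> has to be semi-decidable,
  too.\<close>

lemma fen_filter:
  assumes A: "fen A" and P: "re (\<lambda>z. P (fst z) (snd z))" and nP: "re (\<lambda>z. \<not> P (fst z) (snd z))"
  shows "fen (\<lambda>x. {y \<in> A x. P x y})"
proof -
  have "re (\<lambda>z. (\<forall>y \<in> A (fst z). y \<in> set (snd z) \<or> \<not> P (fst z) y) \<and> (\<forall>y \<in> set (snd z). y \<in> A (fst z) \<and> P (fst z) y))"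
    by (intro re_conj re_disj re_fen_ball fen_comp[OF A] re_ball re_mem re_fen_mem[OF A] re_comp2[OF P]
        re_comp2[of "\<lambda>x y. \<not> P x y", OF nP] tc_intros)
  moreover have "(\<forall>y \<in> A'. y \<in> L \<or> \<not> Q y) \<and> (\<forall>y \<in> L. y \<in> A' \<and> Q y) \<longleftrightarrow> L = {y \<in> A'. Q y}"
    for A' L :: "'b set" and Q by blast
  ultimately show ?thesis using A unfolding fen_def by simp
qed

lemma fen_filter_eq: "fen A \<Longrightarrow> tc (\<lambda>z. f (fst z) (snd z)) \<Longrightarrow> tc (\<lambda>z. g (fst z) (snd z)) \<Longrightarrow> fen (\<lambda>x. {y \<in> A x. f x y = g x y})"
  by (rule fen_filter) (simp_all add: re_eq re_neq)

text \<open>This makes the equations \<open>P \<equiv> lfp \<dots>\<close> available, to which \<open>re_lfp\<close> applies.\<close>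

declare [[inductive_internals]]

text \<open>Recursion along a list, carried out on enumerating lists instead of sets, so that it
  becomes a least fixed point on encoded data.\<close>

inductive lrec :: "('a::enc \<Rightarrow> 'b::enc set) \<Rightarrow> ('a \<times> 'c::enc \<times> 'b \<Rightarrow> 'b set) \<Rightarrow> 'a \<times> 'c list \<times> 'b list \<Rightarrow> bool"
  for Z F where
  "set l = Z x \<Longrightarrow> lrec Z F (x, [], l)"
| "lrec Z F (x, vs, a) \<Longrightarrow> set l = (\<Union>y \<in> set a. F (x, v, y)) \<Longrightarrow> lrec Z F (x, v # vs, l)"

lemma fen_list_rec:
  assumes A: "\<And>x. A x [] = Z x" "\<And>x v l. A x (v # l) = (\<Union>y \<in> A x l. F (x, v, y))" and Z: "fen Z" and F: "fen F"
  shows "fen (\<lambda>z. A (fst z) (snd z))"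
proof -
  have U: "fen (\<lambda>z. \<Union>y \<in> set (fst z). F (fst (snd z), snd (snd z), y))"
    by (intro fen_UN fen_set fen_comp[OF F] tc_intros)
  have V: "re (\<lambda>x. set (fst x) = (\<Union>y \<in> set (fst (snd x)). F (fst (snd (snd x)), snd (snd (snd x)), y)))"
    using re_fen[OF U, of fst snd] by (simp add: tc_intros)
  have U': "re (\<lambda>x. set (f x) = (\<Union>y \<in> set (g x). F (h x, k x, y)))" if "tc f" "tc g" "tc h" "tc k"
    for f :: "'d::enc \<Rightarrow> 'b list" and g h k
    using re_comp[OF V, of "\<lambda>x. (f x, g x, h x, k x)"] that by (simp add: tc_intros)
  have "re (lrec Z F)" unfolding lrec_def
    by (rule re_lfp) (intro reop_intros re_intros re_fen[OF Z] U' tc_intros)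
  then have R: "re (\<lambda>x. lrec Z F (fst (fst x), snd (fst x), snd x))" by (rule re_comp) (intro tc_intros)
  have fin: "finite (A x l)" for x l
  proof (induction l)
    case (Cons v l)
    then show ?case using F unfolding A(2) fen_def by blast
  qed (use Z in \<open>auto simp: A fen_def\<close>)
  have "lrec Z F (x, vs, l) \<longleftrightarrow> set l = A x vs" for x vs l
  proof
    assume "lrec Z F (x, vs, l)"
    then show "set l = A x vs" by (induction "(x, vs, l)" arbitrary: x vs l) (auto simp: A)
  next
    assume "set l = A x vs"
    then show "lrec Z F (x, vs, l)"
    proof (induction vs arbitrary: l)
      case (Cons v vs)
      obtain a where a: "set a = A x vs" using finite_list[OF fin] by blast
      then show ?case using lrec.intros(2)[OF Cons.IH[OF a], of l v] Cons.prems unfolding A by simp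
    qed (auto simp: A intro: lrec.intros)
  qed
  then show ?thesis using R fin unfolding fen_def by simp
qed

lemma fen_list_rec':
  assumes "\<And>x. A x [] = Z x" "\<And>x v l. A x (v # l) = (\<Union>y \<in> A x l. F (x, v, y))" "fen Z" "fen F" "tc f" "tc g"
  shows "fen (\<lambda>x. A (f x) (g x))"
  using fen_comp[OF fen_list_rec[of A Z F, OF assms(1-4)], of "\<lambda>x. (f x, g x)"] assms(5,6) by (simp add: tc_intros)

lemmas fen_intros = fen_UN fen_Un fen_single fen_set fen_filter_eq
lemmas tc_intros2 = tc_intros tc_append tc_power tc_length tc_upt

subsection \<open>Evaluation of formulae in symbolic states\<close>

text \<open>The counterpart of \<open>rch\<close> on the nodes of a state.\<close>

primrec at_depth :: "det list \<Rightarrow> nat \<Rightarrow> var \<Rightarrow> var set" where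
  "at_depth d 0 v = {v}"
| "at_depth d (Suc n) v = (\<Union>u \<in> at_depth d n v. {u} \<union> (\<Union>p \<in> {p \<in> set d. fst p = u}. set (snd (snd p))))"

text \<open>The hypothesis \<open>ok\<close> of \<open>sym_back\<close> in terms of nodes, as
  \<open>shallow_iff\<close> shows.\<close>

definition shallow :: "signature \<Rightarrow> det list \<Rightarrow> opq list \<Rightarrow> nat \<Rightarrow> var \<Rightarrow> bool" where
  "shallow S d op n v \<longleftrightarrow> (\<forall>m<n. \<forall>u \<in> at_depth d m v. \<forall>p \<in> set op. fst p \<noteq> u \<or> (vsort u, snd p) \<in> wide_kinds S)"

definition fresh_lists :: "nat \<Rightarrow> signature \<Rightarrow> nat \<Rightarrow> var list set" where
  "fresh_lists k S q = {nn. fresh_names k S q nn}"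

lemma fen_at_depth: "tc f \<Longrightarrow> tc g \<Longrightarrow> tc h \<Longrightarrow> fen (\<lambda>x. at_depth (f x) (g x) (h x))"
proof -
  assume fgh: "tc f" "tc g" "tc h"
  have "fen (\<lambda>x. at_depth (fst (f x, h x)) (length [0..<g x]) (snd (f x, h x)))"
  proof (rule fen_list_rec'[where A = "\<lambda>x l. at_depth (fst x) (length l) (snd x)"])
    show "at_depth (fst x) (length (m # l)) (snd x) =
      (\<Union>u \<in> at_depth (fst x) (length l) (snd x). (\<lambda>z. {snd (snd z)} \<union> (\<Union>p \<in> {p \<in> set (fst (fst z)). fst p = snd (snd z)}. set (snd (snd p)))) (x, m, u))"
      for x and m :: nat and l by simp
  qed (intro fen_intros tc_intros2 fgh | simp)+
  then show ?thesis by simp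
qed

definition vecs :: "var list \<Rightarrow> srt list \<Rightarrow> var list set" where
  "vecs ns ss = {ws. list_all2 (\<lambda>w s. vsort w = s) ws ss \<and> (\<forall>w \<in> set ws. w \<in> set ns)}"

lemma fen_vecs: "tc f \<Longrightarrow> tc g \<Longrightarrow> fen (\<lambda>x. vecs (f x) (g x))"
proof (rule fen_list_rec'[where A = vecs])
  show "vecs ns [] = (\<lambda>x. {[]}) ns" for ns by (auto simp: vecs_def)
  show "vecs ns (s # ss) = (\<Union>ws \<in> vecs ns ss. (\<lambda>z. \<Union>w \<in> {w \<in> set (fst z). vsort w = fst (snd z)}. {w # snd (snd z)}) (ns, s, ws))"
    for ns s ss by (auto simp: vecs_def list_all2_Cons2)
qed (intro fen_intros tc_intros2 | assumption)+

lemma fen_det_ok: "tc f \<Longrightarrow> tc g \<Longrightarrow> tc h \<Longrightarrow> fen (\<lambda>x. {q. det_ok (set (f x)) (g x) (h x, q)})"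
proof -
  assume fgh: "tc f" "tc g" "tc h"
  note c = tc_comp[OF fgh(1)] tc_comp[OF fgh(2)] tc_comp[OF fgh(3)]
  have "fen (\<lambda>x. \<Union>w \<in> {w \<in> set (g x). w = h x}. \<Union>p \<in> {p \<in> set (f x). gres p = vsort w}. \<Union>ws \<in> vecs (g x) (gargs p). {(p, ws)})"
    by (intro fen_intros fen_vecs tc_intros2 c fgh)
  moreover have "(\<Union>w \<in> {w \<in> set ns. w = v}. \<Union>p \<in> {p \<in> set gl. gres p = vsort w}. \<Union>ws \<in> vecs ns (gargs p). {(p, ws)}) =
    {q. det_ok (set gl) ns (v, q)}" for ns v gl by (auto simp: det_ok_def vecs_def)
  ultimately show ?thesis by simp
qed

lemma finite_big_kinds: "tree_signature S \<Longrightarrow> finite (big_kinds S)" "tree_signature S \<Longrightarrow> finite (wide_kinds S)"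
proof -
  assume "tree_signature S"
  then have "finite (sorts S \<times> {..<2 :: nat})" unfolding tree_signature_def by simp
  moreover have "big_kinds S \<subseteq> sorts S \<times> {..<2}" "wide_kinds S \<subseteq> sorts S \<times> {..<2}" unfolding big_kinds_def wide_kinds_def by auto
  ultimately show "finite (big_kinds S)" "finite (wide_kinds S)" by (meson finite_subset)+
qed

lemma fen_completions:
  assumes S: "tree_signature S" and t: "tc f" "tc g" "tc h"
  shows "fen (\<lambda>x. completions S (set (f x)) (g x) (h x))"
proof -
  have "fen (\<lambda>x. completions S (set (fst (f x, g x))) (snd (f x, g x)) (h x))"
  proof (rule fen_list_rec'[where A = "\<lambda>x l. completions S (set (fst x)) (snd x) l"])
    show "completions S (set (fst x)) (snd x) [] = (\<lambda>x. {([], [])}) x" for x by simp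
    show "completions S (set (fst x)) (snd x) (v # nn) = (\<Union>e \<in> completions S (set (fst x)) (snd x) nn.
      (\<lambda>z. (\<Union>q \<in> {q. det_ok (set (fst (fst z))) (snd (fst z)) (fst (snd z), q)}. {((fst (snd z), q) # fst (snd (snd z)), snd (snd (snd z)))}) \<union>
        (\<Union>p \<in> {p \<in> big_kinds S. fst p = vsort (fst (snd z))}. {(fst (snd (snd z)), (fst (snd z), snd p) # snd (snd (snd z)))})) (x, v, e))" for x v nn
      by (auto; force)
  qed (intro fen_intros fen_det_ok fen_const finite_big_kinds S t tc_intros2)+
  then show ?thesis by simp
qed

text \<open>Writing the names as an interval of numbers allows the admissible lists to be enumerated
  by recursion along this interval.\<close>

lemma fresh_names_iff: "fresh_names k S q nn \<longleftrightarrow> map vname nn = [k..<k + q] \<and> (\<forall>v \<in> set nn. vsort v \<in> sorts S)"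
proof
  assume "fresh_names k S q nn"
  then show "map vname nn = [k..<k + q] \<and> (\<forall>v \<in> set nn. vsort v \<in> sorts S)"
    unfolding fresh_names_def by (auto intro!: nth_equalityI simp: in_set_conv_nth)
next
  assume a: "map vname nn = [k..<k + q] \<and> (\<forall>v \<in> set nn. vsort v \<in> sorts S)"
  then have l: "length nn = q" by (metis add_diff_cancel_left' length_map length_upt)
  then have "vname (nn ! i) = k + i" if "i < q" for i using a that by (metis nth_map nth_upt add_less_cancel_left)
  then show "fresh_names k S q nn" unfolding fresh_names_def using a l by simp
qed

lemma fen_fresh_lists:
  assumes S: "tree_signature S" and t: "tc f" "tc g"
  shows "fen (\<lambda>x. fresh_lists (f x) S (g x))"
proof -
  have fin: "finite (sorts S)" using S unfolding tree_signature_def by blast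
  have "fen (\<lambda>x. {nn. map vname nn = [f x..<f x + g x] \<and> (\<forall>v \<in> set nn. vsort v \<in> sorts S)})"
  proof (rule fen_list_rec'[where A = "\<lambda>x :: nat. \<lambda>l. {nn. map vname nn = l \<and> (\<forall>v \<in> set nn. vsort v \<in> sorts S)}" and f = "\<lambda>x. 0"])
    show "{nn. map vname nn = [] \<and> (\<forall>v \<in> set nn. vsort v \<in> sorts S)} = (\<lambda>x. {[]}) x" for x :: nat by auto
    show "{nn. map vname nn = i # l \<and> (\<forall>v \<in> set nn. vsort v \<in> sorts S)} =
      (\<Union>nn \<in> {nn. map vname nn = l \<and> (\<forall>v \<in> set nn. vsort v \<in> sorts S)}. (\<lambda>z. \<Union>s \<in> sorts S. {V (fst (snd z)) s # snd (snd z)}) (x, i, nn))"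
      for x i l
    proof (intro set_eqI iffI)
      fix nn assume "nn \<in> {nn. map vname nn = i # l \<and> (\<forall>v \<in> set nn. vsort v \<in> sorts S)}"
      then obtain v ns where "nn = v # ns" "vname v = i" "map vname ns = l" "\<forall>v \<in> set nn. vsort v \<in> sorts S"
        by (cases nn) auto
      then show "nn \<in> (\<Union>nn \<in> {nn. map vname nn = l \<and> (\<forall>v \<in> set nn. vsort v \<in> sorts S)}. (\<lambda>z. \<Union>s \<in> sorts S. {V (fst (snd z)) s # snd (snd z)}) (x, i, nn))"
        by (auto intro!: bexI[of _ "vsort v"])
    qed auto
  qed (intro fen_intros fen_const fin tc_intros2 t)+
  then show ?thesis unfolding fresh_lists_def fresh_names_iff .
qed

lemma re_nfinite: "finite A \<Longrightarrow> tc f \<Longrightarrow> re (\<lambda>x. f x \<notin> A)"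
proof -
  assume A: "finite A" and f: "tc f"
  obtain l where l: "set l = A" using finite_list[OF A] by blast
  show ?thesis unfolding l[symmetric] by (intro re_nmem f tc_const)
qed

text \<open>The negation is required as well: to refute an existential formula, candidates violating
  the condition are passed over.\<close>

lemma re_shallow:
  assumes S: "tree_signature S" and t: "tc d" "tc p" "tc n" "tc v"
  shows "re (\<lambda>x. shallow S (d x) (p x) (n x) (v x))" "re (\<lambda>x. \<not> shallow S (d x) (p x) (n x) (v x))"
proof -
  note c = tc_comp[OF t(1)] tc_comp[OF t(2)] tc_comp[OF t(3)] tc_comp[OF t(4)]
  show "re (\<lambda>x. shallow S (d x) (p x) (n x) (v x))" unfolding shallow_def
    by (intro re_intros re_fen_ball fen_at_depth re_finite finite_big_kinds S tc_intros2 c t)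
  have "re (\<lambda>x. \<exists>m. m < n x \<and> (\<exists>u \<in> at_depth (d x) m (v x). \<exists>q. q \<in> set (p x) \<and> fst q = u \<and> (vsort u, snd q) \<notin> wide_kinds S))"
    by (intro re_intros re_fen_bex fen_at_depth re_nfinite finite_big_kinds S tc_intros2 c t)
  then show "re (\<lambda>x. \<not> shallow S (d x) (p x) (n x) (v x))"
    unfolding shallow_def by (simp add: Bex_def)
qed

section \<open>Looking up variables, comparing nodes, adding terms\<close>

inductive lookup :: "(var \<times> var) list \<times> var \<times> var \<Rightarrow> bool" where
  "lookup ((x, v) # e, x, v)"
| "y \<noteq> x \<Longrightarrow> lookup (e, x, v) \<Longrightarrow> lookup ((y, w) # e, x, v)"

lemma lookup_iff: "lookup (e, x, v) \<longleftrightarrow> map_of e x = Some v"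
proof
  show "lookup (e, x, v) \<Longrightarrow> map_of e x = Some v" by (induction "(e, x, v)" arbitrary: e rule: lookup.induct) auto
  show "map_of e x = Some v \<Longrightarrow> lookup (e, x, v)" by (induction e) (auto split: if_splits intro: lookup.intros)
qed

lemma re_lookup: "re lookup"
  unfolding lookup_def by (rule re_lfp) (intro reop_intros re_intros tc_intros)

lemma re_map_of: "tc (f :: 'a::enc \<Rightarrow> (var \<times> var) list) \<Longrightarrow> tc g \<Longrightarrow> tc h \<Longrightarrow> re (\<lambda>x. map_of (f x) (g x) = Some (h x))"
  unfolding lookup_iff[symmetric] by (intro re_comp[OF re_lookup] tc_pair)

text \<open>A derivation is a finite path to a visible difference, and the pairs without a
  derivation form a bisimulation. Both alternatives need positive evidence, since truth and falsity
  of an equation are derived separately.\<close>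

inductive apart :: "(det list \<times> opq list) \<times> var \<times> var \<Rightarrow> bool" where
  lab: "(v, g, ws) \<in> set d \<Longrightarrow> (w, h, us) \<in> set d \<Longrightarrow> g \<noteq> h \<Longrightarrow> apart ((d, op), v, w)"
| left: "(v, q) \<in> set d \<Longrightarrow> (w, b) \<in> set op \<Longrightarrow> apart ((d, op), v, w)"
| right: "(v, b) \<in> set op \<Longrightarrow> (w, q) \<in> set d \<Longrightarrow> apart ((d, op), v, w)"
| opq: "(v, b) \<in> set op \<Longrightarrow> (w, b') \<in> set op \<Longrightarrow> v \<noteq> w \<Longrightarrow> apart ((d, op), v, w)"
| child: "(v, g, ws) \<in> set d \<Longrightarrow> (w, g, us) \<in> set d \<Longrightarrow> drop i ws = x # xs \<Longrightarrow> drop i us = y # ys \<Longrightarrow>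
    apart ((d, op), x, y) \<Longrightarrow> apart ((d, op), v, w)"

lemma re_apart: "re apart"
  unfolding apart_def by (rule re_lfp) (intro reop_conj reop_disj reop_ex reop_X reop_re re_intros tc_intros)

definition bisim :: "det list \<Rightarrow> var \<Rightarrow> var \<Rightarrow> bool" where
  "bisim d v w \<longleftrightarrow> (\<exists>R. (v, w) \<in> set R \<and> (\<forall>p \<in> set R. fst p = snd p \<or>
     (\<exists>g ws us. (fst p, g, ws) \<in> set d \<and> (snd p, g, us) \<in> set d \<and> list_all2 (\<lambda>x y. (x, y) \<in> set R) ws us)))"

lemma re_bisim: "tc f \<Longrightarrow> tc g \<Longrightarrow> tc h \<Longrightarrow> re (\<lambda>x. bisim (f x) (g x) (h x))"
proof -
  assume t: "tc f" "tc g" "tc h"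
  show ?thesis unfolding bisim_def
    by (intro re_intros re_list_all2 tc_intros tc_comp[OF t(1)] tc_comp[OF t(2)] tc_comp[OF t(3)])
qed

inductive fin_node :: "(det list \<times> opq list) \<times> var \<Rightarrow> bool" where
  opq: "(v, 1) \<in> set op \<Longrightarrow> fin_node ((d, op), v)"
| det: "(v, g, ws) \<in> set d \<Longrightarrow> (\<forall>w \<in> set ws. fin_node ((d, op), w)) \<Longrightarrow> fin_node ((d, op), v)"

lemma re_fin_node: "re fin_node"
  unfolding fin_node_def by (rule re_lfp) (intro reop_conj reop_disj reop_ex reop_ball reop_X reop_re re_intros tc_intros)

text \<open>From each node of \<open>R\<close> one can stay in \<open>R\<close> by going to a child,
  unless the node is an infinite opaque leaf; so finiteness can be derived for none of them.\<close>

definition inf_node :: "det list \<Rightarrow> opq list \<Rightarrow> var \<Rightarrow> bool" where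
  "inf_node d op v \<longleftrightarrow> (\<exists>R. v \<in> set R \<and> (\<forall>x \<in> set R. (\<exists>b. (x, b) \<in> set op \<and> b \<noteq> 1) \<or>
     (\<exists>g ws y. (x, g, ws) \<in> set d \<and> y \<in> set ws \<and> y \<in> set R)))"

lemma re_inf_node: "tc f \<Longrightarrow> tc g \<Longrightarrow> tc h \<Longrightarrow> re (\<lambda>x. inf_node (f x) (g x) (h x))"
proof -
  assume t: "tc f" "tc g" "tc h"
  show ?thesis unfolding inf_node_def
    by (intro re_intros tc_intros tc_comp[OF t(1)] tc_comp[OF t(2)] tc_comp[OF t(3)])
qed

type_synonym state = "nat \<times> var list \<times> det list \<times> opq list"

text \<open>Working on lists of codes, one predicate covers a term as well as its arguments. Each
  application becomes a determined node named by the counter of the state, which keeps the names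
  fresh.\<close>

inductive add_trms :: "state \<times> (var \<times> var) list \<times> nat list \<times> state \<times> var list \<Rightarrow> bool" where
  Nil: "add_trms (st, env, [], st, [])"
| Var: "map_of env x = Some v \<Longrightarrow> add_trms (st, env, cs, st', vs) \<Longrightarrow> add_trms (st, env, list_encode [0, code_var x] # cs, st', v # vs)"
| App: "add_trms (st, env, ts, (k, ns, d, op), us) \<Longrightarrow>
    add_trms ((Suc k, V k (gres g) # ns, (V k (gres g), g, us) # d, op), env, cs, st', vs) \<Longrightarrow>
    add_trms (st, env, list_encode (1 # code_gen g # ts) # cs, st', V k (gres g) # vs)"

lemma re_add_trms: "re add_trms"
  unfolding add_trms_def by (rule re_lfp) (intro reop_conj reop_disj reop_ex reop_X reop_re re_intros re_map_of tc_intros)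

text \<open>A finite table lets all binary connectives share one rule; 5 to 8 are their tags in
  \<open>code_fm\<close>.\<close>

definition truth_table :: "(nat \<times> nat \<times> nat \<times> nat) set" where
  "truth_table = (\<lambda>(k, x, y). (k, of_bool x, of_bool y,
     of_bool (if k = 5 then x \<and> y else if k = 6 then x \<or> y else if k = 7 then x \<longrightarrow> y else x = y))) ` ({5, 6, 7, 8} \<times> UNIV \<times> UNIV)"

text \<open>\<open>Ev S ((G, r), N, st, env, c, b)\<close>: in the state \<open>st\<close>, the formula with code \<open>c\<close> has the truth value \<open>b\<close>
  for all trees that agree with the values of the variables down to depth \<open>N\<close>.\<close>

inductive Ev :: "signature \<Rightarrow> (gen list \<times> nat) \<times> nat \<times> state \<times> (var \<times> var) list \<times> nat \<times> nat \<Rightarrow> bool" for S where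
  Tru: "Ev S (par, N, st, env, list_encode [0], 1)"
| Fls: "Ev S (par, N, st, env, list_encode [1], 0)"
| Eq1: "t \<le> N \<Longrightarrow> u \<le> N \<Longrightarrow> add_trms (st, env, [t, u], (k, ns, d, op), [v, w]) \<Longrightarrow> bisim d v w \<Longrightarrow>
    Ev S (par, N, st, env, list_encode [2, t, u], 1)"
| Eq0: "t \<le> N \<Longrightarrow> u \<le> N \<Longrightarrow> add_trms (st, env, [t, u], (k, ns, d, op), [v, w]) \<Longrightarrow> apart ((d, op), v, w) \<Longrightarrow>
    Ev S (par, N, st, env, list_encode [2, t, u], 0)"
| Fin1: "add_trms (st, env, [t], (k, ns, d, op), [v]) \<Longrightarrow> fin_node ((d, op), v) \<Longrightarrow> Ev S (par, N, st, env, list_encode [3, s, t], 1)"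
| Fin0: "add_trms (st, env, [t], (k, ns, d, op), [v]) \<Longrightarrow> inf_node d op v \<Longrightarrow> Ev S (par, N, st, env, list_encode [3, s, t], 0)"
| Neg: "Ev S (par, N, st, env, c, b) \<Longrightarrow> Ev S (par, N, st, env, list_encode [4, c], 1 - b)"
| Bin: "(j, b1, b2, b) \<in> truth_table \<Longrightarrow> Ev S (par, N, st, env, c1, b1) \<Longrightarrow> Ev S (par, N, st, env, c2, b2) \<Longrightarrow>
    Ev S (par, N, st, env, list_encode [j, c1, c2], b)"
| Ex1: "n + 2 * Suc r ^ n + 1 \<le> N \<Longrightarrow> nn \<in> fresh_lists k S q \<Longrightarrow> e \<in> completions S (set G) (nn @ ns) nn \<Longrightarrow> v \<in> set (nn @ ns) \<Longrightarrow>
    vsort v = vsort x \<Longrightarrow> shallow S (fst e @ d) (snd e @ op) n v \<Longrightarrow>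
    Ev S ((G, r), n, (k + q, nn @ ns, fst e @ d, snd e @ op), (x, v) # env, c, 1) \<Longrightarrow>
    Ev S ((G, r), N, (k, ns, d, op), env, list_encode [9, code_var x, c], 1)"
| Ex0: "n + 2 * Suc r ^ n + 1 \<le> N \<Longrightarrow>
    (\<forall>q < Suc (Suc r ^ n). \<forall>nn \<in> fresh_lists k S q. \<forall>e \<in> completions S (set G) (nn @ ns) nn. \<forall>v \<in> set (nn @ ns).
      vsort v \<noteq> vsort x \<or> \<not> shallow S (fst e @ d) (snd e @ op) n v \<or>
      Ev S ((G, r), n, (k + q, nn @ ns, fst e @ d, snd e @ op), (x, v) # env, c, 0)) \<Longrightarrow>
    Ev S ((G, r), N, (k, ns, d, op), env, list_encode [9, code_var x, c], 0)"
| All: "Ev S (par, N, st, env, list_encode [9, x, list_encode [4, c]], b) \<Longrightarrow>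
    Ev S (par, N, st, env, list_encode [10, x, c], 1 - b)"

lemma finite_truth_table: "finite truth_table"
  unfolding truth_table_def by (intro finite_imageI finite_cartesian_product) simp_all

lemma re_mem_completions: "tree_signature S \<Longrightarrow> tc e \<Longrightarrow> tc f \<Longrightarrow> tc g \<Longrightarrow> tc h \<Longrightarrow> re (\<lambda>x. e x \<in> completions S (set (f x)) (g x) (h x))"
  using re_fen_mem[OF fen_completions, of S f g h e "\<lambda>x. x"] by (simp add: tc_id)

lemma re_mem_fresh_lists: "tree_signature S \<Longrightarrow> tc e \<Longrightarrow> tc f \<Longrightarrow> tc g \<Longrightarrow> re (\<lambda>x. e x \<in> fresh_lists (f x) S (g x))"
  using re_fen_mem[OF fen_fresh_lists, of S f g e "\<lambda>x. x"] by (simp add: tc_id)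

lemma re_Ev: "tree_signature S \<Longrightarrow> re (Ev S)"
proof -
  assume S: "tree_signature S"
  show ?thesis
    unfolding Ev_def
    by (rule re_lfp) (intro reop_disj reop_conj reop_ex reop_ball reop_all_less reop_fen_ball reop_X reop_re
      re_conj re_ex re_eq re_le re_neq re_mem re_mem_completions[OF S] re_mem_fresh_lists[OF S] re_comp[OF re_add_trms]
      re_bisim re_comp[OF re_apart] re_comp[OF re_fin_node] re_inf_node
      re_shallow[OF S] re_finite[OF finite_truth_table] tc_intros2 fen_fresh_lists[OF S] fen_completions[OF S])
qed

section \<open>Soundness of the evaluation\<close>

lemma at_depth_sol:
  assumes v: "wf_state S G k ns d op" and K: "\<forall>g \<in> G. gname g < K" and x: "x \<in> set ns"
  shows "at_depth d m x \<subseteq> set ns \<and> rch G m (sol K d op x) = sol K d op ` at_depth d m x"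
proof (induction m)
  case (Suc m)
  let ?h = "sol K d op"
  define C where "C u = (\<Union>p \<in> {p \<in> set d. fst p = u}. set (snd (snd p)))" for u
  have *: "C u \<subseteq> set ns \<and> (if root (?h u) \<in> G then set (children (?h u)) else {}) = ?h ` C u" if u: "u \<in> set ns" for u
  proof (cases "root (?h u) \<in> G")
    case True
    then obtain g ws where q: "(u, g, ws) \<in> set d" using root_cases[OF v K u] by blast
    have "{p \<in> set d. fst p = u} = {(u, g, ws)}" using q wf_stateD(6)[OF v] by auto
    then have "C u = set ws" unfolding C_def by simp
    then show ?thesis using True sol_det[OF v q, of K] det_okD(5)[OF wf_stateD(4)[OF v q]] by simp
  next
    case False
    then obtain b where "(u, b) \<in> set op" using root_cases[OF v K u] by blast
    then have "{p \<in> set d. fst p = u} = {}" using wf_stateD(7)[OF v] by auto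
    then have "C u = {}" unfolding C_def by (simp only: UN_empty)
    then show ?thesis using False by simp
  qed
  have IH: "at_depth d m x \<subseteq> set ns" "rch G m (?h x) = ?h ` at_depth d m x" using Suc by auto
  have dS: "at_depth d (Suc m) x = at_depth d m x \<union> (\<Union>u \<in> at_depth d m x. C u)" unfolding at_depth.simps C_def by blast
  have "(\<Union>t \<in> {t \<in> A. root t \<in> G}. set (children t)) = (\<Union>t \<in> A. if root t \<in> G then set (children t) else {})" for A
    by auto
  then have "rch G (Suc m) (?h x) = ?h ` at_depth d m x \<union> (\<Union>u \<in> at_depth d m x. if root (?h u) \<in> G then set (children (?h u)) else {})"
    unfolding rch.simps IH(2) by (simp only: image_image UN_simps)
  also have "(\<Union>u \<in> at_depth d m x. if root (?h u) \<in> G then set (children (?h u)) else {}) = (\<Union>u \<in> at_depth d m x. ?h ` C u)"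
    using * IH(1) by (intro SUP_cong refl) blast
  also have "?h ` at_depth d m x \<union> \<dots> = ?h ` at_depth d (Suc m) x" unfolding dS by blast
  finally have "rch G (Suc m) (?h x) = ?h ` at_depth d (Suc m) x" .
  moreover have "at_depth d (Suc m) x \<subseteq> set ns" unfolding dS using * IH(1) by blast
  ultimately show ?case by blast
qed (use x in simp)

lemma shallow_iff:
  assumes v: "wf_state S G k ns d op" and K: "\<forall>g \<in> G. gname g < K" and x: "x \<in> set ns"
  shows "shallow S d op n x \<longleftrightarrow> (\<forall>t \<in> inn G n (sol K d op x). root t \<notin> G \<longrightarrow>
    infinite (root ` KT S (gres (root t)) (finite_tree t)))"
proof -
  let ?h = "sol K d op"
  let ?P = "\<lambda>t. root t \<notin> G \<longrightarrow> infinite (root ` KT S (gres (root t)) (finite_tree t))"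
  have node: "(\<forall>p \<in> set op. fst p \<noteq> u \<or> (vsort u, snd p) \<in> wide_kinds S) \<longleftrightarrow> ?P (?h u)" if u: "u \<in> set ns" for u
  proof (cases "root (?h u) \<in> G")
    case True
    then obtain g ws where q: "(u, g, ws) \<in> set d" using root_cases[OF v K u] by blast
    then show ?thesis using True wf_stateD(7)[OF v q] by auto
  next
    case False
    then obtain b where b: "(u, b) \<in> set op" using root_cases[OF v K u] by blast
    have o: "root (?h u) = opq_gen K u b" "finite_tree (?h u) \<longleftrightarrow> b = 1" using sol_opq[OF v b] by auto
    have "(vsort u, b) \<in> big_kinds S" using wf_stateD(5)[OF v b] by blast
    then have "vsort u \<in> sorts S" "b < 2" by (simp_all add: big_kinds_def)
    then have "(vsort u, b) \<in> wide_kinds S \<longleftrightarrow> infinite (root ` KT S (vsort u) (b = 1))" by (simp add: wide_kinds_def)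
    moreover have "(\<forall>p \<in> set op. fst p \<noteq> u \<or> (vsort u, snd p) \<in> wide_kinds S) \<longleftrightarrow> (vsort u, b) \<in> wide_kinds S"
      using b wf_stateD(8)[OF v b] by (metis fst_conv prod.collapse snd_conv)
    moreover have "gres (root (?h u)) = vsort u" using o(1) by (simp add: opq_gen_def)
    ultimately show ?thesis using False o(2) by auto
  qed
  have D: "at_depth d m x \<subseteq> set ns" "rch G m (?h x) = ?h ` at_depth d m x" for m using at_depth_sol[OF v K x] by blast+
  have "shallow S d op n x \<longleftrightarrow> (\<forall>m<n. \<forall>u \<in> at_depth d m x. ?P (?h u))"
    unfolding shallow_def using node D(1) by blast
  also have "\<dots> \<longleftrightarrow> (\<forall>m<n. \<forall>t \<in> rch G m (?h x). ?P t)" unfolding D(2) by blast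
  also have "\<dots> \<longleftrightarrow> (\<forall>t \<in> inn G n (?h x). ?P t)"
  proof (cases n)
    case (Suc m)
    have "rch G j (?h x) \<subseteq> rch G m (?h x)" if "j < n" for j using rch_mono Suc that by simp
    then show ?thesis unfolding inn_def Suc by auto
  qed (simp add: inn_def)
  finally show ?thesis .
qed

lemma apart_sound:
  assumes v: "wf_state S G k ns d op" and K: "\<forall>g \<in> G. gname g < K"
  shows "apart ((d, op), x, y) \<Longrightarrow> sol K d op x \<noteq> sol K d op y"
proof (induction "((d, op), x, y)" arbitrary: x y rule: apart.induct)
  case (lab x g ws y h us)
  then show ?case using sol_det[OF v lab(1), of K] sol_det[OF v lab(2), of K] by simp
next
  case (left x q y b)
  obtain g ws where q: "q = (g, ws)" by fastforce
  have "g \<in> G" using det_okD(2)[OF wf_stateD(4)[OF v]] left(1) q by blast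
  then show ?case using sol_det[OF v left(1)[unfolded q], of K] sol_opq(1)[OF v left(2), of K] opq_gen_notin[OF K] by force
next
  case (right x b y q)
  obtain g ws where q: "q = (g, ws)" by fastforce
  have "g \<in> G" using det_okD(2)[OF wf_stateD(4)[OF v]] right(2) q by blast
  then show ?case using sol_det[OF v right(2)[unfolded q], of K] sol_opq(1)[OF v right(1), of K] opq_gen_notin[OF K] by force
next
  case (opq x b y b')
  then show ?case using sol_opq(1)[OF v opq(1), of K] sol_opq(1)[OF v opq(2), of K] opq_gen_inj by metis
next
  case (child x g ws y us i a xs b ys)
  have "i < length ws \<and> ws ! i = a" "i < length us \<and> us ! i = b"
    using child(3,4) by (metis drop_all leI list.distinct(1) Cons_nth_drop_Suc list.inject)+
  moreover have "map (sol K d op) ws \<noteq> map (sol K d op) us" using calculation child(6) by (metis nth_map)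
  ultimately show ?case using sol_det[OF v child(1), of K] sol_det[OF v child(2), of K] by simp
qed

lemma bisim_sound:
  assumes v: "wf_state S G k ns d op" and b: "bisim d x y"
  shows "sol K d op x = sol K d op y"
proof -
  let ?h = "sol K d op"
  obtain R where R: "(x, y) \<in> set R" "\<forall>p \<in> set R. fst p = snd p \<or>
     (\<exists>g ws us. (fst p, g, ws) \<in> set d \<and> (snd p, g, us) \<in> set d \<and> list_all2 (\<lambda>x y. (x, y) \<in> set R) ws us)"
    using b unfolding bisim_def by blast
  let ?Q = "\<lambda>t u. \<exists>p \<in> set R. t = ?h (fst p) \<and> u = ?h (snd p)"
  show ?thesis
  proof (rule tree_eq_coinduct[where R = ?Q])
    show "?Q (?h x) (?h y)" using R(1) by force
    fix t u assume "?Q t u"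
    then obtain p where p: "p \<in> set R" "t = ?h (fst p)" "u = ?h (snd p)" by blast
    show "root t = root u \<and> list_all2 (\<lambda>t u. ?Q t u \<or> t = u) (children t) (children u)"
    proof (cases "fst p = snd p")
      case True
      then show ?thesis unfolding p(2,3) by (simp add: list_all2_refl)
    next
      case False
      then obtain g ws us where q: "(fst p, g, ws) \<in> set d" "(snd p, g, us) \<in> set d" "list_all2 (\<lambda>x y. (x, y) \<in> set R) ws us"
        using R(2) p(1) by metis
      have "list_all2 (\<lambda>a b. ?Q (?h a) (?h b) \<or> ?h a = ?h b) ws us"
        using q(3) by (rule list_all2_mono) force
      then show ?thesis unfolding p(2,3) sol_det[OF v q(1)] sol_det[OF v q(2)] by (simp add: list_all2_map1 list_all2_map2)
    qed
  qed
qed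

text \<open>The pairs of nodes not derivably apart are a bisimulation: an opaque leaf is apart from
  every other node, determined nodes have equal generators, and corresponding children again are not
  apart.\<close>

lemma bisim_complete:
  assumes v: "wf_state S G k ns d op" and xy: "x \<in> set ns" "y \<in> set ns" "vsort x = vsort y" and n: "\<not> apart ((d, op), x, y)"
  shows "bisim d x y"
proof -
  obtain R where R: "set R = {p \<in> set ns \<times> set ns. \<not> apart ((d, op), p)}"
    using finite_list[of "{p \<in> set ns \<times> set ns. \<not> apart ((d, op), p)}"] by auto
  show ?thesis unfolding bisim_def
  proof (intro exI[of _ R] conjI ballI)
    show "(x, y) \<in> set R" using R xy n by simp
    fix p assume "p \<in> set R"
    then obtain a b where p: "p = (a, b)" "a \<in> set ns" "b \<in> set ns" "\<not> apart ((d, op), a, b)" using R by auto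
    show "fst p = snd p \<or> (\<exists>g ws us. (fst p, g, ws) \<in> set d \<and> (snd p, g, us) \<in> set d \<and> list_all2 (\<lambda>x y. (x, y) \<in> set R) ws us)"
    proof (cases "a = b")
      case False
      have "(\<exists>q. (a, q) \<in> set d) \<and> (\<exists>q. (b, q) \<in> set d)"
        using wf_stateD(3)[OF v p(2)] wf_stateD(3)[OF v p(3)] False p(4) apart.left apart.right apart.opq by metis
      then obtain g ws h us where q: "(a, g, ws) \<in> set d" "(b, h, us) \<in> set d" by auto
      have gh: "g = h" using apart.lab[OF q] p(4) by blast
      have o: "det_ok G ns (a, g, ws)" "det_ok G ns (b, h, us)" using wf_stateD(4)[OF v] q by auto
      have len: "length ws = length us" using det_okD(4)[OF o(1)] det_okD(4)[OF o(2)] gh by (metis length_map)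
      have "(ws ! i, us ! i) \<in> set R" if i: "i < length ws" for i
      proof -
        have "\<not> apart ((d, op), ws ! i, us ! i)"
          using apart.child[OF q(1) q(2)[folded gh], of i "ws ! i" "drop (Suc i) ws" "us ! i" "drop (Suc i) us"]
            Cons_nth_drop_Suc[of i ws] Cons_nth_drop_Suc[of i us] i len p(4) by auto
        moreover have "ws ! i \<in> set ns" "us ! i \<in> set ns" using det_okD(5)[OF o(1)] det_okD(5)[OF o(2)] i len nth_mem by auto
        ultimately show ?thesis unfolding R by simp
      qed
      then have "list_all2 (\<lambda>x y. (x, y) \<in> set R) ws us" using len by (simp add: list_all2_conv_all_nth)
      then show ?thesis using q gh p(1) by auto
    qed (use p in simp)
  qed
qed

lemma fin_node_sound:
  assumes v: "wf_state S G k ns d op"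
  shows "fin_node ((d, op), x) \<Longrightarrow> finite_tree (sol K d op x)"
proof (induction "((d, op), x)" arbitrary: x rule: fin_node.induct)
  case (opq x)
  then show ?case using sol_opq(2)[OF v opq] by simp
next
  case (det x g ws)
  then show ?case using sol_det[OF v det(1), of K] finite_tree_iff[of "sol K d op x"] by auto
qed

lemma inf_node_sound:
  assumes v: "wf_state S G k ns d op" and i: "inf_node d op x"
  shows "\<not> finite_tree (sol K d op x)"
proof -
  obtain R where R: "x \<in> set R" "\<forall>x \<in> set R. (\<exists>b. (x, b) \<in> set op \<and> b \<noteq> 1) \<or>
     (\<exists>g ws y. (x, g, ws) \<in> set d \<and> y \<in> set ws \<and> y \<in> set R)" using i unfolding inf_node_def by blast
  have "finite_tree t \<Longrightarrow> x \<in> set R \<Longrightarrow> t \<noteq> sol K d op x" for t x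
  proof (induction t arbitrary: x rule: finite_tree_induct)
    case (node t)
    show ?case
    proof
      assume t: "t = sol K d op x"
      from R(2) node.prems consider b where "(x, b) \<in> set op" "b \<noteq> 1"
        | g ws y where "(x, g, ws) \<in> set d" "y \<in> set ws" "y \<in> set R" by blast
      then show False
      proof cases
        case 1
        then show ?thesis using sol_opq(2)[OF v 1(1), of K] node.hyps t by simp
      next
        case 2
        have "sol K d op y \<in> set (children t)" using sol_det[OF v 2(1), of K] 2(2) t by simp
        then show ?thesis using node.IH 2(3) by blast
      qed
    qed
  qed
  then show ?thesis using R(1) by blast
qed

text \<open>The nodes for which finiteness is not derivable form the required set: a determined one
  has a child of the same sort of status, an opaque one is infinite.\<close>

lemma inf_node_complete:
  assumes v: "wf_state S G k ns d op" and x: "x \<in> set ns" and n: "\<not> fin_node ((d, op), x)"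
  shows "inf_node d op x"
proof -
  obtain R where R: "set R = {y \<in> set ns. \<not> fin_node ((d, op), y)}"
    using finite_list[of "{y \<in> set ns. \<not> fin_node ((d, op), y)}"] by auto
  show ?thesis unfolding inf_node_def
  proof (intro exI[of _ R] conjI ballI)
    show "x \<in> set R" using R x n by simp
    fix y assume "y \<in> set R"
    then have y: "y \<in> set ns" "\<not> fin_node ((d, op), y)" using R by auto
    show "(\<exists>b. (y, b) \<in> set op \<and> b \<noteq> 1) \<or> (\<exists>g ws z. (y, g, ws) \<in> set d \<and> z \<in> set ws \<and> z \<in> set R)"
      using wf_stateD(3)[OF v y(1)]
    proof
      assume "\<exists>q. (y, q) \<in> set d"
      then obtain g ws where q: "(y, g, ws) \<in> set d" by auto
      obtain z where z: "z \<in> set ws" "\<not> fin_node ((d, op), z)" using fin_node.det[OF q] y(2) by blast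
      then have "z \<in> set R" unfolding R using det_okD(5)[OF wf_stateD(4)[OF v q]] by blast
      then show ?thesis using q z by blast
    next
      assume "\<exists>b. (y, b) \<in> set op"
      then obtain b where b: "(y, b) \<in> set op" by blast
      then have "b \<noteq> 1" using fin_node.opq y(2) by blast
      then show ?thesis using b by blast
    qed
  qed
qed

lemma wf_state_add:
  assumes v: "wf_state S G k ns d op" and s: "s \<in> sorts S" and d: "det_ok G (V k s # ns) (V k s, q)"
  shows "wf_state S G (Suc k) (V k s # ns) ((V k s, q) # d) op"
proof -
  have "fresh_names k S 1 [V k s]" using s by (simp add: fresh_names_def)
  moreover have "([(V k s, q)], []) \<in> completions S G ([V k s] @ ns) [V k s]" using d by (cases q) simp
  ultimately show ?thesis using completions_wf_state[OF v, of 1 "[V k s]" "[(V k s, q)]" "[]"] by simp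
qed

definition env_ok :: "var list \<Rightarrow> (var \<times> var) list \<Rightarrow> var set \<Rightarrow> bool" where
  "env_ok ns env X \<longleftrightarrow> (\<forall>x \<in> X. \<exists>v \<in> set ns. map_of env x = Some v \<and> vsort v = vsort x)"

lemma code_App_inv:
  assumes "code_trm t = list_encode (1 # code_gen g # us)"
  shows "\<exists>ts. t = trm.App g ts \<and> us = map code_trm ts"
proof (cases t)
  case (App h ts)
  then have c: "code_gen h = code_gen g" "us = map code_trm ts" using assms by (auto simp: list_encode_eq simp del: list_encode.simps)
  then have "h = g" by (auto simp: code_gen_def list_encode_eq simp del: list_encode.simps intro: gen.expand)
  then show ?thesis using c App by blast
qed (use assms in \<open>auto simp: list_encode_eq simp del: list_encode.simps\<close>)

text \<open>Nodes added for one term do not change the values of earlier nodes, so what is known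
  about the previous terms persists while the next one is added.\<close>

lemma add_trms_sound:
  assumes S: "tree_signature S" and G: "G \<subseteq> gens S"
  shows "add_trms (st, env, cs, st', vs) \<Longrightarrow> st = (k, ns, d, op) \<Longrightarrow> wf_state S G k ns d op \<Longrightarrow> cs = map code_trm ts \<Longrightarrow>
    \<forall>t \<in> set ts. wf_trm S t \<and> gens_trm t \<subseteq> G \<Longrightarrow>
    \<forall>x \<in> (\<Union>t \<in> set ts. vars_trm t). \<exists>v \<in> set ns. map_of env x = Some v \<and> vsort v = vsort x \<and> sol K d op v = e x \<Longrightarrow>
    \<exists>k' ns' d' op'. st' = (k', ns', d', op') \<and> wf_state S G k' ns' d' op' \<and> set ns \<subseteq> set ns' \<and> set d \<subseteq> set d' \<and> set op \<subseteq> set op' \<and>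
      list_all2 (\<lambda>v t. v \<in> set ns' \<and> vsort v = sort_of t \<and> sol K d' op' v = eval_trm e t) vs ts"
proof (induction "(st, env, cs, st', vs)" arbitrary: st cs st' vs k ns d op ts rule: add_trms.induct)
  case (Nil st)
  then show ?case by auto
next
  case (Var x v st cs st' vs)
  obtain t ts' where ts: "ts = t # ts'" "code_trm t = list_encode [0, code_var x]" "cs = map code_trm ts'"
    using Var.prems(3) by (cases ts) (auto simp del: list_encode.simps code_trm.simps)
  have t: "t = trm.Var x" using inj_code_trm[of t "trm.Var x"] ts(2) by (simp del: list_encode.simps)
  obtain k' ns' d' op' where IH: "st' = (k', ns', d', op')" "wf_state S G k' ns' d' op'" "set ns \<subseteq> set ns'" "set d \<subseteq> set d'"
      "set op \<subseteq> set op'" "list_all2 (\<lambda>v t. v \<in> set ns' \<and> vsort v = sort_of t \<and> sol K d' op' v = eval_trm e t) vs ts'"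
    using Var.hyps(3)[OF Var.prems(1,2) ts(3)] Var.prems(4,5) ts(1) by auto
  have "v \<in> set ns" "vsort v = vsort x" "sol K d op v = e x" using Var.prems(5) Var.hyps(1) ts(1) t by auto
  moreover from this have "sol K d' op' v = e x" using sol_extend[OF Var.prems(2) IH(2,4,5), of v K] by simp
  ultimately show ?case using IH ts(1) t by auto
next
  case (App st us k1 ns1 d1 op1 vs g cs st' ws)
  obtain t ts' where ts: "ts = t # ts'" "code_trm t = list_encode (1 # code_gen g # us)" "cs = map code_trm ts'"
    using App.prems(3) by (cases ts) (auto simp del: list_encode.simps code_trm.simps)
  obtain ts0 where t: "t = trm.App g ts0" "us = map code_trm ts0" using code_App_inv[OF ts(2)] by blast
  have wt: "g \<in> gens S" "g \<in> G" "map sort_of ts0 = gargs g" "\<forall>t \<in> set ts0. wf_trm S t \<and> gens_trm t \<subseteq> G"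
    using App.prems(4) ts(1) t(1) by auto
  have e0: "\<forall>x \<in> (\<Union>t \<in> set ts0. vars_trm t). \<exists>v \<in> set ns. map_of env x = Some v \<and> vsort v = vsort x \<and> sol K d op v = e x"
    using App.prems(5) ts(1) t(1) by auto
  have v1: "wf_state S G k1 ns1 d1 op1" "set ns \<subseteq> set ns1" "set d \<subseteq> set d1" "set op \<subseteq> set op1"
      "list_all2 (\<lambda>v t. v \<in> set ns1 \<and> vsort v = sort_of t \<and> sol K d1 op1 v = eval_trm e t) vs ts0"
    using App.hyps(2)[OF App.prems(1,2) t(2) wt(4) e0] by auto
  let ?v = "V k1 (gres g)"
  have len: "length vs = length ts0" "length ts0 = length (gargs g)" 
    using list_all2_lengthD[OF v1(5)] wt(3) by (simp_all flip: wt(3))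
  have "list_all2 (\<lambda>w s. vsort w = s) vs (gargs g)" unfolding wt(3)[symmetric]
    using v1(5) by (auto simp: list_all2_map2 elim: list_all2_mono)
  moreover have "\<forall>w \<in> set vs. w \<in> set ns1" using v1(5) by (auto simp: list_all2_conv_all_nth in_set_conv_nth)
  ultimately have "det_ok G (?v # ns1) (?v, g, vs)" using wt(2) unfolding det_ok_def by simp
  then have v2: "wf_state S G (Suc k1) (?v # ns1) ((?v, g, vs) # d1) op1"
    using wf_state_add[OF v1(1)] S wt(1) unfolding tree_signature_def by blast
  have ext1: "sol K ((?v, g, vs) # d1) op1 w = sol K d1 op1 w" if "w \<in> set ns1" for w
    by (rule sol_extend[OF v1(1) v2 _ _ that]) auto
  have ext0: "sol K d1 op1 w = sol K d op w" if "w \<in> set ns" for w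
    by (rule sol_extend[OF App.prems(2) v1(1,3,4) that])
  have "map (sol K ((?v, g, vs) # d1) op1) vs = map (eval_trm e) ts0"
    using v1(5) ext1 by (auto simp: list_all2_conv_all_nth intro: nth_equalityI)
  then have sv: "sol K ((?v, g, vs) # d1) op1 ?v = eval_trm e t" using sol_det[OF v2, of ?v g vs K] t(1) by simp
  have e2: "\<forall>x \<in> (\<Union>t \<in> set ts'. vars_trm t). \<exists>v \<in> set (?v # ns1). map_of env x = Some v \<and> vsort v = vsort x \<and>
      sol K ((?v, g, vs) # d1) op1 v = e x"
  proof
    fix x assume "x \<in> (\<Union>t \<in> set ts'. vars_trm t)"
    then obtain w where w: "w \<in> set ns" "map_of env x = Some w" "vsort w = vsort x" "sol K d op w = e x"
      using App.prems(5) ts(1) by auto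
    then show "\<exists>v \<in> set (?v # ns1). map_of env x = Some v \<and> vsort v = vsort x \<and> sol K ((?v, g, vs) # d1) op1 v = e x"
      using ext0[OF w(1)] ext1[of w] v1(2) by auto
  qed
  have w2: "\<forall>t \<in> set ts'. wf_trm S t \<and> gens_trm t \<subseteq> G" using App.prems(4) ts(1) by simp
  obtain k' ns' d' op' where IH: "st' = (k', ns', d', op')" "wf_state S G k' ns' d' op'" "set (?v # ns1) \<subseteq> set ns'"
      "set ((?v, g, vs) # d1) \<subseteq> set d'" "set op1 \<subseteq> set op'"
      "list_all2 (\<lambda>v t. v \<in> set ns' \<and> vsort v = sort_of t \<and> sol K d' op' v = eval_trm e t) ws ts'"
    using App.hyps(4)[OF refl v2 ts(3) w2 e2] by blast
  have "sol K d' op' ?v = eval_trm e t" using sol_extend[OF v2 IH(2,4,5), of ?v K] sv by simp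
  then show ?case using IH v1(2-4) ts(1) t(1) by auto
qed

lemma add_trms_complete:
  "\<forall>x \<in> (\<Union>t \<in> set ts. vars_trm t). map_of env x \<noteq> None \<Longrightarrow> \<exists>st' vs. add_trms (st, env, map code_trm ts, st', vs)"
proof (induction "size_list size ts" arbitrary: ts st rule: less_induct)
  case less
  show ?case
  proof (cases ts)
    case Nil
    have "add_trms (st, env, map code_trm ts, st, [])" unfolding Nil list.map by (rule add_trms.Nil)
    then show ?thesis by blast
  next
    case (Cons t ts')
    show ?thesis
    proof (cases t)
      case (Var x)
      obtain v where v: "map_of env x = Some v" using less.prems Cons Var by auto
      obtain st' vs where "add_trms (st, env, map code_trm ts', st', vs)" using less.hyps[of ts' st] less.prems Cons Var by auto
      from add_trms.Var[OF v this] have "add_trms (st, env, map code_trm ts, st', v # vs)"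
        unfolding Cons Var by (simp del: list_encode.simps)
      then show ?thesis by blast
    next
      case (App g us)
      obtain st1 ws where "add_trms (st, env, map code_trm us, st1, ws)" using less.hyps[of us st] less.prems Cons App by auto
      moreover obtain k ns d op where "st1 = (k, ns, d, op)" using prod_cases4 by blast
      ultimately have 1: "add_trms (st, env, map code_trm us, (k, ns, d, op), ws)" by simp
      obtain st' vs where "add_trms ((Suc k, V k (gres g) # ns, (V k (gres g), g, ws) # d, op), env, map code_trm ts', st', vs)"
        using less.hyps[of ts'] less.prems Cons App by fastforce
      from add_trms.App[OF 1 this] have "add_trms (st, env, map code_trm ts, st', V k (gres g) # vs)"
        unfolding Cons App by (simp del: list_encode.simps)
      then show ?thesis by blast
    qed
  qed
qed

lemma code_var_inj: "code_var x = code_var y \<Longrightarrow> x = y"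
  by (auto simp: code_var_def intro: var.expand)

lemma code_fm_inv:
  "list_encode [0] = code_fm p \<Longrightarrow> p = Tru" "list_encode [1] = code_fm p \<Longrightarrow> p = Fls"
  "list_encode [2, a, b] = code_fm p \<Longrightarrow> \<exists>t u. p = Eq t u \<and> a = code_trm t \<and> b = code_trm u"
  "list_encode [3, s, a] = code_fm p \<Longrightarrow> \<exists>t. p = Fin s t \<and> a = code_trm t"
  "list_encode [4, a] = code_fm p \<Longrightarrow> \<exists>q. p = Neg q \<and> a = code_fm q"
  "list_encode [9, code_var x, a] = code_fm p \<Longrightarrow> \<exists>q. p = Exists x q \<and> a = code_fm q"
  "list_encode [10, y, a] = code_fm p \<Longrightarrow> \<exists>x q. p = Forall x q \<and> y = code_var x \<and> a = code_fm q"
  by (cases p; force simp: list_encode_eq simp del: list_encode.simps dest: code_var_inj)+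

lemma code_fm_bin:
  assumes "list_encode [j, a, b] = code_fm p" "j \<in> {5, 6, 7, 8}"
  shows "\<exists>q q'. a = code_fm q \<and> b = code_fm q' \<and> p = (if j = 5 then And q q' else if j = 6 then Or q q' else if j = 7 then Imp q q' else Iff q q')"
  using assms by (cases p) (auto simp: list_encode_eq simp del: list_encode.simps)

text \<open>The state does not represent \<open>e\<close> itself: its nodes have values that merely
  look like those of \<open>e\<close> down to depth \<open>N\<close>.\<close>

definition ev_inv :: "signature \<Rightarrow> gen set \<Rightarrow> nat \<Rightarrow> nat \<Rightarrow> var list \<Rightarrow> det list \<Rightarrow> opq list \<Rightarrow> (var \<times> var) list \<Rightarrow>
    (tree \<times> tree) set \<Rightarrow> (var \<Rightarrow> tree) \<Rightarrow> fm \<Rightarrow> bool" where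
  "ev_inv S G K N ns d op env M e p \<longleftrightarrow> wf_fm S p \<and> gens_fm p \<subseteq> G \<and> link S G K N ns d op M \<and>
     (\<forall>x \<in> fv p. \<exists>v \<in> set ns. map_of env x = Some v \<and> vsort v = vsort x \<and> (e x, sol K d op v) \<in> M)"

lemma ev_inv_ex:
  assumes i: "ev_inv S G K N ns d op env M e (Exists x p)" and v: "wf_state S G k ns d op" and v': "wf_state S G k' ns' d' op'"
    and sub: "set d \<subseteq> set d'" "set op \<subseteq> set op'" "set ns \<subseteq> set ns'" and c: "c \<in> trees S (vsort x)"
    and w: "w \<in> set ns'" "vsort w = vsort x" and e: "eqv G n (insert (c, sol K d' op' w) M)"
  shows "ev_inv S G K n ns' d' op' ((x, w) # env) (insert (c, sol K d' op' w) M) (e(x := c)) p"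
proof -
  have l: "link S G K N ns d op M" using i unfolding ev_inv_def by blast
  have "link S G K n ns' d' op' (insert (c, sol K d' op' w) M)"
    by (rule link_extend[OF l v v' sub _ w(1) e]) (use c w(2) in simp)
  moreover have "\<exists>u \<in> set ns'. map_of ((x, w) # env) y = Some u \<and> vsort u = vsort y \<and>
      ((e(x := c)) y, sol K d' op' u) \<in> insert (c, sol K d' op' w) M" if y: "y \<in> fv p" for y
  proof (cases "y = x")
    case True
    then show ?thesis using w by auto
  next
    case False
    then obtain u where u: "u \<in> set ns" "map_of env y = Some u" "vsort u = vsort y" "(e y, sol K d op u) \<in> M"
      using i y unfolding ev_inv_def by auto
    then show ?thesis using sol_extend[OF v v' sub(1,2) u(1), of K] sub(3) False by auto
  qed
  ultimately show ?thesis using i unfolding ev_inv_def by simp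
qed

lemma ev_terms:
  assumes pre: "ef_pre S G" and T: "add_trms ((k, ns, d, op), env, map code_trm ts, (k', ns', d', op'), vs)" and v: "wf_state S G k ns d op"
    and ts: "\<forall>t \<in> set ts. wf_trm S t \<and> gens_trm t \<subseteq> G"
    and env: "\<forall>x \<in> (\<Union>t \<in> set ts. vars_trm t). \<exists>v \<in> set ns. map_of env x = Some v \<and> vsort v = vsort x"
  shows "wf_state S G k' ns' d' op' \<and> list_all2 (\<lambda>v t. v \<in> set ns' \<and> vsort v = sort_of t \<and>
    sol K d' op' v = eval_trm (\<lambda>x. sol K d op (the (map_of env x))) t) vs ts"
proof -
  have S: "tree_signature S" "G \<subseteq> gens S" using pre unfolding ef_pre_def by auto
  have e: "\<forall>x \<in> (\<Union>t \<in> set ts. vars_trm t). \<exists>v \<in> set ns. map_of env x = Some v \<and> vsort v = vsort x \<and>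
      sol K d op v = sol K d op (the (map_of env x))"
  proof
    fix x assume "x \<in> (\<Union>t \<in> set ts. vars_trm t)"
    then obtain v where "v \<in> set ns" "map_of env x = Some v" "vsort v = vsort x" using env by blast
    then show "\<exists>v \<in> set ns. map_of env x = Some v \<and> vsort v = vsort x \<and> sol K d op v = sol K d op (the (map_of env x))"
      by (intro bexI[of _ v]) simp_all
  qed
  from add_trms_sound[OF S T refl v refl ts e] show ?thesis by blast
qed

text \<open>The equation is evaluated for the values of nodes, where the added nodes represent the
  terms, and then transferred along the matching. The codes of both terms bound the depth that the
  transfer needs.\<close>

lemma ev_eq:
  assumes pre: "ef_pre S G" and T: "add_trms ((k, ns, d, op), env, [code_trm t, code_trm u], (k', ns', d', op'), [v, w])"
    and v: "wf_state S G k ns d op" and i: "ev_inv S G K N ns d op env M e (Eq t u)" and N: "code_trm t \<le> N" "code_trm u \<le> N"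
  shows "wf_state S G k' ns' d' op' \<and> (sol K d' op' v = sol K d' op' w \<longleftrightarrow> sat S e (Eq t u))"
proof -
  let ?e = "\<lambda>x. sol K d op (the (map_of env x))"
  have T': "add_trms ((k, ns, d, op), env, map code_trm [t, u], (k', ns', d', op'), [v, w])" using T by simp
  have wf: "wf_trm S t" "wf_trm S u" "gens_trm t \<subseteq> G" "gens_trm u \<subseteq> G" using i unfolding ev_inv_def by auto
  have ex: "\<exists>v \<in> set ns. map_of env x = Some v \<and> vsort v = vsort x \<and> (e x, sol K d op v) \<in> M"
    if "x \<in> vars_trm t \<union> vars_trm u" for x
    using i that unfolding ev_inv_def by simp
  have 1: "wf_state S G k' ns' d' op'" "sol K d' op' v = eval_trm ?e t" "sol K d' op' w = eval_trm ?e u"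
    using ev_terms[OF pre T' v, where K = K] wf ex by fastforce+
  have VV: "(e x, ?e x) \<in> M" if "x \<in> vars_trm t \<union> vars_trm u" for x using ex[OF that] by fastforce
  have M: "M \<subseteq> W S \<times> W (opq_sig S G K)" "eqv G N M" using i unfolding ev_inv_def link_def by auto
  have "eval_trm e t = eval_trm e u \<longleftrightarrow> eval_trm ?e t = eval_trm ?e u"
    by (rule trm_eq_match[where VV = "vars_trm t \<union> vars_trm u", OF M VV N wf(1,2)]) (use wf in auto)
  then show ?thesis using 1 by simp
qed

lemma ev_fin:
  assumes pre: "ef_pre S G" and T: "add_trms ((k, ns, d, op), env, [code_trm t], (k', ns', d', op'), [v])"
    and v: "wf_state S G k ns d op" and i: "ev_inv S G K N ns d op env M e (Fin s t)"
  shows "wf_state S G k' ns' d' op' \<and> (finite_tree (sol K d' op' v) \<longleftrightarrow> sat S e (Fin s t))"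
proof -
  let ?e = "\<lambda>x. sol K d op (the (map_of env x))"
  have T': "add_trms ((k, ns, d, op), env, map code_trm [t], (k', ns', d', op'), [v])" using T by simp
  have wf: "wf_trm S t" "gens_trm t \<subseteq> G" using i unfolding ev_inv_def by auto
  have ex: "\<exists>v \<in> set ns. map_of env x = Some v \<and> vsort v = vsort x \<and> (e x, sol K d op v) \<in> M"
    if "x \<in> vars_trm t" for x
    using i that unfolding ev_inv_def by simp
  have 1: "wf_state S G k' ns' d' op'" "sol K d' op' v = eval_trm ?e t"
    using ev_terms[OF pre T' v, where K = K] wf ex by fastforce+
  have VV: "(e x, ?e x) \<in> M" if "x \<in> vars_trm t" for x using ex[OF that] by fastforce
  have M: "eqv G N M" using i unfolding ev_inv_def link_def by auto
  have "finite_tree (eval_trm e t) = finite_tree (eval_trm ?e t)" by (rule trm_fin_match[OF M VV]) auto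
  then show ?thesis using 1 by simp
qed

text \<open>If an existential formula is derived to be true, \<open>sym_back\<close> turns the node
  found into a tree. If it is derived to be false, every tree is matched with one of the candidates
  by \<open>sym_step\<close>, and by \<open>eqv_shallow\<close> this candidate has not been passed
  over, so the induction hypothesis applies to it.\<close>

lemma Ev_sound:
  assumes pre: "ef_pre S (set G)" and K: "\<forall>g \<in> set G. gname g < K" and r: "\<And>g. g \<in> set G \<Longrightarrow> length (gargs g) \<le> r"
  shows "Ev S ((G, r), N, (k, ns, d, op), env, c, b) \<Longrightarrow> c = code_fm p \<Longrightarrow> wf_state S (set G) k ns d op \<Longrightarrow>
    ev_inv S (set G) K N ns d op env M e p \<Longrightarrow> b = of_bool (sat S e p)"
proof (induction "((G, r), N, (k, ns, d, op), env, c, b)" arbitrary: N k ns d op env c b p M e rule: Ev.induct)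
  case Tru
  then show ?case using code_fm_inv(1)[of p] by (simp del: list_encode.simps)
next
  case Fls
  then show ?case using code_fm_inv(2)[of p] by (simp del: list_encode.simps)
next
  case (Eq1 a N b env k' ns' d' op' v w k ns d op)
  obtain t u where p: "p = Eq t u" "a = code_trm t" "b = code_trm u" using code_fm_inv(3)[OF Eq1.prems(1)] by blast
  from ev_eq[OF pre Eq1.hyps(3)[unfolded p(2,3)] Eq1.prems(2) Eq1.prems(3)[unfolded p(1)] Eq1.hyps(1,2)[unfolded p(2,3)]]
    bisim_sound[OF _ Eq1.hyps(4)] p(1) show ?case by (metis of_bool_eq(2))
next
  case (Eq0 a N b env k' ns' d' op' v w k ns d op)
  obtain t u where p: "p = Eq t u" "a = code_trm t" "b = code_trm u" using code_fm_inv(3)[OF Eq0.prems(1)] by blast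
  from ev_eq[OF pre Eq0.hyps(3)[unfolded p(2,3)] Eq0.prems(2) Eq0.prems(3)[unfolded p(1)] Eq0.hyps(1,2)[unfolded p(2,3)]]
    apart_sound[OF _ K Eq0.hyps(4)] p(1) show ?case by (metis of_bool_eq(1))
next
  case (Fin1 env a k' ns' d' op' v N s k ns d op)
  obtain t where p: "p = Fin s t" "a = code_trm t" using code_fm_inv(4)[OF Fin1.prems(1)] by blast
  from ev_fin[OF pre Fin1.hyps(1)[unfolded p(2)] Fin1.prems(2) Fin1.prems(3)[unfolded p(1)]]
    fin_node_sound[OF _ Fin1.hyps(2)] p(1) show ?case by (metis of_bool_eq(2))
next
  case (Fin0 env a k' ns' d' op' v N s k ns d op)
  obtain t where p: "p = Fin s t" "a = code_trm t" using code_fm_inv(4)[OF Fin0.prems(1)] by blast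
  from ev_fin[OF pre Fin0.hyps(1)[unfolded p(2)] Fin0.prems(2) Fin0.prems(3)[unfolded p(1)]]
    inf_node_sound[OF _ Fin0.hyps(2)] p(1) show ?case by (metis of_bool_eq(1))
next
  case (Neg N env c b k ns d op)
  then obtain q where q: "p = fm.Neg q" "c = code_fm q" using code_fm_inv(5) by blast
  then have "b = of_bool (sat S e q)"
    using Neg.hyps(2)[OF q(2) Neg.prems(2), of M e] Neg.prems(3) unfolding ev_inv_def by simp
  then show ?case using q by simp
next
  case (Bin j b1 b2 b N env c1 c2 k ns d op)
  obtain x y where xy: "j \<in> {5, 6, 7, 8}" "b1 = of_bool x" "b2 = of_bool y"
    "b = of_bool (if j = 5 then x \<and> y else if j = 6 then x \<or> y else if j = 7 then x \<longrightarrow> y else x = y)"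
    using Bin.hyps(1) unfolding truth_table_def by auto
  obtain q q' where q: "c1 = code_fm q" "c2 = code_fm q'"
    "p = (if j = 5 then And q q' else if j = 6 then Or q q' else if j = 7 then Imp q q' else Iff q q')"
    using code_fm_bin[OF Bin.prems(1) xy(1)] by blast
  have "p \<in> {And q q', Or q q', Imp q q', Iff q q'}" using q(3) by simp
  then have "wf_fm S p = (wf_fm S q \<and> wf_fm S q')" "gens_fm p = gens_fm q \<union> gens_fm q'" "fv p = fv q \<union> fv q'" by auto
  then have iv: "ev_inv S (set G) K N ns d op env M e q" "ev_inv S (set G) K N ns d op env M e q'"
    using Bin.prems(3) unfolding ev_inv_def by simp_all
  have "x = sat S e q" "y = sat S e q'"
    using Bin.hyps(3)[OF q(1) Bin.prems(2) iv(1)] Bin.hyps(5)[OF q(2) Bin.prems(2) iv(2)] xy(2,3) by (simp_all add: of_bool_eq_iff)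
  then show ?case using q(3) xy(4) by simp
next
  case (Ex1 n N nn k q f ns v x d op env c)
  obtain p' where p: "p = Exists x p'" "c = code_fm p'" using code_fm_inv(6)[OF Ex1.prems(1)] by blast
  have fr: "fresh_names k S q nn" using Ex1.hyps(2) unfolding fresh_lists_def by simp
  have v': "wf_state S (set G) (k + q) (nn @ ns) (fst f @ d) (snd f @ op)"
    using completions_wf_state[OF Ex1.prems(2) fr, of "fst f" "snd f"] Ex1.hyps(3) by simp
  have l: "link S (set G) K N ns d op M" using Ex1.prems(3) unfolding ev_inv_def by blast
  obtain t where t: "t \<in> trees S (vsort v)" "eqv (set G) n (insert (t, sol K (fst f @ d) (snd f @ op) v) M)"
    using sym_back[OF pre Ex1.prems(2) v' K r Ex1.hyps(1) l Ex1.hyps(4)] shallow_iff[OF v' K Ex1.hyps(4)] Ex1.hyps(6) by blast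
  have "ev_inv S (set G) K n (nn @ ns) (fst f @ d) (snd f @ op) ((x, v) # env)
      (insert (t, sol K (fst f @ d) (snd f @ op) v) M) (e(x := t)) p'"
    using t Ex1.hyps(5) by (intro ev_inv_ex[OF Ex1.prems(3)[unfolded p(1)] Ex1.prems(2) v' _ _ _ _ Ex1.hyps(4,5)]) auto
  then have "(1 :: nat) = of_bool (sat S (e(x := t)) p')" by (rule Ex1.hyps(8)[OF p(2) v'])
  then have "sat S (e(x := t)) p'" by (cases "sat S (e(x := t)) p'") simp_all
  then have "sat S e p" using t(1) Ex1.hyps(5) p(1) by auto
  then show ?case by simp
next
  case (Ex0 n N k ns x d op env c)
  obtain p' where p: "p = Exists x p'" "c = code_fm p'" using code_fm_inv(6)[OF Ex0.prems(1)] by blast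
  have l: "link S (set G) K N ns d op M" using Ex0.prems(3) unfolding ev_inv_def by blast
  have M: "M \<subseteq> W S \<times> W (opq_sig S (set G) K)" using l unfolding link_def by blast
  have "\<not> sat S (e(x := t)) p'" if t: "t \<in> trees S (vsort x)" for t
  proof -
    obtain q nn d' op' w where w: "q \<le> Suc r ^ n" "fresh_names k S q nn" "(d', op') \<in> completions S (set G) (nn @ ns) nn"
      "w \<in> set (nn @ ns)" "vsort w = vsort x" "eqv (set G) n (insert (t, sol K (d' @ d) (op' @ op) w) M)"
      using sym_step[OF pre Ex0.prems(2) K r Ex0.hyps(1) l t] by blast
    have v': "wf_state S (set G) (k + q) (nn @ ns) (d' @ d) (op' @ op)" by (rule completions_wf_state[OF Ex0.prems(2) w(2,3)])
    let ?h = "sol K (d' @ d) (op' @ op) w"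
    have "shallow S (d' @ d) (op' @ op) n w"
      unfolding shallow_iff[OF v' K w(4)]
      using eqv_shallow[OF pre w(6), of t ?h] W_trees[OF t] W_trees[OF sol_trees[OF v' w(4), of K]] by blast
    moreover have "q < Suc (Suc r ^ n)" "nn \<in> fresh_lists k S q" using w(1,2) unfolding fresh_lists_def by auto
    moreover have iv: "ev_inv S (set G) K n (nn @ ns) (d' @ d) (op' @ op) ((x, w) # env) (insert (t, ?h) M) (e(x := t)) p'"
      by (rule ev_inv_ex[OF Ex0.prems(3)[unfolded p(1)] Ex0.prems(2) v' _ _ _ t w(4,5,6)]) auto
    ultimately have "(0 :: nat) = of_bool (sat S (e(x := t)) p')"
      using Ex0.hyps(2)[rule_format, of q nn "(d', op')" w] w(3-5) p(2) v' by auto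
    then show ?thesis by (cases "sat S (e(x := t)) p'") simp_all
  qed
  then show ?case using p(1) by simp
next
  case (All N env y c b k ns d op)
  obtain x p' where p: "p = Forall x p'" "y = code_var x" "c = code_fm p'" using code_fm_inv(7)[OF All.prems(1)] by blast
  have "b = of_bool (sat S e (Exists x (fm.Neg p')))"
  proof (rule All.hyps(2)[OF _ All.prems(2)])
    show "list_encode [9, y, list_encode [4, c]] = code_fm (Exists x (fm.Neg p'))" using p by simp
    show "ev_inv S (set G) K N ns d op env M e (Exists x (fm.Neg p'))" using All.prems(3) p(1) unfolding ev_inv_def by simp
  qed
  then show ?case using p(1) by auto
qed

section \<open>Termination of the evaluation\<close>

text \<open>Quantifying over all states and environments makes the induction pass through
  quantifiers, whose bodies are evaluated in enlarged states.\<close>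

definition decides :: "signature \<Rightarrow> gen list \<Rightarrow> nat \<Rightarrow> nat \<Rightarrow> var set \<Rightarrow> nat \<Rightarrow> bool" where
  "decides S G r N X c \<longleftrightarrow> (\<forall>k ns d op env. wf_state S (set G) k ns d op \<longrightarrow> env_ok ns env X \<longrightarrow>
     (\<exists>b :: bool. Ev S ((G, r), N, (k, ns, d, op), env, c, of_bool b)))"

lemma decides_Neg: "decides S G r N X c \<Longrightarrow> decides S G r N X (list_encode [4, c])"
  unfolding decides_def
proof (intro allI impI)
  fix k ns d op env
  assume "\<forall>k ns d op env. wf_state S (set G) k ns d op \<longrightarrow> env_ok ns env X \<longrightarrow>
     (\<exists>b :: bool. Ev S ((G, r), N, (k, ns, d, op), env, c, of_bool b))" "wf_state S (set G) k ns d op" "env_ok ns env X"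
  then obtain b :: bool where "Ev S ((G, r), N, (k, ns, d, op), env, c, of_bool b)" by blast
  from Ev.Neg[OF this] have "Ev S ((G, r), N, (k, ns, d, op), env, list_encode [4, c], of_bool (\<not> b))" by (cases b) (simp_all del: list_encode.simps)
  then show "\<exists>b :: bool. Ev S ((G, r), N, (k, ns, d, op), env, list_encode [4, c], of_bool b)" by blast
qed

lemma decides_Bin:
  assumes j: "j \<in> {5, 6, 7, 8}" and t: "decides S G r N X c" "decides S G r N Y c'"
  shows "decides S G r N (X \<union> Y) (list_encode [j, c, c'])"
  unfolding decides_def
proof (intro allI impI)
  fix k ns d op env assume v: "wf_state S (set G) k ns d op" "env_ok ns env (X \<union> Y)"
  then have "env_ok ns env X" "env_ok ns env Y" unfolding env_ok_def by blast+
  then obtain x y :: bool where e: "Ev S ((G, r), N, (k, ns, d, op), env, c, of_bool x)" "Ev S ((G, r), N, (k, ns, d, op), env, c', of_bool y)"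
    using t v(1) unfolding decides_def by blast
  let ?b = "if j = 5 then x \<and> y else if j = 6 then x \<or> y else if j = 7 then x \<longrightarrow> y else x = y"
  have "(j, of_bool x, of_bool y, of_bool ?b) \<in> truth_table"
    unfolding truth_table_def using j by (intro image_eqI[of _ _ "(j, x, y)"]) auto
  from Ev.Bin[OF this e] show "\<exists>b :: bool. Ev S ((G, r), N, (k, ns, d, op), env, list_encode [j, c, c'], of_bool b)" by blast
qed

lemma decides_Bin':
  assumes "\<exists>n. \<forall>N \<ge> n. decides S G r N X c" "\<exists>n. \<forall>N \<ge> n. decides S G r N Y c'" "j \<in> {5, 6, 7, 8}"
  shows "\<exists>n. \<forall>N \<ge> n. decides S G r N (X \<union> Y) (list_encode [j, c, c'])"
proof -
  obtain n m where "\<forall>N \<ge> n. decides S G r N X c" "\<forall>N \<ge> m. decides S G r N Y c'" using assms(1,2) by blast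
  then have "\<forall>N \<ge> max n m. decides S G r N (X \<union> Y) (list_encode [j, c, c'])" using decides_Bin[OF assms(3)] by simp
  then show ?thesis by blast
qed

text \<open>The body is decided for every candidate. Either some admissible candidate makes it true,
  or it is false for all admissible ones, in particular for those within the bound on the number of
  new nodes.\<close>

lemma decides_Ex:
  assumes t: "decides S G r n X c" and N: "n + 2 * Suc r ^ n + 1 \<le> N"
  shows "decides S G r N (X - {x}) (list_encode [9, code_var x, c])"
  unfolding decides_def
proof (intro allI impI)
  fix k ns d op env assume v: "wf_state S (set G) k ns d op" and e: "env_ok ns env (X - {x})"
  let ?E = "\<lambda>q nn f w b. Ev S ((G, r), n, (k + q, nn @ ns, fst f @ d, snd f @ op), (x, w) # env, c, b)"
  have "\<exists>b :: bool. ?E q nn f w (of_bool b)"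
    if "nn \<in> fresh_lists k S q" "f \<in> completions S (set G) (nn @ ns) nn" "w \<in> set (nn @ ns)" "vsort w = vsort x" for q nn f w
  proof -
    have "wf_state S (set G) (k + q) (nn @ ns) (fst f @ d) (snd f @ op)"
      using completions_wf_state[OF v, of q nn "fst f" "snd f"] that(1,2) unfolding fresh_lists_def by simp
    moreover have "env_ok (nn @ ns) ((x, w) # env) X" using e that(3,4) unfolding env_ok_def by auto
    ultimately show ?thesis using t unfolding decides_def by blast
  qed
  then have tt: "?E q nn f w 1 \<or> ?E q nn f w 0"
    if "nn \<in> fresh_lists k S q" "f \<in> completions S (set G) (nn @ ns) nn" "w \<in> set (nn @ ns)" "vsort w = vsort x" for q nn f w
    using that by (metis of_bool_eq(1) of_bool_eq(2))
  show "\<exists>b :: bool. Ev S ((G, r), N, (k, ns, d, op), env, list_encode [9, code_var x, c], of_bool b)"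
  proof (cases "\<exists>q nn f w. nn \<in> fresh_lists k S q \<and> f \<in> completions S (set G) (nn @ ns) nn \<and> w \<in> set (nn @ ns) \<and> vsort w = vsort x \<and>
      shallow S (fst f @ d) (snd f @ op) n w \<and> ?E q nn f w 1")
    case True
    then obtain q nn f w where "nn \<in> fresh_lists k S q" "f \<in> completions S (set G) (nn @ ns) nn" "w \<in> set (nn @ ns)" "vsort w = vsort x"
      "shallow S (fst f @ d) (snd f @ op) n w" "?E q nn f w 1" by blast
    then have "Ev S ((G, r), N, (k, ns, d, op), env, list_encode [9, code_var x, c], 1)" by (rule Ev.Ex1[OF N])
    then show ?thesis by (intro exI[of _ True]) simp
  next
    case False
    then have "\<forall>q < Suc (Suc r ^ n). \<forall>nn \<in> fresh_lists k S q. \<forall>f \<in> completions S (set G) (nn @ ns) nn. \<forall>w \<in> set (nn @ ns).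
      vsort w \<noteq> vsort x \<or> \<not> shallow S (fst f @ d) (snd f @ op) n w \<or> ?E q nn f w 0" using tt by blast
    then have "Ev S ((G, r), N, (k, ns, d, op), env, list_encode [9, code_var x, c], 0)" by (rule Ev.Ex0[OF N])
    then show ?thesis by (intro exI[of _ False]) simp
  qed
qed

lemma decides_All: "decides S G r N X (list_encode [9, x, list_encode [4, c]]) \<Longrightarrow> decides S G r N X (list_encode [10, x, c])"
  unfolding decides_def
proof (intro allI impI)
  fix k ns d op env
  assume "\<forall>k ns d op env. wf_state S (set G) k ns d op \<longrightarrow> env_ok ns env X \<longrightarrow>
     (\<exists>b :: bool. Ev S ((G, r), N, (k, ns, d, op), env, list_encode [9, x, list_encode [4, c]], of_bool b))"
    "wf_state S (set G) k ns d op" "env_ok ns env X"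
  then obtain b :: bool where "Ev S ((G, r), N, (k, ns, d, op), env, list_encode [9, x, list_encode [4, c]], of_bool b)" by blast
  from Ev.All[OF this] have "Ev S ((G, r), N, (k, ns, d, op), env, list_encode [10, x, c], of_bool (\<not> b))" by (cases b) (simp_all del: list_encode.simps)
  then show "\<exists>b :: bool. Ev S ((G, r), N, (k, ns, d, op), env, list_encode [10, x, c], of_bool b)" by blast
qed

text \<open>A threshold instead of one depth, because the two sides of a binary connective are
  evaluated with the same \<open>N\<close>. It need not be computed: the search will try all
  depths.\<close>

lemma decides_fm:
  assumes pre: "ef_pre S (set G)"
  shows "wf_fm S p \<Longrightarrow> gens_fm p \<subseteq> set G \<Longrightarrow> \<exists>n. \<forall>N \<ge> n. decides S G r N (fv p) (code_fm p)"
proof (induction p)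
  case Tru
  have "Ev S ((G, r), N, (k, ns, d, op), env, list_encode [0], of_bool True)" for N k ns d op env using Ev.Tru by simp
  then show ?case unfolding decides_def code_fm.simps by blast
next
  case Fls
  have "Ev S ((G, r), N, (k, ns, d, op), env, list_encode [1], of_bool False)" for N k ns d op env using Ev.Fls by simp
  then show ?case unfolding decides_def code_fm.simps by blast
next
  case (Eq t u)
  have "decides S G r N (fv (Eq t u)) (code_fm (Eq t u))" if N: "N \<ge> max (code_trm t) (code_trm u)" for N
    unfolding decides_def
  proof (intro allI impI)
    fix k ns d op env assume v: "wf_state S (set G) k ns d op" and e: "env_ok ns env (fv (Eq t u))"
    obtain st vs where T: "add_trms ((k, ns, d, op), env, map code_trm [t, u], st, vs)"
      using add_trms_complete[of "[t, u]" env "(k, ns, d, op)"] e unfolding env_ok_def by fastforce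
    obtain k' ns' d' op' where st: "st = (k', ns', d', op')" using prod_cases4 by blast
    have E: "\<forall>t \<in> set [t, u]. wf_trm S t \<and> gens_trm t \<subseteq> set G"
      "\<forall>x \<in> (\<Union>t \<in> set [t, u]. vars_trm t). \<exists>v \<in> set ns. map_of env x = Some v \<and> vsort v = vsort x"
      using Eq.prems e unfolding env_ok_def by auto
    note E' = ev_terms[OF pre T[unfolded st] v E, where K = 0]
    have v': "wf_state S (set G) k' ns' d' op'" by (rule conjunct1[OF E'])
    have "list_all2 (\<lambda>v t. v \<in> set ns' \<and> vsort v = sort_of t) vs [t, u]"
      by (rule list_all2_mono[OF conjunct2[OF E']]) simp
    then obtain a b where ab: "vs = [a, b]" "a \<in> set ns'" "b \<in> set ns'" "vsort a = vsort b"
      using Eq.prems(1) by (auto simp: list_all2_Cons2)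
    have T2: "add_trms ((k, ns, d, op), env, [code_trm t, code_trm u], (k', ns', d', op'), [a, b])" using T st ab(1) by simp
    have n: "code_trm t \<le> N" "code_trm u \<le> N" using N by auto
    show "\<exists>x :: bool. Ev S ((G, r), N, (k, ns, d, op), env, code_fm (Eq t u), of_bool x)"
    proof (cases "apart ((d', op'), a, b)")
      case True
      from Ev.Eq0[OF n T2 True] show ?thesis unfolding code_fm.simps by (metis of_bool_eq(1))
    next
      case False
      from Ev.Eq1[OF n T2 bisim_complete[OF v' ab(2-4) False]] show ?thesis
        unfolding code_fm.simps by (metis of_bool_eq(2))
    qed
  qed
  then show ?case by blast
next
  case (Fin s t)
  have "decides S G r N (fv (Fin s t)) (code_fm (Fin s t))" for N
    unfolding decides_def
  proof (intro allI impI)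
    fix k ns d op env assume v: "wf_state S (set G) k ns d op" and e: "env_ok ns env (fv (Fin s t))"
    obtain st vs where T: "add_trms ((k, ns, d, op), env, map code_trm [t], st, vs)"
      using add_trms_complete[of "[t]" env "(k, ns, d, op)"] e unfolding env_ok_def by fastforce
    obtain k' ns' d' op' where st: "st = (k', ns', d', op')" using prod_cases4 by blast
    have E: "\<forall>t \<in> set [t]. wf_trm S t \<and> gens_trm t \<subseteq> set G"
      "\<forall>x \<in> (\<Union>t \<in> set [t]. vars_trm t). \<exists>v \<in> set ns. map_of env x = Some v \<and> vsort v = vsort x"
      using Fin.prems e unfolding env_ok_def by auto
    note E' = ev_terms[OF pre T[unfolded st] v E, where K = 0]
    have v': "wf_state S (set G) k' ns' d' op'" by (rule conjunct1[OF E'])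
    have "list_all2 (\<lambda>v t. v \<in> set ns' \<and> vsort v = sort_of t) vs [t]"
      by (rule list_all2_mono[OF conjunct2[OF E']]) simp
    then obtain a where a: "vs = [a]" "a \<in> set ns'" by (auto simp: list_all2_Cons2)
    have T2: "add_trms ((k, ns, d, op), env, [code_trm t], (k', ns', d', op'), [a])" using T st a(1) by simp
    show "\<exists>x :: bool. Ev S ((G, r), N, (k, ns, d, op), env, code_fm (Fin s t), of_bool x)"
    proof (cases "fin_node ((d', op'), a)")
      case True
      from Ev.Fin1[OF T2 True] show ?thesis unfolding code_fm.simps by (metis of_bool_eq(2))
    next
      case False
      from Ev.Fin0[OF T2 inf_node_complete[OF v' a(2) False]] show ?thesis
        unfolding code_fm.simps by (metis of_bool_eq(1))
    qed
  qed
  then show ?case by blast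
next
  case (Neg p)
  then obtain n where "\<forall>N \<ge> n. decides S G r N (fv p) (code_fm p)" by auto
  then show ?case unfolding code_fm.simps fv.simps using decides_Neg by blast
next
  case (And p q)
  then show ?case unfolding code_fm.simps fv.simps by (intro decides_Bin') simp_all
next
  case (Or p q)
  then show ?case unfolding code_fm.simps fv.simps by (intro decides_Bin') simp_all
next
  case (Imp p q)
  then show ?case unfolding code_fm.simps fv.simps by (intro decides_Bin') simp_all
next
  case (Iff p q)
  then show ?case unfolding code_fm.simps fv.simps by (intro decides_Bin') simp_all
next
  case (Exists x p)
  then obtain n where "decides S G r n (fv p) (code_fm p)" by auto
  then have "\<forall>N \<ge> n + 2 * Suc r ^ n + 1. decides S G r N (fv p - {x}) (list_encode [9, code_var x, code_fm p])" using decides_Ex by blast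
  then show ?case unfolding code_fm.simps fv.simps by blast
next
  case (Forall x p)
  then obtain n where "decides S G r n (fv p) (code_fm p)" by auto
  then have "\<forall>N \<ge> n + 2 * Suc r ^ n + 1. decides S G r N (fv p - {x}) (list_encode [10, code_var x, code_fm p])"
    using decides_All[OF decides_Ex[OF decides_Neg]] by blast
  then show ?case unfolding code_fm.simps fv.simps by blast
qed

subsection \<open>The algorithm\<close>

instantiation flat :: enc
begin
definition "enc_flat t = (case t of FVar x \<Rightarrow> 2 * enc x | FApp g ws \<Rightarrow> Suc (2 * enc (g, ws)))"
instance
proof
  show "bij (enc :: flat \<Rightarrow> nat)"
  proof (rule o_bij[where g = "\<lambda>n. if even n then FVar (dec (n div 2)) else FApp (fst (dec (n div 2) :: gen \<times> var list)) (snd (dec (n div 2) :: gen \<times> var list))"])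
    show "(\<lambda>n. if even n then FVar (dec (n div 2)) else FApp (fst (dec (n div 2) :: gen \<times> var list)) (snd (dec (n div 2) :: gen \<times> var list))) \<circ> enc = id"
    proof
      fix t :: flat
      show "((\<lambda>n. if even n then FVar (dec (n div 2)) else FApp (fst (dec (n div 2) :: gen \<times> var list)) (snd (dec (n div 2) :: gen \<times> var list))) \<circ> enc) t = id t"
        by (cases t) (simp_all add: enc_flat_def)
    qed
    show "enc \<circ> (\<lambda>n. if even n then FVar (dec (n div 2)) else FApp (fst (dec (n div 2) :: gen \<times> var list)) (snd (dec (n div 2) :: gen \<times> var list))) = id"
      by (auto simp: fun_eq_iff enc_flat_def)
  qed
qed
end

lemma tc_FVar: "tc f \<Longrightarrow> tc (\<lambda>x. FVar (f x))"
proof (rule tc_of_enc)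
  assume f: "tc f"
  have "tc (\<lambda>x. 2 * enc (f x))" by (intro tc_intros f)
  then show "tc (\<lambda>x. enc (FVar (f x)))" by (simp add: enc_flat_def)
qed

lemma tc_FApp: "tc f \<Longrightarrow> tc g \<Longrightarrow> tc (\<lambda>x. FApp (f x) (g x))"
proof (rule tc_of_enc)
  assume f: "tc f" "tc g"
  have "tc (\<lambda>x. Suc (2 * enc (f x, g x)))" by (intro tc_intros f)
  then show "tc (\<lambda>x. enc (FApp (f x) (g x)))" by (simp add: enc_flat_def)
qed

text \<open>The graph of \<open>foldr\<close>, with a parameter \<open>p\<close>, as a least fixed
  point, so that \<open>tc_graph\<close> makes folding computable.\<close>

inductive fgraph :: "('p::enc \<times> 'a::enc \<times> 'b::enc \<Rightarrow> 'b) \<Rightarrow> 'p \<times> 'a list \<times> 'b \<times> 'b \<Rightarrow> bool" for f where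
  "fgraph f (p, [], z, z)"
| "fgraph f (p, l, z, b) \<Longrightarrow> fgraph f (p, a # l, z, f (p, a, b))"

lemma fgraph_iff: "fgraph f (p, l, z, b) \<longleftrightarrow> foldr (\<lambda>a b. f (p, a, b)) l z = b"
proof
  show "fgraph f (p, l, z, b) \<Longrightarrow> foldr (\<lambda>a b. f (p, a, b)) l z = b"
    by (induction "(p, l, z, b)" arbitrary: l b rule: fgraph.induct) auto
  show "foldr (\<lambda>a b. f (p, a, b)) l z = b \<Longrightarrow> fgraph f (p, l, z, b)"
    by (induction l arbitrary: b) (auto intro: fgraph.intros)
qed

lemma tc_foldr:
  assumes f: "tc f" and plz: "tc p" "tc l" "tc z"
  shows "tc (\<lambda>x. foldr (\<lambda>a b. f (p x, a, b)) (l x) (z x))"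
proof (rule tc_graph)
  have "re (fgraph f)" unfolding fgraph_def
    by (rule re_lfp) (intro reop_disj reop_conj reop_ex reop_X reop_re re_intros tc_intros tc_comp[OF f])
  then have "re (\<lambda>y. fgraph f (p (fst y), l (fst y), z (fst y), snd y))"
    by (rule re_comp) (intro tc_intros tc_comp[OF plz(1)] tc_comp[OF plz(2)] tc_comp[OF plz(3)])
  then show "re (\<lambda>y. foldr (\<lambda>a b. f (p (fst y), a, b)) (l (fst y)) (z (fst y)) = snd y)" unfolding fgraph_iff .
qed

lemma tc_map: "tc (\<lambda>z. g (fst z) (snd z)) \<Longrightarrow> tc l \<Longrightarrow> tc (\<lambda>x. map (g x) (l x))"
proof -
  assume g: "tc (\<lambda>z. g (fst z) (snd z))" and l: "tc l"
  have "tc (\<lambda>z. g (fst z) (fst (snd z)))"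
    using tc_comp[OF g, of "\<lambda>z. (fst z, fst (snd z))"] by (simp add: tc_intros)
  then have "tc (\<lambda>z. g (fst z) (fst (snd z)) # snd (snd z))" by (intro tc_intros)
  from tc_foldr[OF this tc_id l tc_const] have "tc (\<lambda>x. foldr (\<lambda>a b. g x a # b) (l x) [])" by simp
  moreover have "foldr (\<lambda>a b. h a # b) xs [] = map h xs" for h :: "'b \<Rightarrow> 'c" and xs by (induction xs) auto
  ultimately show ?thesis by simp
qed

section \<open>Codes of formulae of solved shape\<close>

text \<open>Formulae are given by \<open>code_fm\<close> only and are not themselves an encoded
  type. A candidate therefore is represented by the lists it is made of, and its code is computed
  from them.\<close>

definition qcode :: "nat \<Rightarrow> var list \<Rightarrow> nat \<Rightarrow> nat" where
  "qcode j xs c = foldr (\<lambda>x b. list_encode [j, code_var x, b]) xs c"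

lemma tc_qcode: "tc f \<Longrightarrow> tc g \<Longrightarrow> tc (\<lambda>x. qcode j (f x) (g x))"
  unfolding qcode_def
  by (rule tc_foldr[where f = "\<lambda>z. list_encode [j, code_var (fst (snd z)), snd (snd z)]" and p = "\<lambda>x. 0 :: nat", simplified fst_conv snd_conv])
     (intro tc_intros | assumption)+

lemma code_Exs: "code_fm (foldr Exists xs p) = qcode 9 xs (code_fm p)"
  unfolding qcode_def by (induction xs) (simp_all del: list_encode.simps)

lemma code_Alls: "code_fm (foldr Forall xs p) = qcode 10 xs (code_fm p)"
  unfolding qcode_def by (induction xs) (simp_all del: list_encode.simps)

text \<open>Codes are positive, so that 0 can stand for the empty conjunction or disjunction.\<close>

definition jstep :: "nat \<times> nat \<times> nat \<Rightarrow> nat" where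
  "jstep z = (if snd (snd z) = 0 then fst (snd z) else list_encode [fst z, fst (snd z), snd (snd z)])"

definition jcode :: "nat \<Rightarrow> nat \<Rightarrow> nat list \<Rightarrow> nat" where
  "jcode j z cs = (let b = foldr (\<lambda>a b. jstep (j, a, b)) cs 0 in if b = 0 then z else b)"

lemma tc_if: "tc f \<Longrightarrow> tc g \<Longrightarrow> tc h \<Longrightarrow> tc (\<lambda>x. if f x = (0 :: nat) then g x else h x)"
proof (rule tc_graph)
  assume t: "tc f" "tc g" "tc h"
  have "re (\<lambda>z. f (fst z) = 0 \<and> g (fst z) = snd z \<or> f (fst z) \<noteq> 0 \<and> h (fst z) = snd z)"
    by (intro re_intros tc_intros tc_comp[OF t(1)] tc_comp[OF t(2)] tc_comp[OF t(3)])
  moreover have "(if a = 0 then b else c) = d \<longleftrightarrow> a = 0 \<and> b = d \<or> a \<noteq> 0 \<and> c = d" for a :: nat and b c d :: 'b by simp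
  ultimately show "re (\<lambda>z. (if f (fst z) = 0 then g (fst z) else h (fst z)) = snd z)" by simp
qed

lemma tc_jcode: "tc f \<Longrightarrow> tc (\<lambda>x. jcode j z (f x))"
proof -
  assume f: "tc f"
  have "tc jstep" unfolding jstep_def by (intro tc_if tc_intros)
  from tc_foldr[OF this tc_const f tc_const] have "tc (\<lambda>x. foldr (\<lambda>a b. jstep (j, a, b)) (f x) 0)" .
  then show ?thesis unfolding jcode_def Let_def by (intro tc_if tc_const)
qed

lemma code_fm_nonzero: "code_fm p \<noteq> 0"
  by (cases p) simp_all

lemma jcode_Cons:
  assumes cs: "\<forall>c \<in> set cs. c \<noteq> 0" and c: "c \<noteq> 0"
  shows "jcode j z (c # cs) = (if cs = [] then c else list_encode [j, c, jcode j z cs])"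
proof -
  have pos: "list_encode (a # l) \<noteq> 0" for a l by simp
  have "foldr (\<lambda>a b. jstep (j, a, b)) cs 0 \<noteq> 0" if "cs \<noteq> []"
    using that cs pos by (cases cs) (auto simp: jstep_def simp del: list_encode.simps)
  then show ?thesis using c pos[of j "[c, foldr (\<lambda>a b. jstep (j, a, b)) cs 0]"]
    by (cases "cs = []") (simp_all add: jcode_def jstep_def Let_def del: list_encode.simps)
qed

lemma code_conj_list: "code_fm (conj_list ps) = jcode 5 (code_fm Tru) (map code_fm ps)"
proof (induction ps rule: conj_list.induct)
  case (3 p q ps)
  then show ?case using jcode_Cons[of "map code_fm (q # ps)" "code_fm p" 5] code_fm_nonzero
    by (auto simp del: list_encode.simps)
qed (simp_all add: jcode_def jstep_def Let_def code_fm_nonzero del: list_encode.simps code_fm.simps)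

lemma code_disj_list: "code_fm (disj_list ps) = jcode 6 (code_fm Fls) (map code_fm ps)"
proof (induction ps rule: disj_list.induct)
  case (3 p q ps)
  then show ?case using jcode_Cons[of "map code_fm (q # ps)" "code_fm p" 6] code_fm_nonzero
    by (auto simp del: list_encode.simps)
qed (simp_all add: jcode_def jstep_def Let_def code_fm_nonzero del: list_encode.simps code_fm.simps)

definition vcode :: "var \<Rightarrow> nat" where "vcode x = list_encode [0, code_var x]"

lemma tc_vcode: "tc f \<Longrightarrow> tc (\<lambda>x. vcode (f x))"
  unfolding vcode_def by (intro tc_intros)

definition fcode :: "flat \<Rightarrow> nat" where "fcode t = code_trm (trm_of_flat t)"

lemma tc_fcode: "tc f \<Longrightarrow> tc (\<lambda>x. fcode (f x))"
proof -
  have "tc fcode"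
  proof (rule tc_graph)
    have "re (\<lambda>z. (\<exists>x. fst z = FVar x \<and> vcode x = snd z) \<or> (\<exists>g ws. fst z = FApp g ws \<and> list_encode (1 # code_gen g # map vcode ws) = snd z))"
      by (intro re_intros tc_intros tc_FVar tc_FApp tc_vcode tc_map)
    moreover have "fcode t = c \<longleftrightarrow> (\<exists>x. t = FVar x \<and> vcode x = c) \<or> (\<exists>g ws. t = FApp g ws \<and> list_encode (1 # code_gen g # map vcode ws) = c)" for t c
      by (cases t) (auto simp: fcode_def vcode_def[abs_def] o_def simp del: list_encode.simps)
    ultimately show "re (\<lambda>z. fcode (fst z) = snd z)" by simp
  qed
  then show "tc f \<Longrightarrow> tc (\<lambda>x. fcode (f x))" by (rule tc_comp)
qed

definition acode :: "eqn list \<Rightarrow> var list \<Rightarrow> nat list" where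
  "acode E F = map (\<lambda>q. list_encode [2, vcode (fst q), fcode (snd q)]) E @ map (\<lambda>u. list_encode [3, vsort u, vcode u]) F"

lemma tc_acode: "tc f \<Longrightarrow> tc g \<Longrightarrow> tc (\<lambda>x. acode (f x) (g x))"
  unfolding acode_def by (intro tc_append tc_map tc_intros tc_vcode tc_fcode)

lemma code_atoms: "map code_fm (atoms_of_basic (Basic E F)) = acode E F"
  by (simp add: atoms_of_basic_def acode_def case_prod_unfold fcode_def vcode_def o_def del: list_encode.simps)

definition ncode :: "eqn list \<Rightarrow> negc \<Rightarrow> nat" where
  "ncode E n = list_encode [4, qcode 9 (fst n) (jcode 5 (code_fm Tru) (acode (E @ fst (snd n)) (snd (snd n))))]"

lemma tc_ncode: "tc f \<Longrightarrow> tc g \<Longrightarrow> tc (\<lambda>x. ncode (f x) (g x))"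
  unfolding ncode_def by (intro tc_intros tc_qcode tc_jcode tc_acode tc_append)

definition scode :: "var list \<Rightarrow> eqn list \<Rightarrow> var list \<Rightarrow> negc list \<Rightarrow> nat" where
  "scode xs E F Ns = qcode 9 xs (jcode 5 (code_fm Tru) (acode E F @ map (ncode E) Ns))"

lemma tc_scode: "tc a \<Longrightarrow> tc b \<Longrightarrow> tc c \<Longrightarrow> tc d \<Longrightarrow> tc (\<lambda>x. scode (a x) (b x) (c x) (d x))"
proof -
  assume t: "tc a" "tc b" "tc c" "tc d"
  show ?thesis unfolding scode_def
    by (intro tc_intros tc_qcode tc_jcode tc_acode tc_append tc_map tc_ncode t tc_comp[OF t(2)])
qed

lemma code_shape_fm: "code_fm (shape_fm xs E F Ns) = scode xs E F Ns"
proof -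
  have "code_fm (Neg (foldr Exists ys (conj_list (atoms_of_basic (Basic (E @ ex) fs))))) = ncode E (ys, ex, fs)" for ys ex fs
    by (simp add: code_Exs code_conj_list code_atoms ncode_def del: list_encode.simps)
  then have "map code_fm (map (\<lambda>(ys, ex, fs). Neg (foldr Exists ys (conj_list (atoms_of_basic (Basic (E @ ex) fs))))) Ns) = map (ncode E) Ns"
    by (auto simp del: code_fm.simps)
  then show ?thesis unfolding shape_fm_def scode_def code_Exs code_conj_list map_append code_atoms by presburger
qed

section \<open>Semi-decidability of the solved shape\<close>

text \<open>The transitive closure of \<open>edges\<close> as an inductive predicate on encoded
  data, to which \<open>re_lfp\<close> applies.\<close>

inductive reachp :: "eqn list \<times> var \<times> var \<Rightarrow> bool" where
  base: "(x, t) \<in> set E \<Longrightarrow> t = FVar y \<or> (\<exists>g ws. t = FApp g ws \<and> y \<in> set ws) \<Longrightarrow> reachp (E, x, y)"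
| step: "reachp (E, x, y) \<Longrightarrow> (y, t) \<in> set E \<Longrightarrow> t = FVar z \<or> (\<exists>g ws. t = FApp g ws \<and> z \<in> set ws) \<Longrightarrow> reachp (E, x, z)"

lemma reachp_iff: "reachp (E, x, y) \<longleftrightarrow> (x, y) \<in> (edges (Basic E F))\<^sup>+"
proof -
  have e: "(x, y) \<in> edges (Basic E F) \<longleftrightarrow> (\<exists>t. (x, t) \<in> set E \<and> (t = FVar y \<or> (\<exists>g ws. t = FApp g ws \<and> y \<in> set ws)))" for x y
  proof -
    have "y \<in> vars_flat t \<longleftrightarrow> t = FVar y \<or> (\<exists>g ws. t = FApp g ws \<and> y \<in> set ws)" for t by (cases t) auto
    then show ?thesis unfolding edges_def by simp
  qed
  show ?thesis
  proof
    show "reachp (E, x, y) \<Longrightarrow> (x, y) \<in> (edges (Basic E F))\<^sup>+"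
    proof (induction "(E, x, y)" arbitrary: y rule: reachp.induct)
      case (step y t z)
      then have "(y, z) \<in> edges (Basic E F)" unfolding e by blast
      with step(2) show ?case by (rule trancl_into_trancl)
    qed (use e in blast)
    show "(x, y) \<in> (edges (Basic E F))\<^sup>+ \<Longrightarrow> reachp (E, x, y)"
    proof (induction rule: trancl_induct)
      case (step y z)
      obtain t where "(y, t) \<in> set E" "t = FVar z \<or> (\<exists>g ws. t = FApp g ws \<and> z \<in> set ws)" using step(2) unfolding e by blast
      from reachp.step[OF step(3) this] show ?case .
    qed (use e reachp.base in blast)
  qed
qed

lemma re_reachp: "re reachp"
  unfolding reachp_def by (rule re_lfp)
    (intro reop_disj reop_conj reop_ex reop_X reop_re re_intros tc_intros tc_FVar tc_FApp)

lemma re_distinct: "tc f \<Longrightarrow> re (\<lambda>x. distinct (f x))"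
proof -
  assume f: "tc f"
  have "re (\<lambda>x. \<forall>i < length (f x). \<forall>j < length (f x). i = j \<or> (\<exists>a b. (i < length (f x) \<and> f x ! i = a) \<and> (j < length (f x) \<and> f x ! j = b) \<and> a \<noteq> b))"
    by (intro re_all_less re_disj re_ex re_eq re_neq re_conj re_nth tc_length tc_intros tc_comp[OF f])
  moreover have "distinct xs \<longleftrightarrow> (\<forall>i < length xs. \<forall>j < length xs. i = j \<or> (\<exists>a b. (i < length xs \<and> xs ! i = a) \<and> (j < length xs \<and> xs ! j = b) \<and> a \<noteq> b))" for xs :: "'b list"
    by (auto simp: distinct_conv_nth)
  ultimately show ?thesis by simp
qed

lemma re_before: "tc l \<Longrightarrow> tc y \<Longrightarrow> tc v \<Longrightarrow> re (\<lambda>x. before (l x) (y x) (v x))"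
proof -
  assume t: "tc l" "tc y" "tc v"
  show ?thesis unfolding before_def
    by (intro re_intros tc_intros tc_comp[OF t(1)] tc_comp[OF t(2)] tc_comp[OF t(3)])
qed

lemma re_eqn_ok: "tc f \<Longrightarrow> tc g \<Longrightarrow> tc h \<Longrightarrow> re (\<lambda>x. eqn_ok (set (f x)) (g x) (h x))"
proof -
  assume t: "tc f" "tc g" "tc h"
  have "re (\<lambda>x. fst (h x) \<in> set (g x) \<and>
      ((\<exists>y. snd (h x) = FVar y \<and> before (g x) y (fst (h x)) \<and> vsort y = vsort (fst (h x))) \<or>
       (\<exists>p ws. snd (h x) = FApp p ws \<and> p \<in> set (f x) \<and> gres p = vsort (fst (h x)) \<and> map vsort ws = gargs p \<and> (\<forall>w \<in> set ws. w \<in> set (g x)))))"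
    by (intro re_intros re_before tc_intros tc_map tc_FVar tc_FApp tc_comp[OF t(1)] tc_comp[OF t(2)] tc_comp[OF t(3)] t)
  then show ?thesis unfolding eqn_ok_def subset_eq .
qed

text \<open>Conditions on sorts are gathered into membership in sets of sorts. As subsets of a
  finite set these are finite, which suffices for semi-decidability even though the sets need not be
  computable from a presentation of the signature.\<close>

lemma shape_iff:
  "shape S G us xs E F Ns \<longleftrightarrow> distinct (us @ xs) \<and> (\<forall>v \<in> set (us @ xs). vsort v \<in> sorts S) \<and>
     (\<forall>q \<in> set E. eqn_ok G (us @ xs) q) \<and> distinct (map fst E @ F) \<and>
     (\<forall>u \<in> set F. u \<in> set (us @ xs) \<and> vsort u \<in> {s \<in> sorts S. mixed S s \<and> \<not> small S s True}) \<and>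
     (\<forall>x \<in> set xs. \<exists>u. u \<in> set us \<and> reachp (E, u, x)) \<and>
     (\<forall>n \<in> set Ns.
       (\<exists>y z. n = ([], [(y, FVar z)], []) \<and> y \<in> set (us @ xs) \<and> y \<notin> set (map fst E) \<and> before (us @ xs) z y \<and>
         vsort y = vsort z \<and> vsort y \<in> {s \<in> sorts S. \<not> (small S s True \<and> small S s False)}) \<or>
       (\<exists>y g ys. n = (ys, [(y, FApp g ys)], []) \<and> y \<in> set (us @ xs) \<and> y \<notin> set (map fst E) \<and> g \<in> G \<and> gres g = vsort y \<and>
         map vsort ys = gargs g \<and> distinct ys \<and> (\<forall>w \<in> set ys. w \<notin> set (us @ xs)) \<and> vsort y \<in> {s \<in> sorts S. infinite (gens_of S s)}) \<or>
       (\<exists>y. n = ([], [], [y]) \<and> y \<in> set (us @ xs) \<and> y \<notin> set (map fst E) \<and> y \<notin> set F \<and>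
         vsort y \<in> {s \<in> sorts S. mixed S s \<and> \<not> small S s False}))"
proof -
  have n: "neg_ok S G ord E F n \<longleftrightarrow>
       (\<exists>y z. n = ([], [(y, FVar z)], []) \<and> y \<in> set ord \<and> y \<notin> set (map fst E) \<and> before ord z y \<and>
         vsort y = vsort z \<and> vsort y \<in> {s \<in> sorts S. \<not> (small S s True \<and> small S s False)}) \<or>
       (\<exists>y g ys. n = (ys, [(y, FApp g ys)], []) \<and> y \<in> set ord \<and> y \<notin> set (map fst E) \<and> g \<in> G \<and> gres g = vsort y \<and>
         map vsort ys = gargs g \<and> distinct ys \<and> (\<forall>w \<in> set ys. w \<notin> set ord) \<and> vsort y \<in> {s \<in> sorts S. infinite (gens_of S s)}) \<or>
       (\<exists>y. n = ([], [], [y]) \<and> y \<in> set ord \<and> y \<notin> set (map fst E) \<and> y \<notin> set F \<and>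
         vsort y \<in> {s \<in> sorts S. mixed S s \<and> \<not> small S s False})"
    if o: "\<forall>v \<in> set ord. vsort v \<in> sorts S" for ord n
    unfolding neg_ok_def disjoint_iff set_map mem_Collect_eq using o by (intro arg_cong2[where f = "(\<or>)"] iff_exI) blast+
  show ?thesis unfolding shape_def Bex_def reachp_iff[of E _ _ F]
    by (intro conj_cong refl ball_cong) (use n in auto)
qed

lemma re_shape:
  assumes S: "tree_signature S" and t: "tc G" "tc us" "tc xs" "tc E" "tc F" "tc Ns"
  shows "re (\<lambda>z. shape S (set (G z)) (us z) (xs z) (E z) (F z) (Ns z))"
proof -
  have fin: "finite {s \<in> sorts S. P s}" for P using S unfolding tree_signature_def by simp
  have sorts: "finite (sorts S)" using S unfolding tree_signature_def by blast
  note c = tc_comp[OF t(1)] tc_comp[OF t(2)] tc_comp[OF t(3)] tc_comp[OF t(4)] tc_comp[OF t(5)] tc_comp[OF t(6)]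
  note s = re_finite[OF sorts] re_finite[OF fin]
  show ?thesis unfolding shape_iff
    by (intro re_conj re_disj re_ex re_ball re_eq re_neq re_mem re_nmem re_distinct s re_eqn_ok re_before re_comp[OF re_reachp]
        tc_intros tc_append tc_map tc_FVar tc_FApp t c)
qed

lemma gens_Exs: "gens_fm (foldr Exists xs p) = gens_fm p" by (induction xs) auto
lemma gens_Alls: "gens_fm (foldr Forall xs p) = gens_fm p" by (induction xs) auto
lemma gens_conj_list: "gens_fm (conj_list ps) = (\<Union>p \<in> set ps. gens_fm p)" by (induction ps rule: conj_list.induct) auto
lemma gens_disj_list: "gens_fm (disj_list ps) = (\<Union>p \<in> set ps. gens_fm p)" by (induction ps rule: disj_list.induct) auto

lemma gens_shape_fm:
  assumes sh: "shape S G us xs E F Ns"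
  shows "gens_fm (shape_fm xs E F Ns) \<subseteq> G"
proof -
  have at: "(\<Union>p \<in> set (atoms_of_basic (Basic E F)). gens_fm p) = (\<Union>q \<in> set E. gens_trm (trm_of_flat (snd q)))" for E F
    unfolding atoms_of_basic_def by (auto simp: case_prod_unfold)
  have fl: "gens_trm (trm_of_flat t) = (case t of FVar x \<Rightarrow> {} | FApp g ws \<Rightarrow> {g})" for t
    by (cases t) auto
  have E: "(\<Union>q \<in> set E. gens_trm (trm_of_flat (snd q))) \<subseteq> G"
    using sh unfolding shape_def eqn_ok_def fl by (fastforce split: flat.splits)
  have N: "(\<Union>q \<in> set ex. gens_trm (trm_of_flat (snd q))) \<subseteq> G" if "(ys, ex, fs) \<in> set Ns" for ys ex fs
  proof -
    have "neg_ok S G (us @ xs) E F (ys, ex, fs)" using sh that unfolding shape_def by blast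
    then show ?thesis unfolding neg_ok_def fl by auto
  qed
  show ?thesis unfolding shape_fm_def gens_Exs gens_conj_list
  proof (rule UN_least)
    fix p assume "p \<in> set (atoms_of_basic (Basic E F) @ map (\<lambda>(ys, ex, fs). Neg (foldr Exists ys (conj_list (atoms_of_basic (Basic (E @ ex) fs))))) Ns)"
    then consider "p \<in> set (atoms_of_basic (Basic E F))"
      | ys ex fs where "(ys, ex, fs) \<in> set Ns" "p = Neg (foldr Exists ys (conj_list (atoms_of_basic (Basic (E @ ex) fs))))" by auto
    then show "gens_fm p \<subseteq> G"
    proof cases
      case 1
      then show ?thesis using at[of E F] E by blast
    next
      case 2
      have "gens_fm p = (\<Union>q \<in> set (E @ ex). gens_trm (trm_of_flat (snd q)))"
        unfolding 2(2) gens_fm.simps gens_Exs gens_conj_list at ..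
      then show ?thesis using E N[OF 2(1)] by simp
    qed
  qed
qed

section \<open>Generators and free variables of a coded formula\<close>

inductive trm_parts :: "nat list \<times> gen list \<times> var list \<Rightarrow> bool" where
  Nil: "trm_parts ([], [], [])"
| Var: "trm_parts (cs, G, X) \<Longrightarrow> trm_parts (list_encode [0, code_var x] # cs, G, x # X)"
| App: "trm_parts (ts, G, X) \<Longrightarrow> trm_parts (cs, G', X') \<Longrightarrow> trm_parts (list_encode (1 # code_gen g # ts) # cs, g # G @ G', X @ X')"

text \<open>At a quantifier the list of remaining free variables is guessed and then checked, so
  several lists may belong to the same formula; only their sets of entries matter.\<close>

inductive fm_parts :: "nat \<times> gen list \<times> var list \<Rightarrow> bool" where
  Const: "j < 2 \<Longrightarrow> fm_parts (list_encode [j], [], [])"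
| Eq: "trm_parts ([t, u], G, X) \<Longrightarrow> fm_parts (list_encode [2, t, u], G, X)"
| Fin: "trm_parts ([t], G, X) \<Longrightarrow> fm_parts (list_encode [3, s, t], G, X)"
| Neg: "fm_parts (c, G, X) \<Longrightarrow> fm_parts (list_encode [4, c], G, X)"
| Bin: "j \<in> {5, 6, 7, 8} \<Longrightarrow> fm_parts (c, G, X) \<Longrightarrow> fm_parts (c', G', X') \<Longrightarrow> fm_parts (list_encode [j, c, c'], G @ G', X @ X')"
| Quant: "j \<in> {9, 10} \<Longrightarrow> fm_parts (c, G, X) \<Longrightarrow> (\<forall>y \<in> set X. y = x \<or> y \<in> set X') \<Longrightarrow> (\<forall>y \<in> set X'. y \<in> set X \<and> y \<noteq> x) \<Longrightarrow>
    fm_parts (list_encode [j, code_var x, c], G, X')"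

lemma re_trm_parts: "re trm_parts"
  unfolding trm_parts_def by (rule re_lfp) (intro reop_disj reop_conj reop_ex reop_X reop_re re_eq tc_intros tc_append)

lemma re_fm_parts: "re fm_parts"
proof -
  have fin: "finite {5, 6, 7, 8 :: nat}" "finite {9, 10 :: nat}" by simp_all
  show ?thesis
    unfolding fm_parts_def by (rule re_lfp) (intro reop_disj reop_conj reop_ex reop_X reop_re re_conj re_disj re_ex re_ball re_eq re_neq re_mem re_less
      re_comp[OF re_trm_parts] re_finite[OF fin(1)] re_finite[OF fin(2)] tc_intros tc_append)
qed

lemma trm_parts_sound:
  "trm_parts (cs, G, X) \<Longrightarrow> cs = map code_trm ts \<Longrightarrow> set G = (\<Union>t \<in> set ts. gens_trm t) \<and> set X = (\<Union>t \<in> set ts. vars_trm t)"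
proof (induction "(cs, G, X)" arbitrary: cs G X ts rule: trm_parts.induct)
  case (Var cs G X x)
  obtain t ts' where ts: "ts = t # ts'" "code_trm t = list_encode [0, code_var x]" "cs = map code_trm ts'"
    using Var.prems by (cases ts) (auto simp del: list_encode.simps code_trm.simps)
  have "t = trm.Var x" using inj_code_trm[of t "trm.Var x"] ts(2) by (simp del: list_encode.simps)
  then show ?case using Var.hyps(2)[OF ts(3)] ts(1) by auto
next
  case (App us G X cs G' X' g)
  obtain t ts' where ts: "ts = t # ts'" "code_trm t = list_encode (1 # code_gen g # us)" "cs = map code_trm ts'"
    using App.prems by (cases ts) (auto simp del: list_encode.simps code_trm.simps)
  obtain ts0 where t: "t = trm.App g ts0" "us = map code_trm ts0" using code_App_inv[OF ts(2)] by blast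
  show ?case using App.hyps(2)[OF t(2)] App.hyps(4)[OF ts(3)] ts(1) t(1) by auto
qed simp

lemma trm_parts_complete: "\<exists>G X. trm_parts (map code_trm ts, G, X)"
proof (induction "size_list size ts" arbitrary: ts rule: less_induct)
  case less
  show ?case
  proof (cases ts)
    case Nil
    then show ?thesis using trm_parts.Nil by auto
  next
    case (Cons t ts')
    obtain G' X' where 1: "trm_parts (map code_trm ts', G', X')" using less.hyps[of ts'] Cons by auto
    show ?thesis
    proof (cases t)
      case (Var x)
      from trm_parts.Var[OF 1] have "trm_parts (map code_trm ts, G', x # X')" unfolding Cons Var by (simp del: list_encode.simps)
      then show ?thesis by blast
    next
      case (App g us)
      obtain G X where 2: "trm_parts (map code_trm us, G, X)" using less.hyps[of us] Cons App by auto
      from trm_parts.App[OF 2 1] have "trm_parts (map code_trm ts, g # G @ G', X @ X')" unfolding Cons App by (simp del: list_encode.simps)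
      then show ?thesis by blast
    qed
  qed
qed

lemma code_fm_quant:
  assumes "list_encode [j, code_var x, a] = code_fm p" "j \<in> {9, 10}"
  shows "\<exists>q. a = code_fm q \<and> p = (if j = 9 then Exists x q else Forall x q)"
  using assms by (cases p) (auto simp: list_encode_eq simp del: list_encode.simps dest: code_var_inj)

lemma fm_parts_sound: "fm_parts (c, G, X) \<Longrightarrow> c = code_fm p \<Longrightarrow> set G = gens_fm p \<and> set X = fv p"
proof (induction "(c, G, X)" arbitrary: c G X p rule: fm_parts.induct)
  case (Const j)
  then have "p = Tru \<or> p = Fls" using code_fm_inv(1,2)[of p] by (auto simp: less_2_cases_iff simp del: list_encode.simps)
  then show ?case by auto
next
  case (Eq t u G X)
  obtain a b where p: "p = fm.Eq a b" "t = code_trm a" "u = code_trm b" using code_fm_inv(3)[OF Eq.prems] by blast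
  show ?case using trm_parts_sound[OF Eq.hyps, of "[a, b]"] p by simp
next
  case (Fin t G X s)
  obtain a where p: "p = fm.Fin s a" "t = code_trm a" using code_fm_inv(4)[OF Fin.prems] by blast
  show ?case using trm_parts_sound[OF Fin.hyps, of "[a]"] p by simp
next
  case (Neg c G X)
  then show ?case using code_fm_inv(5)[OF Neg.prems] by auto
next
  case (Bin j c G X c' G' X')
  obtain q q' where q: "c = code_fm q" "c' = code_fm q'"
    "p = (if j = 5 then And q q' else if j = 6 then Or q q' else if j = 7 then Imp q q' else Iff q q')"
    using code_fm_bin[OF Bin.prems Bin.hyps(1)] by blast
  show ?case using Bin.hyps(3)[OF q(1)] Bin.hyps(5)[OF q(2)] q(3) by simp
next
  case (Quant j c G X x X')
  obtain q where q: "c = code_fm q" "p = (if j = 9 then Exists x q else Forall x q)"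
    using code_fm_quant[OF Quant.prems Quant.hyps(1)] by blast
  have "set X' = set X - {x}" using Quant.hyps(4,5) by blast
  then show ?case using Quant.hyps(3)[OF q(1)] q(2) by simp
qed

lemma fm_parts_complete: "\<exists>G X. fm_parts (code_fm p, G, X)"
proof (induction p)
  case Tru
  have "fm_parts (list_encode [0], [], [])" by (rule fm_parts.Const) simp
  then show ?case unfolding code_fm.simps by blast
next
  case Fls
  have "fm_parts (list_encode [1], [], [])" by (rule fm_parts.Const) simp
  then show ?case unfolding code_fm.simps by blast
next
  case (Eq t u)
  obtain G X where "trm_parts (map code_trm [t, u], G, X)" using trm_parts_complete by blast
  then have "trm_parts ([code_trm t, code_trm u], G, X)" by simp
  from fm_parts.Eq[OF this] show ?case unfolding code_fm.simps by blast
next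
  case (Fin s t)
  obtain G X where "trm_parts (map code_trm [t], G, X)" using trm_parts_complete by blast
  then have "trm_parts ([code_trm t], G, X)" by simp
  from fm_parts.Fin[OF this] show ?case unfolding code_fm.simps by blast
next
  case (Neg p)
  then show ?case using fm_parts.Neg unfolding code_fm.simps by blast
next
  case (And p q)
  then show ?case using fm_parts.Bin[of 5] unfolding code_fm.simps by blast
next
  case (Or p q)
  then show ?case using fm_parts.Bin[of 6] unfolding code_fm.simps by blast
next
  case (Imp p q)
  then show ?case using fm_parts.Bin[of 7] unfolding code_fm.simps by blast
next
  case (Iff p q)
  then show ?case using fm_parts.Bin[of 8] unfolding code_fm.simps by blast
next
  case (Exists x p)
  then obtain G X where "fm_parts (code_fm p, G, X)" by blast
  then have "fm_parts (list_encode [9, code_var x, code_fm p], G, filter (\<lambda>y. y \<noteq> x) X)" by (rule fm_parts.Quant[rotated]) auto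
  then show ?case unfolding code_fm.simps by blast
next
  case (Forall x p)
  then obtain G X where "fm_parts (code_fm p, G, X)" by blast
  then have "fm_parts (list_encode [10, code_var x, code_fm p], G, filter (\<lambda>y. y \<noteq> x) X)" by (rule fm_parts.Quant[rotated]) auto
  then show ?case unfolding code_fm.simps by blast
qed

section \<open>The search\<close>

text \<open>The small trees are closed under children and have their roots in
  \<open>base_gens\<close>, so they form a state without opaque leaves. It is obtained before
  \<open>G\<close>, \<open>K\<close> and \<open>N\<close> are known and can therefore be a constant
  of the algorithm.\<close>

lemma initial_state:
  assumes S: "tree_signature S"
  obtains k ns d where
    "\<And>G. base_gens S \<subseteq> G \<Longrightarrow> wf_state S G k ns d []"
    "\<And>G K N. base_gens S \<subseteq> G \<Longrightarrow> \<forall>g \<in> G. gname g < K \<Longrightarrow> link S G K N ns d [] (Id_on (small_trees S))"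
proof -
  let ?U = "small_trees S"
  obtain ul where ul: "set ul = ?U" "distinct ul" using finite_distinct_list[OF finite_small_trees[OF S]] by blast
  define k where "k = length ul"
  have "\<forall>t \<in> ?U. \<exists>i. i < k \<and> ul ! i = t" using ul(1) unfolding k_def by (auto simp: in_set_conv_nth)
  then obtain f where f: "\<And>t. t \<in> ?U \<Longrightarrow> f t < k \<and> ul ! f t = t" by metis
  define nm where "nm t = V (f t) (gres (root t))" for t
  define ns where "ns = map nm ul"
  define d where "d = map (\<lambda>t. (nm t, root t, map nm (children t))) ul"
  have inj: "t = u" if "t \<in> ?U" "u \<in> ?U" "nm t = nm u" for t u using that f unfolding nm_def by (metis var.inject)
  have ch: "u \<in> ?U" if "t \<in> ?U" "u \<in> set (children t)" for t u using small_trees_child[OF S that] .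
  have tt: "t \<in> trees S (gres (root t))" "gres (root t) \<in> sorts S" if "t \<in> ?U" for t using small_treesD[OF that] by auto
  have v: "wf_state S G k ns d []" if G: "base_gens S \<subseteq> G" for G
    unfolding wf_state_unique
  proof (intro conjI ballI)
    fix v assume "v \<in> set ns"
    then obtain t where t: "t \<in> ?U" "v = nm t" using ul(1) unfolding ns_def by auto
    show "vname v < k" "vsort v \<in> sorts S" using t f tt by (auto simp: nm_def)
    show "v \<in> fst ` set d \<or> v \<in> fst ` set []" using t ul(1) unfolding d_def by force
  next
    fix p assume "p \<in> set d"
    then obtain t where t: "t \<in> ?U" "p = (nm t, root t, map nm (children t))" using ul(1) unfolding d_def by auto
    have "list_all2 (\<lambda>s t. t \<in> trees S s) (gargs (root t)) (children t)" using tt(1)[OF t(1)] trees_iff by blast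
    then have "list_all2 (\<lambda>w s. vsort w = s) (map nm (children t)) (gargs (root t))"
      by (auto simp: list_all2_conv_all_nth nm_def trees_sort)
    moreover have "root t \<in> G" using small_trees_root[OF t(1)] G by blast
    moreover have "set (map nm (children t)) \<subseteq> set ns" using ch[OF t(1)] ul(1) unfolding ns_def by auto
    moreover have "nm t \<in> set ns" using t(1) ul(1) unfolding ns_def by simp
    ultimately show "det_ok G ns p" unfolding t(2) det_ok_def by (auto simp: nm_def)
  next
    show "inj_on fst (set d)"
    proof (rule inj_onI)
      fix p q assume "p \<in> set d" "q \<in> set d" "fst p = fst q"
      then obtain t u where "t \<in> ?U" "u \<in> ?U" "p = (nm t, root t, map nm (children t))" "q = (nm u, root u, map nm (children u))" "nm t = nm u"
        using ul(1) unfolding d_def by auto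
      then show "p = q" using inj by blast
    qed
  qed auto
  have l: "link S G K N ns d [] (Id_on ?U)" if G: "base_gens S \<subseteq> G" and K: "\<forall>g \<in> G. gname g < K" for G K N
  proof -
    have sol: "sol K d [] (nm t) = t" if "t \<in> ?U" for t
    proof (rule solves_unique[where Z = ?U and lab = root and kids = children and h = "\<lambda>t. sol K d [] (nm t)" and k = "\<lambda>t. t"])
      show "solves ?U root children (\<lambda>t. sol K d [] (nm t))"
        unfolding solves_def
      proof
        fix t assume "t \<in> ?U"
        then have "(nm t, root t, map nm (children t)) \<in> set d" using ul(1) unfolding d_def by auto
        from sol_det[OF v[OF G] this, of K] show "sol K d [] (nm t) = Node (root t) (map (\<lambda>t. sol K d [] (nm t)) (children t))"
          by (simp add: o_def)
      qed
      show "solves ?U root children (\<lambda>t. t)" unfolding solves_def by simp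
    qed (use ch that in auto)
    have lev: "lev G n (Id_on ?U) \<subseteq> Id_on ?U" for n
    proof (induction n)
      case (Suc n)
      have "p \<in> Id_on ?U" if "p \<in> nx G (lev G n (Id_on ?U))" for p
      proof -
        obtain t u where tu: "(t, u) \<in> lev G n (Id_on ?U)" "p \<in> set (zip (children t) (children u))"
          using \<open>p \<in> nx G (lev G n (Id_on ?U))\<close> unfolding nx_def by blast
        then have "t \<in> ?U" "u = t" using Suc by auto
        then obtain i where "i < length (children t)" "p = (children t ! i, children t ! i)" using tu(2) by (auto simp: set_zip)
        then obtain w where "w \<in> set (children t)" "p = (w, w)" using nth_mem by metis
        then show ?thesis using ch[OF \<open>t \<in> ?U\<close>] by blast
      qed
      then show ?case using Suc by auto
    qed simp
    have "good (Id_on ?U)" unfolding good_def by auto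
    moreover have "lab G (Id_on ?U)" unfolding lab_def by auto
    ultimately have "eqv G N (Id_on ?U)" unfolding eqv_def using good_mono[OF lev] lab_mono[OF lev] by blast
    moreover have "Id_on ?U \<subseteq> W S \<times> W (opq_sig S G K)" 
    proof
      fix p assume "p \<in> Id_on ?U"
      then obtain t where t: "t \<in> ?U" "p = (t, t)" by auto
      then show "p \<in> W S \<times> W (opq_sig S G K)" using W_trees[OF tt(1)[OF t(1)]] small_opq_sig[OF S G] by blast
    qed
    moreover have "Range (Id_on ?U) \<subseteq> sol K d [] ` set ns"
    proof
      fix t assume "t \<in> Range (Id_on ?U)"
      then have "t \<in> ?U" by auto
      then show "t \<in> sol K d [] ` set ns" using sol ul(1) unfolding ns_def by force
    qed
    moreover have "finite (Id_on ?U)" using finite_small_trees[OF S] by (auto simp: Id_on_def)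
    ultimately show ?thesis unfolding link_def by simp
  qed
  show ?thesis using that[OF v l] .
qed

text \<open>What the search accepts. The arity bound \<open>r\<close> and the depth \<open>N\<close>
  are searched for along with the result: every derivation of truth with a correct \<open>r\<close>
  is sound, and some \<open>N\<close> is large enough. Demanding \<open>X \<noteq> []\<close>
  prevents a disjunction from being returned for a sentence.\<close>

definition simplifies :: "signature \<Rightarrow> gen list \<Rightarrow> nat \<Rightarrow> var list \<Rightarrow> det list \<Rightarrow> nat \<Rightarrow> nat \<Rightarrow> bool" where
  "simplifies S B k ns d c c' \<longleftrightarrow> (\<exists>G X r N. fm_parts (c, G, X) \<and> (\<forall>g \<in> set (B @ G). length (gargs g) \<le> r) \<and>
     (c' = code_fm Tru \<or> c' = code_fm Fls \<or> X \<noteq> [] \<and> (\<exists>cs. cs \<noteq> [] \<and> c' = jcode 6 (code_fm Fls) cs \<and>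
       (\<forall>q \<in> set cs. \<exists>us xs E F Ns. (\<forall>u \<in> set us. u \<in> set X) \<and> shape S (set (B @ G)) us xs E F Ns \<and> q = scode xs E F Ns))) \<and>
     Ev S ((B @ G, r), N, (k, ns, d, []), [], qcode 10 X (list_encode [8, c, c']), 1))"

lemma re_simplifies:
  assumes S: "tree_signature S"
  shows "re (\<lambda>z. simplifies S B k ns d (fst z) (snd z))"
  unfolding simplifies_def
  by (intro re_conj re_disj re_ex re_ball re_eq re_neq re_mem re_le re_comp[OF re_fm_parts] re_comp[OF re_Ev[OF S]] re_shape[OF S]
      tc_intros tc_append tc_length tc_jcode tc_qcode tc_scode)

text \<open>The closure has no free variables, so its truth does not depend on the valuation; it may
  therefore be tested at any single one.\<close>

lemma sat_closure:
  assumes S: "tree_signature S" and wf: "wf_fm S p" "wf_fm S q" and X: "set X = fv p" and q: "fv q \<subseteq> fv p"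
  shows "(\<exists>e. sat S e (foldr Forall X (Iff p q))) \<longleftrightarrow> (\<forall>e. valuation S e \<longrightarrow> sat S e p = sat S e q)"
    "(\<exists>e. sat S e (foldr Forall X (Iff p q))) \<Longrightarrow> sat S e' (foldr Forall X (Iff p q))"
proof -
  let ?c = "foldr Forall X (Iff p q)"
  have fvc: "fv ?c = {}" using X q by (auto simp: fv_Alls)
  have const: "sat S e ?c = sat S e' ?c" for e e' by (rule sat_cong) (simp add: fvc)
  then show "(\<exists>e. sat S e ?c) \<Longrightarrow> sat S e' ?c" by blast
  have srt: "vsort x \<in> sorts S" if "x \<in> set X" for x using fv_wf[OF wf(1)] X \<open>x \<in> set X\<close> by blast
  show "(\<exists>e. sat S e ?c) \<longleftrightarrow> (\<forall>e. valuation S e \<longrightarrow> sat S e p = sat S e q)"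
  proof
    assume "\<exists>e. sat S e ?c"
    then have all: "sat S e ?c" for e using const by blast
    show "\<forall>e. valuation S e \<longrightarrow> sat S e p = sat S e q"
    proof (intro allI impI)
      fix e assume e: "valuation S e"
      have "agree S X e e" using e srt unfolding agree_def valuation_def by blast
      then show "sat S e p = sat S e q" using all[of e] unfolding sat_Alls by simp
    qed
  next
    assume eq: "\<forall>e. valuation S e \<longrightarrow> sat S e p = sat S e q"
    define e where "e v = (SOME t. t \<in> trees S (vsort v))" for v
    have e: "valuation S e" unfolding valuation_def e_def using trees_nonempty[OF S] by (auto simp: some_in_eq)
    have "sat S e ?c" unfolding sat_Alls
    proof (intro allI impI)
      fix w assume "agree S X e w"
      then have "valuation S w" using e unfolding agree_def valuation_def by metis
      then show "sat S w (Iff p q)" using eq by simp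
    qed
    then show "\<exists>e. sat S e ?c" by blast
  qed
qed

lemma gname_bound: "\<exists>K. \<forall>g \<in> set G. gname g < K"
  using finite_nat_set_iff_bounded[of "gname ` set G"] by auto

lemma simplifies_sound:
  assumes S: "tree_signature S" and B: "set B = base_gens S" and wf: "wf_fm S p"
    and v: "\<And>G. base_gens S \<subseteq> G \<Longrightarrow> wf_state S G k ns d []"
    and l: "\<And>G K N. base_gens S \<subseteq> G \<Longrightarrow> \<forall>g \<in> G. gname g < K \<Longrightarrow> link S G K N ns d [] (Id_on (small_trees S))"
    and s: "simplifies S B k ns d (code_fm p) c"
  shows "\<exists>q. c = code_fm q \<and> (q = Tru \<or> q = Fls \<or> fv p \<noteq> {} \<and>
      (\<exists>qs. qs \<noteq> [] \<and> (\<forall>\<chi> \<in> set qs. fully_simplified S \<chi>) \<and> q = disj_list qs)) \<and> equivalent S p q"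
proof -
  obtain G X r N where G: "fm_parts (code_fm p, G, X)" "\<forall>g \<in> set (B @ G). length (gargs g) \<le> r"
    and c: "c = code_fm Tru \<or> c = code_fm Fls \<or> X \<noteq> [] \<and> (\<exists>cs. cs \<noteq> [] \<and> c = jcode 6 (code_fm Fls) cs \<and>
       (\<forall>q \<in> set cs. \<exists>us xs E F Ns. (\<forall>u \<in> set us. u \<in> set X) \<and> shape S (set (B @ G)) us xs E F Ns \<and> q = scode xs E F Ns))"
    and ev: "Ev S ((B @ G, r), N, (k, ns, d, []), [], qcode 10 X (list_encode [8, code_fm p, c]), 1)"
    using s unfolding simplifies_def by blast
  let ?G = "set (B @ G)"
  have GX: "set G = gens_fm p" "set X = fv p" using fm_parts_sound[OF G(1) refl] by auto
  have Gs: "?G \<subseteq> gens S" using gens_fm_sub[OF wf] base_gens_sub B GX(1) by auto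
  have Bs: "base_gens S \<subseteq> ?G" using B by auto
  have pre: "ef_pre S ?G" unfolding ef_pre_def using S Gs Bs by simp
  obtain q where q: "c = code_fm q" "q = Tru \<or> q = Fls \<or> X \<noteq> [] \<and> (\<exists>qs. qs \<noteq> [] \<and>
      (\<forall>\<chi> \<in> set qs. \<exists>us xs E F Ns. set us \<subseteq> set X \<and> shape S ?G us xs E F Ns \<and> \<chi> = shape_fm xs E F Ns) \<and> q = disj_list qs)"
  proof (cases "c = code_fm Tru \<or> c = code_fm Fls")
    case True
    then show ?thesis using that[of Tru] that[of Fls] by blast
  next
    case False
    then obtain cs where cs: "X \<noteq> []" "cs \<noteq> []" "c = jcode 6 (code_fm Fls) cs"
      "\<forall>q \<in> set cs. \<exists>us xs E F Ns. (\<forall>u \<in> set us. u \<in> set X) \<and> shape S ?G us xs E F Ns \<and> q = scode xs E F Ns"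
      using c by blast
    have "\<forall>c \<in> set cs. \<exists>\<chi>. c = code_fm \<chi> \<and> (\<exists>us xs E F Ns. set us \<subseteq> set X \<and> shape S ?G us xs E F Ns \<and> \<chi> = shape_fm xs E F Ns)"
      using cs(4) code_shape_fm by (metis subsetI)
    then obtain h where h: "\<And>c. c \<in> set cs \<Longrightarrow> c = code_fm (h c) \<and>
        (\<exists>us xs E F Ns. set us \<subseteq> set X \<and> shape S ?G us xs E F Ns \<and> h c = shape_fm xs E F Ns)" by metis
    have "map code_fm (map h cs) = cs" using h by (simp add: map_idI)
    then have "c = code_fm (disj_list (map h cs))" using cs(3) code_disj_list by metis
    moreover have "\<forall>\<chi> \<in> set (map h cs). \<exists>us xs E F Ns. set us \<subseteq> set X \<and> shape S ?G us xs E F Ns \<and> \<chi> = shape_fm xs E F Ns"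
      using h by auto
    ultimately show ?thesis using that[of "disj_list (map h cs)"] cs(1,2) by (metis Nil_is_map_conv)
  qed
  have sub: "wf_fm S q \<and> gens_fm q \<subseteq> ?G \<and> fv q \<subseteq> fv p"
  proof (cases "q = Tru \<or> q = Fls")
    case True
    then show ?thesis by auto
  next
    case False
    then obtain qs where qs: "q = disj_list qs"
      "\<forall>\<chi> \<in> set qs. \<exists>us xs E F Ns. set us \<subseteq> set X \<and> shape S ?G us xs E F Ns \<and> \<chi> = shape_fm xs E F Ns" using q(2) by blast
    have "wf_fm S \<chi> \<and> gens_fm \<chi> \<subseteq> ?G \<and> fv \<chi> \<subseteq> fv p" if "\<chi> \<in> set qs" for \<chi>
    proof -
      obtain us xs E F Ns where "set us \<subseteq> set X" "shape S ?G us xs E F Ns" "\<chi> = shape_fm xs E F Ns"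
        using qs(2) \<open>\<chi> \<in> set qs\<close> by blast
      then show ?thesis using wf_shape_fm[OF S Gs] gens_shape_fm[of S ?G us xs E F Ns] fv_shape_fm[of S ?G us xs E F Ns] GX(2) by blast
    qed
    then show ?thesis unfolding qs(1) wf_disj_list gens_disj_list fv_disj_list by blast
  qed
  let ?c = "foldr Forall X (Iff p q)"
  obtain K where K: "\<forall>g \<in> ?G. gname g < K" using gname_bound by blast
  have ev': "Ev S ((B @ G, r), N, (k, ns, d, []), [], code_fm ?c, 1)" using ev q(1) by (simp add: code_Alls del: list_encode.simps)
  have "(1 :: nat) = of_bool (sat S e ?c)" for e
  proof (rule Ev_sound[OF pre K _ ev' refl v[OF Bs], where M = "Id_on (small_trees S)"])
    show "length (gargs g) \<le> r" if "g \<in> ?G" for g using G(2) that by blast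
    have "vsort x \<in> sorts S" if "x \<in> set X" for x using fv_wf[OF wf] GX(2) that by blast
    then show "ev_inv S ?G K N ns d [] [] (Id_on (small_trees S)) e ?c"
      unfolding ev_inv_def wf_Alls gens_Alls fv_Alls using wf sub GX l[OF Bs K] by auto
  qed
  then have "sat S e ?c" for e by (cases "sat S e ?c") (metis of_bool_eq(1) zero_neq_one)+
  then have "\<And>e. valuation S e \<Longrightarrow> sat S e p = sat S e q" using sat_closure(1)[OF S wf _ GX(2), of q] sub by blast
  then have "equivalent S p q" using equivalentI[OF wf] sub by blast
  moreover have "q = Tru \<or> q = Fls \<or> fv p \<noteq> {} \<and> (\<exists>qs. qs \<noteq> [] \<and> (\<forall>\<chi> \<in> set qs. fully_simplified S \<chi>) \<and> q = disj_list qs)"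
  proof (cases "q = Tru \<or> q = Fls")
    case False
    then obtain qs where qs: "X \<noteq> []" "qs \<noteq> []" "q = disj_list qs"
      "\<forall>\<chi> \<in> set qs. \<exists>us xs E F Ns. set us \<subseteq> set X \<and> shape S ?G us xs E F Ns \<and> \<chi> = shape_fm xs E F Ns" using q(2) by blast
    have "\<forall>\<chi> \<in> set qs. fully_simplified S \<chi>"
    proof
      fix \<chi> assume "\<chi> \<in> set qs"
      then obtain us xs E F Ns where "shape S ?G us xs E F Ns" "\<chi> = shape_fm xs E F Ns" using qs(4) by blast
      then show "fully_simplified S \<chi>" using shape_fully_simplified[OF S Gs, of us xs E F Ns] by blast
    qed
    moreover have "fv p \<noteq> {}" using qs(1) GX(2) by auto
    ultimately show ?thesis using qs(2,3) by blast
  qed blast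
  ultimately show ?thesis using q(1) by blast
qed

text \<open>Three facts meet here: an equivalent formula of the required form exists, the evaluation
  of the closed biconditional ends with some value, and by soundness this value is 1.\<close>

lemma simplifies_total:
  assumes S: "tree_signature S" and B: "set B = base_gens S" and wf: "wf_fm S p"
    and v: "\<And>G. base_gens S \<subseteq> G \<Longrightarrow> wf_state S G k ns d []"
    and l: "\<And>G K N. base_gens S \<subseteq> G \<Longrightarrow> \<forall>g \<in> G. gname g < K \<Longrightarrow> link S G K N ns d [] (Id_on (small_trees S))"
  shows "\<exists>c. simplifies S B k ns d (code_fm p) c"
proof -
  obtain G X where fm_parts: "fm_parts (code_fm p, G, X)" using fm_parts_complete by blast
  let ?G = "set (B @ G)"
  have GX: "set G = gens_fm p" "set X = fv p" using fm_parts_sound[OF fm_parts refl] by auto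
  have Gs: "?G \<subseteq> gens S" using gens_fm_sub[OF wf] base_gens_sub B GX(1) by auto
  have Bs: "base_gens S \<subseteq> ?G" using B by auto
  have pre: "ef_pre S ?G" unfolding ef_pre_def using S Gs Bs by simp
  obtain r where r: "\<forall>g \<in> ?G. length (gargs g) \<le> r" using gens_bound[of ?G] by auto
  obtain us where us: "set us = fv p" "distinct us" using finite_distinct_list[OF finite_fv] by blast
  have pG: "gens_fm p \<subseteq> ?G" using GX(1) by simp
  obtain qs where qs: "\<forall>q \<in> set qs. \<exists>xs E F Ns. q = shape_fm xs E F Ns \<and> shape S ?G us xs E F Ns"
    "\<forall>e. valuation S e \<longrightarrow> sat S e p = (\<exists>q \<in> set qs. sat S e q)"
    using nf_exists[OF pre wf pG us(2,1)] by blast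
  \<comment> \<open>A sentence is replaced by its truth value. Without any description the result is
    \<open>Fls\<close>, because a disjunction has to be nonempty.\<close>
  define q where "q = (if X = [] then (if \<exists>e. valuation S e \<and> sat S e p then Tru else Fls)
    else if qs = [] then Fls else disj_list qs)"
  have qprops: "wf_fm S \<chi> \<and> gens_fm \<chi> \<subseteq> ?G \<and> fv \<chi> \<subseteq> fv p" if "\<chi> \<in> set qs" for \<chi>
  proof -
    obtain xs E F Ns where "shape S ?G us xs E F Ns" "\<chi> = shape_fm xs E F Ns"
      using qs(1) \<open>\<chi> \<in> set qs\<close> by blast
    then show ?thesis using wf_shape_fm[OF S Gs] gens_shape_fm[of S ?G us xs E F Ns] fv_shape_fm[of S ?G us xs E F Ns] us(1) by blast
  qed
  have sub: "wf_fm S q" "gens_fm q \<subseteq> ?G" "fv q \<subseteq> fv p"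
    using qprops unfolding q_def by (auto simp: wf_disj_list gens_disj_list fv_disj_list)
  have sat_disj: "sat S e (disj_list qs) = (\<exists>q \<in> set qs. sat S e q)" for e by (rule sat_disj_list)
  have eq: "sat S e p = sat S e q" if e: "valuation S e" for e
  proof (cases "X = []")
    case True
    then have "fv p = {}" using GX(2) by simp
    then have "sat S e p = sat S e' p" for e' by (intro sat_cong) simp
    then show ?thesis using e True unfolding q_def by auto
  next
    case False
    then show ?thesis using qs(2) e sat_disj unfolding q_def by auto
  qed
  let ?c = "foldr Forall X (Iff p q)"
  have wfc: "wf_fm S ?c" "gens_fm ?c \<subseteq> ?G" "fv ?c = {}"
    unfolding wf_Alls gens_Alls fv_Alls using wf sub pG GX(2) fv_wf[OF wf] by auto
  obtain N where "decides S (B @ G) r N {} (code_fm ?c)" using decides_fm[OF pre wfc(1,2), of r] wfc(3) by auto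
  then obtain b :: bool where ev: "Ev S ((B @ G, r), N, (k, ns, d, []), [], code_fm ?c, of_bool b)"
    using v[OF Bs] unfolding decides_def env_ok_def by blast
  obtain K where K: "\<forall>g \<in> ?G. gname g < K" using gname_bound by blast
  obtain e where e: "sat S e ?c" using sat_closure(1)[OF S wf sub(1) GX(2) sub(3)] eq by blast
  have "(of_bool b :: nat) = of_bool (sat S e ?c)"
  proof (rule Ev_sound[OF pre K _ ev refl v[OF Bs], where M = "Id_on (small_trees S)"])
    show "length (gargs g) \<le> r" if "g \<in> ?G" for g using r that by blast
    show "ev_inv S ?G K N ns d [] [] (Id_on (small_trees S)) e ?c"
      unfolding ev_inv_def using wfc l[OF Bs K] by simp
  qed
  then have ev1: "Ev S ((B @ G, r), N, (k, ns, d, []), [], qcode 10 X (list_encode [8, code_fm p, code_fm q]), 1)"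
    using e ev by (simp add: code_Alls del: list_encode.simps)
  have "code_fm q = code_fm Tru \<or> code_fm q = code_fm Fls \<or> X \<noteq> [] \<and> (\<exists>cs. cs \<noteq> [] \<and> code_fm q = jcode 6 (code_fm Fls) cs \<and>
       (\<forall>c \<in> set cs. \<exists>us xs E F Ns. (\<forall>u \<in> set us. u \<in> set X) \<and> shape S ?G us xs E F Ns \<and> c = scode xs E F Ns))"
  proof (cases "X = [] \<or> qs = []")
    case True
    then show ?thesis unfolding q_def by (auto simp del: code_fm.simps)
  next
    case False
    have "\<exists>us xs E F Ns. (\<forall>u \<in> set us. u \<in> set X) \<and> shape S ?G us xs E F Ns \<and> c = scode xs E F Ns"
      if c: "c \<in> set (map code_fm qs)" for c
    proof -
      obtain \<chi> where "\<chi> \<in> set qs" "c = code_fm \<chi>" using c by auto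
      then obtain xs E F Ns where "c = scode xs E F Ns" "shape S ?G us xs E F Ns" using qs(1) code_shape_fm by metis
      then show ?thesis using us(1) GX(2) by blast
    qed
    moreover have "q = disj_list qs" using False unfolding q_def by simp
    then have "code_fm q = jcode 6 (code_fm Fls) (map code_fm qs)" by (simp only: code_disj_list)
    ultimately show ?thesis using False by (metis Nil_is_map_conv)
  qed
  then show ?thesis unfolding simplifies_def using fm_parts r ev1 by blast
qed

theorem theorem11:
  fixes S :: signature
  assumes "tree_signature S"
  shows "\<exists>algorithm :: recf. \<forall>\<phi>. wf_fm S \<phi> \<longrightarrow>
    (\<exists>\<psi>. computes algorithm [code_fm \<phi>] (code_fm \<psi>) \<and>
         (\<psi> = Tru \<or> \<psi> = Fls \<or>
          (\<exists>\<psi>s. \<psi>s \<noteq> [] \<and> (\<forall>\<chi> \<in> set \<psi>s. fully_simplified S \<chi>) \<and> \<psi> = disj_list \<psi>s)) \<and>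
         equivalent S \<phi> \<psi> \<and>
         (fv \<phi> = {} \<longrightarrow> \<psi> = Tru \<or> \<psi> = Fls))"
proof -
  obtain k ns d where init: "\<And>G. base_gens S \<subseteq> G \<Longrightarrow> wf_state S G k ns d []"
    "\<And>G K N. base_gens S \<subseteq> G \<Longrightarrow> \<forall>g \<in> G. gname g < K \<Longrightarrow> link S G K N ns d [] (Id_on (small_trees S))"
    using initial_state[OF assms] by metis
  obtain B where B: "set B = base_gens S" using finite_list[OF finite_base_gens[OF assms]] by blast
  have total: "\<exists>c. simplifies S B k ns d n c" if n: "\<exists>\<phi>. wf_fm S \<phi> \<and> n = code_fm \<phi>" for n
  proof -
    obtain \<phi> where \<phi>: "wf_fm S \<phi>" "n = code_fm \<phi>" using n by blast
    show ?thesis unfolding \<phi>(2) by (rule simplifies_total[OF assms B \<phi>(1) init])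
  qed
  \<comment> \<open>The signature may be undecidable, and with it the set of codes of well-formed
    formulae. The selection asks for no decision: only termination on these codes is
    claimed.\<close>
  have "\<exists>r. \<forall>n. (\<exists>\<phi>. wf_fm S \<phi> \<and> n = code_fm \<phi>) \<longrightarrow> (\<exists>c. computes r [n] c \<and> simplifies S B k ns d n c)"
    by (rule re_selection[where R = "simplifies S B k ns d" and D = "\<lambda>n. \<exists>\<phi>. wf_fm S \<phi> \<and> n = code_fm \<phi>"])
       (rule re_simplifies[OF assms], rule total)
  then obtain algorithm where a: "\<forall>n. (\<exists>\<phi>. wf_fm S \<phi> \<and> n = code_fm \<phi>) \<longrightarrow>
    (\<exists>c. computes algorithm [n] c \<and> simplifies S B k ns d n c)" by blast
  show ?thesis
  proof (intro exI[of _ algorithm] allI impI)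
    fix \<phi> assume wf: "wf_fm S \<phi>"
    obtain c where c: "computes algorithm [code_fm \<phi>] c" "simplifies S B k ns d (code_fm \<phi>) c" using a wf by blast
    obtain \<psi> where "c = code_fm \<psi>" "\<psi> = Tru \<or> \<psi> = Fls \<or> fv \<phi> \<noteq> {} \<and>
        (\<exists>\<psi>s. \<psi>s \<noteq> [] \<and> (\<forall>\<chi> \<in> set \<psi>s. fully_simplified S \<chi>) \<and> \<psi> = disj_list \<psi>s)" "equivalent S \<phi> \<psi>"
      using simplifies_sound[OF assms B wf init c(2)] by blast
    then show "\<exists>\<psi>. computes algorithm [code_fm \<phi>] (code_fm \<psi>) \<and>
         (\<psi> = Tru \<or> \<psi> = Fls \<or>
          (\<exists>\<psi>s. \<psi>s \<noteq> [] \<and> (\<forall>\<chi> \<in> set \<psi>s. fully_simplified S \<chi>) \<and> \<psi> = disj_list \<psi>s)) \<and>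
         equivalent S \<phi> \<psi> \<and>
         (fv \<phi> = {} \<longrightarrow> \<psi> = Tru \<or> \<psi> = Fls)"
      using c(1) by blast
  qed
qed

end
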